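(* Let $T\in\mathcal{KC}(V)$ with $T,\overline{T}$ injective operators of type $\omega\in(0,\pi)$ and let $\theta\in(\omega,\pi)$. Then for every $f\in\mathcal{F}(S_\theta)$ and $g\in\mathcal{F}_L(S_\theta)$, $$D(fg)(T)\supseteq Df(T)g(T)+f(\overline{T})Dg(T)\qquad\text{and}\qquad D(fg)(T)\supseteq Df(T)g(\overline{T})+f(T)Dg(T).$$
   Context: $\mathbb{H}$: quaternions $s=s_0+s_1e_1+s_2e_2+s_3e_3$ with $e_1^2=e_2^2=e_3^2=-1$, $e_1e_2=-e_2e_1=e_3$, $e_2e_3=-e_3e_2=e_1$, $e_3e_1=-e_1e_3=e_2$; $|s|$ Euclidean norm; $\mathbb{S}=\{s:s_0=0,|s|=1\}$; $\mathbb{C}_J=\{u+Jv\}$. $S_\omega=\{re^{J\phi}:r>0,J\in\mathbb{S},|\phi|<\omega\}$, $\overline{S_\omega}$ its closure, $S_\omega^c=\mathbb{H}\setminus S_\omega$. $V$ is a two-sided Banach space over $\mathbb{H}$. $\mathcal{KC}(V)$: closed right-linear operators $T$ with two-sided linear domain, $T=T_0+e_1T_1+e_2T_2+e_3T_3$ with two-sided linear $T_i$, $\operatorname{dom}(T_i)=\operatorname{dom}(T)$, $\operatorname{dom}(T^2)\subseteq\operatorname{dom}(T_iT_j)$, $T_iT_j=T_jT_i$ on $\operatorname{dom}(T^2)$; $\overline{T}:=T_0-e_1T_1-e_2T_2-e_3T_3$. $|T|^2:=\sum_iT_i^2$, $Q_{c,s}(T):=s^2\mathcal{I}-2sT_0+|T|^2$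 on $\operatorname{dom}(T^2)$; $\rho_S(T)$: the $s$ with $Q_{c,s}(T):\operatorname{dom}(T^2)\to V$ bijective, $Q_{c,s}^{-1}(T)$ the inverse; $\sigma_S(T)=\mathbb{H}\setminus\rho_S(T)$. $S_L^{-1}(s,T):=(s\mathcal{I}-\overline{T})Q_{c,s}^{-1}(T)$, $S_R^{-1}(s,T):=sQ_{c,s}^{-1}(T)-\sum_{i=0}^3T_iQ_{c,s}^{-1}(T)\overline{e_i}$ ($e_0=1$). $T$ is of type $\omega$ if $\sigma_S(T)\subseteq\overline{S_\omega}$ and for each $\theta\in(\omega,\pi)$ there is $C_\theta$ with $\|S_L^{-1}(s,T)\|,\|S_R^{-1}(s,T)\|\leq C_\theta/|s|$ on $S_\theta^c\setminus\{0\}$. Left slice hyperholomorphic functions on $S_\theta$: $f(u+Jv)=\alpha(u,v)+J\beta(u,v)$ for all $J\in\mathbb{S}$, with $C^1$ $\mathbb{H}$-valued $\alpha$ even in $v$, $\beta$ odd in $v$, $\partial_u\alpha=\partial_v\beta$, $\partial_v\alpha=-\partial_u\beta$; intrinsic if $\alpha,\beta$ are real valued. Classes on $S_\theta$ (each for some $\alpha>0$, $C\geq0$): $\Psi_L(S_\theta)$ / $\Psi(S_\theta)$: left / intrinsic with $|f(s)|\leq C|s|^\alpha/(1+|s|^{1+2\alpha})$; $\Psi_L^Q(S_\theta)$ / $\Psi^Q(S_\theta)$: left / intrinsic with $|f(s)|\leq C|s|^{1+\alpha}/(1+|s|^{1+2\alpha})$; $\mathcal{F}_L(S_\theta)$ /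 $\mathcal{F}(S_\theta)$: left / intrinsic with $|f(s)|\leq C(|s|^\alpha+|s|^{-\alpha})$. Path integral: with $\gamma(t)=-te^{J\varphi}$ for $t<0$, $\gamma(t)=te^{-J\varphi}$ for $t>0$, $\int_{\partial(S_\varphi\cap\mathbb{C}_J)}F(s)ds_JG(s):=\int_{\mathbb{R}\setminus\{0\}}F(\gamma(t))\gamma'(t)J^{-1}G(\gamma(t))dt$ ($\varphi\in(\omega,\theta)$, $J\in\mathbb{S}$ arbitrary; results independent of them). $S$-functional calculus: $h(T):=\frac{1}{2\pi}\int_{\partial(S_\varphi\cap\mathbb{C}_J)}S_L^{-1}(s,T)ds_Jh(s)$ for $h\in\Psi_L(S_\theta)$; $H^\infty$-calculus: for $g\in\mathcal{F}_L(S_\theta)$, $g(T):=e(T)^{-1}(eg)(T)$ for any $e\in\Psi(S_\theta)$ with $e(T)$ injective and $eg\in\Psi_L(S_\theta)$ (independent of $e$). Harmonic functional calculus: $Dh(T):=\frac{-1}{\pi}\int_{\partial(S_\varphi\cap\mathbb{C}_J)}Q_{c,s}^{-1}(T)ds_Jh(s)$ for $h\in\Psi_L^Q(S_\theta)$. Harmonic $H^\infty$-functional calculus: for $f\in\mathcal{F}_L(S_\theta)$, $Df(T):=e(\overline{T})^{-1}\big(D(ef)(T)-f(T)De(T)\big)$ with $e\in\Psi^Q(S_\theta)$, $e(T),e(\overline{T})$ injective, $ef\in\Psi_L^Q(S_\theta)$ (such $e$ exist; independent of $e$). All operators with $\overline{T}$ are defined analogously; sums, products and inclusions of unbounded operators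 are with natural domains. *)

theory Defs
  imports "HOL-Analysis.Analysis"
begin

type_synonym quat = "real^4"

definition qmk :: "real \<Rightarrow> real \<Rightarrow> real \<Rightarrow> real \<Rightarrow> quat" where
  "qmk a b c d = vector [a, b, c, d]"

definition qmul :: "quat \<Rightarrow> quat \<Rightarrow> quat" where
  "qmul p q = qmk
     (p$1*q$1 - p$2*q$2 - p$3*q$3 - p$4*q$4)
     (p$1*q$2 + p$2*q$1 + p$3*q$4 - p$4*q$3)
     (p$1*q$3 - p$2*q$4 + p$3*q$1 + p$4*q$2)
     (p$1*q$4 + p$2*q$3 - p$3*q$2 + p$4*q$1)"

definition qconj :: "quat \<Rightarrow> quat" where
  "qconj q = qmk (q$1) (- q$2) (- q$3) (- q$4)"

definition qinv :: "quat \<Rightarrow> quat" where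
  "qinv q = (1 / (norm q)^2) *\<^sub>R qconj q"

definition q1 :: quat where "q1 = qmk 1 0 0 0"

definition qe :: "nat \<Rightarrow> quat" where
  "qe i = (if i = 0 then qmk 1 0 0 0 else if i = 1 then qmk 0 1 0 0
           else if i = 2 then qmk 0 0 1 0 else qmk 0 0 0 1)"

definition is_real_q :: "quat \<Rightarrow> bool" where
  "is_real_q q \<longleftrightarrow> q$2 = 0 \<and> q$3 = 0 \<and> q$4 = 0"

definition SS :: "quat set" where
  "SS = {s. s$1 = 0 \<and> norm s = 1}"

definition qexp :: "quat \<Rightarrow> real \<Rightarrow> quat" where
  "qexp J \<phi> = cos \<phi> *\<^sub>R q1 + sin \<phi> *\<^sub>R J"

definition sector :: "real \<Rightarrow> quat set" where
  "sector \<omega> = {r *\<^sub>R qexp J \<phi> | r J \<phi>. 0 < r \<and> J \<in> SS \<and> \<bar>\<phi>\<bar> < \<omega>}"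

text \<open>parameter set of (u,v) with u + J v in the sector (independent of J)\<close>
definition slice_dom :: "real \<Rightarrow> (real \<times> real) set" where
  "slice_dom \<theta> = {(u, v). \<exists>J\<in>SS. u *\<^sub>R q1 + v *\<^sub>R J \<in> sector \<theta>}"

definition slice_fun :: "bool \<Rightarrow> real \<Rightarrow> (quat \<Rightarrow> quat) \<Rightarrow> bool" where
  "slice_fun intr \<theta> f \<longleftrightarrow>
     (\<exists>(\<alpha> :: real \<times> real \<Rightarrow> quat) (\<beta> :: real \<times> real \<Rightarrow> quat)
        (D\<alpha> :: real \<times> real \<Rightarrow> (real \<times> real) \<Rightarrow>\<^sub>L quat) (D\<beta> :: real \<times> real \<Rightarrow> (real \<times> real) \<Rightarrow>\<^sub>L quat).
        (\<forall>x\<in>slice_dom \<theta>. (\<alpha> has_derivative blinfun_apply (D\<alpha> x)) (at x)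
                          \<and> (\<beta> has_derivative blinfun_apply (D\<beta> x)) (at x)) \<and>
        continuous_on (slice_dom \<theta>) D\<alpha> \<and> continuous_on (slice_dom \<theta>) D\<beta> \<and>
        (\<forall>u v. (u, v) \<in> slice_dom \<theta> \<longrightarrow>
            \<alpha> (u, - v) = \<alpha> (u, v) \<and> \<beta> (u, - v) = - \<beta> (u, v) \<and>
            blinfun_apply (D\<alpha> (u, v)) (1, 0) = blinfun_apply (D\<beta> (u, v)) (0, 1) \<and>
            blinfun_apply (D\<alpha> (u, v)) (0, 1) = - blinfun_apply (D\<beta> (u, v)) (1, 0)) \<and>
        (\<forall>J\<in>SS. \<forall>u v. (u, v) \<in> slice_dom \<theta> \<longrightarrow>
            f (u *\<^sub>R q1 + v *\<^sub>R J) = \<alpha> (u, v) + qmul J (\<beta> (u, v))) \<and>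
        (intr \<longrightarrow> (\<forall>x\<in>slice_dom \<theta>. is_real_q (\<alpha> x) \<and> is_real_q (\<beta> x))))"

abbreviation left_slice :: "real \<Rightarrow> (quat \<Rightarrow> quat) \<Rightarrow> bool" where
  "left_slice \<equiv> slice_fun False"
abbreviation intrinsic_slice :: "real \<Rightarrow> (quat \<Rightarrow> quat) \<Rightarrow> bool" where
  "intrinsic_slice \<equiv> slice_fun True"

definition bnd_Psi :: "real \<Rightarrow> (quat \<Rightarrow> quat) \<Rightarrow> bool" where
  "bnd_Psi \<theta> f \<longleftrightarrow> (\<exists>a>0. \<exists>C\<ge>0. \<forall>s\<in>sector \<theta>.
      norm (f s) \<le> C * norm s powr a / (1 + norm s powr (1 + 2 * a)))"
definition bnd_PsiQ :: "real \<Rightarrow> (quat \<Rightarrow> quat) \<Rightarrow> bool" where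
  "bnd_PsiQ \<theta> f \<longleftrightarrow> (\<exists>a>0. \<exists>C\<ge>0. \<forall>s\<in>sector \<theta>.
      norm (f s) \<le> C * norm s powr (1 + a) / (1 + norm s powr (1 + 2 * a)))"
definition bnd_F :: "real \<Rightarrow> (quat \<Rightarrow> quat) \<Rightarrow> bool" where
  "bnd_F \<theta> f \<longleftrightarrow> (\<exists>a>0. \<exists>C\<ge>0. \<forall>s\<in>sector \<theta>.
      norm (f s) \<le> C * (norm s powr a + norm s powr (- a)))"

definition PsiL where "PsiL \<theta> f \<longleftrightarrow> left_slice \<theta> f \<and> bnd_Psi \<theta> f"
definition Psi where "Psi \<theta> f \<longleftrightarrow> intrinsic_slice \<theta> f \<and> bnd_Psi \<theta> f"
definition PsiQL where "PsiQL \<theta> f \<longleftrightarrow> left_slice \<theta> f \<and> bnd_PsiQ \<theta> f"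
definition PsiQ where "PsiQ \<theta> f \<longleftrightarrow> intrinsic_slice \<theta> f \<and> bnd_PsiQ \<theta> f"
definition FL where "FL \<theta> f \<longleftrightarrow> left_slice \<theta> f \<and> bnd_F \<theta> f"
definition FI where "FI \<theta> f \<longleftrightarrow> intrinsic_slice \<theta> f \<and> bnd_F \<theta> f"

definition qprod_fun :: "(quat \<Rightarrow> quat) \<Rightarrow> (quat \<Rightarrow> quat) \<Rightarrow> quat \<Rightarrow> quat" where
  "qprod_fun f g = (\<lambda>s. qmul (f s) (g s))"

text \<open>lm a v = a v (left multiplication), rm a v = v a (right multiplication)\<close>
definition two_sided_banach :: "(quat \<Rightarrow> 'v::banach \<Rightarrow> 'v) \<Rightarrow> (quat \<Rightarrow> 'v \<Rightarrow> 'v) \<Rightarrow> bool" where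
  "two_sided_banach lm rm \<longleftrightarrow>
     (\<forall>a b v. lm (qmul a b) v = lm a (lm b v)) \<and>
     (\<forall>a b v. lm (a + b) v = lm a v + lm b v) \<and>
     (\<forall>a v w. lm a (v + w) = lm a v + lm a w) \<and>
     (\<forall>r v. lm (r *\<^sub>R q1) v = r *\<^sub>R v) \<and>
     (\<forall>a b v. rm (qmul a b) v = rm b (rm a v)) \<and>
     (\<forall>a b v. rm (a + b) v = rm a v + rm b v) \<and>
     (\<forall>a v w. rm a (v + w) = rm a v + rm a w) \<and>
     (\<forall>r v. rm (r *\<^sub>R q1) v = r *\<^sub>R v) \<and>
     (\<forall>a b v. lm a (rm b v) = rm b (lm a v)) \<and>
     (\<forall>a v. norm (lm a v) = norm a * norm v) \<and>
     (\<forall>a v. norm (rm a v) = norm a * norm v)"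

type_synonym 'v op = "'v set \<times> ('v \<Rightarrow> 'v)"

definition op_dom :: "'v op \<Rightarrow> 'v set" where "op_dom A = fst A"
definition op_app :: "'v op \<Rightarrow> 'v \<Rightarrow> 'v" where "op_app A = snd A"

definition op_comp :: "'v op \<Rightarrow> 'v op \<Rightarrow> 'v op" where
  "op_comp A B = ({x \<in> op_dom B. op_app B x \<in> op_dom A}, \<lambda>x. op_app A (op_app B x))"
definition op_add :: "'v::ab_group_add op \<Rightarrow> 'v op \<Rightarrow> 'v op" where
  "op_add A B = (op_dom A \<inter> op_dom B, \<lambda>x. op_app A x + op_app B x)"
definition op_minus :: "'v::ab_group_add op \<Rightarrow> 'v op \<Rightarrow> 'v op" where
  "op_minus A B = (op_dom A \<inter> op_dom B, \<lambda>x. op_app A x - op_app B x)"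
definition op_neg :: "'v::ab_group_add op \<Rightarrow> 'v op" where
  "op_neg A = (op_dom A, \<lambda>x. - op_app A x)"
definition op_inv :: "'v op \<Rightarrow> 'v op" where
  "op_inv A = (op_app A ` op_dom A, inv_into (op_dom A) (op_app A))"
definition op_le :: "'v op \<Rightarrow> 'v op \<Rightarrow> bool" where
  "op_le A B \<longleftrightarrow> op_dom A \<subseteq> op_dom B \<and> (\<forall>x\<in>op_dom A. op_app A x = op_app B x)"
definition inj_op :: "'v op \<Rightarrow> bool" where
  "inj_op A \<longleftrightarrow> inj_on (op_app A) (op_dom A)"
definition closed_op :: "'v::topological_space op \<Rightarrow> bool" where
  "closed_op A \<longleftrightarrow> closed {(x, op_app A x) | x. x \<in> op_dom A}"

definition two_sided_subspace :: "(quat \<Rightarrow> 'v::real_vector \<Rightarrow> 'v) \<Rightarrow> (quat \<Rightarrow> 'v \<Rightarrow> 'v) \<Rightarrow> 'v set \<Rightarrow> bool" where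
  "two_sided_subspace lm rm D \<longleftrightarrow> 0 \<in> D \<and> (\<forall>x\<in>D. \<forall>y\<in>D. x + y \<in> D) \<and>
     (\<forall>a. \<forall>x\<in>D. lm a x \<in> D \<and> rm a x \<in> D)"

definition right_linear_op :: "(quat \<Rightarrow> 'v::real_vector \<Rightarrow> 'v) \<Rightarrow> (quat \<Rightarrow> 'v \<Rightarrow> 'v) \<Rightarrow> 'v op \<Rightarrow> bool" where
  "right_linear_op lm rm A \<longleftrightarrow> two_sided_subspace lm rm (op_dom A) \<and>
     (\<forall>x\<in>op_dom A. \<forall>y\<in>op_dom A. op_app A (x + y) = op_app A x + op_app A y) \<and>
     (\<forall>a. \<forall>x\<in>op_dom A. op_app A (rm a x) = rm a (op_app A x))"

definition two_sided_linear_op :: "(quat \<Rightarrow> 'v::real_vector \<Rightarrow> 'v) \<Rightarrow> (quat \<Rightarrow> 'v \<Rightarrow> 'v) \<Rightarrow> 'v op \<Rightarrow> bool" where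
  "two_sided_linear_op lm rm A \<longleftrightarrow> right_linear_op lm rm A \<and>
     (\<forall>a. \<forall>x\<in>op_dom A. op_app A (lm a x) = lm a (op_app A x))"

definition opT :: "(quat \<Rightarrow> 'v::real_vector \<Rightarrow> 'v) \<Rightarrow> (nat \<Rightarrow> 'v op) \<Rightarrow> 'v op" where
  "opT lm Tc = (op_dom (Tc 0), \<lambda>v. \<Sum>i<4. lm (qe i) (op_app (Tc i) v))"

definition conjC :: "(nat \<Rightarrow> 'v::ab_group_add op) \<Rightarrow> nat \<Rightarrow> 'v op" where
  "conjC Tc = (\<lambda>i. if i = 0 then Tc 0 else op_neg (Tc i))"

definition domT2 :: "(quat \<Rightarrow> 'v::real_vector \<Rightarrow> 'v) \<Rightarrow> (nat \<Rightarrow> 'v op) \<Rightarrow> 'v set" where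
  "domT2 lm Tc = op_dom (op_comp (opT lm Tc) (opT lm Tc))"

definition KC :: "(quat \<Rightarrow> 'v::real_normed_vector \<Rightarrow> 'v) \<Rightarrow> (quat \<Rightarrow> 'v \<Rightarrow> 'v) \<Rightarrow> (nat \<Rightarrow> 'v op) \<Rightarrow> bool" where
  "KC lm rm Tc \<longleftrightarrow> closed_op (opT lm Tc) \<and> right_linear_op lm rm (opT lm Tc) \<and>
     (\<forall>i<4. two_sided_linear_op lm rm (Tc i) \<and> op_dom (Tc i) = op_dom (Tc 0)) \<and>
     (\<forall>i<4. \<forall>j<4. domT2 lm Tc \<subseteq> op_dom (op_comp (Tc i) (Tc j)) \<and>
        (\<forall>v\<in>domT2 lm Tc. op_app (Tc i) (op_app (Tc j) v) = op_app (Tc j) (op_app (Tc i) v)))"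

definition Qop :: "(quat \<Rightarrow> 'v::real_vector \<Rightarrow> 'v) \<Rightarrow> (nat \<Rightarrow> 'v op) \<Rightarrow> quat \<Rightarrow> 'v op" where
  "Qop lm Tc s = (domT2 lm Tc, \<lambda>v. lm (qmul s s) v - 2 *\<^sub>R lm s (op_app (Tc 0) v)
                                   + (\<Sum>i<4. op_app (Tc i) (op_app (Tc i) v)))"

definition rhoS :: "(quat \<Rightarrow> 'v::real_vector \<Rightarrow> 'v) \<Rightarrow> (nat \<Rightarrow> 'v op) \<Rightarrow> quat set" where
  "rhoS lm Tc = {s. bij_betw (op_app (Qop lm Tc s)) (domT2 lm Tc) UNIV}"
definition sigmaS :: "(quat \<Rightarrow> 'v::real_vector \<Rightarrow> 'v) \<Rightarrow> (nat \<Rightarrow> 'v op) \<Rightarrow> quat set" where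
  "sigmaS lm Tc = UNIV - rhoS lm Tc"

definition Qinv :: "(quat \<Rightarrow> 'v::real_vector \<Rightarrow> 'v) \<Rightarrow> (nat \<Rightarrow> 'v op) \<Rightarrow> quat \<Rightarrow> 'v \<Rightarrow> 'v" where
  "Qinv lm Tc s = inv_into (domT2 lm Tc) (op_app (Qop lm Tc s))"

definition SL :: "(quat \<Rightarrow> 'v::real_vector \<Rightarrow> 'v) \<Rightarrow> (nat \<Rightarrow> 'v op) \<Rightarrow> quat \<Rightarrow> 'v \<Rightarrow> 'v" where
  "SL lm Tc s = (\<lambda>v. lm s (Qinv lm Tc s v) - op_app (opT lm (conjC Tc)) (Qinv lm Tc s v))"

text \<open>S_R^{-1}(s,T) = s Q^{-1} - sum_i T_i Q^{-1} conj(e_i); operator times scalar acts as (A a) v = A (a v)\<close>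
definition SR :: "(quat \<Rightarrow> 'v::real_vector \<Rightarrow> 'v) \<Rightarrow> (nat \<Rightarrow> 'v op) \<Rightarrow> quat \<Rightarrow> 'v \<Rightarrow> 'v" where
  "SR lm Tc s = (\<lambda>v. lm s (Qinv lm Tc s v)
                     - (\<Sum>i<4. op_app (Tc i) (Qinv lm Tc s (lm (qconj (qe i)) v))))"

definition type_omega :: "(quat \<Rightarrow> 'v::real_normed_vector \<Rightarrow> 'v) \<Rightarrow> (nat \<Rightarrow> 'v op) \<Rightarrow> real \<Rightarrow> bool" where
  "type_omega lm Tc \<omega> \<longleftrightarrow> sigmaS lm Tc \<subseteq> closure (sector \<omega>) \<and>
     (\<forall>\<theta>. \<omega> < \<theta> \<and> \<theta> < pi \<longrightarrow> (\<exists>C. \<forall>s \<in> (UNIV - sector \<theta>) - {0}. \<forall>v.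
        norm (SL lm Tc s v) \<le> C / norm s * norm v \<and> norm (SR lm Tc s v) \<le> C / norm s * norm v))"

definition gam :: "real \<Rightarrow> quat \<Rightarrow> real \<Rightarrow> quat" where
  "gam \<phi> J t = (if t < 0 then (- t) *\<^sub>R qexp J \<phi> else t *\<^sub>R qexp J (- \<phi>))"
definition gam' :: "real \<Rightarrow> quat \<Rightarrow> real \<Rightarrow> quat" where
  "gam' \<phi> J t = (if t < 0 then - qexp J \<phi> else qexp J (- \<phi>))"

text \<open>int_{d(S_phi cap C_J)} F(s) ds_J h(s), an operator applied to v\<close>
definition pint :: "(quat \<Rightarrow> 'v::real_normed_vector \<Rightarrow> 'v) \<Rightarrow> real \<Rightarrow> quat \<Rightarrow> (quat \<Rightarrow> 'v \<Rightarrow> 'v)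
                     \<Rightarrow> (quat \<Rightarrow> quat) \<Rightarrow> 'v \<Rightarrow> 'v" where
  "pint lm \<phi> J F h = (\<lambda>v. integral (UNIV - {0::real})
       (\<lambda>t. F (gam \<phi> J t) (lm (qmul (gam' \<phi> J t) (qmul (qinv J) (h (gam \<phi> J t)))) v)))"

text \<open>the integration path: angle (omega+theta)/2 in (omega,theta), J = e_1 (results are independent of these)\<close>
definition path_angle :: "real \<Rightarrow> real \<Rightarrow> real" where
  "path_angle \<omega> \<theta> = (\<omega> + \<theta>) / 2"

definition scalc :: "(quat \<Rightarrow> 'v::real_normed_vector \<Rightarrow> 'v) \<Rightarrow> (nat \<Rightarrow> 'v op) \<Rightarrow> real \<Rightarrow> real
                      \<Rightarrow> (quat \<Rightarrow> quat) \<Rightarrow> 'v op" where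
  "scalc lm Tc \<omega> \<theta> h = (UNIV, \<lambda>v. (1 / (2 * pi)) *\<^sub>R pint lm (path_angle \<omega> \<theta>) (qe 1) (SL lm Tc) h v)"

definition hinf :: "(quat \<Rightarrow> 'v::real_normed_vector \<Rightarrow> 'v) \<Rightarrow> (nat \<Rightarrow> 'v op) \<Rightarrow> real \<Rightarrow> real
                      \<Rightarrow> (quat \<Rightarrow> quat) \<Rightarrow> 'v op" where
  "hinf lm Tc \<omega> \<theta> g =
     (let e = (SOME e. Psi \<theta> e \<and> inj_op (scalc lm Tc \<omega> \<theta> e) \<and> PsiL \<theta> (qprod_fun e g))
      in op_comp (op_inv (scalc lm Tc \<omega> \<theta> e)) (scalc lm Tc \<omega> \<theta> (qprod_fun e g)))"

definition hcalc :: "(quat \<Rightarrow> 'v::real_normed_vector \<Rightarrow> 'v) \<Rightarrow> (nat \<Rightarrow> 'v op) \<Rightarrow> real \<Rightarrow> real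
                      \<Rightarrow> (quat \<Rightarrow> quat) \<Rightarrow> 'v op" where
  "hcalc lm Tc \<omega> \<theta> h = (UNIV, \<lambda>v. (- 1 / pi) *\<^sub>R pint lm (path_angle \<omega> \<theta>) (qe 1) (Qinv lm Tc) h v)"

definition hDinf :: "(quat \<Rightarrow> 'v::real_normed_vector \<Rightarrow> 'v) \<Rightarrow> (nat \<Rightarrow> 'v op) \<Rightarrow> real \<Rightarrow> real
                      \<Rightarrow> (quat \<Rightarrow> quat) \<Rightarrow> 'v op" where
  "hDinf lm Tc \<omega> \<theta> f =
     (let e = (SOME e. PsiQ \<theta> e \<and> inj_op (hinf lm Tc \<omega> \<theta> e) \<and> inj_op (hinf lm (conjC Tc) \<omega> \<theta> e)
                       \<and> PsiQL \<theta> (qprod_fun e f))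
      in op_comp (op_inv (hinf lm (conjC Tc) \<omega> \<theta> e))
           (op_minus (hcalc lm Tc \<omega> \<theta> (qprod_fun e f)) (op_comp (hinf lm Tc \<omega> \<theta> f) (hcalc lm Tc \<omega> \<theta> e))))"

end

theory Submission
  imports Defs "HOL-Complex_Analysis.Complex_Analysis"
begin


text \<open>Every unbounded operator is traded for bounded ones. As Q_{c,-1}(T) factors into 1+T and
  1+conj T, the inverses \<open>S1\<close> of 1+T and \<open>S2\<close> of 1+conj T are everywhere
  defined, and Q_{c,s}(T) Q_{c,-1}(T)^{-1} is a quadratic polynomial in 1+s whose coefficients are
  the sum and the product of \<open>S1\<close> and \<open>S2\<close>. The point -1 serves because it
  lies outside every closed sector of angle below \<pi>. The obstacle is that T does not commute
  with left multiplication by the slice: neither \<open>S1\<close> nor \<open>S2\<close> is complex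
  linear, only their sum and product are. Cauchy's argument is therefore run on the harmonic
  integral \<open>A\<close>, which involves just these two, and statements on the S-calculus
  \<open>Phi\<close> are reduced to it by cancelling injective factors. The outcome is the rule
  D(nh)(T) = n(T) Dh(T) + Dn(T) h(conj T) for regularized functions with n intrinsic, together with
  its mirror image under exchange of T and conj T. Inclusions of unbounded operators become
  implications between equations of bounded operators, in which regularizers are cancelled.\<close>

section \<open>Banach-valued integrals over the open half-line\<close>

definition IK :: "nat \<Rightarrow> real set" where
  "IK n = {1 / (real n + 1) .. real n + 1}"

lemma IK_subset: "IK n \<subseteq> {0<..}"
proof
  fix x assume "x \<in> IK n"
  then have "1 / (real n + 1) \<le> x" by (simp add: IK_def)
  moreover have "0 < 1 / (real n + 1)" by simp
  ultimately show "x \<in> {0<..}" by (metis greaterThan_iff less_le_trans)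
qed

lemma continuous_integrable_IK:
  fixes f :: "real \<Rightarrow> 'b::banach"
  assumes "continuous_on {0<..} f"
  shows "f integrable_on IK n"
  using continuous_on_subset[OF assms IK_subset[of n]] integrable_continuous_interval
  unfolding IK_def by blast

text \<open>The singularity at 0 is harmless: the primitive extends continuously to 0, so that the
  fundamental theorem of calculus yields integrability, for values in an arbitrary Banach space.\<close>

lemma halfline_integrable:
  fixes f :: "real \<Rightarrow> 'b::banach" and g :: "real \<Rightarrow> real"
  assumes f: "continuous_on {0<..} f"
    and bnd: "\<And>r. 0 < r \<Longrightarrow> norm (f r) \<le> g r"
    and g: "g integrable_on {0<..}"
  shows "f integrable_on {0<..}"
proof -
  define f0 where "f0 = (\<lambda>x. if x \<in> {0<..} then f x else 0)"
  define g0 where "g0 = (\<lambda>x. if x \<in> {0<..} then g x else 0)"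
  have g0U: "g0 integrable_on UNIV"
    using g unfolding g0_def by (simp only: integrable_restrict_UNIV)
  have g0i: "g0 integrable_on {a..b}" for a b
    using g0U integrable_on_subinterval by blast
  have bnd0: "norm (f0 x) \<le> g0 x" for x
    using bnd by (auto simp: f0_def g0_def)
  have fi: "f0 integrable_on {x..y}" if "0 < x" for x y
  proof -
    have "continuous_on {x..y} f" using f by (rule continuous_on_subset) (use that in auto)
    then have "f integrable_on {x..y}" by (rule integrable_continuous_interval)
    then show ?thesis
      by (rule integrable_eq) (use that in \<open>auto simp: f0_def\<close>)
  qed
  have from0: "f0 integrable_on {0..b}" if b: "0 < b" for b
  proof -
    \<comment> \<open>Integrals from \<open>x\<close> up to the fixed end \<open>b\<close>:
      increments of \<open>H\<close> are dominated by those of \<open>G\<close>, so the continuity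
      of \<open>G\<close> at 0 forces \<open>H\<close> to have a limit there.\<close>
    define H where "H = (\<lambda>x. integral {x..b} f0)"
    define G where "G = (\<lambda>x. integral {x..b} g0)"
    have Gc: "continuous_on {0..b} G"
      unfolding G_def by (rule indefinite_integral_continuous_1'[OF g0i])
    have HG1: "norm (H x - H y) \<le> \<bar>G x - G y\<bar>" if "0 < x" "x \<le> y" "y \<le> b" for x y
    proof -
      have "H x - H y = integral {x..y} f0"
        using Henstock_Kurzweil_Integration.integral_combine[OF that(2,3) fi[OF that(1)]] unfolding H_def by (simp add: algebra_simps)
      moreover have "G x - G y = integral {x..y} g0"
        using Henstock_Kurzweil_Integration.integral_combine[OF that(2,3) g0i] unfolding G_def by (simp add: algebra_simps)
      moreover have "norm (integral {x..y} f0) \<le> integral {x..y} g0"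
        by (rule integral_norm_bound_integral[OF fi[OF that(1)] g0i bnd0])
      ultimately show ?thesis by simp
    qed
    have HG: "norm (H x - H y) \<le> \<bar>G x - G y\<bar>" if "0 < x" "x \<le> b" "0 < y" "y \<le> b" for x y
      using HG1[of x y] HG1[of y x] that by (cases "x \<le> y") (auto simp: norm_minus_commute abs_minus_commute)
    define u where "u = (\<lambda>n. b / (real n + 1))"
    have u: "0 < u n" "u n \<le> b" for n using b by (auto simp: u_def field_simps)
    have u0: "u \<longlonglongrightarrow> 0" unfolding u_def by real_asymp
    have Gu: "(\<lambda>n. G (u n)) \<longlonglongrightarrow> G 0"
      by (rule continuous_on_tendsto_compose[OF Gc u0]) (use u b in \<open>auto intro: less_imp_le eventuallyI\<close>)
    have "Cauchy (\<lambda>n. H (u n))"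
    proof (rule metric_CauchyI)
      fix e :: real assume "0 < e"
      obtain M where M: "\<And>m n. m \<ge> M \<Longrightarrow> n \<ge> M \<Longrightarrow> dist (G (u m)) (G (u n)) < e"
        using metric_CauchyD[OF LIMSEQ_imp_Cauchy[OF Gu] \<open>0 < e\<close>] by blast
      show "\<exists>M. \<forall>m\<ge>M. \<forall>n\<ge>M. dist (H (u m)) (H (u n)) < e"
        using M HG[OF u u] unfolding dist_norm real_norm_def by (meson le_less_trans)
    qed
    then obtain L where L: "(\<lambda>n. H (u n)) \<longlonglongrightarrow> L"
      using Cauchy_convergent convergent_def by blast
    have HL: "norm (H x - L) \<le> \<bar>G x - G 0\<bar>" if "0 < x" "x \<le> b" for x
    proof (rule LIMSEQ_le)
      show "(\<lambda>n. norm (H x - H (u n))) \<longlonglongrightarrow> norm (H x - L)"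
        by (intro tendsto_intros L)
      show "(\<lambda>n. \<bar>G x - G (u n)\<bar>) \<longlonglongrightarrow> \<bar>G x - G 0\<bar>"
        by (intro tendsto_intros Gu)
      show "\<exists>N. \<forall>n\<ge>N. norm (H x - H (u n)) \<le> \<bar>G x - G (u n)\<bar>"
        using HG[OF that u] by blast
    qed
    define H0 where "H0 = (\<lambda>x. if x \<le> 0 then L else H x)"
    have H0: "norm (H0 x - H0 y) \<le> \<bar>G x - G y\<bar>" if "x \<in> {0..b}" "y \<in> {0..b}" for x y
      using HG[of x y] HL[of x] HL[of y] that
      by (cases "x = 0"; cases "y = 0") (auto simp: H0_def norm_minus_commute abs_minus_commute)
    have H0c: "continuous_on {0..b} H0"
      unfolding continuous_on_iff
    proof (intro ballI allI impI)
      fix x e assume x: "x \<in> {0..b}" and "(0::real) < e"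
      then obtain d where "d > 0" and d: "\<And>x'. x' \<in> {0..b} \<Longrightarrow> dist x' x < d \<Longrightarrow> dist (G x') (G x) < e"
        using Gc unfolding continuous_on_iff by meson
      show "\<exists>d>0. \<forall>x'\<in>{0..b}. dist x' x < d \<longrightarrow> dist (H0 x') (H0 x) < e"
        using \<open>d > 0\<close> d H0[OF _ x] unfolding dist_norm real_norm_def by (meson le_less_trans)
    qed
    have der: "(H0 has_vector_derivative - f0 x) (at x)" if "x \<in> {0<..<b}" for x
    proof -
      have x: "0 < x / 2" "x / 2 < x" "x < b" using that by auto
      have "((\<lambda>v. integral {x/2..v} f0) has_vector_derivative f0 x) (at x within {x/2..b})"
      proof (rule integral_has_vector_derivative)
        show "continuous_on {x/2..b} f0"
        proof (rule continuous_on_eq)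
          show "continuous_on {x/2..b} f" using f by (rule continuous_on_subset) (use x in auto)
        qed (use x in \<open>auto simp: f0_def\<close>)
      qed (use x in auto)
      then have 1: "((\<lambda>v. integral {x/2..v} f0) has_vector_derivative f0 x) (at x)"
        using at_within_interior[of x "{x/2..b}"] x by (simp add: interior_atLeastAtMost_real)
      have "((\<lambda>v. integral {x/2..b} f0 - integral {x/2..v} f0) has_vector_derivative - f0 x) (at x)"
        using has_vector_derivative_diff[OF has_vector_derivative_const 1] by simp
      then show ?thesis
      proof (rule has_vector_derivative_transform_within_open[where S = "{x/2<..<b}"])
        fix v assume v: "v \<in> {x/2<..<b}"
        then show "integral {x/2..b} f0 - integral {x/2..v} f0 = H0 v"
          using Henstock_Kurzweil_Integration.integral_combine[of "x/2" v b f0] fi[OF x(1)] x by (auto simp: H0_def H_def algebra_simps)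
      qed (use x in auto)
    qed
    have "((\<lambda>x. - f0 x) has_integral H0 b - H0 0) {0..b}"
      by (rule fundamental_theorem_of_calculus_interior) (use b H0c der in auto)
    then show ?thesis using integrable_neg_iff by blast
  qed
  \<comment> \<open>Towards infinity the integrable bound alone suffices, once the function is
    integrable on every compact interval.\<close>
  show ?thesis
  proof (rule integrable_on_all_intervals_integrable_bound[OF _ _ g])
    fix a b :: real
    define B where "B = \<bar>a\<bar> + \<bar>b\<bar> + 1"
    have "f0 integrable_on {-B..0}"
      by (rule integrable_spike[OF integrable_0, of "{}"]) (auto simp: f0_def)
    moreover have "f0 integrable_on {0..B}" by (rule from0) (simp add: B_def)
    ultimately have "f0 integrable_on {-B..B}"
      using Henstock_Kurzweil_Integration.integrable_combine[of "-B" 0 B f0] by (simp add: B_def)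
    then have "f0 integrable_on cbox a b"
      by (rule integrable_on_subcbox) (auto simp: B_def)
    then show "(\<lambda>x. if x \<in> {0<..} then f x else 0) integrable_on cbox a b"
      by (simp only: f0_def)
  qed (use bnd in auto)
qed

text \<open>The truncated integral is the integral over the whole half-line of the function cut off
  outside \<open>IK n\<close>; the difference of the integrands is then dominated pointwise by the
  same difference for \<open>g\<close>.\<close>

lemma halfline_tail:
  fixes f :: "real \<Rightarrow> 'b::banach" and g :: "real \<Rightarrow> real"
  assumes f: "continuous_on {0<..} f"
    and bnd: "\<And>r. 0 < r \<Longrightarrow> norm (f r) \<le> g r"
    and g: "g integrable_on {0<..}" "continuous_on {0<..} g"
  shows "norm (integral {0<..} f - integral (IK n) f) \<le> integral {0<..} g - integral (IK n) g"
proof -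
  have restr: "(\<lambda>x. if x \<in> IK n then h x else 0) integrable_on {0<..}"
    "integral {0<..} (\<lambda>x. if x \<in> IK n then h x else 0) = integral (IK n) h"
    if "continuous_on {0<..} h" for h :: "real \<Rightarrow> 'c::banach"
    using continuous_integrable_IK[OF that, of n] IK_subset[of n]
    by (auto simp: integrable_restrict_Int Int_absorb1 Int_absorb2 integral_restrict_Int)
  have fi: "f integrable_on {0<..}" by (rule halfline_integrable[OF f bnd g(1)])
  have "integral {0<..} f - integral (IK n) f
      = integral {0<..} (\<lambda>x. f x - (if x \<in> IK n then f x else 0))"
    using integral_diff[OF fi restr(1)[OF f]] restr(2)[OF f] by simp
  also have "norm \<dots> \<le> integral {0<..} (\<lambda>x. g x - (if x \<in> IK n then g x else 0))"
    by (rule integral_norm_bound_integral)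
       (use integrable_diff[OF fi restr(1)[OF f]] integrable_diff[OF g(1) restr(1)[OF g(2)]] bnd in auto)
  also have "\<dots> = integral {0<..} g - integral (IK n) g"
    using integral_diff[OF g(1) restr(1)[OF g(2)]] restr(2)[OF g(2)] by simp
  finally show ?thesis .
qed

lemma halfline_trunc_real:
  fixes g :: "real \<Rightarrow> real"
  assumes g: "g integrable_on {0<..}" "continuous_on {0<..} g" "\<And>r. 0 < r \<Longrightarrow> 0 \<le> g r"
  shows "(\<lambda>n. integral (IK n) g) \<longlonglongrightarrow> integral {0<..} g"
proof -
  have "(\<lambda>n. integral {0<..} (\<lambda>x. if x \<in> IK n then g x else 0)) \<longlonglongrightarrow> integral {0<..} g"
  proof (rule dominated_convergence(2)[where h = g])
    show "(\<lambda>x. if x \<in> IK n then g x else 0) integrable_on {0<..}" for n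
      using continuous_integrable_IK[OF g(2), of n] IK_subset[of n]
      by (simp add: integrable_restrict_Int Int_absorb1 Int_absorb2)
    show "(\<lambda>n. if x \<in> IK n then g x else 0) \<longlonglongrightarrow> g x" if "x \<in> {0<..}" for x
    proof (rule tendsto_eventually)
      have "eventually (\<lambda>n. 1 / (real n + 1) \<le> x) sequentially"
        using that by real_asymp
      moreover have "eventually (\<lambda>n. x \<le> real n + 1) sequentially" by real_asymp
      ultimately show "\<forall>\<^sub>F n in sequentially. (if x \<in> IK n then g x else 0) = g x"
        by eventually_elim (auto simp: IK_def)
    qed
  qed (use g in auto)
  moreover have "integral {0<..} (\<lambda>x. if x \<in> IK n then g x else 0) = integral (IK n) g" for n
    using IK_subset[of n] by (simp add: integral_restrict_Int Int_absorb1 Int_absorb2)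
  ultimately show ?thesis by simp
qed

lemma halfline_trunc:
  fixes f :: "real \<Rightarrow> 'b::banach" and g :: "real \<Rightarrow> real"
  assumes f: "continuous_on {0<..} f"
    and bnd: "\<And>r. 0 < r \<Longrightarrow> norm (f r) \<le> g r"
    and g: "g integrable_on {0<..}" "continuous_on {0<..} g"
  shows "(\<lambda>n. integral (IK n) f) \<longlonglongrightarrow> integral {0<..} f"
proof -
  have g0: "\<And>r. 0 < r \<Longrightarrow> 0 \<le> g r" using bnd norm_ge_zero order_trans by blast
  have "(\<lambda>n. integral {0<..} f - integral (IK n) f) \<longlonglongrightarrow> 0"
  proof (rule Lim_null_comparison)
    show "\<forall>\<^sub>F n in sequentially. norm (integral {0<..} f - integral (IK n) f)
        \<le> integral {0<..} g - integral (IK n) g"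
      using halfline_tail[OF f bnd g] by simp
    show "(\<lambda>n. integral {0<..} g - integral (IK n) g) \<longlonglongrightarrow> 0"
      using tendsto_diff[OF tendsto_const[of "integral {0<..} g"] halfline_trunc_real[OF g g0]] by simp
  qed
  from tendsto_diff[OF tendsto_const this, of "integral {0<..} f"] show ?thesis by simp
qed

text \<open>Truncated integrals depend continuously on the parameter by compactness. The product
  bound makes their convergence uniform where \<open>g\<close> is bounded, in particular on
  [x/2, 2x], and uniform limits of continuous functions are continuous. The rate in the last claim
  is what the exchange of integrals rests on.\<close>

lemma halfline_param:
  fixes f :: "real \<Rightarrow> real \<Rightarrow> 'b::banach"
  assumes f: "continuous_on ({0<..} \<times> {0<..}) (\<lambda>(x, y). f x y)"
    and bnd: "\<And>x y. 0 < x \<Longrightarrow> 0 < y \<Longrightarrow> norm (f x y) \<le> g x * h y"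
    and g: "g integrable_on {0<..}" "continuous_on {0<..} g" "\<And>r. 0 < r \<Longrightarrow> 0 \<le> g r"
    and h: "h integrable_on {0<..}" "continuous_on {0<..} h" "\<And>r. 0 < r \<Longrightarrow> 0 \<le> h r"
  shows "continuous_on {0<..} (\<lambda>x. integral {0<..} (f x))"
    and "continuous_on {0<..} (\<lambda>x. integral (IK n) (f x))"
    and "0 < x \<Longrightarrow> norm (integral {0<..} (f x)) \<le> g x * integral {0<..} h"
    and "0 < x \<Longrightarrow> norm (integral {0<..} (f x) - integral (IK n) (f x))
           \<le> g x * (integral {0<..} h - integral (IK n) h)"
proof -
  have fx: "continuous_on {0<..} (f x)" if "0 < x" for x
  proof -
    have "continuous_on {0<..} (\<lambda>y. (x, y))" by (intro continuous_intros)
    from continuous_on_compose2[OF f this] that show ?thesis by (simp add: image_subset_iff)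
  qed
  have hx: "(\<lambda>y. g x * h y) integrable_on {0<..}" "continuous_on {0<..} (\<lambda>y. g x * h y)" for x
    using h by (auto intro!: continuous_intros integrable_on_mult_right)
  define p where "p = (\<lambda>n x. integral (IK n) (f x))"
  define q where "q = (\<lambda>x. integral {0<..} (f x))"
  define t where "t = (\<lambda>n. integral {0<..} h - integral (IK n) h)"
  have t: "t \<longlonglongrightarrow> 0"
    unfolding t_def using tendsto_diff[OF tendsto_const[of "integral {0<..} h"] halfline_trunc_real[OF h]] by simp
  have pq: "norm (q x - p n x) \<le> g x * t n" if "0 < x" for x n
    using halfline_tail[OF fx[OF that] bnd[OF that] hx[of x], of n]
    unfolding p_def q_def t_def by (simp add: algebra_simps)
  have pc: "continuous_on {0<..} (p n)" for n
    unfolding p_def IK_def interval_cbox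
    by (rule integral_continuous_on_param, rule continuous_on_subset[OF f])
       (use IK_subset[of n] in \<open>auto simp: IK_def\<close>)
  have qc: "continuous_on {0<..} q"
  proof (rule continuous_at_imp_continuous_on, intro ballI)
    fix x :: real assume "x \<in> {0<..}"
    then have x: "0 < x" by simp
    obtain B where B: "\<And>y. y \<in> {x/2..2*x} \<Longrightarrow> norm (g y) \<le> B" "B > 0"
    proof -
      have "compact (g ` {x/2..2*x})"
        by (rule compact_continuous_image[OF continuous_on_subset[OF g(2)]]) (use x in auto)
      from compact_imp_bounded[OF this] show ?thesis
        unfolding bounded_pos using that by (meson imageI)
    qed
    have "uniform_limit {x/2..2*x} p q sequentially"
      unfolding uniform_limit_iff
    proof (intro allI impI)
      fix e :: real assume "0 < e"
      then have "0 < e / B" using B(2) by simp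
      with t have "\<forall>\<^sub>F n in sequentially. dist (t n) 0 < e / B" by (rule tendstoD)
      then show "\<forall>\<^sub>F n in sequentially. \<forall>y\<in>{x/2..2*x}. dist (p n y) (q y) < e"
      proof eventually_elim
        case (elim n)
        show ?case
        proof
          fix y assume y: "y \<in> {x/2..2*x}"
          then have "dist (p n y) (q y) \<le> g y * t n"
            using pq[of y n] x by (simp add: dist_norm norm_minus_commute)
          also have "\<dots> \<le> \<bar>g y\<bar> * \<bar>t n\<bar>" by (metis abs_ge_self abs_mult)
          also have "\<dots> \<le> B * \<bar>t n\<bar>" using B(1)[OF y] by (intro mult_right_mono) auto
          also have "\<dots> < e" using elim B(2) by (simp add: field_simps)
          finally show "dist (p n y) (q y) < e" .
        qed
      qed
    qed
    then have "continuous_on {x/2..2*x} q"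
      by (rule uniform_limit_theorem[rotated])
         (use x in \<open>auto intro!: eventuallyI continuous_on_subset[OF pc]\<close>)
    moreover have "x \<in> interior {x/2..2*x}" using x by (simp add: interior_atLeastAtMost_real)
    ultimately show "isCont q x" by (rule continuous_on_interior)
  qed
  have qb: "norm (q x) \<le> g x * integral {0<..} h" if "0 < x" for x
  proof -
    have "norm (q x) \<le> integral {0<..} (\<lambda>y. g x * h y)"
      unfolding q_def
      by (rule integral_norm_bound_integral[OF halfline_integrable[OF fx[OF that] bnd[OF that] hx(1)] hx(1)])
         (use bnd that in auto)
    then show ?thesis by simp
  qed
  show "continuous_on {0<..} (\<lambda>x. integral {0<..} (f x))" using qc by (simp add: q_def)
  show "continuous_on {0<..} (\<lambda>x. integral (IK n) (f x))" using pc by (simp add: p_def)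
  show "0 < x \<Longrightarrow> norm (integral {0<..} (f x)) \<le> g x * integral {0<..} h"
    using qb by (simp add: q_def)
  show "0 < x \<Longrightarrow> norm (integral {0<..} (f x) - integral (IK n) (f x))
      \<le> g x * (integral {0<..} h - integral (IK n) h)"
    using pq by (simp add: p_def q_def t_def)
qed

text \<open>On a compact square the two orders agree because the integrand is continuous. Both
  iterated integrals are limits of integrals over the squares \<open>IK n\<close> times
  \<open>IK n\<close>, with an error controlled by the tail of one factor of the bound.\<close>

lemma halfline_fubini:
  fixes f :: "real \<Rightarrow> real \<Rightarrow> 'b::banach"
  assumes f: "continuous_on ({0<..} \<times> {0<..}) (\<lambda>(x, y). f x y)"
    and bnd: "\<And>x y. 0 < x \<Longrightarrow> 0 < y \<Longrightarrow> norm (f x y) \<le> g x * h y"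
    and g: "g integrable_on {0<..}" "continuous_on {0<..} g" "\<And>r. 0 < r \<Longrightarrow> 0 \<le> g r"
    and h: "h integrable_on {0<..}" "continuous_on {0<..} h" "\<And>r. 0 < r \<Longrightarrow> 0 \<le> h r"
  shows "integral {0<..} (\<lambda>x. integral {0<..} (f x)) = integral {0<..} (\<lambda>y. integral {0<..} (\<lambda>x. f x y))"
proof -
  \<comment> \<open>Stated for fresh data, so that it can also be applied with the two variables
    exchanged.\<close>
  have half: "(\<lambda>n. integral (IK n) (\<lambda>x. integral (IK n) (f x))) \<longlonglongrightarrow> integral {0<..} (\<lambda>x. integral {0<..} (f x))"
    if f: "continuous_on ({0<..} \<times> {0<..}) (\<lambda>(x, y). f x y)"
    and bnd: "\<And>x y. 0 < x \<Longrightarrow> 0 < y \<Longrightarrow> norm (f x y) \<le> g x * h y"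
    and g: "g integrable_on {0<..}" "continuous_on {0<..} g" "\<And>r. 0 < r \<Longrightarrow> 0 \<le> g r"
    and h: "h integrable_on {0<..}" "continuous_on {0<..} h" "\<And>r. 0 < r \<Longrightarrow> 0 \<le> h r"
    for f :: "real \<Rightarrow> real \<Rightarrow> 'b" and g h
  proof -
    define p where "p = (\<lambda>n x. integral (IK n) (f x))"
    define q where "q = (\<lambda>x. integral {0<..} (f x))"
    define t where "t = (\<lambda>n. integral {0<..} h - integral (IK n) h)"
    note param = halfline_param[OF f bnd g h]
    have t: "t \<longlonglongrightarrow> 0"
      unfolding t_def using tendsto_diff[OF tendsto_const[of "integral {0<..} h"] halfline_trunc_real[OF h]] by simp
    have qc: "continuous_on {0<..} q" and pc: "continuous_on {0<..} (p n)" for n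
      using param(1,2) by (simp_all add: p_def q_def)
    have qb: "norm (q x) \<le> g x * integral {0<..} h" and pq: "norm (q x - p n x) \<le> g x * t n"
      if "0 < x" for x n
      using param(3)[of x] param(4)[of x n] that by (simp_all add: p_def q_def t_def)
    have lq: "(\<lambda>n. integral (IK n) q) \<longlonglongrightarrow> integral {0<..} q"
    proof (rule halfline_trunc[OF qc qb])
      show "(\<lambda>r. g r * integral {0<..} h) integrable_on {0<..}" by (rule integrable_on_mult_left[OF g(1)])
      show "continuous_on {0<..} (\<lambda>r. g r * integral {0<..} h)" using g(2) by (intro continuous_intros)
    qed
    have "(\<lambda>n. integral (IK n) q - integral (IK n) (p n)) \<longlonglongrightarrow> 0"
    proof (rule Lim_null_comparison)
      show "\<forall>\<^sub>F n in sequentially. norm (integral (IK n) q - integral (IK n) (p n)) \<le> integral (IK n) g * t n"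
      proof (rule always_eventually, rule allI)
        fix n
        have "integral (IK n) q - integral (IK n) (p n) = integral (IK n) (\<lambda>x. q x - p n x)"
          by (rule integral_diff[symmetric]) (auto intro: continuous_integrable_IK qc pc)
        also have "norm \<dots> \<le> integral (IK n) (\<lambda>x. g x * t n)"
        proof (rule integral_norm_bound_integral)
          show "(\<lambda>x. q x - p n x) integrable_on IK n"
            by (intro integrable_diff continuous_integrable_IK qc pc)
          show "(\<lambda>x. g x * t n) integrable_on IK n"
            by (intro integrable_on_mult_left continuous_integrable_IK g)
          show "norm (q x - p n x) \<le> g x * t n" if "x \<in> IK n" for x
            using pq[of x n] that IK_subset[of n] by auto
        qed
        also have "\<dots> = integral (IK n) g * t n" by simp
        finally show "norm (integral (IK n) q - integral (IK n) (p n)) \<le> integral (IK n) g * t n" .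
      qed
      show "(\<lambda>n. integral (IK n) g * t n) \<longlonglongrightarrow> 0"
        using tendsto_mult[OF halfline_trunc_real[OF g] t] by simp
    qed
    from tendsto_diff[OF lq this] show ?thesis by (simp add: p_def q_def)
  qed
  have f': "continuous_on ({0<..} \<times> {0<..}) (\<lambda>(y, x). f x y)"
  proof -
    have "continuous_on ({0<..} \<times> {0<..}) (\<lambda>p. (snd p, fst p) :: real \<times> real)"
      by (intro continuous_intros)
    from continuous_on_compose2[OF f this] show ?thesis
      by (auto simp: case_prod_unfold image_subset_iff)
  qed
  have 1: "(\<lambda>n. integral (IK n) (\<lambda>x. integral (IK n) (f x))) \<longlonglongrightarrow> integral {0<..} (\<lambda>x. integral {0<..} (f x))"
    by (rule half[OF f bnd g h])
  have 2: "(\<lambda>n. integral (IK n) (\<lambda>y. integral (IK n) (\<lambda>x. f x y)))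
      \<longlonglongrightarrow> integral {0<..} (\<lambda>y. integral {0<..} (\<lambda>x. f x y))"
    by (rule half[OF f' _ h g]) (use bnd in \<open>auto simp: mult.commute\<close>)
  have "integral (IK n) (\<lambda>x. integral (IK n) (f x)) = integral (IK n) (\<lambda>y. integral (IK n) (\<lambda>x. f x y))" for n
    unfolding IK_def interval_cbox
  proof (rule integral_swap_continuous)
    show "continuous_on (cbox (1 / (real n + 1), 1 / (real n + 1)) (real n + 1, real n + 1)) (\<lambda>(x, y). f x y)"
      by (rule continuous_on_subset[OF f]) (use IK_subset[of n] in \<open>auto simp: IK_def cbox_Pair_eq\<close>)
  qed
  with 1 2 show ?thesis using LIMSEQ_unique by simp
qed

section \<open>Power envelopes for growth at zero and at infinity\<close>

text \<open>A two-sided power weight: \<open>p\<close> and \<open>q\<close> are the critical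
  exponents at 0 and at infinity, and \<open>a\<close> is the margin by which both are beaten.
  Exponents and margins add under multiplication, and the pair (-1,-1) with a positive margin is
  integrable, so every convergence question reduces to adding exponents.\<close>

definition env :: "real \<Rightarrow> real \<Rightarrow> real \<Rightarrow> real \<Rightarrow> real" where
  "env p q a r = (if r \<le> 1 then r powr (p + a) else r powr (q - a))"

lemma env_nonneg: "0 \<le> env p q a r"
  by (simp add: env_def)

lemma env_mono:
  assumes "0 < r" "p' + a' \<le> p + a" "q - a \<le> q' - a'"
  shows "env p q a r \<le> env p' q' a' r"
  using assms by (auto simp: env_def intro: powr_mono powr_mono')

lemma env_mult:
  assumes "0 < r"
  shows "env p q a r * env p' q' b r = env (p + p') (q + q') (a + b) r"
  using assms by (simp add: env_def powr_add[symmetric] algebra_simps)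

lemma env_powr:
  assumes "0 < r"
  shows "r powr s = env s s 0 r"
  by (simp add: env_def)

lemma continuous_on_env: "continuous_on {0<..} (env p q a)"
proof -
  have "env p q a = (\<lambda>r. min r 1 powr (p + a) * max r 1 powr (q - a))"
    by (auto simp: env_def fun_eq_iff min_def max_def)
  then show ?thesis by (auto intro!: continuous_intros)
qed

lemma env_integrable:
  assumes "0 < a"
  shows "env (-1) (-1) a integrable_on {0<..}"
proof -
  have "(\<lambda>r. r powr (a - 1)) integrable_on {0<..1::real}"
    by (rule integrable_on_powr_from_0') (use assms in auto)
  then have 1: "env (-1) (-1) a integrable_on {0<..1}"
    by (rule integrable_eq) (auto simp: env_def algebra_simps)
  have "(\<lambda>r. r powr (-1 - a)) integrable_on {1..}"
    using has_integral_powr_to_inf[of "-1 - a" 1] assms by (auto simp: integrable_on_def)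
  then have 2: "env (-1) (-1) a integrable_on {1..}"
    by (rule integrable_eq) (auto simp: env_def algebra_simps)
  have "env (-1) (-1) a integrable_on ({0<..1} \<union> {1..})"
    by (rule integrable_Un[OF _ 1 2]) (auto intro: negligible_subset[of "{1}"])
  moreover have "{0<..1::real} \<union> {1..} = {0<..}" by auto
  ultimately show ?thesis by simp
qed

section \<open>Rays in a complex module and rotation of contours\<close>

text \<open>Left multiplication of a quaternionic space by one complex slice, in abstract form. The
  action is a parameter \<open>c\<close>, so the same facts serve for the slice acting on the space
  and, through the interpretation \<open>cx\<close>, for scalar integrals.\<close>

locale complex_module =
  fixes c :: "complex \<Rightarrow> 'v::banach \<Rightarrow> 'v"
  assumes bil: "bounded_bilinear c"
    and c_mult: "c (z * w) v = c z (c w v)"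
    and c_1 [simp]: "c 1 v = v"
    and norm_c: "norm (c z v) = cmod z * norm v"
begin

lemmas c_add_left = bounded_bilinear.add_left[OF bil]
lemmas c_add_right = bounded_bilinear.add_right[OF bil]
lemmas c_diff_left = bounded_bilinear.diff_left[OF bil]
lemmas c_diff_right = bounded_bilinear.diff_right[OF bil]
lemmas c_minus_left = bounded_bilinear.minus_left[OF bil]
lemmas c_minus_right = bounded_bilinear.minus_right[OF bil]
lemmas c_scaleR_left = bounded_bilinear.scaleR_left[OF bil]
lemmas c_scaleR_right = bounded_bilinear.scaleR_right[OF bil]
lemmas c_zero_left [simp] = bounded_bilinear.zero_left[OF bil]
lemmas c_zero_right [simp] = bounded_bilinear.zero_right[OF bil]
lemmas c_bounded_linear = bounded_bilinear.bounded_linear_right[OF bil]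
lemmas c_derivative = bounded_bilinear.FDERIV[OF bil]
lemmas c_continuous_on = bounded_bilinear.continuous_on[OF bil]

lemma c_of_real: "c (of_real r) v = r *\<^sub>R v"
  using c_scaleR_left[of r 1 v] by (simp add: scaleR_conv_of_real)

lemma c_commute: "c z (c w v) = c w (c z v)"
  by (metis c_mult mult.commute)

text \<open>The factor \<open>cis y\<close> is the velocity of the path, so this is the contour
  integral of \<open>F\<close> along the ray of angle \<open>y\<close>, traversed outwards.\<close>

definition ray :: "real \<Rightarrow> (complex \<Rightarrow> 'v) \<Rightarrow> 'v" where
  "ray y F = integral {0<..} (\<lambda>r. c (cis y) (F (rcis r y)))"

definition ray_ok :: "real \<Rightarrow> (complex \<Rightarrow> 'v) \<Rightarrow> bool" where
  "ray_ok y F \<longleftrightarrow> continuous_on {0<..} (\<lambda>r. F (rcis r y)) \<and>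
     (\<exists>a>0. \<exists>C. \<forall>r>0. norm (F (rcis r y)) \<le> C * env (-1) (-1) a r)"

lemma ray_okD:
  assumes "ray_ok y F"
  obtains a C where "0 < a" "0 \<le> C"
    "continuous_on {0<..} (\<lambda>r. c (cis y) (F (rcis r y)))"
    "\<And>r. 0 < r \<Longrightarrow> norm (c (cis y) (F (rcis r y))) \<le> C * env (-1) (-1) a r"
    "(\<lambda>r. C * env (-1) (-1) a r) integrable_on {0<..}"
    "continuous_on {0<..} (\<lambda>r. C * env (-1) (-1) a r)"
proof -
  from assms obtain a C where a: "0 < a" and C: "\<forall>r>0. norm (F (rcis r y)) \<le> C * env (-1) (-1) a r"
    and F: "continuous_on {0<..} (\<lambda>r. F (rcis r y))"
    unfolding ray_ok_def by blast
  show ?thesis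
  proof (rule that[OF a])
    show "0 \<le> C" using order_trans[OF norm_ge_zero C[rule_format, of 1]] by (simp add: env_def)
    show "continuous_on {0<..} (\<lambda>r. c (cis y) (F (rcis r y)))"
      by (intro c_continuous_on continuous_on_const F)
    show "norm (c (cis y) (F (rcis r y))) \<le> C * env (-1) (-1) a r" if "0 < r" for r
      using C that by (simp add: norm_c)
    show "(\<lambda>r. C * env (-1) (-1) a r) integrable_on {0<..}"
      by (intro integrable_on_mult_right env_integrable a)
    show "continuous_on {0<..} (\<lambda>r. C * env (-1) (-1) a r)"
      by (intro continuous_intros continuous_on_env)
  qed
qed

lemma ray_integrable:
  assumes "ray_ok y F"
  shows "(\<lambda>r. c (cis y) (F (rcis r y))) integrable_on {0<..}"
  using ray_okD[OF assms] halfline_integrable by metis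

lemma ray_trunc:
  assumes "ray_ok y F"
  shows "(\<lambda>n. integral (IK n) (\<lambda>r. c (cis y) (F (rcis r y)))) \<longlonglongrightarrow> ray y F"
  using ray_okD[OF assms] halfline_trunc unfolding ray_def by metis

lemma ray_add:
  assumes "ray_ok y F" "ray_ok y G"
  shows "ray y (\<lambda>s. F s + G s) = ray y F + ray y G"
  unfolding ray_def c_add_right using assms by (intro integral_add ray_integrable)

lemma ray_diff:
  assumes "ray_ok y F" "ray_ok y G"
  shows "ray y (\<lambda>s. F s - G s) = ray y F - ray y G"
  unfolding ray_def c_diff_right using assms by (intro integral_diff ray_integrable)

lemma ray_linear:
  assumes "ray_ok y F" "bounded_linear L" "\<And>z v. L (c z v) = c z (L v)"
  shows "ray y (\<lambda>s. L (F s)) = L (ray y F)"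
  using integral_linear[OF ray_integrable[OF assms(1)] assms(2)] assms(3)
  unfolding ray_def o_def by simp

lemma ray_cong:
  assumes "\<And>r. 0 < r \<Longrightarrow> F (rcis r y) = G (rcis r y)"
  shows "ray y F = ray y G"
  unfolding ray_def by (rule integral_cong) (simp add: assms)

lemma ray_ok_cong:
  assumes "\<And>r. 0 < r \<Longrightarrow> F (rcis r y) = G (rcis r y)"
  shows "ray_ok y F \<longleftrightarrow> ray_ok y G"
proof -
  have "continuous_on {0<..} (\<lambda>r. F (rcis r y)) = continuous_on {0<..} (\<lambda>r. G (rcis r y))"
    by (rule continuous_on_cong) (use assms in auto)
  then show ?thesis unfolding ray_ok_def using assms by simp
qed

lemma ray_ok_diff:
  assumes "ray_ok y F" "ray_ok y G" shows "ray_ok y (\<lambda>s. F s - G s)"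
proof -
  from assms obtain a b C D where a: "0 < a" "0 < b"
    and C: "\<And>r. 0 < r \<Longrightarrow> norm (F (rcis r y)) \<le> C * env (-1) (-1) a r"
    and D: "\<And>r. 0 < r \<Longrightarrow> norm (G (rcis r y)) \<le> D * env (-1) (-1) b r"
    and "continuous_on {0<..} (\<lambda>r. F (rcis r y))" "continuous_on {0<..} (\<lambda>r. G (rcis r y))"
    unfolding ray_ok_def by metis
  moreover have "norm (F (rcis r y) - G (rcis r y)) \<le> (\<bar>C\<bar> + \<bar>D\<bar>) * env (-1) (-1) (min a b) r"
    if "0 < r" for r
  proof -
    have "norm (F (rcis r y)) \<le> \<bar>C\<bar> * env (-1) (-1) (min a b) r"
      by (rule order_trans[OF C[OF that]], intro mult_mono env_mono) (use that env_nonneg in auto)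
    moreover have "norm (G (rcis r y)) \<le> \<bar>D\<bar> * env (-1) (-1) (min a b) r"
      by (rule order_trans[OF D[OF that]], intro mult_mono env_mono) (use that env_nonneg in auto)
    ultimately show ?thesis using norm_triangle_ineq4[of "F (rcis r y)" "G (rcis r y)"]
      by (simp add: algebra_simps)
  qed
  ultimately show ?thesis unfolding ray_ok_def
    by (intro conjI continuous_on_diff exI[of _ "min a b"] exI[of _ "\<bar>C\<bar> + \<bar>D\<bar>"]) auto
qed

lemma ray_ok_linear:
  assumes "ray_ok y F" "bounded_linear L" shows "ray_ok y (\<lambda>s. L (F s))"
proof -
  from assms obtain a C where a: "0 < a"
    and C: "\<And>r. 0 < r \<Longrightarrow> norm (F (rcis r y)) \<le> C * env (-1) (-1) a r"
    and F: "continuous_on {0<..} (\<lambda>r. F (rcis r y))"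
    unfolding ray_ok_def by metis
  obtain K where K: "0 < K" "\<And>x. norm (L x) \<le> norm x * K"
    using bounded_linear.pos_bounded[OF assms(2)] by blast
  have "norm (L (F (rcis r y))) \<le> (C * K) * env (-1) (-1) a r" if "0 < r" for r
    using order_trans[OF K(2)[of "F (rcis r y)"] mult_right_mono[OF C[OF that], of K]] K(1) by (simp add: mult_ac)
  then show ?thesis unfolding ray_ok_def
    by (intro conjI bounded_linear.continuous_on[OF assms(2) F] exI[of _ a] exI[of _ "C * K"]) (use a in auto)
qed

lemma ray_ok_add:
  assumes "ray_ok y F" "ray_ok y G" shows "ray_ok y (\<lambda>s. F s + G s)"
  using ray_ok_diff[OF assms(1) ray_ok_linear[OF assms(2) bounded_linear_minus[OF bounded_linear_ident]]]
  by simp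

text \<open>Cauchy's theorem for two rays: on truncated rays the derivative of the integral with respect
  to the angle is a boundary term, because the angular derivative of the integrand is a radial one.\<close>

lemma ray_shift:
  fixes F F' :: "complex \<Rightarrow> 'v"
  assumes y: "y1 \<le> y2"
    and der: "\<And>r y. 0 < r \<Longrightarrow> y \<in> {y1..y2} \<Longrightarrow>
        (F has_derivative (\<lambda>h. c h (F' (rcis r y)))) (at (rcis r y))"
    and F': "continuous_on {rcis r y |r y. 0 < r \<and> y \<in> {y1..y2}} F'"
    and bnd: "\<And>r y. 0 < r \<Longrightarrow> y \<in> {y1..y2} \<Longrightarrow> norm (F (rcis r y)) \<le> C * env (-1) (-1) a r"
    and a: "0 < a"
  shows "ray y1 F = ray y2 F" and "y \<in> {y1..y2} \<Longrightarrow> ray_ok y F"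
proof -
  have Fc: "isCont F (rcis r y)" if "0 < r" "y \<in> {y1..y2}" for r y
    using der[OF that] by (rule has_derivative_continuous)
  have rc: "continuous_on X (\<lambda>(y, r). rcis r y)" for X
    unfolding rcis_def case_prod_unfold by (intro continuous_intros)
  have Fcont: "continuous_on {rcis r y |r y. 0 < r \<and> y \<in> {y1..y2}} F"
    by (rule continuous_at_imp_continuous_on) (use Fc in auto)
  have ok: "ray_ok y F" if "y \<in> {y1..y2}" for y
  proof -
    have "continuous_on {0<..} (\<lambda>r. rcis r y)" unfolding rcis_def by (intro continuous_intros)
    then have "continuous_on {0<..} (\<lambda>r. F (rcis r y))"
      by (rule continuous_on_compose2[OF Fcont]) (use that in auto)
    with a bnd that show ?thesis unfolding ray_ok_def by blast
  qed
  then show "y \<in> {y1..y2} \<Longrightarrow> ray_ok y F" .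
  define I where "I = (\<lambda>n y. integral (IK n) (\<lambda>r. c (cis y) (F (rcis r y))))"
  define d where "d = (\<lambda>y r. c \<i> (c (cis y) (F (rcis r y)) + c (cis y) (c (rcis r y) (F' (rcis r y)))))"
  \<comment> \<open>A radial primitive of \<open>d\<close>: because \<open>F'\<close> is a complex
    derivative, turning the ray and moving along it differ only by the factor \<i> r.\<close>
  define b where "b = (\<lambda>y r. c (\<i> * rcis r y) (F (rcis r y)))"
  have dcis: "(cis has_vector_derivative \<i> * cis y) (at y within X)" for y X
    unfolding has_vector_derivative_def by (rule has_derivative_cis[OF has_derivative_ident])
  have chain: "((\<lambda>x. F (p x)) has_vector_derivative c p' (F' (rcis r y))) (at x within X)"
    if "(p has_vector_derivative p') (at x within X)" "p x = rcis r y" "0 < r" "y \<in> {y1..y2}"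
    for p p' r y x X
    using has_derivative_compose[OF that(1)[unfolded has_vector_derivative_def], of F "\<lambda>h. c h (F' (rcis r y))"]
      der[OF that(3,4)] that(2) by (simp add: has_vector_derivative_def c_scaleR_left)
  have dy: "((\<lambda>y. c (cis y) (F (rcis r y))) has_vector_derivative d y r) (at y within {y1..y2})"
    if "0 < r" "y \<in> {y1..y2}" for r y
  proof -
    have 1: "((\<lambda>y. rcis r y) has_vector_derivative of_real r * (\<i> * cis y)) (at y within {y1..y2})"
      unfolding rcis_def by (rule has_vector_derivative_mult_right[OF dcis])
    show ?thesis
      using bounded_bilinear.has_vector_derivative[OF bil dcis chain[OF 1 refl that]]
      by (simp add: d_def c_add_right rcis_def mult_ac add_ac flip: c_mult)
  qed
  have dr: "(b y has_vector_derivative d y r) (at r within X)"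
    if "0 < r" "y \<in> {y1..y2}" for r y X
  proof -
    have 1: "((\<lambda>r. rcis r y) has_vector_derivative cis y) (at r within X)"
      unfolding rcis_def by (auto intro!: derivative_eq_intros simp: scaleR_conv_of_real[symmetric])
    have 2: "((\<lambda>r. \<i> * rcis r y) has_vector_derivative \<i> * cis y) (at r within X)"
      by (rule has_vector_derivative_mult_right[OF 1])
    show ?thesis
      using bounded_bilinear.has_vector_derivative[OF bil 2 chain[OF 1 refl that]]
      by (simp add: d_def b_def c_add_right rcis_def mult_ac add_ac flip: c_mult)
  qed
  have dc: "continuous_on ({y1..y2} \<times> IK n) (\<lambda>(y, r). d y r)" for n
  proof -
    have p: "continuous_on ({y1..y2} \<times> IK n) (\<lambda>x. rcis (snd x) (fst x))"
      using rc[of "{y1..y2} \<times> IK n"] by (simp add: case_prod_unfold)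
    have im: "(\<lambda>x. rcis (snd x) (fst x)) ` ({y1..y2} \<times> IK n) \<subseteq> {rcis r y |r y. 0 < r \<and> y \<in> {y1..y2}}"
    proof safe
      fix b y assume "b \<in> IK n" "y \<in> {y1..y2}"
      then show "\<exists>r y'. rcis (snd (y, b)) (fst (y, b)) = rcis r y' \<and> 0 < r \<and> y' \<in> {y1..y2}"
        using IK_subset[of n] by (intro exI[of _ b] exI[of _ y]) auto
    qed
    from continuous_on_compose2[OF Fcont p im] continuous_on_compose2[OF F' p im]
    show ?thesis unfolding d_def case_prod_unfold
      by (intro c_continuous_on continuous_on_add continuous_on_const p) (auto intro!: continuous_intros)
  qed
  have Ider: "(I n has_vector_derivative b y (real n + 1) - b y (1 / (real n + 1))) (at y within {y1..y2})"
    if "y \<in> {y1..y2}" for n y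
  proof -
    have "(I n has_vector_derivative integral (IK n) (d y)) (at y within {y1..y2})"
      unfolding I_def IK_def interval_cbox
    proof (rule leibniz_rule_vector_derivative)
      show "((\<lambda>y. c (cis y) (F (rcis t y))) has_vector_derivative d x t) (at x within cbox y1 y2)"
        if "x \<in> cbox y1 y2" "t \<in> cbox (1 / (real n + 1)) (real n + 1)" for x t
        using dy[of t x] that IK_subset[of n] by (auto simp: IK_def)
      show "(\<lambda>r. c (cis x) (F (rcis r x))) integrable_on cbox (1 / (real n + 1)) (real n + 1)"
        if "x \<in> cbox y1 y2" for x
        using continuous_integrable_IK ray_okD[OF ok] that by (metis IK_def interval_cbox)
      show "continuous_on (cbox y1 y2 \<times> cbox (1 / (real n + 1)) (real n + 1)) (\<lambda>(x, t). d x t)"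
        using dc[of n] by (simp add: IK_def)
    qed (use that in auto)
    moreover have "(d y has_integral b y (real n + 1) - b y (1 / (real n + 1))) (IK n)"
      unfolding IK_def
    proof (rule fundamental_theorem_of_calculus)
      show "1 / (real n + 1) \<le> real n + 1" by (simp add: field_simps add_increasing)
      show "(b y has_vector_derivative d y r) (at r within {1 / (real n + 1)..real n + 1})"
        if "r \<in> {1 / (real n + 1)..real n + 1}" for r
        using dr[of r y] \<open>y \<in> {y1..y2}\<close> that IK_subset[of n] by (auto simp: IK_def)
    qed
    ultimately show ?thesis by (simp add: integral_unique)
  qed
  \<comment> \<open>The extra factor r raises both critical exponents by one, from -1 to 0, and the
    margin \<open>a\<close> still makes the boundary terms vanish at both ends.\<close>
  have bb: "norm (b y r) \<le> C * env 0 0 a r" if "0 < r" "y \<in> {y1..y2}" for r y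
  proof -
    have "norm (b y r) \<le> r * (C * env (-1) (-1) a r)"
      using bnd[OF that] that(1) by (simp add: b_def norm_c norm_mult rcis_def)
    also have "\<dots> = C * (env 1 1 0 r * env (-1) (-1) a r)"
      using env_powr[OF that(1), of 1] that(1) by simp
    finally show ?thesis using env_mult[OF that(1), of 1 1 0 "-1" "-1" a] by simp
  qed
  define e where "e = (\<lambda>n. C * env 0 0 a (real n + 1) + C * env 0 0 a (1 / (real n + 1)))"
  have est: "norm (I n y2 - I n y1) \<le> e n * (y2 - y1)" for n
  proof -
    have "norm (I n y2 - I n y1) \<le> e n * norm (y2 - y1)"
    proof (rule differentiable_bound[of "{y1..y2}" "I n"])
      show "(I n has_derivative (\<lambda>h. h *\<^sub>R (b x (real n + 1) - b x (1 / (real n + 1))))) (at x within {y1..y2})"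
        if "x \<in> {y1..y2}" for x
        using Ider[OF that] by (simp add: has_vector_derivative_def)
      show "onorm (\<lambda>h. h *\<^sub>R (b x (real n + 1) - b x (1 / (real n + 1)))) \<le> e n" if "x \<in> {y1..y2}" for x
      proof (rule onorm_le)
        fix h :: real
        have "norm (b x (real n + 1) - b x (1 / (real n + 1))) \<le> e n"
          unfolding e_def
          by (rule order_trans[OF norm_triangle_ineq4], intro add_mono bb) (use that in auto)
        then show "norm (h *\<^sub>R (b x (real n + 1) - b x (1 / (real n + 1)))) \<le> e n * norm h"
          by (simp add: mult.commute mult_left_mono)
      qed
    qed (use y in auto)
    then show ?thesis using y by simp
  qed
  have "e \<longlonglongrightarrow> C * 0 + C * 0"
  proof -
    have "(\<lambda>n. env 0 0 a (real n + 1)) \<longlonglongrightarrow> 0"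
    proof (rule Lim_transform_eventually)
      show "(\<lambda>n. (real n + 1) powr - a) \<longlonglongrightarrow> 0" using a by real_asymp
      show "\<forall>\<^sub>F n in sequentially. (real n + 1) powr - a = env 0 0 a (real n + 1)"
        using eventually_gt_at_top[of 0] by eventually_elim (auto simp: env_def)
    qed
    moreover have "(\<lambda>n. env 0 0 a (1 / (real n + 1))) \<longlonglongrightarrow> 0"
    proof (rule Lim_transform_eventually)
      show "(\<lambda>n. (1 / (real n + 1)) powr a) \<longlonglongrightarrow> 0" using a by real_asymp
      show "\<forall>\<^sub>F n in sequentially. (1 / (real n + 1)) powr a = env 0 0 a (1 / (real n + 1))"
        by (auto simp: env_def)
    qed
    ultimately show ?thesis unfolding e_def by (intro tendsto_intros)
  qed
  then have "(\<lambda>n. e n * (y2 - y1)) \<longlonglongrightarrow> 0" using tendsto_mult_left_zero by fastforce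
  then have "(\<lambda>n. I n y2 - I n y1) \<longlonglongrightarrow> 0"
    by (rule Lim_null_comparison[rotated]) (use est in auto)
  moreover have "(\<lambda>n. I n y2 - I n y1) \<longlonglongrightarrow> ray y2 F - ray y1 F"
    unfolding I_def using y by (intro tendsto_diff ray_trunc ok) auto
  ultimately show "ray y1 F = ray y2 F" using LIMSEQ_unique by fastforce
qed

end

lemma env_pos: "0 < r \<Longrightarrow> 0 < env p q a r"
  by (simp add: env_def)

text \<open>A bound near 0 and near infinity extends to the whole closed sector by compactness.\<close>

lemma sector_bound_extend:
  fixes q :: "complex \<Rightarrow> 'v::real_normed_vector"
  assumes q: "continuous_on {rcis r y |r y. 0 < r \<and> y \<in> {y1..y2}} q"
    and bnd: "\<And>r y. 0 < r \<Longrightarrow> y \<in> {y1..y2} \<Longrightarrow> r < r1 \<or> r > r2 \<Longrightarrow> norm (q (rcis r y)) \<le> C * env p p' a r"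
    and r1: "0 < r1"
  obtains C' where "\<And>r y. 0 < r \<Longrightarrow> y \<in> {y1..y2} \<Longrightarrow> norm (q (rcis r y)) \<le> C' * env p p' a r"
proof -
  define X where "X = (\<lambda>(r, y). rcis r y) ` ({r1..r2} \<times> {y1..y2})"
  have Xsub: "X \<subseteq> {rcis r y |r y. 0 < r \<and> y \<in> {y1..y2}}"
    unfolding X_def using r1 by force
  have "compact X" unfolding X_def rcis_def case_prod_unfold
    by (intro compact_continuous_image continuous_intros compact_Times compact_Icc)
  then have "compact (q ` X)"
    by (intro compact_continuous_image continuous_on_subset[OF q Xsub])
  from compact_imp_bounded[OF this] obtain B where B: "\<And>x. x \<in> X \<Longrightarrow> norm (q x) \<le> B"
    by (auto simp: bounded_iff)
  have "\<exists>m>0. \<forall>r\<in>{r1..r2}. m \<le> env p p' a r"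
  proof (cases "{r1..r2} = {}")
    case False
    have "continuous_on {r1..r2} (env p p' a)"
      by (rule continuous_on_subset[OF continuous_on_env]) (use r1 in auto)
    from continuous_attains_inf[OF compact_Icc False this]
    obtain x where "x \<in> {r1..r2}" "\<forall>r\<in>{r1..r2}. env p p' a x \<le> env p p' a r" by blast
    then show ?thesis using env_pos[of x p p' a] r1 by auto
  qed (auto intro: exI[of _ 1])
  then obtain m where m: "0 < m" "\<And>r. r \<in> {r1..r2} \<Longrightarrow> m \<le> env p p' a r" by blast
  show ?thesis
  proof (rule that)
    fix r y :: real assume ry: "0 < r" "y \<in> {y1..y2}"
    show "norm (q (rcis r y)) \<le> (\<bar>C\<bar> + \<bar>B\<bar> / m) * env p p' a r"
    proof (cases "r \<in> {r1..r2}")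
      case True
      then have "norm (q (rcis r y)) \<le> \<bar>B\<bar> / m * m"
        using B[of "rcis r y"] ry m(1) unfolding X_def by force
      also have "\<dots> \<le> (\<bar>C\<bar> + \<bar>B\<bar> / m) * env p p' a r"
        by (rule mult_mono) (use m True in auto)
      finally show ?thesis .
    next
      case False
      then have "norm (q (rcis r y)) \<le> C * env p p' a r" using bnd[OF ry] by auto
      also have "\<dots> \<le> (\<bar>C\<bar> + \<bar>B\<bar> / m) * env p p' a r"
        by (rule mult_right_mono) (use m env_nonneg in \<open>auto intro: add_increasing2\<close>)
      finally show ?thesis .
    qed
  qed
qed

section \<open>Scalar Cauchy integrals along the boundary of a sector\<close>

interpretation cx: complex_module "(*) :: complex \<Rightarrow> complex \<Rightarrow> complex"
  by (rule complex_module.intro) (auto simp: bounded_bilinear_mult norm_mult)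

text \<open>The sector as a strict inequality between cosines of angles: it is visibly open, it
  avoids any argument function, and strictness excludes the vertex.\<close>

definition sec :: "real \<Rightarrow> complex set" where
  "sec t = {z. cmod z * cos t < Re z}"

lemma open_sec: "open (sec t)"
  unfolding sec_def by (intro open_Collect_less continuous_intros)

lemma rcis_in_sec:
  assumes "0 < r" "\<bar>y\<bar> < t" "t \<le> pi"
  shows "rcis r y \<in> sec t"
proof -
  have "cos t < cos \<bar>y\<bar>" using assms by (intro cos_monotone_0_pi) auto
  then show ?thesis using assms(1) by (simp add: sec_def cos_abs_real)
qed

lemma rcis_notin_sec:
  assumes "0 < r" "0 \<le> t" "t \<le> y" "y \<le> 2 * pi - t"
  shows "rcis r y \<notin> sec t"
proof -
  have "cos y \<le> cos t"
  proof (cases "y \<le> pi")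
    case True
    then show ?thesis using assms by (intro cos_monotone_0_pi_le) auto
  next
    case False
    have "cos (2 * pi - y) \<le> cos t" using assms False by (intro cos_monotone_0_pi_le) auto
    then show ?thesis by (simp add: cos_diff)
  qed
  then show ?thesis using assms(1) by (simp add: sec_def)
qed

lemma sec_rcis:
  assumes "z \<in> sec t" "0 < t" "t < pi"
  obtains r y where "0 < r" "\<bar>y\<bar> < t" "z = rcis r y"
proof (rule that[of "cmod z" "Arg z"])
  have z: "z \<noteq> 0" using assms(1) by (auto simp: sec_def)
  then show "0 < cmod z" by simp
  show "z = rcis (cmod z) (Arg z)" by (simp add: rcis_cmod_Arg)
  then have "Re z = cmod z * cos (Arg z)" by (metis Re_rcis)
  then have "cos t < cos \<bar>Arg z\<bar>" using assms(1) z by (simp add: sec_def cos_abs_real)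
  then show "\<bar>Arg z\<bar> < t"
    using assms cos_mono_less_eq[of t "\<bar>Arg z\<bar>"] Arg_bounded[of z] by auto
qed

lemma sec_nz: "z \<in> sec t \<Longrightarrow> z \<noteq> 0"
  by (auto simp: sec_def)

lemma has_derivative_holomorphic:
  assumes "h holomorphic_on S" "open S" "z \<in> S"
  shows "(h has_derivative (\<lambda>w. w * deriv h z)) (at z)"
  using holomorphic_derivI[OF assms(1,2,3)] by (simp add: has_field_derivative_def mult_commute_abs)

lemma cx_shift:
  assumes "q holomorphic_on S" "open S" "y1 \<le> y2" "0 < a"
    and sub: "\<And>r y. 0 < r \<Longrightarrow> y \<in> {y1..y2} \<Longrightarrow> rcis r y \<in> S"
    and bnd: "\<And>r y. 0 < r \<Longrightarrow> y \<in> {y1..y2} \<Longrightarrow> norm (q (rcis r y)) \<le> C * env (-1) (-1) a r"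
  shows "cx.ray y1 q = cx.ray y2 q" and "y \<in> {y1..y2} \<Longrightarrow> cx.ray_ok y q"
proof -
  have 1: "(q has_derivative (\<lambda>h. h * deriv q (rcis r y))) (at (rcis r y))"
    if "0 < r" "y \<in> {y1..y2}" for r y
    using has_derivative_holomorphic[OF assms(1,2) sub[OF that]] .
  have 2: "continuous_on {rcis r y |r y. 0 < r \<and> y \<in> {y1..y2}} (deriv q)"
    using holomorphic_deriv[OF assms(1,2)] by (rule holomorphic_on_imp_continuous_on[THEN continuous_on_subset]) (use sub in auto)
  show "cx.ray y1 q = cx.ray y2 q" by (rule cx.ray_shift(1)[OF assms(3) 1 2 bnd assms(4)])
  show "y \<in> {y1..y2} \<Longrightarrow> cx.ray_ok y q" by (rule cx.ray_shift(2)[OF assms(3) 1 2 bnd assms(4)])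
qed

text \<open>The function is bounded at 0 and decays quadratically at infinity, which is margin 1
  over the critical exponent at either end. Below half of the smaller pole modulus and beyond twice
  the larger one, each factor is at least half of |a| or |b|, respectively half of |s|; compactness
  covers the rest.\<close>

lemma two_pole_shift:
  assumes "y1 \<le> y2" "a \<noteq> 0" "b \<noteq> 0"
    and av: "\<And>r y. 0 < r \<Longrightarrow> y \<in> {y1..y2} \<Longrightarrow> rcis r y \<noteq> a \<and> rcis r y \<noteq> b"
  shows "cx.ray y1 (\<lambda>s. 1 / ((s - a) * (s - b))) = cx.ray y2 (\<lambda>s. 1 / ((s - a) * (s - b)))"
    and "y \<in> {y1..y2} \<Longrightarrow> cx.ray_ok y (\<lambda>s. 1 / ((s - a) * (s - b)))"
proof -
  let ?q = "\<lambda>s. 1 / ((s - a) * (s - b))"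
  have h: "?q holomorphic_on - {a, b}" by (intro holomorphic_intros) auto
  have op: "open (- {a, b})" by (simp add: open_Compl finite_imp_closed)
  have sub: "rcis r y \<in> - {a, b}" if "0 < r" "y \<in> {y1..y2}" for r y
    using av[OF that] by auto
  define r1 where "r1 = min 1 (min (cmod a / 2) (cmod b / 2))"
  define r2 where "r2 = max 1 (max (2 * cmod a) (2 * cmod b))"
  have pos: "0 < cmod (rcis r y - a) * cmod (rcis r y - b)" if "0 < r" "y \<in> {y1..y2}" for r y
    using av[OF that] by simp
  have q: "continuous_on {rcis r y |r y. 0 < r \<and> y \<in> {y1..y2}} ?q"
    by (rule continuous_on_subset[OF holomorphic_on_imp_continuous_on[OF h]]) (use sub in auto)
  have "norm (?q (rcis r y)) \<le> (4 / (cmod a * cmod b) + 4) * env (-1) (-1) 1 r"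
    if ry: "0 < r" "y \<in> {y1..y2}" "r < r1 \<or> r > r2" for r y
    using ry(3)
  proof
    assume r: "r < r1"
    have "cmod a / 2 \<le> cmod (rcis r y - a)" "cmod b / 2 \<le> cmod (rcis r y - b)"
      using norm_triangle_ineq2[of a "rcis r y"] norm_triangle_ineq2[of b "rcis r y"] r ry(1)
      by (auto simp: r1_def norm_minus_commute)
    then have "(cmod a / 2) * (cmod b / 2) \<le> cmod (rcis r y - a) * cmod (rcis r y - b)"
      by (intro mult_mono) auto
    then have "1 / (cmod (rcis r y - a) * cmod (rcis r y - b)) \<le> 1 / ((cmod a / 2) * (cmod b / 2))"
      using assms pos[OF ry(1,2)] by (intro divide_left_mono mult_pos_pos[OF pos[OF ry(1,2)]]) auto
    moreover have "env (-1) (-1) 1 r = 1" using r ry(1) by (simp add: env_def r1_def)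
    ultimately show ?thesis by (simp add: norm_divide norm_mult)
  next
    assume r: "r > r2"
    have "r / 2 \<le> cmod (rcis r y - a)" "r / 2 \<le> cmod (rcis r y - b)"
      using norm_triangle_ineq2[of "rcis r y" a] norm_triangle_ineq2[of "rcis r y" b] r ry(1)
      by (auto simp: r2_def norm_minus_commute)
    then have "(r / 2) * (r / 2) \<le> cmod (rcis r y - a) * cmod (rcis r y - b)"
      using ry(1) by (intro mult_mono) auto
    then have "1 / (cmod (rcis r y - a) * cmod (rcis r y - b)) \<le> 1 / ((r / 2) * (r / 2))"
      using ry(1) by (intro divide_left_mono mult_pos_pos[OF pos[OF ry(1,2)]]) auto
    moreover have "env (-1) (-1) 1 r = 1 / r^2"
      using r ry(1) by (simp add: env_def r2_def powr_minus divide_inverse flip: powr_numeral)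
    ultimately have "norm (?q (rcis r y)) \<le> 4 * env (-1) (-1) 1 r"
      by (simp add: norm_divide norm_mult power2_eq_square)
    also have "\<dots> \<le> (4 / (cmod a * cmod b) + 4) * env (-1) (-1) 1 r"
      by (intro mult_right_mono env_nonneg) auto
    finally show ?thesis .
  qed
  moreover have "0 < r1" using assms by (simp add: r1_def)
  ultimately obtain C where "\<And>r y. 0 < r \<Longrightarrow> y \<in> {y1..y2} \<Longrightarrow> norm (?q (rcis r y)) \<le> C * env (-1) (-1) 1 r"
    using sector_bound_extend[OF q, of r1 r2 _ "-1" "-1" 1] by metis
  note s = cx_shift[OF h op assms(1) zero_less_one sub this]
  show "cx.ray y1 ?q = cx.ray y2 ?q" by (rule s(1))
  show "y \<in> {y1..y2} \<Longrightarrow> cx.ray_ok y ?q" by (rule s(2))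
qed

lemma (in complex_module) ray_period: "ray (2 * pi - y) F = ray (- y) F"
proof -
  have "cis (2 * pi - y) = cis (- y)" by (simp add: cis.code cos_diff sin_diff)
  then show ?thesis by (simp add: ray_def rcis_def)
qed

text \<open>Both rays are turned onto the imaginary axis, where the function becomes -1/(1+r^2) and
  has an arctangent as primitive. This is the explicit value on which the residue formulas below
  rest.\<close>

lemma ray_rational_base:
  assumes "0 < y" "y < pi"
  shows "cx.ray (-y) (\<lambda>s. 1 / ((s - 1) * (s + 1))) - cx.ray y (\<lambda>s. 1 / ((s - 1) * (s + 1))) = pi * \<i>"
proof -
  let ?f = "\<lambda>s::complex. 1 / ((s - 1) * (s - (-1)))"
  have av: "rcis r t \<noteq> 1 \<and> rcis r t \<noteq> -1" if "0 < r" "0 < \<bar>t\<bar>" "\<bar>t\<bar> < pi" for r t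
  proof -
    have "sin t \<noteq> 0" using that sin_gt_zero[of t] sin_gt_zero[of "-t"] by (cases "0 < t") auto
    then show ?thesis using that(1) by (auto simp: complex_eq_iff)
  qed
  have 1: "cx.ray y ?f = cx.ray (pi/2) ?f"
  proof (cases "y \<le> pi/2")
    case True then show ?thesis by (intro two_pole_shift(1) av) (use assms in auto)
  next
    case False then show ?thesis by (intro two_pole_shift(1)[symmetric] av) (use assms in auto)
  qed
  have 2: "cx.ray (-y) ?f = cx.ray (-(pi/2)) ?f"
  proof (cases "y \<le> pi/2")
    case True then show ?thesis by (intro two_pole_shift(1)[symmetric] av) (use assms in auto)
  next
    case False then show ?thesis by (intro two_pole_shift(1) av) (use assms in auto)
  qed
  have f: "cis t * ?f (rcis r t) = - cis t * of_real (1 / (1 + r^2))" if "t = pi/2 \<or> t = -(pi/2)" "0 < r" for t r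
  proof -
    have "cis t = \<i> \<or> cis t = - \<i>" using that(1)
      by (elim disjE; simp only: cis_pi_half cis_minus_pi_half) auto
    then have "(rcis r t)^2 = - ((of_real r)^2)" by (auto simp: rcis_def power_mult_distrib)
    then have "(rcis r t - 1) * (rcis r t - (-1)) = - of_real (1 + r^2)"
      by (simp add: algebra_simps power2_eq_square)
    moreover have "cis t * (1 / - of_real (1 + r^2)) = - cis t * of_real (1 / (1 + r^2))"
      by (simp only: divide_minus_right of_real_divide of_real_1) simp
    ultimately show ?thesis by (simp only:)
  qed
  have lim: "cx.ray t ?f = - cis t * of_real (pi / 2)" if t: "t = pi/2 \<or> t = -(pi/2)" for t
  proof (rule LIMSEQ_unique)
    have avt: "rcis r y \<noteq> 1 \<and> rcis r y \<noteq> -1" if "0 < r" "y \<in> {t..t}" for r y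
      by (rule av[OF that(1)]) (use t that(2) pi_gt_zero in \<open>auto simp del: eq_divide_eq_numeral1\<close>)
    have "cx.ray_ok t ?f" by (rule two_pole_shift(2)[of t t, OF _ _ _ avt]) auto
    then show "(\<lambda>n. integral (IK n) (\<lambda>r. cis t * ?f (rcis r t))) \<longlonglongrightarrow> cx.ray t ?f" by (rule cx.ray_trunc)
    have "integral (IK n) (\<lambda>r. cis t * ?f (rcis r t))
       = - cis t * of_real (arctan (real n + 1) - arctan (1 / (real n + 1)))" for n
    proof (rule integral_unique)
      have "((\<lambda>r. 1 / (1 + r^2)) has_integral (arctan (real n + 1) - arctan (1 / (real n + 1)))) (IK n)"
        unfolding IK_def
        by (rule fundamental_theorem_of_calculus)
           (auto intro!: derivative_eq_intros simp: field_simps add_increasing power2_eq_square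
              simp flip: has_real_derivative_iff_has_vector_derivative)
      then have "((\<lambda>r. - cis t * of_real (1 / (1 + r^2))) has_integral
          - cis t * of_real (arctan (real n + 1) - arctan (1 / (real n + 1)))) (IK n)"
        by (intro has_integral_mult_right has_integral_of_real)
      then show "((\<lambda>r. cis t * ?f (rcis r t)) has_integral
          - cis t * of_real (arctan (real n + 1) - arctan (1 / (real n + 1)))) (IK n)"
        by (rule has_integral_eq[rotated]) (use f[OF t] IK_subset[of n] in auto)
    qed
    moreover have "(\<lambda>n. arctan (real n + 1) - arctan (1 / (real n + 1))) \<longlonglongrightarrow> pi / 2"
      by real_asymp
    then have "(\<lambda>n. - cis t * of_real (arctan (real n + 1) - arctan (1 / (real n + 1)))) \<longlonglongrightarrow> - cis t * of_real (pi / 2)"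
      by (intro tendsto_intros)
    ultimately show "(\<lambda>n. integral (IK n) (\<lambda>r. cis t * ?f (rcis r t))) \<longlonglongrightarrow> - cis t * of_real (pi / 2)"
      by simp
  qed
  have "cx.ray (-y) ?f - cx.ray y ?f = pi * \<i>"
    using lim[of "pi/2"] lim[of "-(pi/2)"] 1 2 by (simp add: complex_eq_iff)
  then show ?thesis by simp
qed

text \<open>Growth with a strict margin over the exponents \<open>p\<close> at 0 and
  \<open>q\<close> at infinity. The exponents 0 0 suffice for the S-calculus and 1 1 for the
  harmonic integral, while 1 0 is the growth of \<Psi>^Q. The cap on \<open>a\<close> costs nothing,
  since a smaller margin is a weaker bound.\<close>

definition cls :: "real \<Rightarrow> real \<Rightarrow> real \<Rightarrow> (complex \<Rightarrow> complex) \<Rightarrow> bool" where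
  "cls t p q h \<longleftrightarrow> h holomorphic_on sec t \<and>
     (\<exists>a C. 0 < a \<and> a \<le> 1 \<and> (\<forall>z\<in>sec t. cmod (h z) \<le> C * env p q a (cmod z)))"

lemma clsE:
  assumes "cls t p q h" "0 < t" "t \<le> pi"
  obtains a C where "h holomorphic_on sec t" "0 < a" "a \<le> 1" "0 \<le> C"
    "\<And>z. z \<in> sec t \<Longrightarrow> cmod (h z) \<le> C * env p q a (cmod z)"
proof -
  from assms obtain a C where h: "h holomorphic_on sec t" "0 < a" "a \<le> 1"
      and b: "\<And>z. z \<in> sec t \<Longrightarrow> cmod (h z) \<le> C * env p q a (cmod z)"
    unfolding cls_def by blast
  have "1 \<in> sec t" using rcis_in_sec[of 1 0 t] assms by simp
  from order_trans[OF norm_ge_zero b[OF this]] have "0 \<le> C" by (simp add: env_def)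
  then show ?thesis using that h b by blast
qed

lemma cls_shift:
  assumes h: "cls t (-1) (-1) h" and "0 < t" "t \<le> pi" "\<bar>y1\<bar> < t" "\<bar>y2\<bar> < t" "y1 \<le> y2"
  shows "cx.ray y1 h = cx.ray y2 h" and "cx.ray_ok y1 h"
proof -
  obtain a C where hol: "h holomorphic_on sec t" "0 < a"
    and b: "\<And>z. z \<in> sec t \<Longrightarrow> cmod (h z) \<le> C * env (-1) (-1) a (cmod z)"
    using clsE[OF assms(1-3)] by metis
  have s: "rcis r y \<in> sec t" if "0 < r" "y \<in> {y1..y2}" for r y
    using rcis_in_sec[of r y t] that assms by auto
  have b': "norm (h (rcis r y)) \<le> C * env (-1) (-1) a r" if "0 < r" "y \<in> {y1..y2}" for r y
    using b[OF s[OF that]] that by simp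
  note c = cx_shift[OF hol(1) open_sec assms(6) hol(2) s b']
  show "cx.ray y1 h = cx.ray y2 h" by (rule c(1))
  show "cx.ray_ok y1 h" by (rule c(2)) (use assms in auto)
qed

text \<open>This kernel has the residue of 1/(s-p) at \<open>p\<close>, but decays quadratically.
  Partial fractions give (p-1) times a term with the poles \<open>p\<close> and 1, both inside the
  sector, plus twice the explicit integral with the poles 1 and -1.\<close>

lemma cauchy_rational:
  assumes f: "0 < f" "f < pi" and p: "p \<in> sec f"
  shows "cx.ray (-f) (\<lambda>s. (1 + p) / ((1 + s) * (s - p))) - cx.ray f (\<lambda>s. (1 + p) / ((1 + s) * (s - p))) = 2 * pi * \<i>"
    and "y = f \<or> y = -f \<Longrightarrow> cx.ray_ok y (\<lambda>s. (1 + p) / ((1 + s) * (s - p)))"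
proof -
  let ?k = "\<lambda>s. (1 + p) / ((1 + s) * (s - p))"
  let ?f = "\<lambda>s::complex. 1 / ((s - p) * (s - 1))"
  let ?g = "\<lambda>s::complex. 1 / ((s - 1) * (s - (-1)))"
  have one: "1 \<in> sec f" using rcis_in_sec[of 1 0 f] f by simp
  have notin: "rcis r y \<notin> sec f" if "0 < r" "y = f \<or> y = - f" for r y
    using rcis_notin_sec[of r f f] rcis_notin_sec[of r f "2 * pi - f"] that f
    by (auto simp: rcis_def cis.code cos_diff sin_diff)
  have ne: "rcis r y \<noteq> p" "rcis r y \<noteq> 1" if "0 < r" "y = f \<or> y = - f" for r y
    using notin[OF that] p one by auto
  have nem: "rcis r y \<noteq> -1" if "0 < r" "y = f \<or> y = - f" for r y
  proof -
    have "sin y \<noteq> 0" using that(2) sin_gt_zero[of f] f by auto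
    then show ?thesis using that(1) by (auto simp: complex_eq_iff)
  qed
  have av: "rcis r y \<noteq> p \<and> rcis r y \<noteq> 1" if "0 < r" "y \<in> {f..2 * pi - f}" for r y
    using rcis_notin_sec[of r f y] that f p one by auto
  \<comment> \<open>With both poles inside, the upper ray can be turned through the exterior, across
    the negative axis, onto the lower one.\<close>
  have D0: "cx.ray f ?f = cx.ray (-f) ?f"
    using two_pole_shift(1)[of f "2 * pi - f" p 1] av f sec_nz[OF p] by (simp add: cx.ray_period)
  have okf: "cx.ray_ok y ?f" if "y = f \<or> y = - f" for y
    by (rule two_pole_shift(2)[of y y]) (use ne that sec_nz[OF p] in auto)
  have okg: "cx.ray_ok y ?g" if "y = f \<or> y = - f" for y
    by (rule two_pole_shift(2)[of y y]) (use ne nem that in auto)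
  have dec: "?k (rcis r y) = (p - 1) * ?f (rcis r y) + 2 * ?g (rcis r y)" if "0 < r" "y = f \<or> y = - f" for r y
  proof -
    have "rcis r y - p \<noteq> 0" "rcis r y - 1 \<noteq> 0" "rcis r y - (-1) \<noteq> 0" "1 + rcis r y \<noteq> 0"
      using ne[OF that] nem[OF that] eq_neg_iff_add_eq_0[of "rcis r y" 1] by (auto simp: add.commute)
    then show ?thesis by (simp add: divide_simps) (simp add: algebra_simps)
  qed
  have okp: "cx.ray_ok y (\<lambda>s. (p - 1) * ?f s)" "cx.ray_ok y (\<lambda>s. 2 * ?g s)" if "y = f \<or> y = - f" for y
    using cx.ray_ok_linear[OF okf[OF that] bounded_linear_mult_right]
      cx.ray_ok_linear[OF okg[OF that] bounded_linear_mult_right] by blast+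
  have ray: "cx.ray y ?k = (p - 1) * cx.ray y ?f + 2 * cx.ray y ?g" if "y = f \<or> y = - f" for y
  proof -
    have "cx.ray y ?k = cx.ray y (\<lambda>s. (p - 1) * ?f s + 2 * ?g s)"
      by (rule cx.ray_cong) (rule dec[OF _ that])
    also have "\<dots> = cx.ray y (\<lambda>s. (p - 1) * ?f s) + cx.ray y (\<lambda>s. 2 * ?g s)"
      by (rule cx.ray_add[OF okp[OF that]])
    also have "cx.ray y (\<lambda>s. (p - 1) * ?f s) = (p - 1) * cx.ray y ?f"
      by (rule cx.ray_linear[OF okf[OF that] bounded_linear_mult_right]) simp
    also have "cx.ray y (\<lambda>s. 2 * ?g s) = 2 * cx.ray y ?g"
      by (rule cx.ray_linear[OF okg[OF that] bounded_linear_mult_right]) simp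
    finally show ?thesis .
  qed
  have gen: "(A * x + 2 * y) - (A * x' + 2 * y') = A * (x - x') + 2 * (y - y')" for A x x' y y' :: complex
    by algebra
  show "cx.ray (-f) ?k - cx.ray f ?k = 2 * pi * \<i>"
  proof -
    have "cx.ray (-f) ?k - cx.ray f ?k
        = (p - 1) * (cx.ray (-f) ?f - cx.ray f ?f) + 2 * (cx.ray (-f) ?g - cx.ray f ?g)"
      unfolding ray[OF disjI1[OF refl]] ray[OF disjI2[OF refl]] by (rule gen)
    then show ?thesis using D0 ray_rational_base[OF f] by simp
  qed
  show "cx.ray_ok y ?k" if "y = f \<or> y = -f"
    using cx.ray_ok_add[OF okp[OF that]]
    by (subst cx.ray_ok_cong[where G = "\<lambda>s. (p - 1) * ?f s + 2 * ?g s", OF dec[OF _ that]])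
qed

text \<open>Cauchy's formula on an unbounded sector. After subtracting n(p) times the rational
  kernel of the previous formula the singularity at \<open>p\<close> is removable, and what is left
  vanishes by turning one ray onto the other across the sector.\<close>

lemma cauchy_rays:
  assumes n: "cls t 0 0 n" and t: "0 < f" "f < t" "t \<le> pi" and p: "p \<in> sec f"
  shows "cx.ray (-f) (\<lambda>s. n s / (s - p)) - cx.ray f (\<lambda>s. n s / (s - p)) = 2 * pi * \<i> * n p"
    and "y = f \<or> y = -f \<Longrightarrow> cx.ray_ok y (\<lambda>s. n s / (s - p))"
proof -
  obtain a C where hol: "n holomorphic_on sec t" and a: "0 < a" "a \<le> 1" and C: "0 \<le> C"
    and b: "\<And>z. z \<in> sec t \<Longrightarrow> cmod (n z) \<le> C * env 0 0 a (cmod z)"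
    using clsE[OF n] t by (metis less_trans)
  have insec: "rcis r y \<in> sec t" if "0 < r" "y \<in> {-f..f}" for r y
    using rcis_in_sec[of r y t] that t by auto
  have pt: "p \<in> sec t"
    using sec_rcis[OF p] t rcis_in_sec by (metis less_le_trans less_trans)
  have p0: "p \<noteq> 0" using sec_nz[OF p] .
  have m1: "1 + z \<noteq> 0" if "z \<in> sec t" for z
  proof
    assume "1 + z = 0"
    then have "z = -1" by (simp add: add_eq_0_iff)
    then have "cos t < cos pi" using that by (simp add: sec_def)
    then show False using cos_ge_minus_one[of t] by simp
  qed
  \<comment> \<open>The factor (1+p)/(1+s) is 1 at \<open>p\<close>, has its pole outside the
    sector, and makes the subtracted constant decay at infinity.\<close>
  define g where "g = (\<lambda>s. n s - n p * (1 + p) / (1 + s))"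
  define q where "q = (\<lambda>z. if z = p then deriv g p else (g z - g p) / (z - p))"
  have gp: "g p = 0" using m1[OF pt] by (simp add: g_def)
  have ghol: "g holomorphic_on sec t"
    unfolding g_def by (intro holomorphic_intros hol) (use m1 in auto)
  have qhol: "q holomorphic_on sec t"
    unfolding q_def by (rule pole_lemma_open[OF ghol open_sec])
  define D where "D = 2 * cmod (n p) * cmod (1 + p)"
  define r1 where "r1 = min (1/2) (cmod p / 2)"
  define r2 where "r2 = max 2 (2 * cmod p)"
  have qb: "norm (q (rcis r y)) \<le> (2 * (C + D) / cmod p + 2 * (C + D)) * env (-1) (-1) a r"
    if ry: "0 < r" "y \<in> {-f..f}" "r < r1 \<or> r > r2" for r y
  proof -
    have ne: "rcis r y \<noteq> p" using ry(3) ry(1) p0 by (auto simp: r1_def r2_def)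
    have nb: "cmod (n (rcis r y)) \<le> C * env 0 0 a r" using b[OF insec[OF ry(1,2)]] ry(1) by simp
    have D: "0 \<le> D" by (simp add: D_def)
    have qe: "norm (q (rcis r y)) = cmod (g (rcis r y)) / cmod (rcis r y - p)"
      using ne by (simp add: q_def gp norm_divide)
    have gb0: "cmod (g (rcis r y)) \<le> cmod (n (rcis r y)) + (D / 2) / cmod (1 + rcis r y)"
      unfolding g_def D_def by (rule order_trans[OF norm_triangle_ineq4]) (simp add: norm_mult norm_divide)
    from ry(3) show ?thesis
    proof
      assume r: "r < r1"
      have "1 / 2 \<le> cmod (1 + rcis r y)"
        using norm_triangle_ineq2[of 1 "- rcis r y"] r ry(1) by (simp add: r1_def)
      then have "(D / 2) / cmod (1 + rcis r y) \<le> (D / 2) / (1 / 2)"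
        using D by (intro divide_left_mono) auto
      moreover have "C * env 0 0 a r \<le> C * 1"
        using r ry(1) a C by (intro mult_left_mono) (auto simp: env_def r1_def powr_le1)
      ultimately have g: "cmod (g (rcis r y)) \<le> C + D" using gb0 nb by simp
      have d: "cmod p / 2 \<le> cmod (rcis r y - p)"
        using norm_triangle_ineq2[of p "rcis r y"] r ry(1) by (simp add: r1_def norm_minus_commute)
      have "norm (q (rcis r y)) \<le> (C + D) / (cmod p / 2)"
        unfolding qe using g d p0 C D by (intro frac_le) auto
      also have "\<dots> \<le> (2 * (C + D) / cmod p + 2 * (C + D)) * 1" using C D by (simp add: algebra_simps add_divide_distrib)
      also have "\<dots> \<le> (2 * (C + D) / cmod p + 2 * (C + D)) * env (-1) (-1) a r"
      proof (rule mult_left_mono)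
        have "r powr 0 \<le> r powr (a - 1)" using r ry(1) a by (intro powr_mono') (auto simp: r1_def)
        then show "1 \<le> env (-1) (-1) a r" using r ry(1) by (simp add: env_def r1_def)
      qed (use C D in auto)
      finally show ?thesis .
    next
      assume r: "r > r2"
      have e: "env 0 0 a r = r powr (-a)" "env (-1) (-1) a r = r powr (-a) / r"
      proof -
        have eq: "- a - 1 = - 1 - a" by simp
        then show "env 0 0 a r = r powr (-a)" "env (-1) (-1) a r = r powr (-a) / r"
          using r ry(1) powr_diff[of r "-a" 1, unfolded eq] by (simp_all add: env_def r2_def)
      qed
      have "r / 2 \<le> cmod (1 + rcis r y)"
        using norm_triangle_ineq2[of "rcis r y" "-1"] r ry(1) by (simp add: r2_def add.commute)
      then have "(D / 2) / cmod (1 + rcis r y) \<le> (D / 2) / (r / 2)"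
        using D ry(1) by (intro divide_left_mono) (auto intro!: mult_pos_pos)
      also have "\<dots> = D * r powr (-1)" using ry(1) by (simp add: powr_neg_one)
      also have "\<dots> \<le> D * r powr (-a)"
        using D r a by (intro mult_left_mono powr_mono) (auto simp: r2_def)
      finally have g: "cmod (g (rcis r y)) \<le> (C + D) * r powr (-a)"
        using gb0 nb e(1) by (simp add: algebra_simps)
      have d: "r / 2 \<le> cmod (rcis r y - p)"
        using norm_triangle_ineq2[of "rcis r y" p] r ry(1) by (simp add: r2_def)
      have "norm (q (rcis r y)) \<le> ((C + D) * r powr (-a)) / (r / 2)"
        unfolding qe using g d ry(1) C D by (intro frac_le) auto
      also have "\<dots> = 2 * (C + D) * env (-1) (-1) a r" by (simp add: e)
      also have "\<dots> \<le> (2 * (C + D) / cmod p + 2 * (C + D)) * env (-1) (-1) a r"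
        using C D by (intro mult_right_mono env_nonneg) auto
      finally show ?thesis .
    qed
  qed
  have qc: "continuous_on {rcis r y |r y. 0 < r \<and> y \<in> {-f..f}} q"
    by (rule continuous_on_subset[OF holomorphic_on_imp_continuous_on[OF qhol]]) (use insec in auto)
  have "0 < r1" using p0 by (simp add: r1_def)
  then obtain C' where C': "\<And>r y. 0 < r \<Longrightarrow> y \<in> {-f..f} \<Longrightarrow> norm (q (rcis r y)) \<le> C' * env (-1) (-1) a r"
    using sector_bound_extend[OF qc, of r1 r2 _ "-1" "-1" a] qb by metis
  have ff: "-f \<le> f" using t by simp
  have D0: "cx.ray (-f) q = cx.ray f q"
    by (rule cx_shift(1)[OF qhol open_sec ff a(1) insec C'])
  have okq: "cx.ray_ok y q" if "y = f \<or> y = -f" for y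
    by (rule cx_shift(2)[OF qhol open_sec ff a(1) insec C']) (use that ff in auto)
  let ?k = "\<lambda>s. (1 + p) / ((1 + s) * (s - p))"
  have fpi: "f < pi" using t by simp
  have eq: "n (rcis r y) / (rcis r y - p) = q (rcis r y) + n p * ?k (rcis r y)"
    if y: "y = f \<or> y = -f" and r: "0 < r" for y r
  proof -
    have "rcis r y \<notin> sec f"
      using rcis_notin_sec[of r f f] rcis_notin_sec[of r f "2 * pi - f"] r y t
      by (auto simp: rcis_def cis.code cos_diff sin_diff)
    then have ne: "rcis r y - p \<noteq> 0" using p by auto
    have "1 + rcis r y \<noteq> 0" using m1 insec[OF r, of y] y ff by auto
    with ne m1[OF pt] show ?thesis
      by (simp add: q_def gp g_def divide_simps)
  qed
  have okk: "cx.ray_ok y (\<lambda>s. n p * ?k s)" if y: "y = f \<or> y = -f" for y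
    by (rule cx.ray_ok_linear[OF cauchy_rational(2)[OF t(1) fpi p y] bounded_linear_mult_right])
  have ray: "cx.ray y (\<lambda>s. n s / (s - p)) = cx.ray y q + n p * cx.ray y ?k" if y: "y = f \<or> y = -f" for y
  proof -
    have "cx.ray y (\<lambda>s. n s / (s - p)) = cx.ray y (\<lambda>s. q s + n p * ?k s)"
      by (rule cx.ray_cong) (rule eq[OF y])
    also have "\<dots> = cx.ray y q + cx.ray y (\<lambda>s. n p * ?k s)"
      by (rule cx.ray_add[OF okq[OF y] okk[OF y]])
    also have "cx.ray y (\<lambda>s. n p * ?k s) = n p * cx.ray y ?k"
      by (rule cx.ray_linear[OF cauchy_rational(2)[OF t(1) fpi p y] bounded_linear_mult_right]) simp
    finally show ?thesis .
  qed
  show "cx.ray_ok y (\<lambda>s. n s / (s - p))" if y: "y = f \<or> y = -f"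
    using cx.ray_ok_add[OF okq[OF y] okk[OF y]]
    by (subst cx.ray_ok_cong[where G = "\<lambda>s. q s + n p * ?k s", OF eq[OF y]])
  have gen: "(u + n p * x) - (u + n p * x') = n p * (x - x')" for u x x' :: complex by algebra
  show "cx.ray (-f) (\<lambda>s. n s / (s - p)) - cx.ray f (\<lambda>s. n s / (s - p)) = 2 * pi * \<i> * n p"
    unfolding ray[OF disjI1[OF refl]] ray[OF disjI2[OF refl]] D0 gen cauchy_rational(1)[OF t(1) fpi p]
    by simp
qed

section \<open>Bounded operators, the relative resolvent and the harmonic integral\<close>

text \<open>\<open>S\<close> and \<open>S'\<close> stand for the inverses of 1+T and 1+conj T, and
  \<open>N s\<close> for Q_{c,-1}(T) Q_{c,s}(T)^{-1}. Both \<open>S\<close> and \<open>S'\<close>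
  are real linear; \<open>Rc\<close> and \<open>sgc\<close> grant complex linearity to their product
  and sum. Since \<open>S v = v\<close> says T v = 0, the conditions \<open>inj1\<close> and
  \<open>inj1'\<close> are the injectivity of T and conj T. The bound \<open>bR\<close> is for the
  inverse of Q, and \<open>bS\<close>, \<open>bS'\<close> are the left S-resolvent bounds. The
  angles separate the spectrum, the contour and the domain of the functions.\<close>

locale op_calc = complex_module c for c :: "complex \<Rightarrow> 'v::banach \<Rightarrow> 'v" +
  fixes S S' :: "'v \<Rightarrow> 'v" and N :: "complex \<Rightarrow> 'v \<Rightarrow> 'v" and f0 f t K :: real
  assumes angles: "0 < f0" "f0 < f" "f < t" "t < pi"
    and blS: "bounded_linear S" and blS': "bounded_linear S'"
    and SS': "S' (S v) = S (S' v)"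
    and Rc: "S (S' (c z v)) = c z (S (S' v))"
    and sgc: "S (c z v) + S' (c z v) = c z (S v + S' v)"
    and injS: "S v = 0 \<Longrightarrow> v = 0" and injS': "S' v = 0 \<Longrightarrow> v = 0"
    and inj1: "S v = v \<Longrightarrow> v = 0" and inj1': "S' v = v \<Longrightarrow> v = 0"
    and M_N: "Re s < cmod s * cos f0 \<Longrightarrow>
        N s v - c (1 + s) (S (N s v) + S' (N s v)) + c ((1 + s)^2) (S (S' (N s v))) = v"
    and N_M: "Re s < cmod s * cos f0 \<Longrightarrow>
        N s (v - c (1 + s) (S v + S' v) + c ((1 + s)^2) (S (S' v))) = v"
    and bR: "Re s < cmod s * cos f0 \<Longrightarrow> norm (S (S' (N s v))) \<le> K / (cmod s)^2 * norm v"
    and bS: "Re s < cmod s * cos f0 \<Longrightarrow>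
        norm (c (1 + s) (S (S' (N s v))) - S (N s v)) \<le> K / cmod s * norm v"
    and bS': "Re s < cmod s * cos f0 \<Longrightarrow>
        norm (c (1 + s) (S (S' (N s v))) - S' (N s v)) \<le> K / cmod s * norm v"
begin

definition R :: "'v \<Rightarrow> 'v" where "R v = S (S' v)"
definition sg :: "'v \<Rightarrow> 'v" where "sg v = S v + S' v"
definition Om :: "complex set" where "Om = {s. Re s < cmod s * cos f0}"
text \<open>The symmetry between T and its conjugate: a statement about \<open>pr X Y\<close> is
  proved once and covers both assignments.\<close>

definition pr :: "('v \<Rightarrow> 'v) \<Rightarrow> ('v \<Rightarrow> 'v) \<Rightarrow> bool" where
  "pr X Y \<longleftrightarrow> X = S \<and> Y = S' \<or> X = S' \<and> Y = S"

lemma prS [simp]: "pr S S'" "pr S' S" by (auto simp: pr_def)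
lemma pr_sym: "pr X Y \<Longrightarrow> pr Y X" by (auto simp: pr_def)
lemma pr_comp: "pr X Y \<Longrightarrow> X (Y v) = R v" by (auto simp: pr_def R_def SS')
lemma pr_add: "pr X Y \<Longrightarrow> X v + Y v = sg v" by (auto simp: pr_def sg_def)
lemma pr_bl: "pr X Y \<Longrightarrow> bounded_linear X" by (auto simp: pr_def blS blS')
lemma pr_inj: "pr X Y \<Longrightarrow> X v = 0 \<Longrightarrow> v = 0" by (auto simp: pr_def dest: injS injS')
lemma pr_inj1: "pr X Y \<Longrightarrow> X v = v \<Longrightarrow> v = 0" by (auto simp: pr_def dest: inj1 inj1')

lemma R_bl: "bounded_linear R"
  unfolding R_def[abs_def] by (rule bounded_linear_compose[OF blS blS'])
lemma sg_bl: "bounded_linear sg"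
  unfolding sg_def[abs_def] by (rule bounded_linear_add[OF blS blS'])

lemma R_c: "R (c z v) = c z (R v)" by (simp add: R_def Rc)
lemma sg_c: "sg (c z v) = c z (sg v)" by (simp add: sg_def sgc)
lemma pr_R: "pr X Y \<Longrightarrow> X (R v) = R (X v)" by (auto simp: pr_def R_def SS')
lemma pr_sg: "pr X Y \<Longrightarrow> X (sg v) = sg (X v)"
  by (auto simp: pr_def sg_def SS' linear_add[OF bounded_linear.linear] blS blS')
lemma R_sg: "R (sg v) = sg (R v)"
  by (simp add: sg_def pr_R[OF prS(1)] pr_R[OF prS(2)] linear_add[OF bounded_linear.linear[OF R_bl]])
lemma R_inj: "R v = 0 \<Longrightarrow> v = 0" unfolding R_def by (blast dest: injS injS')

lemmas R_add = linear_add[OF bounded_linear.linear[OF R_bl]]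
lemmas R_diff = linear_diff[OF bounded_linear.linear[OF R_bl]]
lemmas R_0 [simp] = linear_0[OF bounded_linear.linear[OF R_bl]]
lemmas sg_add = linear_add[OF bounded_linear.linear[OF sg_bl]]
lemmas sg_diff = linear_diff[OF bounded_linear.linear[OF sg_bl]]

text \<open>This is Q_{c,s}(T) Q_{c,-1}(T)^{-1}, that is, Q expanded at s = -1; the coefficients
  \<open>sg\<close> and \<open>R\<close> commute with the slice.\<close>

definition Mo :: "complex \<Rightarrow> 'v \<Rightarrow> 'v" where
  "Mo s v = v - c (1 + s) (sg v) + c ((1 + s)^2) (R v)"

lemma OmD: "s \<in> Om \<Longrightarrow> Re s < cmod s * cos f0" by (simp add: Om_def)
lemma Om_nz: "s \<in> Om \<Longrightarrow> s \<noteq> 0" by (auto simp: Om_def)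
lemma open_Om: "open Om"
  unfolding Om_def by (intro open_Collect_less continuous_intros)

lemma MoN: "s \<in> Om \<Longrightarrow> Mo s (N s v) = v"
  using M_N[OF OmD] by (simp add: Mo_def R_def sg_def)
lemma NMo: "s \<in> Om \<Longrightarrow> N s (Mo s v) = v"
  using N_M[OF OmD] by (simp add: Mo_def R_def sg_def)

text \<open>The inverse of \<open>Mo s\<close> inherits its commutant. The operators
  \<open>S\<close> and \<open>S'\<close> are not covered individually, because they need not commute
  with the coefficients \<open>c (1 + s)\<close>.\<close>

lemma N_commute:
  assumes "s \<in> Om" "\<And>v. L (Mo s v) = Mo s (L v)"
  shows "N s (L v) = L (N s v)"
  using NMo[OF assms(1), of "L (N s v)"] by (simp add: MoN[OF assms(1)] flip: assms(2))

lemma Mo_R: "R (Mo s v) = Mo s (R v)"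
  by (simp add: Mo_def R_add R_diff R_c R_sg)
lemma Mo_sg: "sg (Mo s v) = Mo s (sg v)"
  by (simp add: Mo_def sg_add sg_diff sg_c R_sg)
lemma Mo_c: "c z (Mo s v) = Mo s (c z v)"
  by (simp add: Mo_def c_add_right c_diff_right sg_c R_c c_commute[of z])
lemma Mo_add: "Mo s (u + v) = Mo s u + Mo s v"
  by (simp add: Mo_def R_add sg_add c_add_right)
lemma Mo_diff: "Mo s (u - v) = Mo s u - Mo s v"
  by (simp add: Mo_def R_diff sg_diff c_diff_right)
lemma Mo_Mo: "Mo p (Mo s v) = Mo s (Mo p v)"
  unfolding Mo_def[of p] by (simp add: Mo_diff Mo_add flip: Mo_R Mo_sg Mo_c)

lemma N_R: "s \<in> Om \<Longrightarrow> N s (R v) = R (N s v)" by (rule N_commute) (simp_all add: Mo_R)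
lemma N_sg: "s \<in> Om \<Longrightarrow> N s (sg v) = sg (N s v)" by (rule N_commute) (simp_all add: Mo_sg)
lemma N_c: "s \<in> Om \<Longrightarrow> N s (c z v) = c z (N s v)" by (rule N_commute) (simp_all add: Mo_c)
lemma N_Mo: "s \<in> Om \<Longrightarrow> N s (Mo p v) = Mo p (N s v)" by (rule N_commute) (simp_all add: Mo_Mo)
lemma N_N: "s \<in> Om \<Longrightarrow> p \<in> Om \<Longrightarrow> N p (N s v) = N s (N p v)"
  by (rule N_commute) (simp_all add: N_Mo)
lemma N_add: "s \<in> Om \<Longrightarrow> N s (u + v) = N s u + N s v"
  using NMo[of s "N s u + N s v"] by (simp add: Mo_add MoN)
lemma N_diff: "s \<in> Om \<Longrightarrow> N s (u - v) = N s u - N s v"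
  using NMo[of s "N s u - N s v"] by (simp add: Mo_diff MoN)

lemma N_eq: "s \<in> Om \<Longrightarrow> N s v = v + c (1 + s) (sg (N s v)) - c ((1 + s)^2) (R (N s v))"
  using MoN[of s v] by (simp add: Mo_def algebra_simps)

text \<open>The left S-resolvent: for X = \<open>S\<close> the term \<open>X (N s v)\<close> is (1 +
  conj T) applied to the inverse of Q, so the difference is (s - conj T) applied to it.\<close>

definition SL :: "('v \<Rightarrow> 'v) \<Rightarrow> complex \<Rightarrow> 'v \<Rightarrow> 'v" where
  "SL X s v = c (1 + s) (R (N s v)) - X (N s v)"

lemma SL_bound: "pr X Y \<Longrightarrow> s \<in> Om \<Longrightarrow> norm (SL X s v) \<le> K / cmod s * norm v"
  using bS[OF OmD] bS'[OF OmD] by (auto simp: pr_def SL_def R_def)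
lemma RN_bound: "s \<in> Om \<Longrightarrow> norm (R (N s v)) \<le> K / (cmod s)^2 * norm v"
  using bR[OF OmD] by (simp add: R_def)

text \<open>The bound at s = -1 decides the sign. On the trivial space the estimates carry no
  information, hence the alternative.\<close>

lemma K_nonneg: "0 \<le> K \<or> (\<forall>v::'v. v = 0)"
proof (rule disjCI)
  assume "\<not> (\<forall>v::'v. v = 0)"
  then obtain v :: 'v where v: "v \<noteq> 0" by blast
  have "-1 \<in> Om" using angles cos_monotone_0_pi[of 0 f0] cos_monotone_0_pi[of f0 pi] by (simp add: Om_def)
  from order_trans[OF norm_ge_zero RN_bound[OF this, of v]] have "0 \<le> K * norm v" by simp
  then show "0 \<le> K" using v by (simp add: zero_le_mult_iff)
qed

definition nb :: "complex \<Rightarrow> real" where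
  "nb s = 1 + cmod (1 + s) * (2 * (cmod (1 + s) * (K / (cmod s)^2) + K / cmod s)) + (cmod (1 + s))^2 * (K / (cmod s)^2)"

text \<open>By \<open>N_eq\<close> it is enough to bound \<open>R (N s v)\<close> and
  \<open>sg (N s v)\<close>; each half of the latter is \<open>c (1 + s) (R (N s v))\<close> minus a
  left resolvent. The constant is locally bounded in \<open>s\<close>, which is what continuity
  requires.\<close>

lemma N_bound: assumes s: "s \<in> Om" shows "norm (N s v) \<le> nb s * norm v"
proof -
  have X: "norm (X (N s v)) \<le> (cmod (1 + s) * (K / (cmod s)^2) + K / cmod s) * norm v" if p: "pr X Y" for X Y
  proof -
    have "norm (X (N s v)) = norm (c (1 + s) (R (N s v)) - SL X s v)" by (simp add: SL_def)
    also have "\<dots> \<le> cmod (1 + s) * (K / (cmod s)^2 * norm v) + K / cmod s * norm v"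
      by (rule order_trans[OF norm_triangle_ineq4], unfold norm_c,
          intro add_mono mult_left_mono RN_bound SL_bound[OF p] s norm_ge_zero)
    finally show ?thesis by (simp add: algebra_simps)
  qed
  have sg: "norm (sg (N s v)) \<le> 2 * (cmod (1 + s) * (K / (cmod s)^2) + K / cmod s) * norm v"
  proof -
    have "norm (sg (N s v)) \<le> (cmod (1 + s) * (K / (cmod s)^2) + K / cmod s) * norm v
        + (cmod (1 + s) * (K / (cmod s)^2) + K / cmod s) * norm v"
      unfolding sg_def by (rule order_trans[OF norm_triangle_ineq add_mono[OF X[OF prS(1)] X[OF prS(2)]]])
    then show ?thesis by (simp add: algebra_simps)
  qed
  have "norm (N s v) \<le> norm v + norm (c (1 + s) (sg (N s v))) + norm (c ((1 + s)^2) (R (N s v)))"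
    by (subst N_eq[OF s]) (rule order_trans[OF norm_triangle_ineq4 add_right_mono[OF norm_triangle_ineq]])
  also have "\<dots> \<le> norm v + cmod (1 + s) * (2 * (cmod (1 + s) * (K / (cmod s)^2) + K / cmod s) * norm v)
      + (cmod (1 + s))^2 * (K / (cmod s)^2 * norm v)"
    unfolding norm_c norm_power
    by (intro add_mono mult_left_mono RN_bound s sg norm_ge_zero zero_le_power2 order_refl)
  also have "\<dots> = nb s * norm v" by (simp add: nb_def algebra_simps)
  finally show ?thesis .
qed

lemma N_bl: assumes s: "s \<in> Om" shows "bounded_linear (N s)"
proof (rule bounded_linear_intro[where K = "nb s"])
  show "N s (r *\<^sub>R v) = r *\<^sub>R N s v" for r v using N_c[OF s, of "of_real r" v] by (simp add: c_of_real)
qed (use N_bound[OF s] N_add[OF s] in \<open>auto simp: mult.commute\<close>)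

text \<open>The second resolvent identity: N_p - N_s equals N_p (M_s - M_p) N_s, and the difference
  of the two quadratic polynomials is divisible by p - s.\<close>

lemma N_resolvent:
  assumes s: "s \<in> Om" and p: "p \<in> Om"
  shows "N p v - N s v = c (p - s) (N p (sg (N s v) - c (2 + s + p) (R (N s v))))"
proof -
  let ?u = "N s v"
  have "Mo s ?u - Mo p ?u = c ((1 + p) - (1 + s)) (sg ?u) + c ((1 + s)^2 - (1 + p)^2) (R ?u)"
    unfolding Mo_def c_diff_left by simp
  also have "(1 + s)^2 - (1 + p)^2 = - ((p - s) * (2 + s + p))" by (simp add: power2_eq_square algebra_simps)
  also have "c ((1 + p) - (1 + s)) (sg ?u) + c (- ((p - s) * (2 + s + p))) (R ?u)
      = c (p - s) (sg ?u - c (2 + s + p) (R ?u))"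
    by (simp add: c_minus_left c_mult c_diff_right)
  finally have "N p (Mo s ?u - Mo p ?u) = c (p - s) (N p (sg ?u - c (2 + s + p) (R ?u)))"
    by (simp add: N_c[OF p])
  then show ?thesis using s p by (simp add: N_diff MoN NMo)
qed

lemma nb_cont: "s \<in> Om \<Longrightarrow> isCont nb s"
  unfolding nb_def[abs_def] using Om_nz by (intro continuous_intros) auto

lemma eventually_Om: "s \<in> Om \<Longrightarrow> eventually (\<lambda>p. p \<in> Om) (at s)"
  using open_Om eventually_at_topological by blast

lemma N_tendsto:
  assumes s: "s \<in> Om" shows "((\<lambda>p. N p v) \<longlongrightarrow> N s v) (at s)"
proof -
  have "((\<lambda>p. N p v - N s v) \<longlongrightarrow> 0) (at s)"
  proof (rule Lim_null_comparison)
    show "\<forall>\<^sub>F p in at s. norm (N p v - N s v)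
        \<le> cmod (p - s) * (nb p * norm (sg (N s v) - c (2 + s + p) (R (N s v))))"
      using eventually_Om[OF s]
      by eventually_elim (simp add: N_resolvent[OF s] norm_c mult_left_mono N_bound)
    have "isCont (\<lambda>p. cmod (p - s) * (nb p * norm (sg (N s v) - c (2 + s + p) (R (N s v))))) s"
      by (intro continuous_intros nb_cont s bounded_bilinear.continuous[OF bil])
    then show "((\<lambda>p. cmod (p - s) * (nb p * norm (sg (N s v) - c (2 + s + p) (R (N s v))))) \<longlongrightarrow> 0) (at s)"
      by (simp add: isCont_def)
  qed
  then show ?thesis by (simp add: LIM_zero_iff)
qed

lemma N_cont_comp:
  assumes s: "s \<in> Om" and u: "isCont u s" shows "isCont (\<lambda>p. N p (u p)) s"
proof -
  have 1: "((\<lambda>p. N p (u p - u s)) \<longlongrightarrow> 0) (at s)"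
  proof (rule Lim_null_comparison)
    show "\<forall>\<^sub>F p in at s. norm (N p (u p - u s)) \<le> nb p * norm (u p - u s)"
      using eventually_Om[OF s] by eventually_elim (rule N_bound)
    have "isCont (\<lambda>p. nb p * norm (u p - u s)) s"
      by (intro continuous_intros nb_cont s u)
    then show "((\<lambda>p. nb p * norm (u p - u s)) \<longlongrightarrow> 0) (at s)" by (simp add: isCont_def)
  qed
  have "((\<lambda>p. N p (u p - u s) + N p (u s)) \<longlongrightarrow> 0 + N s (u s)) (at s)"
    by (intro tendsto_add 1 N_tendsto s)
  moreover have "\<forall>\<^sub>F p in at s. N p (u p - u s) + N p (u s) = N p (u p)"
    using eventually_Om[OF s] by eventually_elim (simp add: N_diff)
  ultimately show ?thesis unfolding isCont_def by (simp add: Lim_transform_eventually)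
qed

text \<open>The derivative of \<open>N s v\<close> in s, read off from \<open>N_resolvent\<close> by
  putting p = s in the cofactor of p - s.\<close>

definition DN :: "complex \<Rightarrow> 'v \<Rightarrow> 'v" where
  "DN s v = N s (sg (N s v) - c (2 + 2 * s) (R (N s v)))"

lemma N_cont: "s \<in> Om \<Longrightarrow> isCont (\<lambda>p. N p v) s"
  by (rule N_cont_comp) auto

lemma DN_cont: "s \<in> Om \<Longrightarrow> isCont (\<lambda>p. DN p v) s"
  unfolding DN_def
  by (intro N_cont_comp continuous_intros bounded_bilinear.continuous[OF bil]
      bounded_linear.isCont[OF sg_bl] bounded_linear.isCont[OF R_bl] N_cont)

lemma N_deriv:
  assumes s: "s \<in> Om"
  shows "((\<lambda>p. N p v) has_derivative (\<lambda>h. c h (DN s v))) (at s)"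
  unfolding has_derivative_iff_norm
proof (intro conjI)
  show "bounded_linear (\<lambda>h. c h (DN s v))" by (rule bounded_bilinear.bounded_linear_left[OF bil])
  let ?u = "\<lambda>p. sg (N s v) - c (2 + s + p) (R (N s v))"
  have "isCont (\<lambda>p. N p (?u p)) s"
    by (intro N_cont_comp s continuous_intros bounded_bilinear.continuous[OF bil])
  then have "((\<lambda>p. norm (N p (?u p) - DN s v)) \<longlongrightarrow> 0) (at s)"
    by (simp add: isCont_def DN_def tendsto_norm_zero_iff LIM_zero_iff add.assoc flip: mult_2)
  then show "((\<lambda>p. norm (N p v - N s v - c (p - s) (DN s v)) / norm (p - s)) \<longlongrightarrow> 0) (at s)"
  proof (rule Lim_transform_eventually)
    have "eventually (\<lambda>p. p \<noteq> s) (at s)" by (simp add: eventually_at_filter)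
    with eventually_Om[OF s]
    show "\<forall>\<^sub>F p in at s. norm (N p (?u p) - DN s v) = norm (N p v - N s v - c (p - s) (DN s v)) / norm (p - s)"
      by eventually_elim (simp add: N_resolvent[OF s] norm_c flip: c_diff_right)
  qed
qed


lemma angles_pi: "f < pi" "f0 < pi" "0 < f" "0 < t" using angles by auto

lemma rcis_Om:
  assumes "0 < r" "f \<le> y" "y \<le> 2 * pi - f"
  shows "rcis r y \<in> Om" "rcis r (-y) \<in> Om"
proof -
  have "cos y < cos f0"
  proof (cases "y \<le> pi")
    case True
    then show ?thesis using assms angles by (intro cos_monotone_0_pi) auto
  next
    case False
    have "cos (2 * pi - y) < cos f0" using assms angles False by (intro cos_monotone_0_pi) auto
    then show ?thesis by (simp add: cos_diff)
  qed
  then show "rcis r y \<in> Om" "rcis r (-y) \<in> Om" using assms(1) by (auto simp: Om_def)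
qed

lemma rcis_Om':
  assumes "0 < r" "y1 \<le> y" "y \<le> y2" "f \<le> y1 \<and> y2 \<le> 2 * pi - f \<or> -t < y1 \<and> y2 \<le> -f"
  shows "rcis r y \<in> Om"
  using assms rcis_Om[of r y] rcis_Om(2)[of r "-y"] angles by auto

text \<open>The integrand of the harmonic calculus, since \<open>R (N s v)\<close> is the inverse of
  Q_{c,s}(T) applied to \<open>v\<close>.\<close>

definition G :: "(complex \<Rightarrow> complex) \<Rightarrow> 'v \<Rightarrow> complex \<Rightarrow> 'v" where
  "G h v s = c (h s) (R (N s v))"

lemma RN_deriv:
  assumes "s \<in> Om" shows "((\<lambda>p. R (N p v)) has_derivative (\<lambda>h. c h (R (DN s v)))) (at s)"
  using bounded_linear.has_derivative[OF R_bl N_deriv[OF assms, of v]] by (simp add: R_c)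

lemma G_deriv:
  assumes "s \<in> Om" "h holomorphic_on D" "open D" "s \<in> D"
  shows "(G h v has_derivative (\<lambda>w. c w (c (h s) (R (DN s v)) + c (deriv h s) (R (N s v))))) (at s)"
  unfolding G_def[abs_def]
  using c_derivative[OF has_derivative_holomorphic[OF assms(2,3,4)] RN_deriv[OF assms(1)]]
  by (simp add: c_add_right c_mult c_commute[of "h s"])

lemma RN_cont: "s \<in> Om \<Longrightarrow> isCont (\<lambda>p. R (N p v)) s"
  by (intro bounded_linear.isCont[OF R_bl] N_cont)

text \<open>The inverse of Q decays like |s|^{-2}, so \<open>h\<close> may lie within the exponents
  1 at both ends and still leave an integrable envelope. The contour can hence be turned anywhere
  between the angles \<open>f\<close> and \<open>t\<close>, which provides the second contour of the
  double integral.\<close>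

lemma G_shift:
  assumes h: "cls t 1 1 h" and y: "y1 \<le> y2" "f \<le> y1 \<and> y2 < t \<or> -t < y1 \<and> y2 \<le> -f"
  shows "ray y1 (G h v) = ray y2 (G h v)" and "y \<in> {y1..y2} \<Longrightarrow> ray_ok y (G h v)"
proof -
  obtain a C where hol: "h holomorphic_on sec t" and a: "0 < a" and C: "0 \<le> C"
    and b: "\<And>z. z \<in> sec t \<Longrightarrow> cmod (h z) \<le> C * env 1 1 a (cmod z)"
    using clsE[OF h] angles_pi angles by (metis less_imp_le)
  have inS: "rcis r y \<in> sec t" if "0 < r" "y \<in> {y1..y2}" for r y
    using that y angles by (intro rcis_in_sec) auto
  have inO: "rcis r y \<in> Om" if "0 < r" "y \<in> {y1..y2}" for r y
    by (rule rcis_Om'[of r y1 y y2]) (use that y angles in auto)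
  have 1: "(G h v has_derivative (\<lambda>w. c w (c (h (rcis r y)) (R (DN (rcis r y) v))
      + c (deriv h (rcis r y)) (R (N (rcis r y) v))))) (at (rcis r y))"
    if "0 < r" "y \<in> {y1..y2}" for r y
    by (rule G_deriv[OF inO[OF that] hol open_sec inS[OF that]])
  have 2: "continuous_on {rcis r y |r y. 0 < r \<and> y \<in> {y1..y2}}
      (\<lambda>s. c (h s) (R (DN s v)) + c (deriv h s) (R (N s v)))"
  proof (intro continuous_on_add c_continuous_on)
    show "continuous_on {rcis r y |r y. 0 < r \<and> y \<in> {y1..y2}} h"
      by (rule continuous_on_subset[OF holomorphic_on_imp_continuous_on[OF hol]]) (use inS in auto)
    show "continuous_on {rcis r y |r y. 0 < r \<and> y \<in> {y1..y2}} (deriv h)"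
      by (rule continuous_on_subset[OF holomorphic_on_imp_continuous_on[OF holomorphic_deriv[OF hol open_sec]]])
        (use inS in auto)
    show "continuous_on {rcis r y |r y. 0 < r \<and> y \<in> {y1..y2}} (\<lambda>s. R (DN s v))"
      by (rule continuous_at_imp_continuous_on)
         (use inO in \<open>auto intro!: bounded_linear.isCont[OF R_bl] DN_cont\<close>)
    show "continuous_on {rcis r y |r y. 0 < r \<and> y \<in> {y1..y2}} (\<lambda>s. R (N s v))"
      by (rule continuous_at_imp_continuous_on) (use inO in \<open>auto intro!: RN_cont\<close>)
  qed
  have 3: "norm (G h v (rcis r y)) \<le> (C * K * norm v) * env (-1) (-1) a r"
    if ry: "0 < r" "y \<in> {y1..y2}" for r y
  proof -
    have "norm (G h v (rcis r y)) \<le> (C * env 1 1 a r) * (K / r^2 * norm v)"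
      unfolding G_def norm_c using b[OF inS[OF ry]] RN_bound[OF inO[OF ry], of v] ry(1) C env_nonneg[of 1 1 a r]
      by (intro mult_mono) auto
    also have "\<dots> = (C * K * norm v) * (env 1 1 a r * env (-2) (-2) 0 r)"
      using env_powr[OF ry(1), of "-2"] ry(1) by (simp add: powr_minus divide_inverse)
    finally show ?thesis using env_mult[OF ry(1), of 1 1 a "-2" "-2" 0] by simp
  qed
  show "ray y1 (G h v) = ray y2 (G h v)" by (rule ray_shift(1)[OF y(1) 1 2 3 a])
  show "y \<in> {y1..y2} \<Longrightarrow> ray_ok y (G h v)" by (rule ray_shift(2)[OF y(1) 1 2 3 a])
qed

lemma G_ok:
  assumes "cls t 1 1 h" "y = f \<or> y = -f" shows "ray_ok y (G h v)"
  using G_shift(2)[OF assms(1), of f f f v] G_shift(2)[OF assms(1), of "-f" "-f" "-f" v] assms(2) angles by auto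

text \<open>Outwards along the lower ray and inwards along the upper one, so the sector lies to the
  left of the path.\<close>

definition cint :: "(complex \<Rightarrow> 'v) \<Rightarrow> 'v" where
  "cint F = c (1 / (2 * pi * \<i>)) (ray (-f) F - ray f F)"

definition cok :: "(complex \<Rightarrow> 'v) \<Rightarrow> bool" where
  "cok F \<longleftrightarrow> ray_ok f F \<and> ray_ok (-f) F"

lemma cint_cong:
  assumes "\<And>r y. 0 < r \<Longrightarrow> y = f \<or> y = -f \<Longrightarrow> F (rcis r y) = F' (rcis r y)"
  shows "cint F = cint F'"
  unfolding cint_def using ray_cong[of F f F'] ray_cong[of F "-f" F'] assms by simp

lemma cok_cong:
  assumes "\<And>r y. 0 < r \<Longrightarrow> y = f \<or> y = -f \<Longrightarrow> F (rcis r y) = F' (rcis r y)"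
  shows "cok F \<longleftrightarrow> cok F'"
  unfolding cok_def using ray_ok_cong[of F f F'] ray_ok_cong[of F "-f" F'] assms by simp

lemma cint_add: "cok F \<Longrightarrow> cok F' \<Longrightarrow> cint (\<lambda>s. F s + F' s) = cint F + cint F'"
  unfolding cint_def cok_def by (simp add: ray_add c_add_right c_diff_right)
lemma cint_diff: "cok F \<Longrightarrow> cok F' \<Longrightarrow> cint (\<lambda>s. F s - F' s) = cint F - cint F'"
  unfolding cint_def cok_def by (simp add: ray_diff c_add_right c_diff_right)
lemma cint_linear:
  assumes "cok F" "bounded_linear L" "\<And>z v. L (c z v) = c z (L v)"
  shows "cint (\<lambda>s. L (F s)) = L (cint F)"
  using assms linear_diff[OF bounded_linear.linear[OF assms(2)]]
  unfolding cint_def cok_def by (simp add: ray_linear)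
lemma cok_add: "cok F \<Longrightarrow> cok F' \<Longrightarrow> cok (\<lambda>s. F s + F' s)"
  unfolding cok_def using ray_ok_add by blast
lemma cok_diff: "cok F \<Longrightarrow> cok F' \<Longrightarrow> cok (\<lambda>s. F s - F' s)"
  unfolding cok_def using ray_ok_diff by blast
lemma cok_linear: "cok F \<Longrightarrow> bounded_linear L \<Longrightarrow> cok (\<lambda>s. L (F s))"
  unfolding cok_def using ray_ok_linear by blast

lemma cok_G: "cls t 1 1 h \<Longrightarrow> cok (G h v)"
  unfolding cok_def using G_ok by blast

text \<open>Up to the factor -2 this is the harmonic functional calculus: its prefactor -1/\<pi> is
  -2 times 1/(2\<pi>), and the 1/\<i> sits in the path element.\<close>

definition A :: "(complex \<Rightarrow> complex) \<Rightarrow> 'v \<Rightarrow> 'v" where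
  "A h v = cint (G h v)"

lemma ray_norm_bound:
  assumes F: "ray_ok y F" and a: "0 < a" and b: "\<And>r. 0 < r \<Longrightarrow> norm (F (rcis r y)) \<le> B * env (-1) (-1) a r"
  shows "norm (ray y F) \<le> B * integral {0<..} (env (-1) (-1) a)"
proof -
  have "norm (ray y F) \<le> integral {0<..} (\<lambda>r. B * env (-1) (-1) a r)"
    unfolding ray_def
    by (rule integral_norm_bound_integral[OF ray_integrable[OF F]])
       (use b a in \<open>auto simp: norm_c intro!: integrable_on_mult_right env_integrable\<close>)
  then show ?thesis by simp
qed

lemma ray_lin_bl:
  assumes ok: "\<And>v. ray_ok y (F v)" and lin: "\<And>s. s \<in> Om \<Longrightarrow> linear (\<lambda>v. F v s)"
    and y: "y = f \<or> y = -f" and a: "0 < a"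
    and b: "\<And>v r. 0 < r \<Longrightarrow> norm (F v (rcis r y)) \<le> B * norm v * env (-1) (-1) a r"
  shows "bounded_linear (\<lambda>v. ray y (F v))"
proof (rule bounded_linear_intro[where K = "B * integral {0<..} (env (-1) (-1) a)"])
  have Om: "rcis r y \<in> Om" if "0 < r" for r
    using rcis_Om[OF that, of f] y angles by auto
  show "ray y (F (u + v)) = ray y (F u) + ray y (F v)" for u v
    using ray_add[OF ok ok, of u v] ray_cong[of "F (u + v)" y "\<lambda>s. F u s + F v s"]
      linear_add[OF lin[OF Om]] by simp
  show "ray y (F (r *\<^sub>R v)) = r *\<^sub>R ray y (F v)" for r v
    using ray_linear[OF ok bounded_linear_scaleR_right, of r v] ray_cong[of "F (r *\<^sub>R v)" y "\<lambda>s. r *\<^sub>R F v s"]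
      linear_scale[OF lin[OF Om]] c_scaleR_right by simp
  show "norm (ray y (F v)) \<le> norm v * (B * integral {0<..} (env (-1) (-1) a))" for v
    using ray_norm_bound[OF ok a b, of v] by (simp add: mult_ac)
qed

lemma RN_bl: "s \<in> Om \<Longrightarrow> bounded_linear (\<lambda>v. R (N s v))"
  by (rule bounded_linear_compose[OF R_bl N_bl])

lemma G_bound:
  assumes "cls t 1 1 h"
  obtains a B where "0 < a" "\<And>v r y. 0 < r \<Longrightarrow> y = f \<or> y = -f \<Longrightarrow>
      norm (G h v (rcis r y)) \<le> B * norm v * env (-1) (-1) a r"
proof -
  obtain a C where a: "0 < a" and C: "0 \<le> C"
    and b: "\<And>z. z \<in> sec t \<Longrightarrow> cmod (h z) \<le> C * env 1 1 a (cmod z)"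
    using clsE[OF assms] angles_pi angles by (metis less_imp_le)
  have "norm (G h v (rcis r y)) \<le> (C * K) * norm v * env (-1) (-1) a r"
    if ry: "0 < r" "y = f \<or> y = -f" for v r y
  proof -
    have inS: "rcis r y \<in> sec t" using ry angles by (intro rcis_in_sec) auto
    have inO: "rcis r y \<in> Om" using rcis_Om[OF ry(1), of f] ry angles by auto
    have "norm (G h v (rcis r y)) \<le> (C * env 1 1 a r) * (K / r^2 * norm v)"
      unfolding G_def norm_c using b[OF inS] RN_bound[OF inO, of v] ry(1) C env_nonneg[of 1 1 a r]
      by (intro mult_mono) auto
    also have "\<dots> = (C * K * norm v) * (env 1 1 a r * env (-2) (-2) 0 r)"
      using env_powr[OF ry(1), of "-2"] ry(1) by (simp add: powr_minus divide_inverse)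
    finally show ?thesis using env_mult[OF ry(1), of 1 1 a "-2" "-2" 0] by simp
  qed
  with a show ?thesis using that by blast
qed

lemma A_bl:
  assumes h: "cls t 1 1 h" shows "bounded_linear (A h)"
proof -
  obtain a B where a: "0 < a" and b: "\<And>v r y. 0 < r \<Longrightarrow> y = f \<or> y = -f \<Longrightarrow>
      norm (G h v (rcis r y)) \<le> B * norm v * env (-1) (-1) a r"
    using G_bound[OF h] by metis
  have lin: "linear (\<lambda>v. G h v s)" if "s \<in> Om" for s
    unfolding G_def by (rule bounded_linear.linear[OF bounded_linear_compose[OF c_bounded_linear RN_bl[OF that]]])
  have "bounded_linear (\<lambda>v. ray y (G h v))" if "y = f \<or> y = -f" for y
    by (rule ray_lin_bl[OF G_ok[OF h that] lin that a b]) (use that in auto)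
  then have "bounded_linear (\<lambda>v. ray (-f) (G h v) - ray f (G h v))"
    by (intro bounded_linear_sub) auto
  then show ?thesis
    unfolding A_def[abs_def] cint_def by (rule bounded_linear_compose[OF c_bounded_linear])
qed

lemma contour_Om: "0 < r \<Longrightarrow> y = f \<or> y = -f \<Longrightarrow> rcis r y \<in> Om"
  using rcis_Om[of r f] angles by auto
lemma contour_sec: "0 < r \<Longrightarrow> y = f \<or> y = -f \<Longrightarrow> rcis r y \<in> sec t"
  using angles by (intro rcis_in_sec) auto

lemma A_lin_commute:
  assumes h: "cls t 1 1 h" and L: "bounded_linear L" "\<And>z v. L (c z v) = c z (L v)"
    and LN: "\<And>s v. s \<in> Om \<Longrightarrow> L (R (N s v)) = R (N s (L v))"
  shows "A h (L v) = L (A h v)"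
proof -
  have "A h (L v) = cint (\<lambda>s. L (G h v s))"
    unfolding A_def by (rule cint_cong) (simp add: G_def L LN contour_Om)
  also have "\<dots> = L (A h v)" unfolding A_def by (rule cint_linear[OF cok_G[OF h] L])
  finally show ?thesis .
qed

lemma A_c: "cls t 1 1 h \<Longrightarrow> A h (c z v) = c z (A h v)"
  by (rule A_lin_commute) (auto intro: c_bounded_linear c_commute simp: N_c R_c)
lemma A_R: "cls t 1 1 h \<Longrightarrow> A h (R v) = R (A h v)"
  by (rule A_lin_commute) (auto intro: R_bl simp: N_R R_c)
lemma A_sg: "cls t 1 1 h \<Longrightarrow> A h (sg v) = sg (A h v)"
  by (rule A_lin_commute) (auto intro: sg_bl simp: N_sg sg_c R_sg)
lemma A_N: "cls t 1 1 h \<Longrightarrow> p \<in> Om \<Longrightarrow> A h (N p v) = N p (A h v)"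
  by (rule A_lin_commute) (auto intro: N_bl simp: N_N N_c N_R)
lemma A_A: "cls t 1 1 h \<Longrightarrow> cls t 1 1 n \<Longrightarrow> A h (A n v) = A n (A h v)"
  by (rule A_lin_commute) (auto intro: A_bl simp: A_N A_c A_R)

definition csym :: "(complex \<Rightarrow> complex) \<Rightarrow> bool" where
  "csym h \<longleftrightarrow> (\<forall>s\<in>sec t. h (cnj s) = cnj (h s))"

lemma cnj_Om: "s \<in> Om \<Longrightarrow> cnj s \<in> Om" by (simp add: Om_def)

lemma c_cnj_add: "c z v + c (cnj z) v = (2 * Re z) *\<^sub>R v"
proof -
  have "c z v + c (cnj z) v = c (of_real (2 * Re z)) v"
    by (simp only: complex_add_cnj flip: c_add_left)
  then show ?thesis by (simp only: c_of_real)
qed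

text \<open>The cross terms of the expanded product occur in conjugate pairs, and
  \<open>c z v + c (cnj z) v\<close> is a real multiple of \<open>v\<close>; so only real
  coefficients survive.\<close>

lemma conj_product:
  fixes w q :: complex
  defines "M \<equiv> \<lambda>w q v. v - c w (sg v) + c q (R v)"
  shows "M (cnj w) (cnj q) (M w q u) = u - (2 * Re w) *\<^sub>R sg u + (2 * Re q) *\<^sub>R R u
      + (cmod w)^2 *\<^sub>R sg (sg u) - (2 * Re (w * cnj q)) *\<^sub>R R (sg u) + (cmod q)^2 *\<^sub>R R (R u)"
proof -
  have "M (cnj w) (cnj q) (M w q u) = u - c w (sg u) + c q (R u)
      - (c (cnj w) (sg u) - c (cnj w * w) (sg (sg u)) + c (cnj w * q) (R (sg u)))
      + (c (cnj q) (R u) - c (cnj q * w) (R (sg u)) + c (cnj q * q) (R (R u)))"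
    unfolding M_def by (simp only: sg_add sg_diff R_add R_diff sg_c R_c c_add_right c_diff_right c_mult R_sg)
  also have "\<dots> = u - (c w (sg u) + c (cnj w) (sg u)) + (c q (R u) + c (cnj q) (R u))
      + c (w * cnj w) (sg (sg u)) - (c (w * cnj q) (R (sg u)) + c (cnj (w * cnj q)) (R (sg u)))
      + c (q * cnj q) (R (R u))"
    by (simp add: mult.commute[of "cnj w"] mult.commute[of "cnj q"] algebra_simps)
  also have "w * cnj w = of_real ((cmod w)^2)" by (metis complex_norm_square)
  also have "q * cnj q = of_real ((cmod q)^2)" by (metis complex_norm_square)
  finally show ?thesis unfolding c_cnj_add c_of_real .
qed

lemma conj_sum:
  fixes w q k :: complex
  shows "c k (R (v - c (cnj w) (sg v) + c (cnj q) (R v))) + c (cnj k) (R (v - c w (sg v) + c q (R v)))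
    = (2 * Re k) *\<^sub>R R v - (2 * Re (k * cnj w)) *\<^sub>R R (sg v) + (2 * Re (k * cnj q)) *\<^sub>R R (R v)"
proof -
  have "c k (R (v - c (cnj w) (sg v) + c (cnj q) (R v))) + c (cnj k) (R (v - c w (sg v) + c q (R v)))
    = c k (R v) - c (k * cnj w) (R (sg v)) + c (k * cnj q) (R (R v))
       + (c (cnj k) (R v) - c (cnj k * w) (R (sg v)) + c (cnj k * q) (R (R v)))"
    by (simp only: R_add R_diff R_c c_add_right c_diff_right c_mult)
  also have "\<dots> = (c k (R v) + c (cnj k) (R v)) - (c (k * cnj w) (R (sg v)) + c (cnj (k * cnj w)) (R (sg v)))
       + (c (k * cnj q) (R (R v)) + c (cnj (k * cnj q)) (R (R v)))"
    by simp
  finally show ?thesis unfolding c_cnj_add .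
qed

text \<open>The product of \<open>Mo s\<close> and \<open>Mo (cnj s)\<close> has real coefficients, so that an integral over a
  contour symmetric in the real axis commutes also with operators that are not complex linear.\<close>

lemma symmetric_commute:
  assumes s: "s \<in> Om" and X: "bounded_linear X" "\<And>v. X (R v) = R (X v)" "\<And>v. X (sg v) = sg (X v)"
  shows "X (c k (R (N s v)) + c (cnj k) (R (N (cnj s) v))) = c k (R (N s (X v))) + c (cnj k) (R (N (cnj s) (X v)))"
proof -
  note s' = cnj_Om[OF s]
  note Xlin = linear_add[OF bounded_linear.linear[OF X(1)]] linear_diff[OF bounded_linear.linear[OF X(1)]]
     linear_scale[OF bounded_linear.linear[OF X(1)]]
  note Rs = linear_scale[OF bounded_linear.linear[OF R_bl]] linear_scale[OF bounded_linear.linear[OF sg_bl]]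
  define Z where "Z = (\<lambda>v. c k (R (N s v)) + c (cnj k) (R (N (cnj s) v)))"
  define P where "P = (\<lambda>v. (2 * Re k) *\<^sub>R R v - (2 * Re (k * cnj (1 + s))) *\<^sub>R R (sg v)
      + (2 * Re (k * cnj ((1 + s)^2))) *\<^sub>R R (R v))"
  define Q where "Q = (\<lambda>v. v - (2 * Re (1 + s)) *\<^sub>R sg v + (2 * Re ((1 + s)^2)) *\<^sub>R R v
      + (cmod (1 + s))^2 *\<^sub>R sg (sg v) - (2 * Re ((1 + s) * cnj ((1 + s)^2))) *\<^sub>R R (sg v)
      + (cmod ((1 + s)^2))^2 *\<^sub>R R (R v))"
  have w: "1 + cnj s = cnj (1 + s)" "(cnj (1 + s))^2 = cnj ((1 + s)^2)" by simp_all
  have Q: "Mo (cnj s) (Mo s u) = Q u" for u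
    unfolding Mo_def w Q_def by (rule conj_product)
  have P: "Q (Z v) = P v" for v
  proof -
    have "Q (Z v) = Mo (cnj s) (Mo s (c k (R (N s v)))) + Mo (cnj s) (Mo s (c (cnj k) (R (N (cnj s) v))))"
      by (simp only: Z_def Mo_add Q[symmetric])
    also have "Mo (cnj s) (Mo s (c (cnj k) (R (N (cnj s) v)))) = Mo s (Mo (cnj s) (c (cnj k) (R (N (cnj s) v))))"
      by (rule Mo_Mo)
    also have "Mo (cnj s) (Mo s (c k (R (N s v)))) = c k (R (Mo (cnj s) v))"
      by (simp only: Mo_c[symmetric] Mo_R[symmetric] MoN[OF s])
    also have "Mo s (Mo (cnj s) (c (cnj k) (R (N (cnj s) v)))) = c (cnj k) (R (Mo s v))"
      by (simp only: Mo_c[symmetric] Mo_R[symmetric] MoN[OF s'])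
    finally show ?thesis unfolding Mo_def w P_def using conj_sum[where k = k and w = "1 + s" and q = "(1 + s)^2" and v = v] by simp
  qed
  have "Q (X (Z v)) = X (Q (Z v))" unfolding Q_def by (simp add: Xlin X(2,3))
  also have "\<dots> = X (P v)" by (simp add: P)
  also have "\<dots> = P (X v)" unfolding P_def by (simp add: Xlin X(2,3))
  also have "\<dots> = Q (Z (X v))" by (simp add: P)
  finally have "Mo (cnj s) (Mo s (X (Z v))) = Mo (cnj s) (Mo s (Z (X v)))" by (simp add: Q)
  then have "X (Z v) = Z (X v)" by (metis NMo s s')
  then show ?thesis by (simp add: Z_def)
qed

text \<open>Meant for real linear \<open>X\<close> such as \<open>S\<close>, which cannot be moved
  past the scalars. When \<open>h\<close> is symmetric, the two rays are paired at conjugate points,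
  and each pair commutes with \<open>X\<close> by \<open>symmetric_commute\<close>, already under
  the integral sign.\<close>

lemma A_commute:
  assumes h: "cls t 1 1 h" "csym h"
    and X: "bounded_linear X" "\<And>v. X (R v) = R (X v)" "\<And>v. X (sg v) = sg (X v)"
  shows "X (A h v) = A h (X v)"
proof -
  let ?k = "1 / (2 * pi * \<i>) :: complex"
  \<comment> \<open>The minus sign is the inward orientation of the upper ray; as 1/(2\<pi>\<i>) is
    purely imaginary, it makes the coefficient on the lower ray exactly
    \<open>cnj (z r)\<close>.\<close>
  define z where "z = (\<lambda>r. - (?k * cis f * h (rcis r f)))"
  have zc: "cnj (z r) = ?k * cis (-f) * h (rcis r (-f))" if "0 < r" for r
  proof -
    have "cnj (rcis r f) = rcis r (-f)" by (simp add: rcis_def cis_cnj)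
    moreover have "h (cnj (rcis r f)) = cnj (h (rcis r f))"
      using h(2) contour_sec[OF that, of f] unfolding csym_def by blast
    ultimately have "h (rcis r (-f)) = cnj (h (rcis r f))" by simp
    then show ?thesis by (simp add: z_def cis_cnj)
  qed
  define Z where "Z = (\<lambda>v r. c (z r) (R (N (rcis r f) v)) + c (cnj (z r)) (R (N (cnj (rcis r f)) v)))"
  have A: "(Z v has_integral A h v) {0<..}" for v
  proof -
    have i: "((\<lambda>r. c (cis y) (G h v (rcis r y))) has_integral ray y (G h v)) {0<..}" if "y = f \<or> y = -f" for y
      unfolding ray_def using ray_integrable[OF G_ok[OF h(1) that]] by (simp add: integrable_integral)
    have "((\<lambda>r. c ?k (c (cis (-f)) (G h v (rcis r (-f))) - c (cis f) (G h v (rcis r f)))) has_integral A h v) {0<..}"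
      unfolding A_def cint_def
      using has_integral_linear[OF has_integral_diff[OF i[of "-f"] i[of f]] c_bounded_linear[of ?k]]
      by (simp add: o_def)
    then show ?thesis
    proof (rule has_integral_eq[rotated])
      fix r :: real assume "r \<in> {0<..}"
      then have r: "0 < r" by simp
      have cn: "cnj (rcis r f) = rcis r (-f)" by (simp add: rcis_def cis_cnj)
      show "c ?k (c (cis (-f)) (G h v (rcis r (-f))) - c (cis f) (G h v (rcis r f))) = Z v r"
        unfolding Z_def zc[OF r] cn 
        by (simp only: z_def G_def c_diff_right c_minus_left c_mult uminus_add_conv_diff)
    qed
  qed
  have "((\<lambda>r. X (Z v r)) has_integral X (A h v)) {0<..}"
    using has_integral_linear[OF A[of v] X(1)] by (simp add: o_def)
  then have "((\<lambda>r. Z (X v) r) has_integral X (A h v)) {0<..}"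
    by (rule has_integral_eq[rotated])
       (use symmetric_commute[OF contour_Om X] in \<open>auto simp: Z_def\<close>)
  then show ?thesis using A[of "X v"] has_integral_unique by blast
qed

lemma A_pr: "cls t 1 1 h \<Longrightarrow> csym h \<Longrightarrow> pr X Y \<Longrightarrow> X (A h v) = A h (X v)"
  by (rule A_commute) (auto simp: pr_bl pr_R pr_sg)

end

section \<open>Growth classes, distances in sectors and iterated ray integrals\<close>

text \<open>Growth without a margin, for factors such as 1+s and 1/(1+s) that attain their
  exponents. The product with a function of class \<open>cls\<close> takes its margin from the
  latter.\<close>

definition bnd :: "real \<Rightarrow> real \<Rightarrow> real \<Rightarrow> (complex \<Rightarrow> complex) \<Rightarrow> bool" where
  "bnd t p q h \<longleftrightarrow> h holomorphic_on sec t \<and> (\<exists>C. \<forall>z\<in>sec t. cmod (h z) \<le> C * env p q 0 (cmod z))"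

lemma cls_mono:
  assumes "cls t p q h" "p' \<le> p" "q \<le> q'" "0 < t" "t \<le> pi"
  shows "cls t p' q' h"
proof -
  obtain a C where h: "h holomorphic_on sec t" "0 < a" "a \<le> 1" "0 \<le> C"
    and b: "\<And>z. z \<in> sec t \<Longrightarrow> cmod (h z) \<le> C * env p q a (cmod z)"
    using clsE[OF assms(1,4,5)] by metis
  have "cmod (h z) \<le> C * env p' q' a (cmod z)" if "z \<in> sec t" for z
  proof (rule order_trans[OF b[OF that]])
    show "C * env p q a (cmod z) \<le> C * env p' q' a (cmod z)"
      using sec_nz[OF that] assms(2,3) h(4) by (intro mult_left_mono env_mono) auto
  qed
  then show ?thesis unfolding cls_def using h by blast
qed

lemma cls_mult_bnd:
  assumes "bnd t p q k" "cls t p' q' h" "0 < t" "t \<le> pi"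
  shows "cls t (p + p') (q + q') (\<lambda>s. k s * h s)"
proof -
  obtain a C where h: "h holomorphic_on sec t" "0 < a" "a \<le> 1" "0 \<le> C"
    and b: "\<And>z. z \<in> sec t \<Longrightarrow> cmod (h z) \<le> C * env p' q' a (cmod z)"
    using clsE[OF assms(2-4)] by metis
  from assms(1) obtain D where k: "k holomorphic_on sec t" "\<And>z. z \<in> sec t \<Longrightarrow> cmod (k z) \<le> D * env p q 0 (cmod z)"
    unfolding bnd_def by blast
  have "cmod (k z * h z) \<le> (D * C) * env (p + p') (q + q') a (cmod z)" if "z \<in> sec t" for z
  proof -
    have "cmod (k z * h z) \<le> (D * env p q 0 (cmod z)) * (C * env p' q' a (cmod z))"
      unfolding norm_mult using k(2)[OF that] b[OF that]
      by (intro mult_mono) (auto intro: order_trans[OF norm_ge_zero])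
    also have "\<dots> = (D * C) * (env p q 0 (cmod z) * env p' q' a (cmod z))" by simp
    finally show ?thesis using env_mult[of "cmod z" p q 0 p' q' a] sec_nz[OF that] by simp
  qed
  moreover have "(\<lambda>s. k s * h s) holomorphic_on sec t" by (intro holomorphic_intros k h)
  ultimately show ?thesis unfolding cls_def using h by blast
qed

lemma cls_imp_bnd:
  assumes "cls t p q h" "0 < t" "t \<le> pi" shows "bnd t p q h"
proof -
  obtain a C where h: "h holomorphic_on sec t" "0 < a" "a \<le> 1" "0 \<le> C"
    and b: "\<And>z. z \<in> sec t \<Longrightarrow> cmod (h z) \<le> C * env p q a (cmod z)"
    using clsE[OF assms] by metis
  have "cmod (h z) \<le> C * env p q 0 (cmod z)" if "z \<in> sec t" for z
    by (rule order_trans[OF b[OF that]], intro mult_left_mono env_mono) (use sec_nz[OF that] h in auto)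
  then show ?thesis unfolding bnd_def using h by blast
qed

lemma cls_mult:
  assumes "cls t p q k" "cls t p' q' h" "0 < t" "t \<le> pi"
  shows "cls t (p + p') (q + q') (\<lambda>s. k s * h s)"
  by (rule cls_mult_bnd[OF cls_imp_bnd[OF assms(1,3,4)] assms(2-4)])

lemma bnd_one_plus: "bnd t 0 1 (\<lambda>s. 1 + s)"
  unfolding bnd_def
proof (intro conjI exI[of _ 2] ballI)
  fix z assume "z \<in> sec t"
  then have "0 < cmod z" using sec_nz by auto
  have "cmod (1 + z) \<le> 1 + cmod z" using norm_triangle_ineq[of 1 z] by simp
  also have "\<dots> \<le> 2 * env 0 1 0 (cmod z)" using \<open>0 < cmod z\<close> by (simp add: env_def)
  finally show "cmod (1 + z) \<le> 2 * env 0 1 0 (cmod z)" .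
qed (intro holomorphic_intros)

lemma bnd_ident: "bnd t 1 1 (\<lambda>s. s)"
  unfolding bnd_def
  by (intro conjI exI[of _ 1] ballI holomorphic_intros) (auto simp: env_def dest: sec_nz)

text \<open>Replacing Re z by its lower bound |z| cos t turns |1+z|^2 into a convex combination of
  (1+|z|)^2 and (1-|z|)^2 with weights (1 + cos t)/2 and (1 - cos t)/2. So the distance to -1 is
  comparable with 1+|z|.\<close>

lemma sec_one_plus:
  assumes "z \<in> sec t" "0 \<le> t" "t < pi"
  shows "(1 + cos t) / 2 * (1 + cmod z)^2 \<le> (cmod (1 + z))^2" "1 + z \<noteq> 0"
proof -
  have t: "-1 < cos t" using cos_monotone_0_pi[of t pi] assms by simp
  have "(cmod (1 + z))^2 = 1 + 2 * Re z + (cmod z)^2"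
    unfolding cmod_power2 by (simp add: power2_eq_square algebra_simps)
  also have "\<dots> \<ge> 1 + 2 * (cmod z * cos t) + (cmod z)^2" using assms by (simp add: sec_def)
  also have "1 + 2 * (cmod z * cos t) + (cmod z)^2 = (1 + cos t) / 2 * (1 + cmod z)^2 + (1 - cos t) / 2 * (1 - cmod z)^2"
    by (simp add: field_simps power2_eq_square)
  finally show "(1 + cos t) / 2 * (1 + cmod z)^2 \<le> (cmod (1 + z))^2"
    using cos_le_one[of t] by (smt (verit) divide_nonneg_nonneg mult_nonneg_nonneg zero_le_power2)
  moreover have "0 < (1 + cos t) / 2 * (1 + cmod z)^2"
    using t by (intro mult_pos_pos zero_less_power add_pos_nonneg) auto
  ultimately show "1 + z \<noteq> 0" by auto
qed

lemma bnd_inverse_one_plus: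
  assumes "0 < t" "t < pi" shows "bnd t 0 (-1) (\<lambda>s. 1 / (1 + s))"
  unfolding bnd_def
proof (intro conjI ballI)
  define d where "d = sqrt ((1 + cos t) / 2)"
  have d: "0 < d" unfolding d_def using cos_monotone_0_pi[of t pi] assms by simp
  show "\<exists>C. \<forall>z\<in>sec t. cmod (1 / (1 + z)) \<le> C * env 0 (-1) 0 (cmod z)"
  proof (intro exI ballI)
    fix z assume z: "z \<in> sec t"
    have "(d * (1 + cmod z))^2 \<le> (cmod (1 + z))^2"
      using sec_one_plus(1)[OF z] assms d by (simp add: power_mult_distrib d_def add_nonneg_nonneg)
    then have "d * (1 + cmod z) \<le> cmod (1 + z)" by (rule power2_le_imp_le) simp
    then have "cmod (1 / (1 + z)) \<le> 1 / (d * (1 + cmod z))"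
      using d by (simp add: norm_divide frac_le add_pos_nonneg)
    also have "\<dots> = 1 / d * (1 / (1 + cmod z))" by simp
    also have "\<dots> \<le> 1 / d * env 0 (-1) 0 (cmod z)"
    proof (rule mult_left_mono)
      have "0 < cmod z" using sec_nz[OF z] by simp
      have i: "1 / (1 + cmod z) \<le> 1 / 1" "1 / (1 + cmod z) \<le> 1 / cmod z"
        using \<open>0 < cmod z\<close> by (intro frac_le; simp)+
      show "1 / (1 + cmod z) \<le> env 0 (-1) 0 (cmod z)"
      proof (cases "cmod z \<le> 1")
        case True
        then have "env 0 (-1) 0 (cmod z) = 1 / 1" using \<open>0 < cmod z\<close> by (simp add: env_def)
        with i(1) show ?thesis by (simp only:)
      next
        case False
        then have "env 0 (-1) 0 (cmod z) = 1 / cmod z" by (simp add: env_def powr_neg_one)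
        with i(2) show ?thesis by (simp only:)
      qed
    qed (use d in auto)
    finally show "cmod (1 / (1 + z)) \<le> 1 / d * env 0 (-1) 0 (cmod z)" .
  qed
  show "(\<lambda>s. 1 / (1 + s)) holomorphic_on sec t"
    using sec_one_plus(2) assms by (intro holomorphic_intros) auto
qed

text \<open>The same splitting, now with the angle between two rays. It bounds the Cauchy kernel
  between the two contours by a multiple of 1/(x+z).\<close>

lemma ray_distance:
  assumes "0 < x" "0 < z"
  shows "(1 - cos (y - y')) / 2 * (x + z)^2 \<le> (cmod (rcis x y - rcis z y'))^2"
proof -
  have "(cmod (rcis x y - rcis z y'))^2
      = x^2 * ((cos y)^2 + (sin y)^2) + z^2 * ((cos y')^2 + (sin y')^2) - 2 * x * z * cos (y - y')"
    unfolding cmod_power2 by (simp add: cos_diff power2_eq_square algebra_simps del: sin_cos_squared_add sin_cos_squared_add2 sin_cos_squared_add3)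
  also have "\<dots> = x^2 + z^2 - 2 * x * z * cos (y - y')" by (simp only: sin_cos_squared_add2 mult_1_right)
  also have "\<dots> = (1 - cos (y - y')) / 2 * (x + z)^2 + (1 + cos (y - y')) / 2 * (x - z)^2"
    by (simp add: field_simps power2_eq_square)
  finally show ?thesis
    using cos_ge_minus_one[of "y - y'"] by (smt (verit) divide_nonneg_nonneg mult_nonneg_nonneg zero_le_power2)
qed

lemma cos_less_one:
  assumes "0 < d" "d < 2 * pi" shows "cos d < 1"
proof (cases "d \<le> pi")
  case True then show ?thesis using cos_monotone_0_pi[of 0 d] assms by simp
next
  case False
  then have "cos (2 * pi - d) < 1" using cos_monotone_0_pi[of 0 "2 * pi - d"] assms by simp
  then show ?thesis by (simp add: cos_diff)
qed

text \<open>The bound separates the two radii, so the half-line version applies once the constant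
  factors \<open>cis y\<close> and \<open>cis y'\<close> have been moved inside; they are invertible
  and hence also removable.\<close>

lemma (in complex_module) ray_fubini:
  fixes KK :: "complex \<Rightarrow> complex \<Rightarrow> 'v"
  assumes cont: "continuous_on ({0<..} \<times> {0<..}) (\<lambda>(x, z). KK (rcis x y) (rcis z y'))"
    and a: "0 < a" "0 < b"
    and bnd: "\<And>x z. 0 < x \<Longrightarrow> 0 < z \<Longrightarrow>
        norm (KK (rcis x y) (rcis z y')) \<le> C * env (-1) (-1) a x * env (-1) (-1) b z"
  shows "ray y (\<lambda>s. ray y' (KK s)) = ray y' (\<lambda>p. ray y (\<lambda>s. KK s p))"
    and "ray_ok y (\<lambda>s. ray y' (KK s))"
proof -
  let ?F = "\<lambda>x z. c (cis y) (c (cis y') (KK (rcis x y) (rcis z y')))"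
  have slice1: "continuous_on {0<..} (\<lambda>z. KK (rcis x y) (rcis z y'))" if "0 < x" for x
  proof -
    have "continuous_on {0<..} (\<lambda>z. (x, z))" by (intro continuous_intros)
    from continuous_on_compose2[OF cont this] that show ?thesis by (simp add: image_subset_iff)
  qed
  have slice2: "continuous_on {0<..} (\<lambda>x. KK (rcis x y) (rcis z y'))" if "0 < z" for z
  proof -
    have "continuous_on {0<..} (\<lambda>x. (x, z))" by (intro continuous_intros)
    from continuous_on_compose2[OF cont this] that show ?thesis by (simp add: image_subset_iff)
  qed
  have ok1: "ray_ok y' (KK (rcis x y))" if "0 < x" for x
    unfolding ray_ok_def using slice1[OF that] a(2) bnd[OF that] by blast
  have ok2: "ray_ok y (\<lambda>s. KK s (rcis z y'))" if "0 < z" for z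
  proof -
    have "norm (KK (rcis x y) (rcis z y')) \<le> (C * env (-1) (-1) b z) * env (-1) (-1) a x" if "0 < x" for x
      using bnd[OF that \<open>0 < z\<close>] by (simp add: mult_ac)
    with slice2[OF that] a(1) show ?thesis unfolding ray_ok_def by blast
  qed
  have i1: "c (cis y) (ray y' (KK (rcis x y))) = integral {0<..} (?F x)" if "0 < x" for x
    unfolding ray_def using integral_linear[OF ray_integrable[OF ok1[OF that]] c_bounded_linear[of "cis y"]]
    by (simp add: o_def)
  have i2: "c (cis y') (ray y (\<lambda>s. KK s (rcis z y'))) = integral {0<..} (\<lambda>x. ?F x z)" if "0 < z" for z
    unfolding ray_def using integral_linear[OF ray_integrable[OF ok2[OF that]] c_bounded_linear[of "cis y'"]]
    by (simp add: o_def c_commute[of "cis y"])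
  have cF: "continuous_on ({0<..} \<times> {0<..}) (\<lambda>(x, z). ?F x z)"
    using cont by (auto simp: case_prod_unfold intro!: c_continuous_on continuous_intros)
  have bF: "norm (?F x z) \<le> (\<bar>C\<bar> * env (-1) (-1) a x) * env (-1) (-1) b z" if "0 < x" "0 < z" for x z
  proof -
    have "norm (?F x z) \<le> C * (env (-1) (-1) a x * env (-1) (-1) b z)"
      using bnd[OF that] by (simp add: norm_c mult.assoc)
    also have "\<dots> \<le> \<bar>C\<bar> * (env (-1) (-1) a x * env (-1) (-1) b z)"
      by (intro mult_right_mono mult_nonneg_nonneg env_nonneg) auto
    finally show ?thesis by (simp add: mult.assoc)
  qed
  have g: "(\<lambda>x. \<bar>C\<bar> * env (-1) (-1) a x) integrable_on {0<..}" "continuous_on {0<..} (\<lambda>x. \<bar>C\<bar> * env (-1) (-1) a x)"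
    "\<And>x. 0 < x \<Longrightarrow> 0 \<le> \<bar>C\<bar> * env (-1) (-1) a x"
    by (auto intro!: integrable_on_mult_right env_integrable a continuous_intros continuous_on_env simp: env_nonneg)
  have h: "env (-1) (-1) b integrable_on {0<..}" "continuous_on {0<..} (env (-1) (-1) b)"
    "\<And>x. 0 < x \<Longrightarrow> 0 \<le> env (-1) (-1) b x"
    by (auto intro!: env_integrable a continuous_on_env simp: env_nonneg)
  have "ray y (\<lambda>s. ray y' (KK s)) = integral {0<..} (\<lambda>x. integral {0<..} (?F x))"
    unfolding ray_def[of y] by (rule integral_cong) (simp add: i1)
  also have "\<dots> = integral {0<..} (\<lambda>z. integral {0<..} (\<lambda>x. ?F x z))"
    by (rule halfline_fubini[OF cF bF g h])
  also have "\<dots> = ray y' (\<lambda>p. ray y (\<lambda>s. KK s p))"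
    unfolding ray_def[of y'] by (rule integral_cong) (simp add: i2)
  finally show "ray y (\<lambda>s. ray y' (KK s)) = ray y' (\<lambda>p. ray y (\<lambda>s. KK s p))" .
  show "ray_ok y (\<lambda>s. ray y' (KK s))"
    unfolding ray_ok_def
  proof (intro conjI)
    have inv: "c (cis (-y)) (c (cis y) v) = v" for v
      using c_mult[of "cis (-y)" "cis y" v] by (simp add: cis_mult)
    have e: "ray y' (KK (rcis x y)) = c (cis (-y)) (integral {0<..} (?F x))" if "0 < x" for x
      using i1[OF that] inv by metis
    have "continuous_on {0<..} (\<lambda>x. c (cis (-y)) (integral {0<..} (?F x)))"
      by (intro c_continuous_on continuous_on_const halfline_param(1)[OF cF bF g h])
    then show "continuous_on {0<..} (\<lambda>x. ray y' (KK (rcis x y)))"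
      by (rule continuous_on_eq) (simp add: e)
    show "\<exists>a>0. \<exists>C. \<forall>r>0. norm (ray y' (KK (rcis r y))) \<le> C * env (-1) (-1) a r"
    proof (intro exI conjI allI impI)
      fix x :: real assume x: "0 < x"
      have "norm (integral {0<..} (?F x)) \<le> (\<bar>C\<bar> * env (-1) (-1) a x) * integral {0<..} (env (-1) (-1) b)"
        by (rule halfline_param(3)[OF cF bF g h x])
      then show "norm (ray y' (KK (rcis x y))) \<le> (\<bar>C\<bar> * integral {0<..} (env (-1) (-1) b)) * env (-1) (-1) a x"
        by (simp add: e[OF x] norm_c mult_ac)
    qed (rule a)
  qed
qed

text \<open>The pole is avoided by every ray between the two, so one ray can be turned onto the
  other across the sector. The denominator is at least |s|/2 near 0 and at least half the radius far
  out, while the decay of \<open>h\<close> provides the margin.\<close>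

lemma cauchy_rays_outside:
  assumes h: "cls t 0 0 h" and t: "0 < f" "f < t" "t \<le> pi" and s: "s \<noteq> 0"
    and out: "\<And>r y. 0 < r \<Longrightarrow> y \<in> {-f..f} \<Longrightarrow> rcis r y \<noteq> s"
  shows "cx.ray (-f) (\<lambda>p. h p / (s - p)) = cx.ray f (\<lambda>p. h p / (s - p))"
    and "y = f \<or> y = -f \<Longrightarrow> cx.ray_ok y (\<lambda>p. h p / (s - p))"
proof -
  let ?q = "\<lambda>p. h p / (s - p)"
  obtain a C where hol: "h holomorphic_on sec t" and a: "0 < a" "a \<le> 1" and C: "0 \<le> C"
    and b: "\<And>z. z \<in> sec t \<Longrightarrow> cmod (h z) \<le> C * env 0 0 a (cmod z)"
    using clsE[OF h] t by (metis less_trans)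
  have insec: "rcis r y \<in> sec t" if "0 < r" "y \<in> {-f..f}" for r y
    using rcis_in_sec[of r y t] that t by auto
  have qhol: "?q holomorphic_on (sec t - {s})"
    by (intro holomorphic_intros holomorphic_on_subset[OF hol]) auto
  have op: "open (sec t - {s})" by (intro open_Diff open_sec) auto
  have sub: "rcis r y \<in> sec t - {s}" if "0 < r" "y \<in> {-f..f}" for r y
    using insec[OF that] out[OF that] by auto
  define r1 where "r1 = min 1 (cmod s / 2)"
  define r2 where "r2 = max 1 (2 * cmod s)"
  have qb: "norm (?q (rcis r y)) \<le> (2 * C / cmod s + 2 * C) * env (-1) (-1) a r"
    if ry: "0 < r" "y \<in> {-f..f}" "r < r1 \<or> r > r2" for r y
  proof -
    have nb: "cmod (h (rcis r y)) \<le> C * env 0 0 a r" using b[OF insec[OF ry(1,2)]] ry(1) by simp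
    from ry(3) show ?thesis
    proof
      assume r: "r < r1"
      have d: "cmod s / 2 \<le> cmod (s - rcis r y)"
        using norm_triangle_ineq2[of s "rcis r y"] r ry(1) by (simp add: r1_def)
      have "r powr 1 \<le> 1" using r ry(1) by (simp add: r1_def)
      have e: "env 0 0 a r \<le> env (-1) (-1) a r"
        using r ry(1) a by (auto simp: env_def r1_def intro!: powr_mono')
      have "norm (?q (rcis r y)) \<le> (C * env (-1) (-1) a r) / (cmod s / 2)"
        unfolding norm_divide using nb d s order_trans[OF nb mult_left_mono[OF e C]] C env_nonneg
        by (intro frac_le) auto
      also have "\<dots> = 2 * C / cmod s * env (-1) (-1) a r" by simp
      also have "\<dots> \<le> (2 * C / cmod s + 2 * C) * env (-1) (-1) a r"
        using C by (intro mult_right_mono env_nonneg) auto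
      finally show ?thesis .
    next
      assume r: "r > r2"
      have d: "r / 2 \<le> cmod (s - rcis r y)"
        using norm_triangle_ineq3[of s "rcis r y"] r ry(1) by (simp add: r2_def)
      have eq: "- a - 1 = - 1 - a" by simp
      have e: "env 0 0 a r = r * env (-1) (-1) a r"
        using r ry(1) powr_diff[of r "-a" 1, unfolded eq] by (simp add: env_def r2_def)
      have "norm (?q (rcis r y)) \<le> (C * (r * env (-1) (-1) a r)) / (r / 2)"
        unfolding norm_divide using nb d ry(1) C env_nonneg[of "-1" "-1" a r]
        by (intro frac_le) (auto simp: e)
      also have "\<dots> = 2 * C * env (-1) (-1) a r" using ry(1) by simp
      also have "\<dots> \<le> (2 * C / cmod s + 2 * C) * env (-1) (-1) a r"
        using C by (intro mult_right_mono env_nonneg) auto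
      finally show ?thesis .
    qed
  qed
  have qc: "continuous_on {rcis r y |r y. 0 < r \<and> y \<in> {-f..f}} ?q"
    by (rule continuous_on_subset[OF holomorphic_on_imp_continuous_on[OF qhol]]) (use sub in auto)
  have "0 < r1" using s by (simp add: r1_def)
  then obtain C' where C': "\<And>r y. 0 < r \<Longrightarrow> y \<in> {-f..f} \<Longrightarrow> norm (?q (rcis r y)) \<le> C' * env (-1) (-1) a r"
    using sector_bound_extend[OF qc, of r1 r2 _ "-1" "-1" a] qb by metis
  have ff: "-f \<le> f" using t by simp
  show "cx.ray (-f) ?q = cx.ray f ?q"
    by (rule cx_shift(1)[OF qhol op ff a(1) sub C'])
  show "cx.ray_ok y ?q" if "y = f \<or> y = -f"
    by (rule cx_shift(2)[OF qhol op ff a(1) sub C']) (use that ff in auto)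
qed

section \<open>The double contour integral and the product formula\<close>

context op_calc
begin

lemma cls11: "cls t 1 0 h \<Longrightarrow> cls t 1 1 h"
  using cls_mono[of t 1 0 h 1 1] angles by auto
lemma cls00: "cls t 1 0 h \<Longrightarrow> cls t 0 0 h"
  using cls_mono[of t 1 0 h 0 0] angles by auto
lemma cls_one_plus: "cls t p q h \<Longrightarrow> cls t p (q + 1) (\<lambda>s. (1 + s) * h s)"
  using cls_mult_bnd[OF bnd_one_plus, of t p q h] angles by (simp add: add.commute[of 1 q])
lemma cls_prod: "cls t 1 0 n \<Longrightarrow> cls t 1 0 h \<Longrightarrow> cls t 1 0 (\<lambda>s. n s * h s)"
  using cls_mult[of t 1 0 n 1 0 h] angles cls_mono[of t 2 0 "\<lambda>s. n s * h s" 1 0] by auto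

text \<open>Angle of the outer contour. Any value strictly between \<open>f\<close> and
  \<open>t\<close> keeps the two contours apart, with functions and resolvents defined on
  both.\<close>

definition fo :: real where "fo = (f + t) / 2"

lemma fo: "f < fo" "fo < t" "0 < fo" "fo < pi" "f + fo < 2 * pi" using angles by (auto simp: fo_def field_simps)

lemma outer_Om: "0 < r \<Longrightarrow> y = fo \<or> y = -fo \<Longrightarrow> rcis r y \<in> Om"
  using rcis_Om[of r fo] fo angles by auto

definition oint :: "(complex \<Rightarrow> 'v) \<Rightarrow> 'v" where
  "oint F = c (1 / (2 * pi * \<i>)) (ray (-fo) F - ray fo F)"

lemma oint_A: "cls t 1 1 n \<Longrightarrow> oint (G n v) = A n v"
  using G_shift(1)[of n "-fo" "-f" v] G_shift(1)[of n f fo v] fo angles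
  by (simp add: oint_def A_def cint_def)

lemma oint_ok: "cls t 1 1 n \<Longrightarrow> y = fo \<or> y = -fo \<Longrightarrow> ray_ok y (G n v)"
  using G_shift(2)[of n "-fo" "-f" "-fo" v] G_shift(2)[of n f fo fo v] fo angles by auto

definition ook :: "(complex \<Rightarrow> 'v) \<Rightarrow> bool" where
  "ook F \<longleftrightarrow> ray_ok fo F \<and> ray_ok (-fo) F"

lemma oint_cong:
  assumes "\<And>r y. 0 < r \<Longrightarrow> y = fo \<or> y = -fo \<Longrightarrow> F (rcis r y) = F' (rcis r y)"
  shows "oint F = oint F'"
  unfolding oint_def using ray_cong[of F fo F'] ray_cong[of F "-fo" F'] assms by simp
lemma oint_add: "ook F \<Longrightarrow> ook F' \<Longrightarrow> oint (\<lambda>s. F s + F' s) = oint F + oint F'"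
  unfolding oint_def ook_def by (simp add: ray_add c_add_right c_diff_right)
lemma oint_diff: "ook F \<Longrightarrow> ook F' \<Longrightarrow> oint (\<lambda>s. F s - F' s) = oint F - oint F'"
  unfolding oint_def ook_def by (simp add: ray_diff c_add_right c_diff_right)
lemma oint_linear:
  assumes "ook F" "bounded_linear L" "\<And>z v. L (c z v) = c z (L v)"
  shows "oint (\<lambda>s. L (F s)) = L (oint F)"
  using assms linear_diff[OF bounded_linear.linear[OF assms(2)]]
  unfolding oint_def ook_def by (simp add: ray_linear)
lemma ook_diff: "ook F \<Longrightarrow> ook F' \<Longrightarrow> ook (\<lambda>s. F s - F' s)"
  unfolding ook_def using ray_ok_diff by blast
lemma ook_linear: "ook F \<Longrightarrow> bounded_linear L \<Longrightarrow> ook (\<lambda>s. L (F s))"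
  unfolding ook_def using ray_ok_linear by blast
lemma ook_G: "cls t 1 1 h \<Longrightarrow> ook (G h v)"
  unfolding ook_def using oint_ok by blast

lemma ray_scalar:
  assumes "cx.ray_ok y k" shows "ray y (\<lambda>s. c (k s) w) = c (cx.ray y k) w" "ray_ok y (\<lambda>s. c (k s) w)"
proof -
  have bl: "bounded_linear (\<lambda>z. c z w)" by (rule bounded_bilinear.bounded_linear_left[OF bil])
  show "ray y (\<lambda>s. c (k s) w) = c (cx.ray y k) w"
    using integral_linear[OF cx.ray_integrable[OF assms] bl]
    by (simp add: ray_def cx.ray_def o_def c_mult)
  obtain a C where a: "0 < a" and b: "\<And>r. 0 < r \<Longrightarrow> norm (k (rcis r y)) \<le> C * env (-1) (-1) a r"
      and k: "continuous_on {0<..} (\<lambda>r. k (rcis r y))"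
    using assms unfolding cx.ray_ok_def by blast
  have "norm (c (k (rcis r y)) w) \<le> (C * norm w) * env (-1) (-1) a r" if "0 < r" for r
    using mult_right_mono[OF b[OF that] norm_ge_zero[of w]] by (simp add: norm_c mult_ac)
  moreover have "continuous_on {0<..} (\<lambda>r. c (k (rcis r y)) w)" by (intro c_continuous_on k continuous_on_const)
  ultimately show "ray_ok y (\<lambda>s. c (k s) w)" unfolding ray_ok_def using a by blast
qed

text \<open>Without the extra \<open>R\<close> this reads Q_p^{-1} - Q_s^{-1} = (s-p)(s+p-2T_0)
  Q_s^{-1} Q_p^{-1}. Multiplication by \<open>R\<close> replaces the unbounded factor s+p-2T_0 by
  (1+s) \<open>R\<close> + (1+p) \<open>R\<close> - \<open>sg\<close>, because \<open>sg\<close> is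
  2+2T_0 times \<open>R\<close>.\<close>

lemma resolvent_identity:
  assumes s: "s \<in> Om" and p: "p \<in> Om" and sp: "s \<noteq> p"
  shows "c (1 / (s - p)) (R (R (N p v))) = c (1 / (s - p)) (R (R (N s v)))
      + (c (1 + s) (R (R (N s (R (N p v))))) - sg (R (N s (R (N p v))))) + c (1 + p) (R (R (N s (R (N p v)))))"
proof -
  let ?W = "R (N s (R (N p v)))"
  have "R (R (N p v)) - R (R (N s v)) = c (p - s) (R (R (N p (sg (N s v) - c (2 + s + p) (R (N s v))))))"
    using N_resolvent[OF s p, of v] by (simp add: R_c flip: R_diff)
  also have "R (R (N p (sg (N s v) - c (2 + s + p) (R (N s v))))) = sg ?W - c (2 + s + p) (R ?W)"
    by (simp add: N_diff[OF p] N_sg[OF p] N_c[OF p] N_R[OF p] N_R[OF s] N_N[OF s p] R_diff R_sg R_c)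
  also have "c (p - s) (sg ?W - c (2 + s + p) (R ?W)) = c (s - p) ((c (1 + s) (R ?W) - sg ?W) + c (1 + p) (R ?W))"
  proof -
    have "2 + s + p = (1 + s) + (1 + p)" by simp
    then have "sg ?W - c (2 + s + p) (R ?W) = - ((c (1 + s) (R ?W) - sg ?W) + c (1 + p) (R ?W))"
      by (simp only: c_add_left) simp
    moreover have "c (p - s) (- x) = c (s - p) x" for x by (simp add: c_diff_left c_minus_right)
    ultimately show ?thesis by (simp only:)
  qed
  finally have "R (R (N p v)) = R (R (N s v)) + c (s - p) ((c (1 + s) (R ?W) - sg ?W) + c (1 + p) (R ?W))"
    by (simp add: algebra_simps)
  then have "c (1 / (s - p)) (R (R (N p v))) = c (1 / (s - p)) (R (R (N s v)))
     + c (1 / (s - p)) (c (s - p) ((c (1 + s) (R ?W) - sg ?W) + c (1 + p) (R ?W)))"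
    by (simp only: c_add_right)
  also have "c (1 / (s - p)) (c (s - p) x) = x" for x using sp by (simp flip: c_mult)
  finally show ?thesis by (simp add: add.assoc)
qed

text \<open>In the resolvent identity the term with the bare Cauchy kernel has its pole outside the
  inner contour and integrates to zero. The other two depend on \<open>p\<close> only through the
  integrands of \<open>A\<close> for h and for (1+p)h.\<close>

lemma inner_integral:
  assumes h: "cls t 1 0 h" and s: "s \<in> Om" "\<And>r y. 0 < r \<Longrightarrow> y \<in> {-f..f} \<Longrightarrow> rcis r y \<noteq> s"
  shows "cint (\<lambda>p. c (h p / (s - p)) (R (R (N p v))))
     = (c (1 + s) (R (R (N s (A h v)))) - sg (R (N s (A h v)))) + R (R (N s (A (\<lambda>p. (1 + p) * h p) v)))"
    and "cok (\<lambda>p. c (h p / (s - p)) (R (R (N p v))))"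
proof -
  let ?h1 = "\<lambda>p. (1 + p) * h p"
  have h1: "cls t 1 1 ?h1" using cls_one_plus[OF h] by simp
  define L where "L = (\<lambda>u. c (1 + s) (R (R (N s u))) - sg (R (N s u)))"
  define L' where "L' = (\<lambda>u. R (R (N s u)))"
  let ?w = "R (R (N s v))"
  have blR: "bounded_linear (\<lambda>u. R (R (N s u)))"
    by (rule bounded_linear_compose[OF R_bl RN_bl[OF s(1)]])
  have bl: "bounded_linear L" "bounded_linear L'"
    unfolding L_def L'_def
    by (rule bounded_linear_sub[OF bounded_linear_compose[OF c_bounded_linear blR]
          bounded_linear_compose[OF sg_bl RN_bl[OF s(1)]]], rule blR)
  have Lc: "L (c z u) = c z (L u)" "L' (c z u) = c z (L' u)" for z u
    by (simp_all only: L_def L'_def N_c[OF s(1)] R_c sg_c c_diff_right c_commute[of "1 + s" z])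
  have ne: "rcis r y \<noteq> s" if "0 < r" "y = f \<or> y = -f" for r y
    using s(2)[of r y] that angles by auto
  have eq: "c (h p / (s - p)) (R (R (N p v))) = c (h p / (s - p)) ?w + L (G h v p) + L' (G ?h1 v p)"
    if p: "p = rcis r y" "0 < r" "y = f \<or> y = -f" for p r y
  proof -
    have "s \<noteq> p" "p \<in> Om" using ne p contour_Om by auto
    have cm: "c (h p) (c (1 / (s - p)) x) = c (h p / (s - p)) x" for x
      by (simp flip: c_mult)
    have "c (h p) (c (1 / (s - p)) (R (R (N p v)))) = c (h p) (c (1 / (s - p)) ?w + L (R (N p v)) + c (1 + p) (L' (R (N p v))))"
      using resolvent_identity[OF s(1) \<open>p \<in> Om\<close> \<open>s \<noteq> p\<close>, of v] by (simp only: L_def L'_def)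
    also have "\<dots> = c (h p) (c (1 / (s - p)) ?w) + c (h p) (L (R (N p v))) + c (1 + p) (c (h p) (L' (R (N p v))))"
      by (simp only: c_add_right c_commute[of "h p" "1 + p"])
    finally show ?thesis by (simp only: cm G_def Lc c_mult)
  qed
  have z0: "s \<noteq> 0" using Om_nz[OF s(1)] .
  note co = cauchy_rays_outside[OF cls00[OF h] angles_pi(3) angles(3) less_imp_le[OF angles(4)] z0 s(2)]
  have ok0: "cok (\<lambda>p. c (h p / (s - p)) ?w)"
    unfolding cok_def using ray_scalar(2)[OF co(2)] by blast
  have z: "cint (\<lambda>p. c (h p / (s - p)) ?w) = 0"
    unfolding cint_def using ray_scalar(1)[OF co(2)] co(1) by simp
  have okL: "cok (\<lambda>p. L (G h v p))" "cok (\<lambda>p. L' (G ?h1 v p))"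
    by (rule cok_linear[OF cok_G[OF cls11[OF h]] bl(1)], rule cok_linear[OF cok_G[OF h1] bl(2)])
  have "cint (\<lambda>p. c (h p / (s - p)) (R (R (N p v)))) = cint (\<lambda>p. c (h p / (s - p)) ?w + L (G h v p) + L' (G ?h1 v p))"
    by (rule cint_cong) (rule eq[OF refl])
  also have "\<dots> = cint (\<lambda>p. c (h p / (s - p)) ?w) + cint (\<lambda>p. L (G h v p)) + cint (\<lambda>p. L' (G ?h1 v p))"
    by (simp add: cint_add cok_add ok0 okL)
  also have "cint (\<lambda>p. L (G h v p)) = L (A h v)"
    unfolding A_def by (rule cint_linear[OF cok_G[OF cls11[OF h]] bl(1) Lc(1)])
  also have "cint (\<lambda>p. L' (G ?h1 v p)) = L' (A ?h1 v)"
    unfolding A_def by (rule cint_linear[OF cok_G[OF h1] bl(2) Lc(2)])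
  finally show "cint (\<lambda>p. c (h p / (s - p)) (R (R (N p v))))
     = (c (1 + s) (R (R (N s (A h v)))) - sg (R (N s (A h v)))) + R (R (N s (A ?h1 v)))"
    by (simp add: z L_def L'_def)
  show "cok (\<lambda>p. c (h p / (s - p)) (R (R (N p v))))"
  proof -
    have "cok (\<lambda>p. c (h p / (s - p)) (R (R (N p v)))) \<longleftrightarrow> cok (\<lambda>p. c (h p / (s - p)) ?w + L (G h v p) + L' (G ?h1 v p))"
      by (rule cok_cong) (rule eq[OF refl])
    with cok_add[OF cok_add[OF ok0 okL(1)] okL(2)] show ?thesis by (simp only:)
  qed
qed

text \<open>Of the lower bound d(x+z) for the distance only d x is kept: then \<open>n\<close>
  supplies an integrable envelope in x, and the harmonic integrand of \<open>h\<close> supplies one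
  in z.\<close>

lemma kernel_bound:
  assumes n: "cls t 1 0 n" and h: "cls t 1 0 h" and y: "y = fo \<or> y = -fo" "y' = f \<or> y' = -f"
  shows "\<exists>a>0. \<exists>b>0. \<exists>C. \<forall>x>0. \<forall>z>0.
        norm (c (n (rcis x y) * h (rcis z y') / (rcis x y - rcis z y')) (R (R (N (rcis z y') v))))
          \<le> C * env (-1) (-1) a x * env (-1) (-1) b z"
proof -
  obtain a C where a: "0 < a" "0 \<le> C" and bn: "\<And>z. z \<in> sec t \<Longrightarrow> cmod (n z) \<le> C * env 0 0 a (cmod z)"
    using clsE[OF cls00[OF n]] angles_pi angles by (metis less_imp_le)
  obtain b D where b: "0 < b" and bG: "\<And>v r y. 0 < r \<Longrightarrow> y = f \<or> y = -f \<Longrightarrow>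
      norm (G h v (rcis r y)) \<le> D * norm v * env (-1) (-1) b r"
    using G_bound[OF cls11[OF h]] by metis
  obtain B where B: "0 < B" "\<And>x. norm (R x) \<le> norm x * B" using bounded_linear.pos_bounded[OF R_bl] by blast
  define d where "d = sqrt ((1 - cos (y - y')) / 2)"
  have c1: "cos (y - y') < 1"
    using y cos_less_one[of "fo - f"] cos_less_one[of "fo + f"] fo angles
    by (auto simp: cos_diff cos_add)
  then have d: "0 < d" by (simp add: d_def)
  have kb: "norm (c (n (rcis x y) * h (rcis z y') / (rcis x y - rcis z y')) (R (R (N (rcis z y') v))))
     \<le> (C / d * (D * norm v * B)) * env (-1) (-1) a x * env (-1) (-1) b z" if xz: "0 < x" "0 < z" for x z
  proof -
    have "(d * (x + z))^2 \<le> (cmod (rcis x y - rcis z y'))^2"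
      using ray_distance[OF xz, of y y'] c1 by (simp add: power_mult_distrib d_def)
    then have "d * (x + z) \<le> cmod (rcis x y - rcis z y')" by (rule power2_le_imp_le) simp
    moreover have "d * x \<le> d * (x + z)" using d xz by (intro mult_left_mono) auto
    ultimately have dist: "d * x \<le> cmod (rcis x y - rcis z y')" by simp
    have nin: "rcis x y \<in> sec t" using y xz fo angles by (intro rcis_in_sec) auto
    have "cmod (n (rcis x y)) / cmod (rcis x y - rcis z y') \<le> (C * env 0 0 a x) / (d * x)"
      using bn[OF nin] xz d dist a(2) env_nonneg[of 0 0 a x] by (intro frac_le) auto
    also have "\<dots> = C / d * (env 0 0 a x * env (-1) (-1) 0 x)"
    proof -
      have "env (-1) (-1) 0 x = 1 / x" using env_powr[OF xz(1), of "-1"] xz by (simp add: powr_neg_one)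
      then show ?thesis by simp
    qed
    also have "\<dots> = C / d * env (-1) (-1) a x" using env_mult[OF xz(1), of 0 0 a "-1" "-1" 0] by simp
    finally have 1: "cmod (n (rcis x y)) / cmod (rcis x y - rcis z y') \<le> C / d * env (-1) (-1) a x" .
    have 2: "norm (c (h (rcis z y')) (R (R (N (rcis z y') v)))) \<le> D * norm v * env (-1) (-1) b z * B"
    proof -
      have "norm (R (G h v (rcis z y'))) \<le> norm (G h v (rcis z y')) * B" by (rule B(2))
      also have "\<dots> \<le> D * norm v * env (-1) (-1) b z * B"
        using bG[OF xz(2) y(2)] B(1) by (intro mult_right_mono) auto
      finally show ?thesis by (simp add: G_def R_c)
    qed
    have "norm (c (n (rcis x y) * h (rcis z y') / (rcis x y - rcis z y')) (R (R (N (rcis z y') v))))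
      = (cmod (n (rcis x y)) / cmod (rcis x y - rcis z y')) * norm (c (h (rcis z y')) (R (R (N (rcis z y') v))))"
      by (simp add: norm_c norm_mult norm_divide)
    also have "\<dots> \<le> (C / d * env (-1) (-1) a x) * (D * norm v * env (-1) (-1) b z * B)"
      using a d by (intro mult_mono 1 2) (auto simp: env_nonneg)
    finally show ?thesis by (simp only: mult_ac)
  qed
  show ?thesis
    by (rule exI[of _ a], rule conjI[OF a(1)], rule exI[of _ b], rule conjI[OF b], rule exI, intro allI impI, erule (1) kb)
qed

text \<open>The double contour integral: \<open>n\<close> is represented by its Cauchy integral over the outer contour.\<close>

lemma product_core:
  assumes n: "cls t 1 0 n" and h: "cls t 1 0 h"
  shows "R (A (\<lambda>s. n s * h s) v) = R (A (\<lambda>s. (1 + s) * n s) (A h v)) - sg (A n (A h v))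
      + R (A n (A (\<lambda>s. (1 + s) * h s) v))"
proof -
  let ?k = "1 / (2 * pi * \<i>) :: complex"
  let ?h1 = "\<lambda>s. (1 + s) * h s" and ?n1 = "\<lambda>s. (1 + s) * n s"
  have n1: "cls t 1 1 ?n1" using cls_one_plus[OF n] by simp
  have nh: "cls t 1 1 (\<lambda>s. n s * h s)" by (rule cls11[OF cls_prod[OF n h]])
  define W where "W = (\<lambda>p. R (R (N p v)))"
  define KK where "KK = (\<lambda>s p. c (n s * h p / (s - p)) (W p))"
  have rayKK: "ray_ok y' (\<lambda>p. ray y (\<lambda>s. KK s p))" "ray_ok y (\<lambda>s. ray y' (KK s))"
    "ray y' (\<lambda>p. ray y (\<lambda>s. KK s p)) = ray y (\<lambda>s. ray y' (KK s))"
    if y: "y = fo \<or> y = -fo" "y' = f \<or> y' = -f" for y y'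
  proof -
    have "\<exists>a>0. \<exists>b>0. \<exists>C. \<forall>x>0. \<forall>z>0.
        norm (KK (rcis x y) (rcis z y')) \<le> C * env (-1) (-1) a x * env (-1) (-1) b z"
      unfolding KK_def W_def by (rule kernel_bound[OF n h y])
    then obtain a b C where ab: "0 < a" "0 < b" and bd0: "\<forall>x>0. \<forall>z>0.
        norm (KK (rcis x y) (rcis z y')) \<le> C * env (-1) (-1) a x * env (-1) (-1) b z"
      by (elim exE conjE) (rule that)
    have bd: "norm (KK (rcis x y) (rcis z y')) \<le> C * env (-1) (-1) a x * env (-1) (-1) b z"
      if "0 < x" "0 < z" for x z
      using bd0 that by simp
    have bd': "norm (KK (rcis z y) (rcis x y')) \<le> C * env (-1) (-1) b x * env (-1) (-1) a z" if "0 < x" "0 < z" for x z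
      using bd[OF that(2,1)] by (simp add: mult_ac)
    have ne: "rcis x y \<noteq> rcis z y'" if "0 < x" "0 < z" for x z
    proof
      assume eq: "rcis x y = rcis z y'"
      have "rcis z y' \<in> sec fo" using y that fo angles by (intro rcis_in_sec) auto
      moreover have "rcis x y \<notin> sec fo"
        using rcis_notin_sec[of x fo fo] rcis_notin_sec[of x fo "2 * pi - fo"] y that fo
        by (auto simp: rcis_def cis.code cos_diff sin_diff)
      ultimately show False using eq by simp
    qed
    have inn: "rcis x y \<in> sec t" if "0 < x" for x using that y fo angles by (intro rcis_in_sec) auto
    have cn: "continuous_on {0<..} (\<lambda>x. n (rcis x y))"
      by (rule continuous_on_compose2[of "sec t"])
         (use n inn in \<open>auto simp: cls_def rcis_def intro!: holomorphic_on_imp_continuous_on continuous_intros\<close>)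
    have ch: "continuous_on {0<..} (\<lambda>z. h (rcis z y'))"
      by (rule continuous_on_compose2[of "sec t"])
         (use h contour_sec[OF _ y(2)] in \<open>auto simp: cls_def rcis_def intro!: holomorphic_on_imp_continuous_on continuous_intros\<close>)
    have "continuous_on Om W"
      unfolding W_def
      by (intro continuous_at_imp_continuous_on ballI bounded_linear.isCont[OF R_bl] RN_cont)
    then have cW: "continuous_on {0<..} (\<lambda>z. W (rcis z y'))"
      by (rule continuous_on_compose2)
         (use contour_Om[OF _ y(2)] in \<open>auto simp: rcis_def intro!: continuous_intros\<close>)
    have cont: "continuous_on ({0<..} \<times> {0<..}) (\<lambda>(x, z). KK (rcis x y) (rcis z y'))"
      unfolding KK_def case_prod_unfold
    proof (intro c_continuous_on continuous_on_divide continuous_on_mult continuous_on_diff)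
      show "continuous_on ({0<..} \<times> {0<..}) (\<lambda>p. n (rcis (fst p) y))"
        by (rule continuous_on_compose2[OF cn]) (auto intro!: continuous_intros)
      show "continuous_on ({0<..} \<times> {0<..}) (\<lambda>p. h (rcis (snd p) y'))"
        by (rule continuous_on_compose2[OF ch]) (auto intro!: continuous_intros)
      show "continuous_on ({0<..} \<times> {0<..}) (\<lambda>p. W (rcis (snd p) y'))"
        by (rule continuous_on_compose2[OF cW]) (auto intro!: continuous_intros)
      show "\<forall>x\<in>{0<..} \<times> {0<..}. rcis (fst x) y - rcis (snd x) y' \<noteq> 0" using ne by auto
    qed (auto simp: rcis_def intro!: continuous_intros)
    have cont': "continuous_on ({0<..} \<times> {0<..}) (\<lambda>(z, x). KK (rcis x y) (rcis z y'))"
    proof -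
      have "continuous_on ({0<..} \<times> {0<..}) (\<lambda>p. (snd p, fst p) :: real \<times> real)" by (intro continuous_intros)
      from continuous_on_compose2[OF cont this] show ?thesis
        by (auto simp: case_prod_unfold image_subset_iff)
    qed
    show "ray_ok y (\<lambda>s. ray y' (KK s))" by (rule ray_fubini(2)[OF cont ab bd])
    show "ray_ok y' (\<lambda>p. ray y (\<lambda>s. KK s p))" by (rule ray_fubini(2)[OF cont' ab(2,1) bd'])
    show "ray y' (\<lambda>p. ray y (\<lambda>s. KK s p)) = ray y (\<lambda>s. ray y' (KK s))"
      by (rule ray_fubini(1)[OF cont ab bd, symmetric])
  qed
  have pin: "rcis r y' \<in> sec fo" if "0 < r" "y' = f \<or> y' = -f" for r y'
    using that fo angles by (intro rcis_in_sec) auto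
  \<comment> \<open>Integration over \<open>s\<close> first: \<open>p\<close> lies inside the outer
    contour, so Cauchy's formula reproduces n(p).\<close>
  have E1: "oint (\<lambda>s. KK s p) = c (n p * h p) (W p)" if p: "p \<in> sec fo" for p
  proof -
    note cr = cauchy_rays[OF cls00[OF n] fo(3,2) less_imp_le[OF angles(4)] p]
    have KK': "KK s p = c (n s / (s - p)) (c (h p) (W p))" for s
      by (simp add: KK_def flip: c_mult)
    have "oint (\<lambda>s. KK s p) = c ?k (c (cx.ray (-fo) (\<lambda>s. n s / (s - p)) - cx.ray fo (\<lambda>s. n s / (s - p))) (c (h p) (W p)))"
      unfolding oint_def KK' using ray_scalar(1)[OF cr(2)] by (simp add: c_diff_left)
    also have "\<dots> = c (n p * h p) (W p)" unfolding cr(1) by (simp flip: c_mult)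
    finally show ?thesis .
  qed
  \<comment> \<open>Integration over \<open>p\<close> first: \<open>s\<close> lies outside the inner
    contour, so no Cauchy term remains.\<close>
  have E4: "cint (KK s) = R (G ?n1 (A h v) s) - sg (G n (A h v) s) + R (G n (A ?h1 v) s)"
    and okE4: "cok (KK s)"
    if s: "s = rcis r y" "0 < r" "y = fo \<or> y = -fo" for s r y
  proof -
    have sO: "s \<in> Om" using outer_Om s by simp
    have out: "rcis r' y' \<noteq> s" if "0 < r'" "y' \<in> {-f..f}" for r' y'
    proof -
      have "rcis r' y' \<in> sec fo" using that fo angles by (intro rcis_in_sec) auto
      moreover have "s \<notin> sec fo"
        using rcis_notin_sec[of r fo fo] rcis_notin_sec[of r fo "2 * pi - fo"] s fo
        by (auto simp: rcis_def cis.code cos_diff sin_diff)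
      ultimately show ?thesis by auto
    qed
    have ii: "cint (\<lambda>p. c (h p / (s - p)) (W p))
        = (c (1 + s) (R (R (N s (A h v)))) - sg (R (N s (A h v)))) + R (R (N s (A ?h1 v)))"
      unfolding W_def by (rule inner_integral(1)[OF h sO]) (rule out)
    have KK': "KK s = (\<lambda>p. c (n s) (c (h p / (s - p)) (W p)))"
      by (simp add: KK_def fun_eq_iff flip: c_mult)
    have ok: "cok (\<lambda>p. c (h p / (s - p)) (W p))"
      unfolding W_def by (rule inner_integral(2)[OF h sO]) (rule out)
    show "cok (KK s)" unfolding KK' by (rule cok_linear[OF ok c_bounded_linear])
    have "cint (KK s) = c (n s) (cint (\<lambda>p. c (h p / (s - p)) (W p)))"
      unfolding KK' by (rule cint_linear[OF ok c_bounded_linear]) (rule c_commute)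
    also have "\<dots> = R (G ?n1 (A h v) s) - sg (G n (A h v) s) + R (G n (A ?h1 v) s)"
      unfolding ii
      by (simp add: G_def R_c sg_c c_add_right c_diff_right c_mult[symmetric] mult.commute)
    finally show "cint (KK s) = R (G ?n1 (A h v) s) - sg (G n (A h v) s) + R (G n (A ?h1 v) s)" .
  qed
  have ex: "cint (\<lambda>p. oint (\<lambda>s. KK s p)) = oint (\<lambda>s. cint (KK s))"
  proof -
    have l: "ray y' (\<lambda>p. oint (\<lambda>s. KK s p))
        = c ?k (ray y' (\<lambda>p. ray (-fo) (\<lambda>s. KK s p)) - ray y' (\<lambda>p. ray fo (\<lambda>s. KK s p)))"
      if "y' = f \<or> y' = -f" for y'
      unfolding oint_def
      by (subst ray_linear[OF ray_ok_diff[OF rayKK(1) rayKK(1)] c_bounded_linear c_commute])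
         (use that in \<open>auto simp: ray_diff[OF rayKK(1) rayKK(1)]\<close>)
    have r: "ray y (\<lambda>s. cint (KK s))
        = c ?k (ray y (\<lambda>s. ray (-f) (KK s)) - ray y (\<lambda>s. ray f (KK s)))"
      if "y = fo \<or> y = -fo" for y
      unfolding cint_def
      by (subst ray_linear[OF ray_ok_diff[OF rayKK(2) rayKK(2)] c_bounded_linear c_commute])
         (use that in \<open>auto simp: ray_diff[OF rayKK(2) rayKK(2)]\<close>)
    show ?thesis
      unfolding cint_def[of "\<lambda>p. oint (\<lambda>s. KK s p)"] oint_def[of "\<lambda>s. cint (KK s)"]
      by (simp add: l r rayKK(3) c_diff_right algebra_simps)
  qed
  have "R (A (\<lambda>s. n s * h s) v) = cint (\<lambda>p. R (G (\<lambda>s. n s * h s) v p))"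
    unfolding A_def by (rule cint_linear[OF cok_G[OF nh] R_bl R_c, symmetric])
  also have "\<dots> = cint (\<lambda>p. oint (\<lambda>s. KK s p))"
    by (rule cint_cong) (simp add: E1 pin G_def R_c W_def)
  also have "\<dots> = oint (\<lambda>s. cint (KK s))" by (rule ex)
  also have "\<dots> = oint (\<lambda>s. R (G ?n1 (A h v) s) - sg (G n (A h v) s) + R (G n (A ?h1 v) s))"
    by (rule oint_cong) (rule E4[OF refl])
  also have "\<dots> = oint (\<lambda>s. R (G ?n1 (A h v) s)) - oint (\<lambda>s. sg (G n (A h v) s)) + oint (\<lambda>s. R (G n (A ?h1 v) s))"
  proof -
    have "ook (\<lambda>s. R (G ?n1 (A h v) s))" "ook (\<lambda>s. sg (G n (A h v) s))" "ook (\<lambda>s. R (G n (A ?h1 v) s))"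
      by (rule ook_linear[OF ook_G[OF n1] R_bl], rule ook_linear[OF ook_G[OF cls11[OF n]] sg_bl],
          rule ook_linear[OF ook_G[OF cls11[OF n]] R_bl])
    then show ?thesis by (simp add: oint_add oint_diff ook_diff)
  qed
  also have "\<dots> = R (A ?n1 (A h v)) - sg (A n (A h v)) + R (A n (A ?h1 v))"
    by (simp add: oint_linear[OF ook_G[OF n1] R_bl R_c] oint_linear[OF ook_G[OF cls11[OF n]] R_bl R_c]
        oint_linear[OF ook_G[OF cls11[OF n]] sg_bl sg_c] oint_A n1 cls11[OF n])
  finally show ?thesis .
qed


section \<open>Residues at the point -1\<close>

text \<open>Complex differentiability with a continuous derivative, in the form that the rotation of
  rays asks for.\<close>

definition vhol :: "(complex \<Rightarrow> 'v) \<Rightarrow> bool" where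
  "vhol F \<longleftrightarrow> (\<exists>F'. (\<forall>s\<in>Om. (F has_derivative (\<lambda>h. c h (F' s))) (at s)) \<and> continuous_on Om F')"

lemma vhol_add:
  assumes "vhol F" "vhol F'" shows "vhol (\<lambda>s. F s + F' s)"
proof -
  from assms obtain D D' where
    D: "\<And>s. s \<in> Om \<Longrightarrow> (F has_derivative (\<lambda>h. c h (D s))) (at s)" "continuous_on Om D" and
    D': "\<And>s. s \<in> Om \<Longrightarrow> (F' has_derivative (\<lambda>h. c h (D' s))) (at s)" "continuous_on Om D'"
    unfolding vhol_def by blast
  have "((\<lambda>s. F s + F' s) has_derivative (\<lambda>h. c h (D s + D' s))) (at s)" if "s \<in> Om" for s
    using has_derivative_add[OF D(1)[OF that] D'(1)[OF that]] by (simp add: c_add_right)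
  then show ?thesis
    unfolding vhol_def using continuous_on_add[OF D(2) D'(2)] by (intro exI[of _ "\<lambda>s. D s + D' s"] conjI ballI)
qed

lemma vhol_smult:
  assumes p: "p holomorphic_on Om" and u: "vhol u"
  shows "vhol (\<lambda>s. c (p s) (u s))"
proof -
  from u obtain D where D: "\<And>s. s \<in> Om \<Longrightarrow> (u has_derivative (\<lambda>h. c h (D s))) (at s)" "continuous_on Om D"
    unfolding vhol_def by blast
  have uc: "continuous_on Om u"
    by (intro continuous_at_imp_continuous_on ballI has_derivative_continuous[OF D(1)])
  have "((\<lambda>s. c (p s) (u s)) has_derivative (\<lambda>h. c h (c (p s) (D s) + c (deriv p s) (u s)))) (at s)" if "s \<in> Om" for s
    using c_derivative[OF has_derivative_holomorphic[OF p open_Om that] D(1)[OF that]]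
    by (simp add: c_add_right c_mult c_commute[of "p s"])
  moreover have "continuous_on Om (\<lambda>s. c (p s) (D s) + c (deriv p s) (u s))"
    by (rule continuous_on_add[OF c_continuous_on[OF holomorphic_on_imp_continuous_on[OF p] D(2)]
          c_continuous_on[OF holomorphic_on_imp_continuous_on[OF holomorphic_deriv[OF p open_Om]] uc]])
  ultimately show ?thesis
    unfolding vhol_def by (intro exI[of _ "\<lambda>s. c (p s) (D s) + c (deriv p s) (u s)"] conjI ballI)
qed

lemma vhol_const: "vhol (\<lambda>s. u)"
  unfolding vhol_def by (intro exI[of _ "\<lambda>_. 0"]) auto

lemma vhol_N:
  assumes L: "bounded_linear L" "\<And>z v. L (c z v) = c z (L v)"
  shows "vhol (\<lambda>s. L (N s v))"
  unfolding vhol_def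
proof (intro exI conjI ballI)
  show "((\<lambda>s. L (N s v)) has_derivative (\<lambda>h. c h (L (DN s v)))) (at s)" if "s \<in> Om" for s
    using bounded_linear.has_derivative[OF L(1) N_deriv[OF that, of v]] by (simp add: L(2))
  show "continuous_on Om (\<lambda>s. L (DN s v))"
    by (rule continuous_at_imp_continuous_on) (auto intro!: bounded_linear.isCont[OF L(1)] DN_cont)
qed

lemma A_cong: "(\<And>s. s \<in> sec t \<Longrightarrow> h s = h' s) \<Longrightarrow> A h v = A h' v"
  unfolding A_def by (rule cint_cong) (simp add: G_def contour_sec)

lemma bnd_inverse_power: "bnd t 0 (-real j) (\<lambda>s. 1 / (1 + s) ^ j)"
proof (induction j)
  case 0
  then show ?case by (auto simp: bnd_def env_def intro!: exI[of _ 1] dest: sec_nz)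
next
  case (Suc j)
  from bnd_inverse_one_plus[OF angles_pi(4) angles(4)]
  obtain C where C: "\<And>z. z \<in> sec t \<Longrightarrow> cmod (1 / (1 + z)) \<le> C * env 0 (-1) 0 (cmod z)"
    and hol: "(\<lambda>s. 1 / (1 + s)) holomorphic_on sec t" unfolding bnd_def by blast
  from Suc obtain D where D: "\<And>z. z \<in> sec t \<Longrightarrow> cmod (1 / (1 + z) ^ j) \<le> D * env 0 (-real j) 0 (cmod z)"
    and hol': "(\<lambda>s. 1 / (1 + s) ^ j) holomorphic_on sec t" unfolding bnd_def by blast
  show ?case unfolding bnd_def
  proof (intro conjI exI ballI)
    show "(\<lambda>s. 1 / (1 + s) ^ Suc j) holomorphic_on sec t"
      using holomorphic_on_mult[OF hol hol'] by simp
    fix z assume z: "z \<in> sec t"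
    have "cmod (1 / (1 + z) ^ Suc j) = cmod (1 / (1 + z)) * cmod (1 / (1 + z) ^ j)"
      by (simp add: norm_divide norm_mult norm_power)
    also have "\<dots> \<le> (C * env 0 (-1) 0 (cmod z)) * (D * env 0 (-real j) 0 (cmod z))"
      by (intro mult_mono C D z order_trans[OF norm_ge_zero C[OF z]]) auto
    also have "\<dots> = (C * D) * (env 0 (-1) 0 (cmod z) * env 0 (-real j) 0 (cmod z))" by simp
    finally show "cmod (1 / (1 + z) ^ Suc j) \<le> (C * D) * env 0 (-real (Suc j)) 0 (cmod z)"
      using env_mult[of "cmod z" 0 "-1" 0 0 "-real j" 0] sec_nz[OF z] by simp
  qed
qed

text \<open>The only pole is outside the sector, and for j at least 2 there is margin at both ends,
  so the two rays can be turned onto each other.\<close>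

lemma cint_inverse_power:
  assumes "2 \<le> j" shows "cint (\<lambda>s. c (1 / (1 + s) ^ j) w) = 0" "cok (\<lambda>s. c (1 / (1 + s) ^ j) w)"
proof -
  have cl: "cls t (-1) (-1) (\<lambda>s. 1 / (1 + s) ^ j)"
  proof -
    from bnd_inverse_power[of j] obtain D where D: "\<And>z. z \<in> sec t \<Longrightarrow> cmod (1 / (1 + z) ^ j) \<le> D * env 0 (-real j) 0 (cmod z)"
      and hol': "(\<lambda>s. 1 / (1 + s) ^ j) holomorphic_on sec t" unfolding bnd_def by blast
    have "cmod (1 / (1 + z) ^ j) \<le> \<bar>D\<bar> * env (-1) (-1) 1 (cmod z)" if "z \<in> sec t" for z
    proof (rule order_trans[OF D[OF that]], rule mult_mono)
      show "env 0 (- real j) 0 (cmod z) \<le> env (-1) (-1) 1 (cmod z)"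
        using assms sec_nz[OF that] by (intro env_mono) auto
    qed (auto simp: env_nonneg)
    then show ?thesis unfolding cls_def using hol' zero_less_one by blast
  qed
  note cs = cls_shift[OF cl angles_pi(4) less_imp_le[OF angles(4)]]
  have "cx.ray (-f) (\<lambda>s. 1 / (1 + s) ^ j) = cx.ray f (\<lambda>s. 1 / (1 + s) ^ j)"
    by (rule cs(1)) (use angles in auto)
  moreover have ok: "cx.ray_ok y (\<lambda>s. 1 / (1 + s) ^ j)" if "y = f \<or> y = -f" for y
    by (rule cs(2)[of y y]) (use that angles in auto)
  ultimately show "cint (\<lambda>s. c (1 / (1 + s) ^ j) w) = 0"
    unfolding cint_def using ray_scalar(1)[OF ok] by simp
  show "cok (\<lambda>s. c (1 / (1 + s) ^ j) w)" unfolding cok_def using ray_scalar(2)[OF ok] by blast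
qed

text \<open>The value 1/2 is the residue at the pole 1, which lies inside the sector.\<close>

lemma cint_base: "cint (\<lambda>s. c (1 / ((s - 1) * (s + 1))) w) = (1/2) *\<^sub>R w" "cok (\<lambda>s. c (1 / ((s - 1) * (s + 1))) w)"
proof -
  have ne: "rcis r y \<noteq> 1 \<and> rcis r y \<noteq> -1" if "0 < r" "y = f \<or> y = -f" for r y
  proof -
    have "sin y \<noteq> 0" using that(2) sin_gt_zero[of f] angles by auto
    then show ?thesis using that(1) by (auto simp: complex_eq_iff)
  qed
  have ok: "cx.ray_ok y (\<lambda>s. 1 / ((s - 1) * (s + 1)))" if "y = f \<or> y = -f" for y
    using two_pole_shift(2)[of y y 1 "-1" y] ne that by auto
  have "cint (\<lambda>s. c (1 / ((s - 1) * (s + 1))) w) = c (1 / (2 * pi * \<i>)) (c (pi * \<i>) w)"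
    unfolding cint_def using ray_scalar(1)[OF ok] ray_rational_base[OF angles_pi(3,1)]
    by (simp flip: c_diff_left)
  also have "\<dots> = c (of_real (1/2)) w" by (simp flip: c_mult)
  finally show "cint (\<lambda>s. c (1 / ((s - 1) * (s + 1))) w) = (1/2) *\<^sub>R w" by (simp only: c_of_real)
  show "cok (\<lambda>s. c (1 / ((s - 1) * (s + 1))) w)" unfolding cok_def using ray_scalar(2)[OF ok] by blast
qed

text \<open>Residue calculus at the pole \<open>-1\<close> outside the sector: subtracting the principal part leaves a
  function holomorphic outside the sector, whose integral vanishes by rotating one ray onto the other.\<close>

lemma A_eval:
  assumes k: "cls t 1 1 k" and F: "vhol F"
    and kb: "\<And>s. cmod s < 1/2 \<Longrightarrow> cmod (k s) \<le> 8 * (cmod s)^2" "\<And>s. cmod s > 2 \<Longrightarrow> cmod (k s) \<le> 8"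
    and eq: "\<And>s. s \<in> Om \<Longrightarrow> s \<noteq> -1 \<Longrightarrow> c (k s) (R (N s v))
        = F s + c (1 / (1 + s)^2) a + c (1 / (1 + s)^3) b - c (1 / ((s - 1) * (s + 1))) (2 *\<^sub>R d)"
  shows "A k v = - d"
proof -
  from F obtain F' where D: "\<And>s. s \<in> Om \<Longrightarrow> (F has_derivative (\<lambda>h. c h (F' s))) (at s)" "continuous_on Om F'"
    unfolding vhol_def by blast
  have inO: "rcis r y \<in> Om" if "0 < r" "y \<in> {f..2 * pi - f}" for r y
    using rcis_Om(1)[of r y] that by auto
  have ff: "f \<le> 2 * pi - f" using angles by simp
  have D1: "(F has_derivative (\<lambda>h. c h (F' (rcis r y)))) (at (rcis r y))" if "0 < r" "y \<in> {f..2 * pi - f}" for r y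
    by (rule D(1)[OF inO[OF that]])
  have D2: "continuous_on {rcis r y |r y. 0 < r \<and> y \<in> {f..2 * pi - f}} F'"
    by (rule continuous_on_subset[OF D(2)]) (use inO in auto)
  have Fc: "continuous_on {rcis r y |r y. 0 < r \<and> y \<in> {f..2 * pi - f}} F"
  proof (rule continuous_at_imp_continuous_on, rule ballI)
    fix x assume "x \<in> {rcis r y |r y. 0 < r \<and> y \<in> {f..2 * pi - f}}"
    then have "x \<in> Om" using inO by auto
    then show "isCont F x" by (rule has_derivative_continuous[OF D(1)])
  qed
  have K0: "0 \<le> K * norm v"
    using K_nonneg by (metis mult_nonneg_nonneg mult_zero_right norm_ge_zero norm_zero order_refl)
  \<comment> \<open>The factor 8 is 2^3: the distances to 1 and -1 are at least 1/2 for small r and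
    r/2 for large r, and enter with power at most three. The 16 comes from the doubled vector
    \<open>2 *\<^sub>R d\<close>.\<close>
  define B where "B = 8 * (K * norm v) + 8 * norm a + 8 * norm b + 16 * norm d"
  have Fb: "norm (F (rcis r y)) \<le> B * env (-1) (-1) 1 r"
    if ry: "0 < r" "y \<in> {f..2 * pi - f}" "r < 1/2 \<or> r > 2" for r y
  proof -
    let ?s = "rcis r y"
    have sr: "cmod ?s = r" using ry(1) by simp
    have "?s \<noteq> -1"
    proof
      assume "?s = -1"
      then have "cmod ?s = 1" by (simp only: norm_minus_cancel norm_one)
      with sr ry(3) show False by simp
    qed
    note s = inO[OF ry(1,2)] this sr
    have F: "F ?s = c (k ?s) (R (N ?s v)) - c (1 / (1 + ?s)^2) a - c (1 / (1 + ?s)^3) b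
        + c (1 / ((?s - 1) * (?s + 1))) (2 *\<^sub>R d)"
      using eq[OF s(1,2)] by simp
    have R: "norm (R (N ?s v)) \<le> K / r^2 * norm v" using RN_bound[OF s(1), of v] s(3) by simp
    have n3: "norm (x - y - z + w) \<le> norm x + norm y + norm z + norm w" for x y z w :: 'v
      by (rule order_trans[OF norm_triangle_ineq], rule add_right_mono,
          rule order_trans[OF norm_triangle_ineq4], rule add_right_mono, rule norm_triangle_ineq4)
    have main: "norm (F ?s) \<le> cmod (k ?s) * (K / r^2 * norm v) + 1 / (cmod (1 + ?s))^2 * norm a
       + 1 / (cmod (1 + ?s))^3 * norm b + 1 / (cmod (?s - 1) * cmod (?s + 1)) * (2 * norm d)"
      unfolding F
    proof (rule order_trans[OF n3], intro add_mono)
      show "norm (c (k ?s) (R (N ?s v))) \<le> cmod (k ?s) * (K / r^2 * norm v)"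
        unfolding norm_c by (rule mult_left_mono[OF R norm_ge_zero])
    qed (simp_all add: norm_c norm_divide norm_mult norm_power)
    from ry(3) show ?thesis
    proof
      assume r: "r < 1/2"
      have l: "1/2 \<le> cmod (1 + ?s)" "1/2 \<le> cmod (?s - 1)" "1/2 \<le> cmod (?s + 1)"
        using norm_triangle_ineq2[of 1 "-?s"] norm_triangle_ineq2[of 1 ?s] r s(3) ry(1)
        by (auto simp: norm_minus_commute add.commute)
      have "cmod (k ?s) * (K / r^2 * norm v) \<le> (8 * r^2) * (K / r^2 * norm v)"
        using kb(1)[of ?s] s(3) r K0 ry(1) by (intro mult_right_mono) auto
      also have "\<dots> = 8 * (K * norm v)" using ry(1) by simp
      finally have 1: "cmod (k ?s) * (K / r^2 * norm v) \<le> 8 * (K * norm v)" .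
      have "1 / (cmod (1 + ?s))^2 \<le> 1 / (1/2)^2" by (intro divide_left_mono power_mono l) (use l in \<open>auto intro!: mult_pos_pos\<close>)
      then have 2: "1 / (cmod (1 + ?s))^2 * norm a \<le> 8 * norm a" by (intro mult_right_mono) (auto simp: power2_eq_square)
      have "1 / (cmod (1 + ?s))^3 \<le> 1 / (1/2)^3" by (intro divide_left_mono power_mono l) (use l in \<open>auto intro!: mult_pos_pos\<close>)
      then have 3: "1 / (cmod (1 + ?s))^3 * norm b \<le> 8 * norm b" by (intro mult_right_mono) (auto simp: power3_eq_cube)
      have "1 / (cmod (?s - 1) * cmod (?s + 1)) \<le> 1 / ((1/2) * (1/2))"
        by (intro divide_left_mono mult_mono l) (use l in \<open>auto intro!: mult_pos_pos\<close>)
      then have 4: "1 / (cmod (?s - 1) * cmod (?s + 1)) * (2 * norm d) \<le> 8 * (2 * norm d)"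
        by (intro mult_right_mono) auto
      have "env (-1) (-1) 1 r = 1" using r ry(1) by (simp add: env_def)
      then show ?thesis
        using order_trans[OF main add_mono[OF add_mono[OF add_mono[OF 1 2] 3] 4]] unfolding B_def by simp
    next
      assume r: "r > 2"
      have l: "r/2 \<le> cmod (1 + ?s)" "r/2 \<le> cmod (?s - 1)" "r/2 \<le> cmod (?s + 1)"
        using norm_triangle_ineq2[of ?s "-1"] norm_triangle_ineq2[of ?s 1] r s(3)
        by (auto simp: norm_minus_commute add.commute)
      have e: "env (-1) (-1) 1 r = 1 / r^2"
        using r by (simp add: env_def powr_minus divide_inverse flip: powr_numeral)
      have 1: "cmod (k ?s) * (K / r^2 * norm v) \<le> 8 * (K / r^2 * norm v)"
        using kb(2)[of ?s] s(3) r K0 by (intro mult_right_mono) auto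
      have "1 / (cmod (1 + ?s))^2 \<le> 1 / (r/2)^2"
        using l r by (intro divide_left_mono power_mono) (auto intro!: mult_pos_pos zero_less_power)
      also have "\<dots> \<le> 8 * (1 / r^2)" using r by (simp add: power2_eq_square divide_right_mono)
      finally have 2: "1 / (cmod (1 + ?s))^2 * norm a \<le> 8 * (1 / r^2) * norm a" by (intro mult_right_mono) auto
      have "1 / (cmod (1 + ?s))^3 \<le> 1 / (r/2)^3"
        using l r by (intro divide_left_mono power_mono) (auto intro!: mult_pos_pos zero_less_power)
      also have "1 / (r/2)^3 = 8 / r^2 * (1 / r)" using r by (simp add: power2_eq_square power3_eq_cube)
      also have "\<dots> \<le> 8 / r^2 * 1" using r by (intro mult_left_mono) auto
      also have "\<dots> = 8 * (1 / r^2)" by simp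
      finally have 3: "1 / (cmod (1 + ?s))^3 * norm b \<le> 8 * (1 / r^2) * norm b" by (intro mult_right_mono) auto
      have "1 / (cmod (?s - 1) * cmod (?s + 1)) \<le> 1 / ((r/2) * (r/2))"
        using l r by (intro divide_left_mono mult_mono) (auto intro!: mult_pos_pos)
      also have "\<dots> \<le> 8 * (1 / r^2)" using r by (simp add: power2_eq_square divide_right_mono)
      finally have 4: "1 / (cmod (?s - 1) * cmod (?s + 1)) * (2 * norm d) \<le> 8 * (1 / r^2) * (2 * norm d)"
        by (intro mult_right_mono) auto
      have "B * (1 / r^2) = 8 * (K / r^2 * norm v) + 8 * (1 / r^2) * norm a + 8 * (1 / r^2) * norm b
          + 8 * (1 / r^2) * (2 * norm d)"
        unfolding B_def by (simp add: ring_distribs add_divide_distrib)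
      then show ?thesis
        unfolding e using order_trans[OF main add_mono[OF add_mono[OF add_mono[OF 1 2] 3] 4]] by (simp only:)
    qed
  qed
  obtain C where C: "\<And>r y. 0 < r \<Longrightarrow> y \<in> {f..2 * pi - f} \<Longrightarrow> norm (F (rcis r y)) \<le> C * env (-1) (-1) 1 r"
  proof (rule sector_bound_extend[OF Fc])
    show "norm (F (rcis r y)) \<le> B * env (-1) (-1) 1 r"
      if "0 < r" "y \<in> {f..2 * pi - f}" "r < 1/2 \<or> r > 2" for r y by (rule Fb[OF that])
    show "(0::real) < 1/2" by simp
  qed (rule that)
  note sh = ray_shift[OF ff D1 D2 C zero_less_one]
  have "ray f F = ray (2 * pi - f) F" by (rule sh(1))
  then have F0: "ray (-f) F = ray f F" by (simp only: ray_period)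
  have okF: "cok F"
  proof -
    have 1: "ray_ok f F" by (rule sh(2)) (use ff in auto)
    have 2: "ray_ok (2 * pi - f) F" by (rule sh(2)) (use ff in auto)
    have "rcis r (2 * pi - f) = rcis r (- f)" for r by (simp add: rcis_def cis.code cos_diff sin_diff)
    with 1 2 show ?thesis unfolding cok_def ray_ok_def by (simp only:)
  qed
  have cF: "cint F = 0" unfolding cint_def by (simp add: F0)
  \<comment> \<open>A simple pole 1/(1+s) is not integrable along the rays. It is represented by
    -2/((s-1)(s+1)), which has the same residue at -1 and decays; the new pole at 1 lies outside
    \<open>Om\<close>, so \<open>F\<close> stays holomorphic there.\<close>
  let ?a = "\<lambda>s. c (1 / (1 + s)^2) a" and ?b = "\<lambda>s. c (1 / (1 + s)^3) b"
    and ?d = "\<lambda>s. c (1 / ((s - 1) * (s + 1))) (2 *\<^sub>R d)"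
  have oks: "cok ?a" "cok ?b" "cok ?d"
    by (rule cint_inverse_power(2), simp, rule cint_inverse_power(2), simp, rule cint_base(2))
  have vals: "cint ?a = 0" "cint ?b = 0" "cint ?d = (1/2) *\<^sub>R (2 *\<^sub>R d)"
    by (rule cint_inverse_power(1), simp, rule cint_inverse_power(1), simp, rule cint_base(1))
  have "A k v = cint (\<lambda>s. F s + ?a s + ?b s - ?d s)"
    unfolding A_def
  proof (rule cint_cong)
    fix r y :: real assume ry: "0 < r" "y = f \<or> y = -f"
    have "sin y \<noteq> 0" using ry(2) sin_gt_zero[of f] angles by auto
    then have "rcis r y \<noteq> -1" using ry(1) by (auto simp: complex_eq_iff)
    then show "G k v (rcis r y) = F (rcis r y) + ?a (rcis r y) + ?b (rcis r y) - ?d (rcis r y)"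
      unfolding G_def by (rule eq[OF contour_Om[OF ry]])
  qed
  also have "\<dots> = cint F + cint ?a + cint ?b - cint ?d"
    unfolding cint_diff[OF cok_add[OF cok_add[OF okF oks(1)] oks(2)] oks(3)]
      cint_add[OF cok_add[OF okF oks(1)] oks(2)] cint_add[OF okF oks(1)] ..
  also have "\<dots> = - d" unfolding vals cF by simp
  finally show ?thesis .
qed


section \<open>The S-functional calculus and its link to the harmonic integral\<close>

text \<open>The direction of the ray times the inverse of the imaginary unit, that is, the path
  element ds_J.\<close>

definition u :: "real \<Rightarrow> complex" where "u y = - \<i> * cis y"

text \<open>Here, unlike in \<open>cint\<close>, the scalar acts on the argument of the operator:
  the S-resolvent is not complex linear, and the path element stands to its right.\<close>

definition pI :: "(complex \<Rightarrow> 'v \<Rightarrow> 'v) \<Rightarrow> (complex \<Rightarrow> complex) \<Rightarrow> 'v \<Rightarrow> 'v" where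
  "pI F h v = integral {0<..} (\<lambda>r. F (rcis r (-f)) (c (u (-f) * h (rcis r (-f))) v) - F (rcis r f) (c (u f * h (rcis r f)) v))"

text \<open>The S-functional calculus of one complex component: h(T) for X = \<open>S\<close> and
  h(conj T) for X = \<open>S'\<close>.\<close>

definition Phi :: "('v \<Rightarrow> 'v) \<Rightarrow> (complex \<Rightarrow> complex) \<Rightarrow> 'v \<Rightarrow> 'v" where
  "Phi X h v = (1 / (2 * pi)) *\<^sub>R pI (SL X) h v"

lemma Phi_cong: "(\<And>s. s \<in> sec t \<Longrightarrow> h s = h' s) \<Longrightarrow> Phi X h v = Phi X h' v"
  unfolding Phi_def pI_def
  by (rule arg_cong[where f = "(*\<^sub>R) (1 / (2 * pi))"], rule integral_cong) (simp add: contour_sec)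

text \<open>For the complex linear \<open>R (N s)\<close> the scalar may stand on either side, so
  both conventions agree; 1/(2\<pi>\<i>) is -\<i>/(2\<pi>), and the -\<i> is part of
  \<open>u\<close>.\<close>

lemma A_pI:
  assumes h: "cls t 1 1 h" shows "A h v = (1 / (2 * pi)) *\<^sub>R pI (\<lambda>s v. R (N s v)) h v"
proof -
  have e: "c (- \<i>) (c (cis y) (G h v (rcis r y))) = R (N (rcis r y) (c (u y * h (rcis r y)) v))"
    if "0 < r" "y = f \<or> y = -f" for r y
    by (simp only: u_def G_def N_c[OF contour_Om[OF that]] R_c c_mult)
  have i: "((\<lambda>r. c (cis y) (G h v (rcis r y))) has_integral ray y (G h v)) {0<..}" if "y = f \<or> y = -f" for y
    unfolding ray_def using ray_integrable[OF G_ok[OF h that]] by (simp add: integrable_integral)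
  have "((\<lambda>r. c (- \<i>) (c (cis (-f)) (G h v (rcis r (-f))) - c (cis f) (G h v (rcis r f))))
      has_integral c (- \<i>) (ray (-f) (G h v) - ray f (G h v))) {0<..}"
    using has_integral_linear[OF has_integral_diff[OF i[of "-f"] i[of f]] c_bounded_linear[of "- \<i>"]]
    by (simp add: o_def)
  then have "((\<lambda>r. R (N (rcis r (-f)) (c (u (-f) * h (rcis r (-f))) v)) - R (N (rcis r f) (c (u f * h (rcis r f)) v)))
      has_integral c (- \<i>) (ray (-f) (G h v) - ray f (G h v))) {0<..}"
    by (rule has_integral_eq[rotated]) (simp only: c_diff_right e greaterThan_iff simp_thms)
  then have "pI (\<lambda>s v. R (N s v)) h v = c (- \<i>) (ray (-f) (G h v) - ray f (G h v))"
    unfolding pI_def by (rule integral_unique)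
  moreover have "1 / (2 * pi * \<i>) = of_real (1 / (2 * pi)) * (- \<i>)" by (simp add: field_simps)
  ultimately show ?thesis unfolding A_def cint_def by (simp only: c_mult c_of_real)
qed

lemma SL_c: "s \<in> Om \<Longrightarrow> pr X Y \<Longrightarrow> SL X s (c k v) = c k (c (1 + s) (R (N s v))) - X (c k (N s v))"
  by (simp add: SL_def N_c R_c c_commute[of "1 + s"])

lemma SL_ray:
  assumes h: "cls t 0 0 h" and p: "pr X Y" and y: "y = f \<or> y = -f"
  shows "(\<lambda>r. SL X (rcis r y) (c (u y * h (rcis r y)) v)) integrable_on {0<..}"
    and "\<exists>B. \<forall>v. norm (integral {0<..} (\<lambda>r. SL X (rcis r y) (c (u y * h (rcis r y)) v))) \<le> B * norm v"
proof -
  obtain a C where hol: "h holomorphic_on sec t" and a: "0 < a" and C: "0 \<le> C"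
    and b: "\<And>z. z \<in> sec t \<Longrightarrow> cmod (h z) \<le> C * env 0 0 a (cmod z)"
    using clsE[OF h] angles_pi angles by (metis less_imp_le)
  let ?F = "\<lambda>v r. SL X (rcis r y) (c (u y * h (rcis r y)) v)"
  have hc: "continuous_on {0<..} (\<lambda>r. h (rcis r y))"
    by (rule continuous_on_compose2[of "sec t"])
       (use hol contour_sec[OF _ y] in \<open>auto simp: rcis_def intro!: holomorphic_on_imp_continuous_on continuous_intros\<close>)
  have NC: "continuous_on {0<..} (\<lambda>r. N (rcis r y) v)" for v
  proof (rule continuous_on_compose2[of Om])
    show "continuous_on Om (\<lambda>s. N s v)" by (intro continuous_at_imp_continuous_on ballI N_cont)
  qed (use contour_Om[OF _ y] in \<open>auto simp: rcis_def intro!: continuous_intros\<close>)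
  have Fc: "continuous_on {0<..} (?F v)" for v
  proof (rule continuous_on_eq)
    show "continuous_on {0<..} (\<lambda>r. c (u y * h (rcis r y)) (c (1 + rcis r y) (R (N (rcis r y) v)))
        - X (c (u y * h (rcis r y)) (N (rcis r y) v)))"
    proof (rule continuous_on_diff)
      show "continuous_on {0<..} (\<lambda>r. c (u y * h (rcis r y)) (c (1 + rcis r y) (R (N (rcis r y) v))))"
        by (intro c_continuous_on continuous_on_mult continuous_on_const hc bounded_linear.continuous_on[OF R_bl] NC)
           (auto simp: rcis_def intro!: continuous_intros)
      show "continuous_on {0<..} (\<lambda>r. X (c (u y * h (rcis r y)) (N (rcis r y) v)))"
        by (intro bounded_linear.continuous_on[OF pr_bl[OF p]] c_continuous_on continuous_on_mult continuous_on_const hc NC)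
    qed
  qed (use contour_Om[OF _ y] in \<open>simp add: SL_c[OF _ p]\<close>)
  have Fb: "norm (?F v r) \<le> (K * C * norm v) * env (-1) (-1) a r" if r: "0 < r" for v r
  proof -
    have "norm (?F v r) \<le> K / r * norm (c (u y * h (rcis r y)) v)"
      using SL_bound[OF p contour_Om[OF r y]] r by simp
    also have "\<dots> = K * norm v * (1 / r) * cmod (h (rcis r y))" by (simp add: norm_c norm_mult u_def)
    also have "\<dots> \<le> K * norm v * (1 / r) * (C * env 0 0 a r)"
    proof (rule mult_left_mono)
      show "cmod (h (rcis r y)) \<le> C * env 0 0 a r" using b[OF contour_sec[OF r y]] r by simp
      have "0 \<le> K * norm v"
        using K_nonneg by (metis mult_nonneg_nonneg mult_zero_right norm_ge_zero norm_zero order_refl)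
      then show "0 \<le> K * norm v * (1 / r)" using r by simp
    qed
    also have "1 / r = env (-1) (-1) 0 r" using env_powr[OF r, of "-1"] r by (simp add: powr_neg_one)
    also have "K * norm v * env (-1) (-1) 0 r * (C * env 0 0 a r) = (K * C * norm v) * (env (-1) (-1) 0 r * env 0 0 a r)"
      by (simp only: mult_ac)
    finally show ?thesis using env_mult[OF r, of "-1" "-1" 0 0 0 a] by simp
  qed
  have gi: "(\<lambda>r. (K * C * norm v) * env (-1) (-1) a r) integrable_on {0<..}" for v
    by (intro integrable_on_mult_right env_integrable a)
  show int: "?F v integrable_on {0<..}" for v
    by (rule halfline_integrable[OF Fc Fb gi])
  have bB: "norm (integral {0<..} (?F v)) \<le> (K * C * integral {0<..} (env (-1) (-1) a)) * norm v" for v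
  proof -
    have "norm (integral {0<..} (?F v)) \<le> integral {0<..} (\<lambda>r. (K * C * norm v) * env (-1) (-1) a r)"
      by (rule integral_norm_bound_integral[OF int gi]) (use Fb in auto)
    then show ?thesis by (simp add: mult_ac)
  qed
  show "\<exists>B. \<forall>v. norm (integral {0<..} (?F v)) \<le> B * norm v" by (rule exI, rule allI, rule bB)
qed

lemma SL_add: "s \<in> Om \<Longrightarrow> pr X Y \<Longrightarrow> SL X s (v + w) = SL X s v + SL X s w"
  by (simp add: SL_def N_add R_add c_add_right linear_add[OF bounded_linear.linear[OF pr_bl]])
lemma SL_diff: "s \<in> Om \<Longrightarrow> pr X Y \<Longrightarrow> SL X s (v - w) = SL X s v - SL X s w"
  by (simp add: SL_def N_diff R_diff c_diff_right linear_diff[OF bounded_linear.linear[OF pr_bl]])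

lemma SL_scaleR: assumes "s \<in> Om" "pr X Y" shows "SL X s (r *\<^sub>R v) = r *\<^sub>R SL X s v"
  by (simp add: SL_def linear_scale[OF bounded_linear.linear[OF N_bl[OF assms(1)]]]
      linear_scale[OF bounded_linear.linear[OF R_bl]] c_scaleR_right
      linear_scale[OF bounded_linear.linear[OF pr_bl[OF assms(2)]]] scaleR_diff_right)

lemma pI_SL:
  assumes h: "cls t 0 0 h" and p: "pr X Y"
  shows "pI (SL X) h v = integral {0<..} (\<lambda>r. SL X (rcis r (-f)) (c (u (-f) * h (rcis r (-f))) v))
      - integral {0<..} (\<lambda>r. SL X (rcis r f) (c (u f * h (rcis r f)) v))"
    and "(\<lambda>r. SL X (rcis r (-f)) (c (u (-f) * h (rcis r (-f))) v) - SL X (rcis r f) (c (u f * h (rcis r f)) v)) integrable_on {0<..}"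
  unfolding pI_def
  using integral_diff[OF SL_ray(1)[OF h p, of "-f" v] SL_ray(1)[OF h p, of f v]]
    integrable_diff[OF SL_ray(1)[OF h p, of "-f" v] SL_ray(1)[OF h p, of f v]] by simp_all

lemma Phi_bl:
  assumes h: "cls t 0 0 h" and p: "pr X Y" shows "bounded_linear (Phi X h)"
proof -
  have "bounded_linear (\<lambda>v. integral {0<..} (\<lambda>r. SL X (rcis r y) (c (u y * h (rcis r y)) v)))"
    if y: "y = f \<or> y = -f" for y
  proof -
    from SL_ray(2)[OF h p y]
    obtain B where "\<forall>v. norm (integral {0<..} (\<lambda>r. SL X (rcis r y) (c (u y * h (rcis r y)) v))) \<le> B * norm v"
      by (rule exE)
    note B = spec[OF this]
    show ?thesis
    proof (rule bounded_linear_intro[where K = B])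
      fix v w and x :: real
      show "integral {0<..} (\<lambda>r. SL X (rcis r y) (c (u y * h (rcis r y)) (v + w)))
        = integral {0<..} (\<lambda>r. SL X (rcis r y) (c (u y * h (rcis r y)) v))
        + integral {0<..} (\<lambda>r. SL X (rcis r y) (c (u y * h (rcis r y)) w))"
        unfolding integral_add[OF SL_ray(1)[OF h p y] SL_ray(1)[OF h p y], symmetric]
        by (rule integral_cong) (simp add: c_add_right SL_add[OF contour_Om[OF _ y] p])
      show "integral {0<..} (\<lambda>r. SL X (rcis r y) (c (u y * h (rcis r y)) (x *\<^sub>R v)))
        = x *\<^sub>R integral {0<..} (\<lambda>r. SL X (rcis r y) (c (u y * h (rcis r y)) v))"
        unfolding integral_cmul[symmetric]
        by (rule integral_cong) (simp add: c_scaleR_right SL_scaleR[OF contour_Om[OF _ y] p])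
      show "norm (integral {0<..} (\<lambda>r. SL X (rcis r y) (c (u y * h (rcis r y)) v))) \<le> norm v * B"
        using B[of v] by (simp add: mult.commute)
    qed
  qed
  from bounded_linear_sub[OF this[of "-f"] this[of f]]
  have "bounded_linear (pI (SL X) h)" by (simp add: pI_SL(1)[OF h p, abs_def])
  then show ?thesis unfolding Phi_def[abs_def] by (rule bounded_linear_const_scaleR)
qed

lemma Phi_linear_int:
  assumes h: "cls t 0 0 h" and p: "pr X Y" and L: "bounded_linear L"
  shows "((\<lambda>r. L (SL X (rcis r (-f)) (c (u (-f) * h (rcis r (-f))) v)) - L (SL X (rcis r f) (c (u f * h (rcis r f)) v)))
     has_integral (2 * pi) *\<^sub>R L (Phi X h v)) {0<..}"
proof -
  have "((\<lambda>r. SL X (rcis r (-f)) (c (u (-f) * h (rcis r (-f))) v) - SL X (rcis r f) (c (u f * h (rcis r f)) v))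
     has_integral (2 * pi) *\<^sub>R Phi X h v) {0<..}"
    using integrable_integral[OF pI_SL(2)[OF h p, of v]] by (simp add: Phi_def pI_def)
  from has_integral_linear[OF this L] show ?thesis
    by (simp add: o_def linear_diff[OF bounded_linear.linear[OF L]] linear_scale[OF bounded_linear.linear[OF L]])
qed

lemma A_linear_int:
  assumes h: "cls t 1 1 h" and L: "bounded_linear L"
  shows "((\<lambda>r. L (R (N (rcis r (-f)) (c (u (-f) * h (rcis r (-f))) v))) - L (R (N (rcis r f) (c (u f * h (rcis r f)) v))))
     has_integral (2 * pi) *\<^sub>R L (A h v)) {0<..}"
proof -
  let ?F = "\<lambda>r. R (N (rcis r (-f)) (c (u (-f) * h (rcis r (-f))) v)) - R (N (rcis r f) (c (u f * h (rcis r f)) v))"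
  have e: "c (- \<i>) (c (cis y) (G h v (rcis r y))) = R (N (rcis r y) (c (u y * h (rcis r y)) v))"
    if "0 < r" "y = f \<or> y = -f" for r y
    by (simp only: u_def G_def N_c[OF contour_Om[OF that]] R_c c_mult)
  have i: "(\<lambda>r. R (N (rcis r y) (c (u y * h (rcis r y)) v))) integrable_on {0<..}" if y: "y = f \<or> y = -f" for y
  proof -
    have "(\<lambda>r. c (- \<i>) (c (cis y) (G h v (rcis r y)))) integrable_on {0<..}"
      using integrable_linear[OF ray_integrable[OF G_ok[OF h y]] c_bounded_linear[of "- \<i>"]] by (simp add: o_def)
    then show ?thesis by (rule integrable_eq) (simp add: e y)
  qed
  have "?F integrable_on {0<..}" by (intro integrable_diff i) auto
  then have "(?F has_integral (2 * pi) *\<^sub>R A h v) {0<..}"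
    using A_pI[OF h, of v] by (simp add: pI_def integrable_integral)
  from has_integral_linear[OF this L] show ?thesis
    by (simp add: o_def linear_diff[OF bounded_linear.linear[OF L]] linear_scale[OF bounded_linear.linear[OF L]])
qed

text \<open>Since Y X = \<open>R\<close>, applying \<open>Y\<close> to the left resolvent leaves
  (1+s) Y R N - R N, the integrands of two harmonic integrals. As \<open>Y\<close> is injective,
  identities for \<open>Phi\<close> can be checked on this right-hand side.\<close>

lemma Phi_A:
  assumes h: "cls t 1 0 h" and p: "pr X Y"
  shows "Y (Phi X h v) = Y (A (\<lambda>s. (1 + s) * h s) v) - A h v"
proof -
  let ?h1 = "\<lambda>s. (1 + s) * h s"
  have h1: "cls t 1 1 ?h1" using cls_one_plus[OF h] by simp
  have py: "pr Y X" by (rule pr_sym[OF p])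
  have e: "Y (SL X s (c (k * h s) v)) = Y (R (N s (c (k * ?h1 s) v))) - R (N s (c (k * h s) v))" if "s \<in> Om" for s k
    by (simp add: SL_def linear_diff[OF bounded_linear.linear[OF pr_bl[OF py]]] pr_comp[OF py] N_c[OF that] R_c
        c_mult[symmetric] mult_ac)
  have "((\<lambda>r. Y (SL X (rcis r (-f)) (c (u (-f) * h (rcis r (-f))) v)) - Y (SL X (rcis r f) (c (u f * h (rcis r f)) v)))
      has_integral (2 * pi) *\<^sub>R Y (A ?h1 v) - (2 * pi) *\<^sub>R A h v) {0<..}"
    by (rule has_integral_eq[OF _ has_integral_diff[OF A_linear_int[OF h1 pr_bl[OF py]] A_linear_int[OF cls11[OF h] bounded_linear_ident]]])
       (simp add: e contour_Om)
  then have "(2 * pi) *\<^sub>R Y (Phi X h v) = (2 * pi) *\<^sub>R (Y (A ?h1 v) - A h v)"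
    using Phi_linear_int[OF cls00[OF h] p pr_bl[OF py], of v] has_integral_unique
    unfolding scaleR_diff_right by blast
  then show ?thesis by simp
qed

lemma cls_inv: "cls t p q h \<Longrightarrow> cls t p (q - 1) (\<lambda>s. h s / (1 + s))"
  using cls_mult_bnd[OF bnd_inverse_one_plus[OF angles_pi(4) angles(4)], of p q h] angles by simp

lemma cls_mono': "cls t p q h \<Longrightarrow> p' \<le> p \<Longrightarrow> q \<le> q' \<Longrightarrow> cls t p' q' h"
  using cls_mono[of t p q h p' q'] angles by auto

text \<open>The function 1/(1+s) corresponds to the operator \<open>X\<close>. The resolvent
  equation leaves a term without resolvent; it integrates to zero, because h/(1+s) decays fast
  enough for the contour to be closed up across the sector.\<close>

lemma Phi_resolvent:
  assumes h: "cls t 0 0 h" and p: "pr X Y"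
  shows "Phi X (\<lambda>s. h s / (1 + s)) v = X (Phi X h v)"
proof -
  let ?h1 = "\<lambda>s. h s / (1 + s)"
  have h1: "cls t 0 (-1) ?h1" using cls_inv[OF h] by simp
  have h1': "cls t 0 0 ?h1" "cls t (-1) (-1) ?h1" by (rule cls_mono'[OF h1]; simp)+
  note blX = pr_bl[OF p]
  note Xl = linear_diff[OF bounded_linear.linear[OF blX]] linear_add[OF bounded_linear.linear[OF blX]]
  \<comment> \<open>Obtained by applying \<open>X\<close> to \<open>Mo s (N s w) = w\<close> and
    splitting \<open>sg\<close> into \<open>X\<close> and \<open>Y\<close>.\<close>
  have id: "SL X s w = X (SL X s (c (1 + s) w)) - X w" if s: "s \<in> Om" for s w
  proof -
    let ?u = "N s w"
    have "X (SL X s (c (1 + s) w)) = X (c ((1 + s)^2) (R ?u)) - X (X (c (1 + s) ?u))"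
      by (simp add: SL_def N_c[OF s] R_c Xl power2_eq_square c_mult)
    moreover have "X (c (1 + s) (sg ?u)) = X (X (c (1 + s) ?u)) + c (1 + s) (R ?u)"
    proof -
      have "X (c (1 + s) (sg ?u)) = X (X (c (1 + s) ?u) + Y (c (1 + s) ?u))"
        by (simp only: sg_c[symmetric] pr_add[OF p])
      then show ?thesis by (simp add: Xl pr_comp[OF p] R_c)
    qed
    moreover have "X w = X ?u - X (c (1 + s) (sg ?u)) + X (c ((1 + s)^2) (R ?u))"
      using MoN[OF s, of w] by (simp add: Mo_def flip: Xl)
    ultimately show ?thesis unfolding SL_def[of X s w] by simp
  qed
  have m1: "1 + rcis r y \<noteq> 0" if "0 < r" "y = f \<or> y = -f" for r y
    using sec_one_plus(2)[OF contour_sec[OF that]] angles by simp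
  have ok: "cx.ray_ok y ?h1" if "y = f \<or> y = -f" for y
    by (rule cls_shift(2)[OF h1'(2), of y y]) (use that angles in auto)
  have i0: "((\<lambda>r. c (u y * ?h1 (rcis r y)) v) has_integral c (- \<i> * cx.ray y ?h1) v) {0<..}" if y: "y = f \<or> y = -f" for y
  proof -
    have "((\<lambda>r. cis y * ?h1 (rcis r y)) has_integral cx.ray y ?h1) {0<..}"
      unfolding cx.ray_def using cx.ray_integrable[OF ok[OF y]] by (simp add: integrable_integral)
    from has_integral_linear[OF has_integral_mult_right[OF this, of "- \<i>"] bounded_bilinear.bounded_linear_left[OF bil, of v]]
    show ?thesis by (simp add: o_def u_def mult.assoc)
  qed
  have "cx.ray (-f) ?h1 = cx.ray f ?h1"
    by (rule cls_shift(1)[OF h1'(2)]) (use angles in auto)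
  then have "((\<lambda>r. c (u (-f) * ?h1 (rcis r (-f))) v - c (u f * ?h1 (rcis r f)) v) has_integral 0) {0<..}"
    using has_integral_diff[OF i0[of "-f"] i0[of f]] by simp
  from has_integral_linear[OF this blX]
  have z: "((\<lambda>r. X (c (u (-f) * ?h1 (rcis r (-f))) v) - X (c (u f * ?h1 (rcis r f)) v)) has_integral 0) {0<..}"
    by (simp add: o_def Xl linear_0[OF bounded_linear.linear[OF blX]])
  have sw: "a - b - (d - e) = a - d - (b - e)" for a b d e :: 'v by simp
  have e: "SL X (rcis r y) (c (u y * ?h1 (rcis r y)) v)
     = X (SL X (rcis r y) (c (u y * h (rcis r y)) v)) - X (c (u y * ?h1 (rcis r y)) v)"
    if ry: "0 < r" "y = f \<or> y = -f" for r y
  proof -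
    have "(1 + rcis r y) * (u y * ?h1 (rcis r y)) = u y * h (rcis r y)"
      using m1[OF ry] by simp
    then have "c (1 + rcis r y) (c (u y * ?h1 (rcis r y)) v) = c (u y * h (rcis r y)) v"
      by (simp only: c_mult[symmetric])
    then show ?thesis using id[OF contour_Om[OF ry], of "c (u y * ?h1 (rcis r y)) v"] by (simp only:)
  qed
  have "((\<lambda>r. SL X (rcis r (-f)) (c (u (-f) * ?h1 (rcis r (-f))) v) - SL X (rcis r f) (c (u f * ?h1 (rcis r f)) v))
      has_integral (2 * pi) *\<^sub>R X (Phi X h v) - 0) {0<..}"
    by (rule has_integral_eq[OF _ has_integral_diff[OF Phi_linear_int[OF h p blX] z]])
       (simp only: e greaterThan_iff simp_thms, rule sw)
  from has_integral_unique[OF this Phi_linear_int[OF h1'(1) p bounded_linear_ident]]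
  show ?thesis by simp
qed

end

section \<open>Product rules and commutation\<close>

lemma cnj_sec: "s \<in> sec t \<Longrightarrow> cnj s \<in> sec t" by (simp add: sec_def)

context op_calc
begin

lemma csym_mult: "csym g \<Longrightarrow> csym h \<Longrightarrow> csym (\<lambda>s. g s * h s)" by (simp add: csym_def)
lemma csym_one_plus: "csym h \<Longrightarrow> csym (\<lambda>s. (1 + s) * h s)" by (simp add: csym_def)
lemma csym_inv: "csym h \<Longrightarrow> csym (\<lambda>s. h s / (1 + s))" by (simp add: csym_def)

lemma pr_add': "pr X Y \<Longrightarrow> X (v + w) = X v + X w" "pr X Y \<Longrightarrow> X (v - w) = X v - X w"
  by (rule linear_add[OF bounded_linear.linear[OF pr_bl]], assumption,
      rule linear_diff[OF bounded_linear.linear[OF pr_bl]], assumption)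

lemma pr_cancel: assumes p: "pr X Y" and "X v = X w" shows "v = w"
proof -
  have "X (v - w) = 0" by (simp only: pr_add'(2)[OF p] assms(2) diff_self)
  from pr_inj[OF p this] show ?thesis by (simp only: right_minus_eq)
qed

lemma A_add: "cls t 1 1 h \<Longrightarrow> A h (v + w) = A h v + A h w"
  "cls t 1 1 h \<Longrightarrow> A h (v - w) = A h v - A h w"
  by (rule linear_add[OF bounded_linear.linear[OF A_bl]], assumption,
      rule linear_diff[OF bounded_linear.linear[OF A_bl]], assumption)

text \<open>In \<open>product_core\<close> the middle term is split by \<open>sg\<close> = X + Y,
  one half going to each product; \<open>Phi_A\<close> recognizes both halves as \<open>R\<close>
  applied to a product on the right, and \<open>R\<close> is injective. Moving \<open>Y\<close> past
  \<open>A n\<close> is where the symmetry of \<open>n\<close> enters.\<close>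

lemma product_A:
  assumes n: "cls t 1 0 n" "csym n" and h: "cls t 1 0 h" and p: "pr X Y"
  shows "A (\<lambda>s. n s * h s) v = Phi X n (A h v) + A n (Phi Y h v)"
proof -
  let ?n1 = "\<lambda>s. (1 + s) * n s" and ?h1 = "\<lambda>s. (1 + s) * h s"
  have py: "pr Y X" by (rule pr_sym[OF p])
  note n11 = cls11[OF n(1)]
  have 1: "R (Phi X n (A h v)) = R (A ?n1 (A h v)) - X (A n (A h v))"
  proof -
    have "R (Phi X n (A h v)) = X (Y (Phi X n (A h v)))" by (simp only: pr_comp[OF p])
    also have "\<dots> = X (Y (A ?n1 (A h v)) - A n (A h v))" by (simp only: Phi_A[OF n(1) p])
    finally show ?thesis by (simp only: pr_add'[OF p] pr_comp[OF p])
  qed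
  have 2: "R (A n (Phi Y h v)) = R (A n (A ?h1 v)) - Y (A n (A h v))"
  proof -
    have "R (A n (Phi Y h v)) = A n (Y (X (Phi Y h v)))" by (simp only: A_R[OF n11] pr_comp[OF py])
    also have "\<dots> = A n (Y (X (A ?h1 v) - A h v))" by (simp only: Phi_A[OF h py])
    finally show ?thesis by (simp only: pr_add'[OF py] pr_comp[OF py] A_add[OF n11] A_R[OF n11] A_pr[OF n11 n(2) py])
  qed
  have "R (A (\<lambda>s. n s * h s) v) = R (Phi X n (A h v) + A n (Phi Y h v))"
    unfolding R_add 1 2 product_core[OF n(1) h] pr_add[OF p, symmetric] by simp
  then have "R (A (\<lambda>s. n s * h s) v - (Phi X n (A h v) + A n (Phi Y h v))) = 0" by (simp add: R_diff)
  from R_inj[OF this] show ?thesis by simp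
qed

lemma Phi_add:
  assumes "cls t 0 0 h" "pr X Y"
  shows "Phi X h (v + w) = Phi X h v + Phi X h w" "Phi X h (v - w) = Phi X h v - Phi X h w"
  by (rule linear_add[OF bounded_linear.linear[OF Phi_bl[OF assms]]],
      rule linear_diff[OF bounded_linear.linear[OF Phi_bl[OF assms]]])

lemma Phi_diff_fun:
  assumes h: "cls t 0 0 h" and g: "cls t 0 0 g" and d: "cls t 0 0 (\<lambda>s. h s - g s)" and p: "pr X Y"
  shows "Phi X (\<lambda>s. h s - g s) v = Phi X h v - Phi X g v"
proof -
  have e: "SL X (rcis r y) (c (u y * (h (rcis r y) - g (rcis r y))) v)
      = SL X (rcis r y) (c (u y * h (rcis r y)) v) - SL X (rcis r y) (c (u y * g (rcis r y)) v)"
    if "0 < r" "y = f \<or> y = -f" for r y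
    by (simp only: right_diff_distrib c_diff_left SL_diff[OF contour_Om[OF that] p])
  have sw: "a - b - (d - e) = a - d - (b - e)" for a b d e :: 'v by simp
  have "((\<lambda>r. SL X (rcis r (-f)) (c (u (-f) * (h (rcis r (-f)) - g (rcis r (-f)))) v)
        - SL X (rcis r f) (c (u f * (h (rcis r f) - g (rcis r f))) v))
      has_integral (2 * pi) *\<^sub>R Phi X h v - (2 * pi) *\<^sub>R Phi X g v) {0<..}"
    by (rule has_integral_eq[OF _ has_integral_diff[OF Phi_linear_int[OF h p bounded_linear_ident]
              Phi_linear_int[OF g p bounded_linear_ident]]])
       (simp only: e greaterThan_iff simp_thms, rule sw)
  from has_integral_unique[OF Phi_linear_int[OF d p bounded_linear_ident] this]
  have "(2 * pi) *\<^sub>R Phi X (\<lambda>s. h s - g s) v = (2 * pi) *\<^sub>R (Phi X h v - Phi X g v)"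
    by (simp only: scaleR_diff_right)
  then show ?thesis by simp
qed

text \<open>With X the inverse of 1+T, the operator X - X^2 is T (1+T)^{-2}, the value of the
  calculus at s/(1+s)^2. It is injective because X and 1 - X are.\<close>

definition P1 :: "('v \<Rightarrow> 'v) \<Rightarrow> 'v \<Rightarrow> 'v" where "P1 X v = X v - X (X v)"

lemma P1_inj: assumes p: "pr X Y" and "P1 X v = P1 X w" shows "v = w"
proof -
  have "X ((v - w) - X (v - w)) = 0" using assms(2) by (simp add: P1_def pr_add'[OF p] algebra_simps)
  from pr_inj[OF p this] have "X (v - w) = v - w" by simp
  from pr_inj1[OF p this] show ?thesis by simp
qed

definition psi1 :: "complex \<Rightarrow> complex" where "psi1 s = s / (1 + s)^2"

lemma bnd_psi1: "bnd t 1 (-1) psi1"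
  unfolding bnd_def
proof
  from bnd_inverse_one_plus[OF angles_pi(4) angles(4)]
  obtain C where C: "\<And>z. z \<in> sec t \<Longrightarrow> cmod (1 / (1 + z)) \<le> C * env 0 (-1) 0 (cmod z)"
    unfolding bnd_def by blast
  show "psi1 holomorphic_on sec t" unfolding psi1_def[abs_def]
    using sec_one_plus(2) angles by (intro holomorphic_intros) auto
  show "\<exists>D. \<forall>z\<in>sec t. cmod (psi1 z) \<le> D * env 1 (-1) 0 (cmod z)"
  proof (intro exI ballI)
    fix z assume z: "z \<in> sec t"
    have nz: "0 < cmod z" using sec_nz[OF z] by simp
    have "cmod (psi1 z) = cmod z * (cmod (1 / (1 + z)) * cmod (1 / (1 + z)))"
      by (simp add: psi1_def norm_divide norm_mult power2_eq_square)
    also have "\<dots> = env 1 1 0 (cmod z) * (cmod (1 / (1 + z)) * cmod (1 / (1 + z)))"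
      using nz by (simp add: env_def)
    also have "\<dots> \<le> env 1 1 0 (cmod z) * ((C * env 0 (-1) 0 (cmod z)) * (C * env 0 (-1) 0 (cmod z)))"
      by (intro mult_left_mono mult_mono C z order_trans[OF norm_ge_zero C[OF z]]) (auto simp: env_nonneg)
    also have "\<dots> = (C * C) * (env 1 1 0 (cmod z) * (env 0 (-1) 0 (cmod z) * env 0 (-1) 0 (cmod z)))"
      by (simp only: mult_ac)
    finally have "cmod (psi1 z) \<le> (C * C) * (env 1 1 0 (cmod z) * (env 0 (-1) 0 (cmod z) * env 0 (-1) 0 (cmod z)))" .
    then show "cmod (psi1 z) \<le> (C * C) * env 1 (-1) 0 (cmod z)"
      by (simp only: env_mult[OF nz]) simp
  qed
qed

lemma csym_psi1: "csym psi1" by (simp add: csym_def psi1_def)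

lemma cls_psi1: "cls t 0 0 h \<Longrightarrow> cls t 1 0 (\<lambda>s. psi1 s * h s)"
  using cls_mult_bnd[OF bnd_psi1, of 0 0 h] angles cls_mono'[of 1 "-1" "\<lambda>s. psi1 s * h s" 1 0] by simp

lemma cls_cong:
  assumes "cls t p q h" "\<And>s. s \<in> sec t \<Longrightarrow> g s = h s" shows "cls t p q g"
proof -
  have "g holomorphic_on sec t \<longleftrightarrow> h holomorphic_on sec t"
    by (rule holomorphic_cong[OF refl assms(2)])
  then show ?thesis using assms unfolding cls_def by simp
qed

text \<open>By s/(1+s)^2 = 1/(1+s) - 1/(1+s)^2 this is \<open>Phi_resolvent\<close> applied once and
  twice.\<close>

lemma Phi_psi1:
  assumes h: "cls t 0 0 h" and p: "pr X Y"
  shows "Phi X (\<lambda>s. psi1 s * h s) v = P1 X (Phi X h v)"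
proof -
  let ?h1 = "\<lambda>s. h s / (1 + s)" and ?h2 = "\<lambda>s. h s / (1 + s) / (1 + s)"
  have h1: "cls t 0 0 ?h1" by (rule cls_mono'[OF cls_inv[OF h]]) auto
  have h2: "cls t 0 0 ?h2" by (rule cls_mono'[OF cls_inv[OF h1]]) auto
  have eq: "psi1 s * h s = ?h1 s - ?h2 s" if "s \<in> sec t" for s
  proof -
    have gen: "(w - 1) / w^2 * x = x / w - x / w / w" if "w \<noteq> 0" for w x :: complex
      using that by (simp add: field_simps power2_eq_square)
    show ?thesis using gen[OF sec_one_plus(2)[OF that]] angles by (simp add: psi1_def)
  qed
  have d: "cls t 0 0 (\<lambda>s. ?h1 s - ?h2 s)"
    by (rule cls_cong[OF cls00[OF cls_psi1[OF h]]]) (rule eq[symmetric])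
  have "Phi X (\<lambda>s. psi1 s * h s) v = Phi X (\<lambda>s. ?h1 s - ?h2 s) v" by (rule Phi_cong[OF eq])
  also have "\<dots> = Phi X ?h1 v - Phi X ?h2 v" by (rule Phi_diff_fun[OF h1 h2 d p])
  also have "\<dots> = P1 X (Phi X h v)"
    by (simp only: Phi_resolvent[OF h1 p] Phi_resolvent[OF h p] P1_def)
  finally show ?thesis .
qed

lemma Phi_commute1:
  assumes n: "cls t 1 0 n" "csym n" and p: "pr X Y" and Z: "bounded_linear Z"
    and ZY: "\<And>v. Z (Y v) = Y (Z v)"
    and ZA: "\<And>k v. cls t 1 1 k \<Longrightarrow> csym k \<Longrightarrow> Z (A k v) = A k (Z v)"
  shows "Z (Phi X n v) = Phi X n (Z v)"
proof -
  have py: "pr Y X" by (rule pr_sym[OF p])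
  have n1: "cls t 1 1 (\<lambda>s. (1 + s) * n s)" using cls_one_plus[OF n(1)] by simp
  have "Y (Z (Phi X n v)) = Z (Y (A (\<lambda>s. (1 + s) * n s) v) - A n v)"
    by (simp only: ZY[symmetric] Phi_A[OF n(1) p])
  also have "\<dots> = Y (A (\<lambda>s. (1 + s) * n s) (Z v)) - A n (Z v)"
    by (simp only: linear_diff[OF bounded_linear.linear[OF Z]] ZY ZA[OF n1 csym_one_plus[OF n(2)]] ZA[OF cls11[OF n(1)] n(2)])
  also have "\<dots> = Y (Phi X n (Z v))" by (simp only: Phi_A[OF n(1) p])
  finally have "Y (Z (Phi X n v) - Phi X n (Z v)) = 0" by (simp only: pr_add'[OF py] diff_self)
  from pr_inj[OF py this] show ?thesis by simp
qed

text \<open>The factor \<open>psi1\<close> lifts \<open>n\<close> into the class where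
  \<open>Phi_A\<close> expresses everything by harmonic integrals, with which \<open>Z\<close>
  commutes. It appears on both sides as the injective operator \<open>P1 X\<close> and is
  cancelled.\<close>

lemma Phi_commute:
  assumes n: "cls t 0 0 n" "csym n" and p: "pr X Y" and Z: "bounded_linear Z"
    and ZX: "\<And>v. Z (X v) = X (Z v)" and ZY: "\<And>v. Z (Y v) = Y (Z v)"
    and ZA: "\<And>k v. cls t 1 1 k \<Longrightarrow> csym k \<Longrightarrow> Z (A k v) = A k (Z v)"
  shows "Z (Phi X n v) = Phi X n (Z v)"
proof (rule P1_inj[OF p])
  have "P1 X (Z (Phi X n v)) = Z (P1 X (Phi X n v))"
    by (simp only: P1_def ZX linear_diff[OF bounded_linear.linear[OF Z]])
  also have "\<dots> = Z (Phi X (\<lambda>s. psi1 s * n s) v)" by (simp only: Phi_psi1[OF n(1) p])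
  also have "\<dots> = Phi X (\<lambda>s. psi1 s * n s) (Z v)"
    by (rule Phi_commute1[OF cls_psi1[OF n(1)] csym_mult[OF csym_psi1 n(2)] p Z ZY ZA])
  also have "\<dots> = P1 X (Phi X n (Z v))" by (simp only: Phi_psi1[OF n(1) p])
  finally show "P1 X (Z (Phi X n v)) = P1 X (Phi X n (Z v))" .
qed

lemma pr_cases: "pr X Y \<Longrightarrow> pr X' Y' \<Longrightarrow> X' = X \<and> Y' = Y \<or> X' = Y \<and> Y' = X"
  unfolding pr_def by blast

lemma pr_pr: "pr X Y \<Longrightarrow> pr X' Y' \<Longrightarrow> X' (X v) = X (X' v)"
  using pr_cases[of X Y X' Y'] pr_comp[of X Y v] pr_comp[of Y X v] pr_sym[of X Y] by auto

lemma Phi_pr: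
  assumes "cls t 0 0 n" "csym n" "pr X Y" "pr X' Y'"
  shows "X' (Phi X n v) = Phi X n (X' v)"
  by (rule Phi_commute[OF assms(1-3) pr_bl[OF assms(4)] pr_pr[OF assms(3,4)] pr_pr[OF pr_sym[OF assms(3)] assms(4)]])
     (rule A_pr[OF _ _ assms(4)])

lemma Phi_A_commute:
  assumes "cls t 0 0 n" "csym n" "pr X Y" "cls t 1 1 k" "csym k"
  shows "A k (Phi X n v) = Phi X n (A k v)"
  by (rule Phi_commute[OF assms(1-3) A_bl[OF assms(4)] A_pr[OF assms(4,5,3), symmetric]
        A_pr[OF assms(4,5) pr_sym[OF assms(3)], symmetric] A_A[OF assms(4)]])

lemma Phi_Phi_commute:
  assumes "cls t 0 0 n" "csym n" "pr X Y" "cls t 0 0 m" "csym m" "pr X' Y'"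
  shows "Phi X' m (Phi X n v) = Phi X n (Phi X' m v)"
  by (rule Phi_commute[OF assms(1-3) Phi_bl[OF assms(4,6)] Phi_pr[OF assms(4,5,6,3), symmetric]
        Phi_pr[OF assms(4,5,6) pr_sym[OF assms(3)], symmetric]])
     (rule Phi_A_commute[OF assms(4-6), symmetric])

text \<open>\<open>Phi_A\<close> is applied to n h/(1+s), whose product with 1+s is n h again.
  Expanding both harmonic integrals by \<open>product_A\<close>, the two terms containing
  \<open>A n\<close> cancel, and \<open>Phi_A\<close> read backwards for h/(1+s) identifies the
  rest. The factor 1/(1+s) is removed at the end by cancelling \<open>X\<close>.\<close>

lemma Phi_mult1:
  assumes n: "cls t 1 0 n" "csym n" and h: "cls t 1 0 h" "csym h" and p: "pr X Y"
  shows "Phi X (\<lambda>s. n s * h s) v = Phi X n (Phi X h v)"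
proof -
  have py: "pr Y X" by (rule pr_sym[OF p])
  let ?h1 = "\<lambda>s. h s / (1 + s)" and ?nh1 = "\<lambda>s. n s * (h s / (1 + s))"
  have h1: "cls t 1 0 ?h1" by (rule cls_mono'[OF cls_inv[OF h(1)]]) auto
  have nh1: "cls t 1 0 ?nh1" by (rule cls_prod[OF n(1) h1])
  have e1: "A (\<lambda>s. (1 + s) * ?nh1 s) w = A (\<lambda>s. n s * h s) w" for w
    by (rule A_cong) (use sec_one_plus(2) angles in auto)
  have e2: "A (\<lambda>s. (1 + s) * ?h1 s) w = A h w" for w
    by (rule A_cong) (use sec_one_plus(2) angles in auto)
  have yA: "Y (A n (Phi Y h v)) = A n (Phi Y ?h1 v)"
    by (simp only: Phi_resolvent[OF cls00[OF h(1)] py] A_pr[OF cls11[OF n(1)] n(2) py])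
  have "Y (Phi X ?nh1 v) = Y (Phi X n (A h v)) + Y (A n (Phi Y h v)) - (Phi X n (A ?h1 v) + A n (Phi Y ?h1 v))"
    by (simp only: Phi_A[OF nh1 p] e1 product_A[OF n h(1) p] product_A[OF n h1 p] pr_add'[OF py])
  also have "\<dots> = Phi X n (Y (A h v)) - Phi X n (A ?h1 v)"
    by (simp add: yA Phi_pr[OF cls00[OF n(1)] n(2) p py])
  also have "\<dots> = Phi X n (Y (Phi X ?h1 v))"
    by (simp only: Phi_A[OF h1 p] e2 Phi_add[OF cls00[OF n(1)] p])
  also have "\<dots> = Y (Phi X n (Phi X ?h1 v))"
    by (simp only: Phi_pr[OF cls00[OF n(1)] n(2) p py])
  finally have "Y (Phi X ?nh1 v) = Y (Phi X n (Phi X ?h1 v))" .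
  then have 1: "Phi X ?nh1 v = Phi X n (Phi X ?h1 v)" by (rule pr_cancel[OF py])
  have 2: "Phi X (\<lambda>s. (n s * h s) / (1 + s)) v = Phi X ?nh1 v" by (rule Phi_cong) simp
  have "X (Phi X (\<lambda>s. n s * h s) v) = Phi X (\<lambda>s. (n s * h s) / (1 + s)) v"
    by (rule Phi_resolvent[OF cls00[OF cls_prod[OF n(1) h(1)]] p, symmetric])
  also have "\<dots> = Phi X n (Phi X ?h1 v)" unfolding 2 1 ..
  also have "Phi X ?h1 v = X (Phi X h v)" by (rule Phi_resolvent[OF cls00[OF h(1)] p])
  also have "Phi X n (X (Phi X h v)) = X (Phi X n (Phi X h v))"
    by (rule Phi_pr[OF cls00[OF n(1)] n(2) p p, symmetric])
  finally show ?thesis by (rule pr_cancel[OF p])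
qed

text \<open>One \<open>psi1\<close> on each factor reduces this to the better class; the two
  resulting copies of \<open>P1 X\<close> are injective.\<close>

lemma Phi_mult:
  assumes n: "cls t 0 0 n" "csym n" and h: "cls t 0 0 h" "csym h" and p: "pr X Y"
  shows "Phi X (\<lambda>s. n s * h s) v = Phi X n (Phi X h v)"
proof -
  let ?n = "\<lambda>s. psi1 s * n s" and ?h = "\<lambda>s. psi1 s * h s"
  have nh: "cls t 0 0 (\<lambda>s. n s * h s)" using cls_mult[OF n(1) h(1)] angles by simp
  have pnh: "cls t 0 0 (\<lambda>s. psi1 s * (n s * h s))" by (rule cls00[OF cls_psi1[OF nh]])
  have "P1 X (P1 X (Phi X (\<lambda>s. n s * h s) v)) = Phi X (\<lambda>s. psi1 s * (psi1 s * (n s * h s))) v"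
    by (simp only: Phi_psi1[OF pnh p] Phi_psi1[OF nh p])
  also have "\<dots> = Phi X (\<lambda>s. ?n s * ?h s) v" by (rule Phi_cong) simp
  also have "\<dots> = Phi X ?n (Phi X ?h v)"
    by (rule Phi_mult1[OF cls_psi1[OF n(1)] csym_mult[OF csym_psi1 n(2)] cls_psi1[OF h(1)] csym_mult[OF csym_psi1 h(2)] p])
  also have "\<dots> = P1 X (P1 X (Phi X n (Phi X h v)))"
    by (simp only: Phi_psi1[OF n(1) p] Phi_psi1[OF h(1) p] P1_def Phi_add[OF n(1) p] Phi_pr[OF n p p])
  finally have "P1 X (P1 X (Phi X (\<lambda>s. n s * h s) v)) = P1 X (P1 X (Phi X n (Phi X h v)))" .
  from P1_inj[OF p P1_inj[OF p this]] show ?thesis .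
qed

section \<open>Explicit regularizers and their values\<close>

lemma holomorphic_Om_ne: assumes "s \<in> Om" shows "s \<noteq> 1"
proof
  assume "s = 1"
  with OmD[OF assms] have "1 < cos f0" by simp
  then show False using cos_le_one[of f0] by linarith
qed

lemma holomorphic_inverse_minus_one: "(\<lambda>s. 1 / (s - 1)) holomorphic_on Om"
proof -
  have "s \<noteq> 1" if "s \<in> Om" for s by (rule holomorphic_Om_ne[OF that])
  then show ?thesis by (intro holomorphic_intros) auto
qed

text \<open>The coefficient of (1+s)^2 in the expansion of \<open>N s\<close> at s = -1, where
  \<open>N s\<close> inverts 1 - w \<open>sg\<close> + w^2 \<open>R\<close> with w = 1+s.\<close>

definition tau :: "'v \<Rightarrow> 'v" where "tau v = sg (sg v) - R v"

lemma power_quotient_bnd: "bnd t 2 (2 - real j) (\<lambda>s. s^2 / (1 + s)^j)"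
proof -
  from bnd_inverse_power[of j] obtain D where
    D: "\<And>z. z \<in> sec t \<Longrightarrow> cmod (1 / (1 + z) ^ j) \<le> D * env 0 (-real j) 0 (cmod z)"
    and hol: "(\<lambda>s. 1 / (1 + s) ^ j) holomorphic_on sec t" unfolding bnd_def by blast
  show ?thesis unfolding bnd_def
  proof (intro conjI exI ballI)
    have "(\<lambda>s. s^2 * (1 / (1 + s)^j)) holomorphic_on sec t" by (intro holomorphic_on_mult hol holomorphic_intros)
    then show "(\<lambda>s. s^2 / (1 + s)^j) holomorphic_on sec t" by simp
    fix z assume z: "z \<in> sec t"
    have nz: "0 < cmod z" using sec_nz[OF z] by simp
    have "cmod (z^2 / (1 + z)^j) = (cmod z)^2 * cmod (1 / (1 + z) ^ j)"
      by (simp add: norm_divide norm_power)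
    also have "\<dots> \<le> (cmod z)^2 * (D * env 0 (-real j) 0 (cmod z))"
      by (intro mult_left_mono D z) auto
    also have "(cmod z)^2 = env 2 2 0 (cmod z)" using nz by (simp add: env_def)
    also have "env 2 2 0 (cmod z) * (D * env 0 (-real j) 0 (cmod z)) = D * (env 2 2 0 (cmod z) * env 0 (-real j) 0 (cmod z))"
      by (simp only: mult_ac)
    finally show "cmod (z^2 / (1 + z)^j) \<le> D * env 2 (2 - real j) 0 (cmod z)"
      unfolding env_mult[OF nz] by simp
  qed
qed

lemma cls_power_quotient:
  assumes "2 - real j \<le> q - 1" shows "cls t 1 q (\<lambda>s. s^2 / (1 + s)^j)"
proof -
  from power_quotient_bnd[of j] obtain D where
    D: "\<And>z. z \<in> sec t \<Longrightarrow> cmod (z^2 / (1 + z) ^ j) \<le> D * env 2 (2 - real j) 0 (cmod z)"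
    and hol: "(\<lambda>s. s^2 / (1 + s) ^ j) holomorphic_on sec t" unfolding bnd_def by blast
  have "cmod (z^2 / (1 + z)^j) \<le> \<bar>D\<bar> * env 1 q 1 (cmod z)" if z: "z \<in> sec t" for z
  proof (rule order_trans[OF D[OF z]], rule mult_mono)
    show "env 2 (2 - real j) 0 (cmod z) \<le> env 1 q 1 (cmod z)"
      using assms sec_nz[OF z] by (intro env_mono) auto
  qed (auto simp: env_nonneg)
  then show ?thesis unfolding cls_def using hol zero_less_one by blast
qed

lemma quotient_bounds:
  assumes "j = 2 \<or> j = 3"
  shows "cmod s < 1/2 \<Longrightarrow> cmod (s^2 / (1 + s)^j) \<le> 8 * (cmod s)^2"
    and "cmod s > 2 \<Longrightarrow> cmod (s^2 / (1 + s)^j) \<le> 8"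
proof -
  have e: "cmod (s^2 / (1 + s)^j) = (cmod s)^2 / (cmod (1 + s))^j" by (simp add: norm_divide norm_power)
  show "cmod (s^2 / (1 + s)^j) \<le> 8 * (cmod s)^2" if s: "cmod s < 1/2"
  proof -
    have l: "1/2 \<le> cmod (1 + s)" using norm_triangle_ineq2[of 1 "-s"] s by simp
    have "(1/8::real) \<le> (1/2)^j" using assms by (auto simp: power2_eq_square power3_eq_cube)
    also have "\<dots> \<le> (cmod (1 + s))^j" by (rule power_mono[OF l]) simp
    finally have "(cmod s)^2 / (cmod (1 + s))^j \<le> (cmod s)^2 / (1/8)" by (intro frac_le) auto
    then show ?thesis unfolding e by simp
  qed
  show "cmod (s^2 / (1 + s)^j) \<le> 8" if s: "cmod s > 2"
  proof -
    have l: "cmod s / 2 \<le> cmod (1 + s)" using norm_triangle_ineq2[of s "-1"] s by (simp add: add.commute)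
    have "(cmod s / 2)^2 \<le> (cmod s / 2)^j" using s by (intro power_increasing) (use assms in auto)
    also have "\<dots> \<le> (cmod (1 + s))^j" by (rule power_mono[OF l]) simp
    finally have "(cmod s)^2 / (cmod (1 + s))^j \<le> (cmod s)^2 / (cmod s / 2)^2"
      using s by (intro frac_le) auto
    also have "\<dots> = 4"
    proof -
      have "s \<noteq> 0" using s by auto
      then show ?thesis by (simp add: power2_eq_square)
    qed
    finally show ?thesis unfolding e by simp
  qed
qed

text \<open>Substituting \<open>N_eq\<close> into its own first-order term gives the Taylor
  expansion at -1 with an exact remainder, valid on all of \<open>Om\<close>.\<close>

lemma N_eq2:
  assumes s: "s \<in> Om"
  shows "N s v = v + c (1 + s) (sg v) + c ((1 + s)^2) (tau (N s v) - c (1 + s) (sg (R (N s v))))"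
proof -
  let ?u = "N s v"
  have 1: "sg ?u = sg v + c (1 + s) (sg (sg ?u)) - c ((1 + s)^2) (sg (R ?u))"
    by (subst N_eq[OF s]) (simp only: sg_add sg_diff sg_c)
  have "?u = v + c (1 + s) (sg ?u) - c ((1 + s)^2) (R ?u)" by (rule N_eq[OF s])
  also have "c (1 + s) (sg ?u) = c (1 + s) (sg v) + c ((1 + s)^2) (sg (sg ?u)) - c ((1 + s)^2) (c (1 + s) (sg (R ?u)))"
    by (subst 1) (simp only: c_add_right c_diff_right power2_eq_square c_mult)
  finally show ?thesis by (simp add: tau_def c_diff_right c_add_right algebra_simps)
qed

lemma tau_lin: "tau (v + w) = tau v + tau w" "tau (v - w) = tau v - tau w" "tau (c z v) = c z (tau v)"
  "bounded_linear tau"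
proof -
  show "bounded_linear tau"
    unfolding tau_def[abs_def] by (rule bounded_linear_sub[OF bounded_linear_compose[OF sg_bl sg_bl] R_bl])
qed (simp_all add: tau_def sg_add sg_diff R_add R_diff sg_c R_c c_diff_right)

lemma N_eq3:
  assumes s: "s \<in> Om"
  shows "N s v = v + c (1 + s) (sg v) + c ((1 + s)^2) (tau v)
     + c ((1 + s)^3) (tau (sg (N s v)) - sg (R (N s v)) - c (1 + s) (tau (R (N s v))))"
proof -
  let ?u = "N s v"
  have 1: "tau ?u = tau v + c (1 + s) (tau (sg ?u)) - c ((1 + s)^2) (tau (R ?u))"
    by (subst N_eq[OF s]) (simp only: tau_lin)
  have 3: "c ((1 + s)^2) (c (1 + s) x) = c ((1 + s)^3) x" "c ((1 + s)^2) (c ((1 + s)^2) x) = c ((1 + s)^3) (c (1 + s) x)" for x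
    by (simp_all add: c_mult[symmetric] power2_eq_square power3_eq_cube mult_ac)
  have "?u = v + c (1 + s) (sg v) + c ((1 + s)^2) (tau ?u - c (1 + s) (sg (R ?u)))" by (rule N_eq2[OF s])
  also have "c ((1 + s)^2) (tau ?u - c (1 + s) (sg (R ?u)))
     = c ((1 + s)^2) (tau v) + c ((1 + s)^3) (tau (sg ?u) - sg (R ?u) - c (1 + s) (tau (R ?u)))"
    by (subst 1) (simp add: c_add_right c_diff_right 3)
  finally show ?thesis by (simp only: add.assoc)
qed

lemma one_plus_nonzero:
  fixes s :: complex
  assumes "s \<noteq> -1" shows "1 + s \<noteq> 0"
proof
  assume "1 + s = 0"
  then have "s + 1 = 0" by (simp only: add.commute)
  then show False using assms by (simp only: eq_neg_iff_add_eq_0[symmetric])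
qed

text \<open>The simple pole 1/w is replaced by p - 2q: the term p = 1/(s-1) is holomorphic on
  \<open>Om\<close>, and q decays like s^{-2}. Doubled terms are written as sums so that additivity
  of \<open>c\<close> can distribute them.\<close>

lemma partial_fractions:
  fixes s :: complex
  assumes "s \<noteq> -1" "s \<noteq> 1"
  defines "w \<equiv> 1 + s" and "p \<equiv> 1 / (s - 1)" and "q \<equiv> 1 / ((s - 1) * (s + 1))"
  shows "s^2 / w^2 = 1 + 1 / w^2 - ((p - (q + q)) + (p - (q + q)))"
    and "s^2 / w = (s - 1) + (p - (q + q))"
    and "s^2 / w^3 = 1 / w^3 - (1 / w^2 + 1 / w^2) + (p - (q + q))"
proof -
  have w: "w \<noteq> 0" "s - 1 \<noteq> 0" "s + 1 = w" "s = w - 1"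
    using assms(2) one_plus_nonzero[OF assms(1)] by (auto simp: w_def)
  have pq: "p - (q + q) = 1 / w"
  proof -
    have "p - (q + q) = (w - 2) / ((s - 1) * w)"
      unfolding p_def q_def w(3) using w(1,2) by (simp add: divide_simps)
    also have "w - 2 = s - 1" by (simp add: w_def)
    finally show ?thesis using w(2) by simp
  qed
  show "s^2 / w^2 = 1 + 1 / w^2 - ((p - (q + q)) + (p - (q + q)))"
    "s^2 / w = (s - 1) + (p - (q + q))"
    "s^2 / w^3 = 1 / w^3 - (1 / w^2 + 1 / w^2) + (p - (q + q))"
    unfolding pq w(4) using w(1) by (simp_all add: field_simps power2_eq_square power3_eq_cube)
qed

lemma RL_comm: "bounded_linear (\<lambda>x. R (tau x))" "bounded_linear (\<lambda>x. R (sg (R x)))"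
  "bounded_linear (\<lambda>x. R (tau (sg x) - sg (R x)))" "bounded_linear (\<lambda>x. R (tau (R x)))"
  using bounded_linear_compose[OF R_bl tau_lin(4)]
    bounded_linear_compose[OF R_bl bounded_linear_compose[OF sg_bl R_bl]]
    bounded_linear_compose[OF R_bl bounded_linear_sub[OF bounded_linear_compose[OF tau_lin(4) sg_bl]
        bounded_linear_compose[OF sg_bl R_bl]]]
    bounded_linear_compose[OF R_bl bounded_linear_compose[OF tau_lin(4) R_bl]] by auto

text \<open>A residue at w = 1+s = 0: expanding s^2 = 1 - 2w + w^2 against 1 + w \<open>sg\<close>
  gives the coefficient \<open>sg\<close> - 2 of 1/w after division by w^2. The sign is reversed
  because -1 lies outside the contour.\<close>

lemma A_k0: "A (\<lambda>s. s^2 / (1 + s)^2) v = R (v + v - sg v)"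
proof -
  define F where "F = (\<lambda>s. R v + c (s - 1) (R (sg v)) + c (1 / (s - 1)) (R (sg v - (v + v)))
      + c (s^2) (R (tau (N s v))) + c (- (s^2 * (1 + s))) (R (sg (R (N s v)))))"
  have t2: "vhol (\<lambda>s. c (s - 1) (R (sg v)))"
    by (rule vhol_smult[OF _ vhol_const]) (intro holomorphic_intros)
  have t3: "vhol (\<lambda>s. c (1 / (s - 1)) (R (sg v - (v + v))))"
    by (rule vhol_smult[OF holomorphic_inverse_minus_one vhol_const])
  have t4: "vhol (\<lambda>s. c (s^2) (R (tau (N s v))))"
    by (rule vhol_smult[OF _ vhol_N[OF RL_comm(1)]]) (intro holomorphic_intros, simp add: tau_lin sg_c R_c R_diff c_diff_right)
  have t5: "vhol (\<lambda>s. c (- (s^2 * (1 + s))) (R (sg (R (N s v)))))"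
    by (rule vhol_smult[OF _ vhol_N[OF RL_comm(2)]]) (intro holomorphic_intros, simp add: tau_lin sg_c R_c)
  have Fh: "vhol F"
    unfolding F_def by (rule vhol_add[OF vhol_add[OF vhol_add[OF vhol_add[OF vhol_const t2] t3] t4] t5])
  have "A (\<lambda>s. s^2 / (1 + s)^2) v = - R (sg v - (v + v))"
  proof (rule A_eval[where a = "R v" and b = 0 and F = F])
    show "cls t 1 1 (\<lambda>s. s^2 / (1 + s)^2)" by (rule cls_power_quotient) simp
    show "vhol F" by (rule Fh)
    show "cmod s < 1/2 \<Longrightarrow> cmod (s^2 / (1 + s)^2) \<le> 8 * (cmod s)^2"
      "cmod s > 2 \<Longrightarrow> cmod (s^2 / (1 + s)^2) \<le> 8" for s
      using quotient_bounds[of 2 s] by blast+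
    fix s assume s: "s \<in> Om" "s \<noteq> -1"
    define w p q where "w = 1 + s" and "p = 1 / (s - 1)" and "q = 1 / ((s - 1) * (s + 1))"
    have w0: "w \<noteq> 0" unfolding w_def by (rule one_plus_nonzero[OF s(2)])
    note pf = partial_fractions[OF s(2) holomorphic_Om_ne[OF s(1)], folded w_def p_def q_def]
    let ?E = "R (tau (N s v)) - c w (R (sg (R (N s v))))"
    have "c (s^2 / w^2) (R (N s v)) = c (s^2 / w^2) (R v) + c (s^2 / w^2) (c w (R (sg v))) + c (s^2 / w^2) (c (w^2) ?E)"
      by (subst N_eq2[OF s(1), of v, folded w_def]) (simp only: R_add R_c R_diff c_add_right)
    also have "c (s^2 / w^2) (c w (R (sg v))) = c (s^2 / w) (R (sg v))"
      using w0 by (simp add: c_mult[symmetric] power2_eq_square)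
    also have "c (s^2 / w^2) (c (w^2) ?E) = c (s^2) ?E"
      using w0 by (simp add: c_mult[symmetric])
    also have "c (s^2 / w^2) (R v) + c (s^2 / w) (R (sg v)) + c (s^2) ?E
      = F s + c (1 / w^2) (R v) + c (1 / w^3) 0 - c q (2 *\<^sub>R R (sg v - (v + v)))"
      unfolding pf(1,2) F_def p_def[symmetric] w_def[symmetric]
      by (simp only: c_add_left c_diff_left c_minus_left c_add_right c_diff_right c_mult R_add R_diff scaleR_2 c_1 c_zero_right)
         (simp add: algebra_simps)
    finally show "c (s^2 / (1 + s)^2) (R (N s v))
      = F s + c (1 / (1 + s)^2) (R v) + c (1 / (1 + s)^3) 0 - c (1 / ((s - 1) * (s + 1))) (2 *\<^sub>R R (sg v - (v + v)))"
      unfolding w_def q_def .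
  qed
  then show ?thesis by (simp add: R_add R_diff)
qed

text \<open>The same residue with a triple pole, so one more order of the expansion enters: the
  coefficient of 1/w is \<open>tau\<close> - 2 \<open>sg\<close> + 1.\<close>

lemma A_h0: "A (\<lambda>s. s^2 / (1 + s)^3) v = - R (tau v - (sg v + sg v) + v)"
proof -
  define F where "F = (\<lambda>s. R (sg v - (tau v + tau v)) + c (1 + s) (R (tau v)) + c (1 / (s - 1)) (R (tau v - (sg v + sg v) + v))
      + c (s^2) (R (tau (sg (N s v)) - sg (R (N s v)))) + c (- (s^2 * (1 + s))) (R (tau (R (N s v)))))"
  have t2: "vhol (\<lambda>s. c (1 + s) (R (tau v)))"
    by (rule vhol_smult[OF _ vhol_const]) (intro holomorphic_intros)
  have t3: "vhol (\<lambda>s. c (1 / (s - 1)) (R (tau v - (sg v + sg v) + v)))"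
    by (rule vhol_smult[OF holomorphic_inverse_minus_one vhol_const])
  have t4: "vhol (\<lambda>s. c (s^2) (R (tau (sg (N s v)) - sg (R (N s v)))))"
    by (rule vhol_smult[OF _ vhol_N[OF RL_comm(3)]]) (intro holomorphic_intros, simp add: tau_lin sg_c R_c R_diff c_diff_right)
  have t5: "vhol (\<lambda>s. c (- (s^2 * (1 + s))) (R (tau (R (N s v)))))"
    by (rule vhol_smult[OF _ vhol_N[OF RL_comm(4)]]) (intro holomorphic_intros, simp add: tau_lin sg_c R_c)
  have Fh: "vhol F"
    unfolding F_def by (rule vhol_add[OF vhol_add[OF vhol_add[OF vhol_add[OF vhol_const t2] t3] t4] t5])
  show ?thesis
  proof (rule A_eval[where a = "R (sg v - (v + v))" and b = "R v" and F = F])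
    show "cls t 1 1 (\<lambda>s. s^2 / (1 + s)^3)" by (rule cls_power_quotient) simp
    show "vhol F" by (rule Fh)
    show "cmod s < 1/2 \<Longrightarrow> cmod (s^2 / (1 + s)^3) \<le> 8 * (cmod s)^2"
      "cmod s > 2 \<Longrightarrow> cmod (s^2 / (1 + s)^3) \<le> 8" for s
      using quotient_bounds[of 3 s] by blast+
    fix s assume s: "s \<in> Om" "s \<noteq> -1"
    define w p q where "w = 1 + s" and "p = 1 / (s - 1)" and "q = 1 / ((s - 1) * (s + 1))"
    have w0: "w \<noteq> 0" unfolding w_def by (rule one_plus_nonzero[OF s(2)])
    note pf = partial_fractions[OF s(2) holomorphic_Om_ne[OF s(1)], folded w_def p_def q_def]
    let ?E = "R (tau (sg (N s v)) - sg (R (N s v))) - c w (R (tau (R (N s v))))"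
    have "c (s^2 / w^3) (R (N s v)) = c (s^2 / w^3) (R v) + c (s^2 / w^3) (c w (R (sg v)))
        + c (s^2 / w^3) (c (w^2) (R (tau v))) + c (s^2 / w^3) (c (w^3) ?E)"
      by (subst N_eq3[OF s(1), of v, folded w_def]) (simp only: R_add R_c R_diff c_add_right)
    also have "c (s^2 / w^3) (c w (R (sg v))) = c (s^2 / w^2) (R (sg v))"
      using w0 by (simp add: c_mult[symmetric] power2_eq_square power3_eq_cube)
    also have "c (s^2 / w^3) (c (w^2) (R (tau v))) = c (s^2 / w) (R (tau v))"
      using w0 by (simp add: c_mult[symmetric] power2_eq_square power3_eq_cube)
    also have "c (s^2 / w^3) (c (w^3) ?E) = c (s^2) ?E"
      using w0 by (simp add: c_mult[symmetric])
    also have "c (s^2 / w^3) (R v) + c (s^2 / w^2) (R (sg v)) + c (s^2 / w) (R (tau v)) + c (s^2) ?E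
      = F s + c (1 / w^2) (R (sg v - (v + v))) + c (1 / w^3) (R v) - c q (2 *\<^sub>R R (tau v - (sg v + sg v) + v))"
    proof -
      have sw: "s - 1 = w - 1 - 1" by (simp add: w_def)
      show ?thesis
        unfolding pf F_def p_def[symmetric] w_def[symmetric] unfolding sw
        by (simp only: c_add_left c_diff_left c_minus_left c_add_right c_diff_right c_mult R_add R_diff scaleR_2 c_1 c_zero_right)
         (simp add: algebra_simps)
    qed
    finally show "c (s^2 / (1 + s)^3) (R (N s v))
      = F s + c (1 / (1 + s)^2) (R (sg v - (v + v))) + c (1 / (1 + s)^3) (R v)
        - c (1 / ((s - 1) * (s + 1))) (2 *\<^sub>R R (tau v - (sg v + sg v) + v))"
      unfolding w_def q_def .
  qed
qed

text \<open>The seed of all regularizers: order 2 at 0 and order -1 at infinity put it into the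
  class of \<Psi>^Q, and the real coefficients make it intrinsic.\<close>

definition h0 :: "complex \<Rightarrow> complex" where "h0 s = s^2 / (1 + s)^3"

lemma cls_h0: "cls t 1 0 h0"
  unfolding h0_def[abs_def] by (rule cls_power_quotient) simp

text \<open>The value X (1-X)^2 is T^2 (1+T)^{-3}, as it should be. \<open>Phi_A\<close> reduces it
  to the two residues just computed, and \<open>Y\<close> is cancelled.\<close>

lemma Phi_h0: assumes p: "pr X Y" shows "Phi X h0 v = X (v - (X v + X v) + X (X v))"
proof -
  have py: "pr Y X" by (rule pr_sym[OF p])
  have e: "A (\<lambda>s. (1 + s) * h0 s) v = A (\<lambda>s. s^2 / (1 + s)^2) v"
    by (rule A_cong) (use sec_one_plus(2) angles in \<open>simp add: h0_def power3_eq_cube power2_eq_square\<close>)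
  have e': "A h0 v = A (\<lambda>s. s^2 / (1 + s)^3) v" by (simp add: h0_def[abs_def])
  have "Y (Phi X h0 v) = Y (R (v + v - sg v)) + R (tau v - (sg v + sg v) + v)"
    by (simp only: Phi_A[OF cls_h0 p] e e' A_k0 A_h0 diff_minus_eq_add)
  also have "\<dots> = R (Y v + Y v - Y (sg v) + (tau v - (sg v + sg v) + v))"
    by (simp only: pr_R[OF py] pr_add'[OF py] R_add[symmetric])
  also have "Y v + Y v - Y (sg v) + (tau v - (sg v + sg v) + v) = v - (X v + X v) + X (X v)"
    by (simp add: tau_def pr_add[OF p, symmetric] pr_add'[OF p] pr_add'[OF py] pr_comp[OF p] pr_comp[OF py])
  also have "R (v - (X v + X v) + X (X v)) = Y (X (v - (X v + X v) + X (X v)))" by (simp only: pr_comp[OF py])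
  finally have "Y (Phi X h0 v - X (v - (X v + X v) + X (X v))) = 0" by (simp only: pr_add'[OF py] diff_self)
  from pr_inj[OF py this] show ?thesis by simp
qed

lemma Phi_h0_inj: assumes p: "pr X Y" and "Phi X h0 v = 0" shows "v = 0"
proof -
  have "X (v - (X v + X v) + X (X v)) = 0" using assms(2) Phi_h0[OF p] by simp
  from pr_inj[OF p this] have "X (v - X v) = v - X v" by (simp add: pr_add'[OF p] algebra_simps)
  from pr_inj1[OF p this] have "X v = v" by simp
  from pr_inj1[OF p this] show ?thesis .
qed

text \<open>Order m+2 at 0 and -m-1 at infinity, so a suitable \<open>m\<close> tames any function
  of polynomial growth, while the operator remains injective.\<close>

definition psi :: "nat \<Rightarrow> complex \<Rightarrow> complex" where "psi m s = h0 s * psi1 s ^ m"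

lemma psi_Suc: "psi (Suc m) = (\<lambda>s. psi1 s * psi m s)"
  by (simp add: psi_def fun_eq_iff)

lemma cls_psi: "cls t 1 0 (psi m)"
proof (induction m)
  case 0
  then show ?case using cls_h0 by (simp add: psi_def[abs_def])
next
  case (Suc m)
  show ?case unfolding psi_Suc by (rule cls_psi1[OF cls00[OF Suc]])
qed

lemma Phi_psi_inj:
  assumes p: "pr X Y" shows "Phi X (psi m) v = 0 \<Longrightarrow> v = 0"
proof (induction m)
  case 0
  then have "Phi X h0 v = 0" by (simp add: psi_def[abs_def])
  then show ?case by (rule Phi_h0_inj[OF p])
next
  case (Suc m)
  have "P1 X (Phi X (psi m) v) = P1 X 0"
    using Suc.prems unfolding psi_Suc Phi_psi1[OF cls00[OF cls_psi] p]
    by (simp only: P1_def linear_0[OF bounded_linear.linear[OF pr_bl[OF p]]] diff_self)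
  from P1_inj[OF p this] show ?case by (rule Suc.IH)
qed

end

section \<open>Quaternions and the complex components of slice functions\<close>

lemma vector_4_nth:
  "(vector [a, b, c, d] :: real^4) $ 1 = a" "(vector [a, b, c, d] :: real^4) $ 2 = b"
  "(vector [a, b, c, d] :: real^4) $ 3 = c" "(vector [a, b, c, d] :: real^4) $ 4 = d"
  unfolding vector_def by simp_all

lemma qmk_nth [simp]: "qmk a b c d $ 1 = a" "qmk a b c d $ 2 = b" "qmk a b c d $ 3 = c" "qmk a b c d $ 4 = d"
  by (simp_all add: qmk_def vector_4_nth)

lemma quat_eq_iff: "p = q \<longleftrightarrow> p $ 1 = q $ 1 \<and> p $ 2 = q $ 2 \<and> p $ 3 = q $ 3 \<and> p $ 4 = (q $ 4 :: real)"
  for p q :: quat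
  by (simp add: vec_eq_iff forall_4)

lemma qmul_nth [simp]:
  "qmul p q $ 1 = p$1*q$1 - p$2*q$2 - p$3*q$3 - p$4*q$4"
  "qmul p q $ 2 = p$1*q$2 + p$2*q$1 + p$3*q$4 - p$4*q$3"
  "qmul p q $ 3 = p$1*q$3 - p$2*q$4 + p$3*q$1 + p$4*q$2"
  "qmul p q $ 4 = p$1*q$4 + p$2*q$3 - p$3*q$2 + p$4*q$1"
  by (simp_all add: qmul_def)

lemma q1_nth [simp]: "q1 $ 1 = 1" "q1 $ 2 = 0" "q1 $ 3 = 0" "q1 $ 4 = 0"
  by (simp_all add: q1_def)

lemma qe_simps: "qe 0 = qmk 1 0 0 0" "qe 1 = qmk 0 1 0 0" "qe (Suc 0) = qmk 0 1 0 0" "qe 2 = qmk 0 0 1 0" "qe 3 = qmk 0 0 0 1"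
  by (simp_all add: qe_def)

lemma sum_less_4: "(\<Sum>i<4. g i) = g 0 + g 1 + g 2 + g (3::nat)"
  by (simp add: eval_nat_numeral)

lemma norm_quat: "(norm q)^2 = (q$1)^2 + (q$2)^2 + (q$3)^2 + (q$4 :: real)^2" for q :: quat
  by (simp add: norm_vec_def L2_set_def sum_4 add_nonneg_nonneg)

lemma norm_qmul: "norm (qmul p q) = norm p * norm q"
proof -
  have "(norm (qmul p q))^2 = (norm p * norm q)^2"
    unfolding power_mult_distrib norm_quat by (simp add: power2_eq_square algebra_simps)
  then show ?thesis by (rule power2_eq_imp_eq) auto
qed

lemma qmul_assoc: "qmul (qmul p q) r = qmul p (qmul q r)"
  by (simp add: quat_eq_iff algebra_simps)
lemma qmul_add_left: "qmul (p + q) r = qmul p r + qmul q r"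
  by (simp add: quat_eq_iff algebra_simps)
lemma qmul_add_right: "qmul p (q + r) = qmul p q + qmul p r"
  by (simp add: quat_eq_iff algebra_simps)
lemma qmul_scaleR_left: "qmul (x *\<^sub>R p) q = x *\<^sub>R qmul p q"
  by (simp add: quat_eq_iff algebra_simps)
lemma qmul_scaleR_right: "qmul p (x *\<^sub>R q) = x *\<^sub>R qmul p q"
  by (simp add: quat_eq_iff algebra_simps)
lemma qmul_0 [simp]: "qmul 0 q = 0" "qmul p 0 = 0"
  by (simp_all add: quat_eq_iff)
lemma qmul_q1 [simp]: "qmul q1 q = q" "qmul q q1 = q"
  by (simp_all add: quat_eq_iff)
lemma qmul_sum_right: "qmul p (\<Sum>i\<in>A. g i) = (\<Sum>i\<in>A. qmul p (g i))"
  by (induction A rule: infinite_finite_induct) (simp_all add: qmul_add_right)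

lemma SS_iff: "J \<in> SS \<longleftrightarrow> J$1 = 0 \<and> (J$2)^2 + (J$3)^2 + (J$4)^2 = 1"
proof -
  have "norm J = 1 \<longleftrightarrow> (norm J)^2 = 1" by (simp add: power2_eq_1_iff) (use norm_ge_zero[of J] in linarith)
  then show ?thesis unfolding SS_def norm_quat by auto
qed

lemma SS_uminus: "J \<in> SS \<Longrightarrow> - J \<in> SS" by (simp add: SS_iff)
lemma qe1_SS: "qe 1 \<in> SS" by (simp add: SS_iff qe_simps)

definition qJ :: "quat \<Rightarrow> complex \<Rightarrow> quat" where
  "qJ J z = Re z *\<^sub>R q1 + Im z *\<^sub>R J"

lemma qJ_uminus: "qJ (- J) z = qJ J (cnj z)" by (simp add: qJ_def)

lemma qJ_mult:
  assumes "J \<in> SS" shows "qmul (qJ J z) (qJ J w) = qJ J (z * w)"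
proof -
  have J: "J$1 = 0" "J$2 * J$2 + J$3 * J$3 + J$4 * J$4 = 1"
    using assms by (auto simp: SS_iff power2_eq_square)
  have JJ: "qmul J J = - q1" using J by (simp add: quat_eq_iff algebra_simps)
  show ?thesis
    by (simp add: qJ_def qmul_add_left qmul_add_right qmul_scaleR_left qmul_scaleR_right JJ scaleR_add_left algebra_simps)
qed

lemma qJ_add: "qJ J (z + w) = qJ J z + qJ J w" by (simp add: qJ_def scaleR_add_left)
lemma qJ_nth1: "J \<in> SS \<Longrightarrow> qJ J z $ 1 = Re z" by (simp add: qJ_def SS_iff)

lemma norm_qJ:
  assumes "J \<in> SS" shows "norm (qJ J z) = cmod z"
proof -
  have J: "J$1 = 0" "J$2 * J$2 + J$3 * J$3 + J$4 * J$4 = 1"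
    using assms by (auto simp: SS_iff power2_eq_square)
  have "(norm (qJ J z))^2 = (Re z)^2 + (Im z)^2 * (J$2 * J$2 + J$3 * J$3 + J$4 * J$4)"
    unfolding norm_quat using J(1) by (simp add: qJ_def power2_eq_square algebra_simps)
  also have "\<dots> = (cmod z)^2" by (simp add: J(2) cmod_power2)
  finally show ?thesis by (rule power2_eq_imp_eq) auto
qed

lemma qexp_qJ: "qexp J y = qJ J (cis y)" by (simp add: qexp_def qJ_def)

lemma quat_slice:
  obtains J z where "J \<in> SS" "s = qJ J z" "0 \<le> Im z"
proof -
  define y where "y = sqrt ((s$2)^2 + (s$3)^2 + (s$4)^2)"
  show ?thesis
  proof (cases "y = 0")
    case True
    then have "(s$2)^2 + (s$3)^2 + (s$4)^2 = 0" by (simp add: y_def)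
    then have "s$2 = 0" "s$3 = 0" "s$4 = 0" by (simp_all add: add_nonneg_eq_0_iff)
    then have "s = qJ (qe 1) (of_real (s$1))" by (simp add: quat_eq_iff qJ_def)
    then show ?thesis using that[OF qe1_SS] by simp
  next
    case False
    have y2: "y^2 = (s$2)^2 + (s$3)^2 + (s$4)^2" by (simp add: y_def add_nonneg_nonneg)
    define J where "J = qmk 0 (s$2 / y) (s$3 / y) (s$4 / y)"
    have "J \<in> SS"
      using False by (simp add: SS_iff J_def power_divide y2[symmetric] add_divide_distrib[symmetric])
    moreover have "s = qJ J (Complex (s$1) y)" using False by (simp add: quat_eq_iff qJ_def J_def)
    moreover have "0 \<le> y" by (simp add: y_def add_nonneg_nonneg)
    ultimately show ?thesis using that by simp
  qed
qed

text \<open>Membership is decided by the real part and the norm, and both are preserved by the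
  embedding of the complex plane as a slice.\<close>

lemma sector_qJ:
  assumes J: "J \<in> SS" and t: "0 < t" "t < pi"
  shows "qJ J z \<in> sector t \<longleftrightarrow> z \<in> sec t"
proof
  assume "qJ J z \<in> sector t"
  then obtain r J' y where r: "0 < r" "J' \<in> SS" "\<bar>y\<bar> < t" and e: "qJ J z = r *\<^sub>R qexp J' y"
    unfolding sector_def by blast
  have e': "r *\<^sub>R qexp J' y = qJ J' (rcis r y)" by (simp add: qexp_qJ qJ_def scaleR_add_right)
  have "Re z = Re (rcis r y)" using e e' qJ_nth1[OF J] qJ_nth1[OF r(2)] by metis
  moreover have "cmod z = cmod (rcis r y)" using e e' norm_qJ[OF J] norm_qJ[OF r(2)] by metis
  moreover have "rcis r y \<in> sec t" using r t by (intro rcis_in_sec) auto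
  ultimately show "z \<in> sec t" by (simp add: sec_def)
next
  assume "z \<in> sec t"
  then obtain r y where "0 < r" "\<bar>y\<bar> < t" "z = rcis r y" using sec_rcis t by metis
  moreover have "r *\<^sub>R qexp J y = qJ J (rcis r y)" by (simp add: qexp_qJ qJ_def scaleR_add_right)
  ultimately show "qJ J z \<in> sector t" unfolding sector_def using J by force
qed

lemma slice_dom_iff:
  assumes t: "0 < t" "t < pi" shows "(a, b) \<in> slice_dom t \<longleftrightarrow> Complex a b \<in> sec t"
proof -
  have "(a, b) \<in> slice_dom t \<longleftrightarrow> (\<exists>J\<in>SS. qJ J (Complex a b) \<in> sector t)"
    by (simp add: slice_dom_def qJ_def)
  then show ?thesis using sector_qJ[OF _ t] qe1_SS by blast
qed

definition qc :: "nat \<Rightarrow> quat \<Rightarrow> real" where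
  "qc i q = (if i = 0 then q$1 else if i = 1 then q$2 else if i = 2 then q$3 else q$4)"

lemma qc_sum: "q = (\<Sum>i<4. qc i q *\<^sub>R qe i)"
  by (simp add: sum_less_4 quat_eq_iff qc_def qe_simps)

lemma qc_bl: "bounded_linear (qc i)"
  unfolding qc_def[abs_def]
  by (cases "i = 0"; cases "i = 1"; cases "i = 2") (simp_all add: bounded_linear_vec_nth)

lemma qc_le_norm: "\<bar>qc i q\<bar> \<le> norm q"
  unfolding qc_def by (auto intro: component_le_norm_cart)

text \<open>The values of \<alpha> and \<beta> are expanded in the basis \<open>qe i\<close>, placed
  on the right. Component i is then the complex function \<alpha>_i + \<i> \<beta>_i: the
  Cauchy-Riemann equations make it holomorphic, and the parities of \<alpha> and \<beta> make it
  symmetric. The right-hand units can later be moved onto the vector.\<close>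

definition slice_rep :: "real \<Rightarrow> (quat \<Rightarrow> quat) \<Rightarrow> (nat \<Rightarrow> complex \<Rightarrow> complex) \<Rightarrow> bool" where
  "slice_rep t h H \<longleftrightarrow> (\<forall>i<4. H i holomorphic_on sec t \<and> (\<forall>s\<in>sec t. H i (cnj s) = cnj (H i s))) \<and>
     (\<forall>J\<in>SS. \<forall>z\<in>sec t. h (qJ J z) = (\<Sum>i<4. qmul (qJ J (H i z)) (qe i)))"

definition intrinsic_rep :: "real \<Rightarrow> (quat \<Rightarrow> quat) \<Rightarrow> (complex \<Rightarrow> complex) \<Rightarrow> bool" where
  "intrinsic_rep t h G \<longleftrightarrow> G holomorphic_on sec t \<and> (\<forall>s\<in>sec t. G (cnj s) = cnj (G s)) \<and>
     (\<forall>J\<in>SS. \<forall>z\<in>sec t. h (qJ J z) = qJ J (G z))"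

lemma slice_fun_imp:
  assumes t: "0 < t" "t < pi" and h: "slice_fun intr t h"
  obtains al be H where "\<And>i. H i = (\<lambda>z. Complex (qc i (al (Re z, Im z))) (qc i (be (Re z, Im z))))"
    "\<And>i. H i holomorphic_on sec t" "\<And>i s. s \<in> sec t \<Longrightarrow> H i (cnj s) = cnj (H i s)"
    "\<And>J z. J \<in> SS \<Longrightarrow> z \<in> sec t \<Longrightarrow> h (qJ J z) = al (Re z, Im z) + qmul J (be (Re z, Im z))"
    "intr \<Longrightarrow> (\<forall>z\<in>sec t. is_real_q (al (Re z, Im z)) \<and> is_real_q (be (Re z, Im z)))"
proof -
  from h obtain al be :: "real \<times> real \<Rightarrow> quat" and Da Db where
    D: "\<And>x. x \<in> slice_dom t \<Longrightarrow> (al has_derivative blinfun_apply (Da x)) (at x)"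
       "\<And>x. x \<in> slice_dom t \<Longrightarrow> (be has_derivative blinfun_apply (Db x)) (at x)" and
    P: "\<And>u v. (u, v) \<in> slice_dom t \<Longrightarrow> al (u, - v) = al (u, v) \<and> be (u, - v) = - be (u, v) \<and>
            blinfun_apply (Da (u, v)) (1, 0) = blinfun_apply (Db (u, v)) (0, 1) \<and>
            blinfun_apply (Da (u, v)) (0, 1) = - blinfun_apply (Db (u, v)) (1, 0)" and
    E: "\<And>J u v. J \<in> SS \<Longrightarrow> (u, v) \<in> slice_dom t \<Longrightarrow> h (u *\<^sub>R q1 + v *\<^sub>R J) = al (u, v) + qmul J (be (u, v))" and
    I: "intr \<Longrightarrow> \<forall>x\<in>slice_dom t. is_real_q (al x) \<and> is_real_q (be x)"
    unfolding slice_fun_def by blast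
  have dom: "(Re z, Im z) \<in> slice_dom t" if "z \<in> sec t" for z
    using that slice_dom_iff[OF t] by (simp add: complex_surj)
  define H where "H = (\<lambda>i z. Complex (qc i (al (Re z, Im z))) (qc i (be (Re z, Im z))))"
  show ?thesis
  proof (rule that)
    show "H i = (\<lambda>z. Complex (qc i (al (Re z, Im z))) (qc i (be (Re z, Im z))))" for i by (simp add: H_def)
    show "H i holomorphic_on sec t" for i
    proof (rule holomorphic_onI)
      fix z assume z: "z \<in> sec t"
      let ?x = "(Re z, Im z)"
      define a where "a = qc i (blinfun_apply (Da ?x) (1, 0))"
      define b where "b = qc i (blinfun_apply (Db ?x) (1, 0))"
      have p: "((\<lambda>z. (Re z, Im z)) has_derivative (\<lambda>h. (Re h, Im h))) (at z)"
        by (auto intro!: derivative_eq_intros)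
      have dal: "((\<lambda>z. qc i (al (Re z, Im z))) has_derivative (\<lambda>h. qc i (blinfun_apply (Da ?x) (Re h, Im h)))) (at z)"
        by (rule bounded_linear.has_derivative[OF qc_bl has_derivative_compose[OF p D(1)[OF dom[OF z]]]])
      have dbe: "((\<lambda>z. qc i (be (Re z, Im z))) has_derivative (\<lambda>h. qc i (blinfun_apply (Db ?x) (Re h, Im h)))) (at z)"
        by (rule bounded_linear.has_derivative[OF qc_bl has_derivative_compose[OF p D(2)[OF dom[OF z]]]])
      have lin: "blinfun_apply L (x, y) = x *\<^sub>R blinfun_apply L (1, 0) + y *\<^sub>R blinfun_apply L (0, 1)"
        for L :: "(real \<times> real) \<Rightarrow>\<^sub>L quat" and x y
      proof -
        have "(x, y) = x *\<^sub>R (1, 0) + y *\<^sub>R (0, 1)" by simp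
        then show ?thesis by (metis blinfun.add_right blinfun.scaleR_right)
      qed
      note ql = linear_add[OF bounded_linear.linear[OF qc_bl]] linear_scale[OF bounded_linear.linear[OF qc_bl]]
        linear_neg[OF bounded_linear.linear[OF qc_bl]] linear_diff[OF bounded_linear.linear[OF qc_bl]]
      have 1: "qc i (blinfun_apply (Da ?x) (Re h, Im h)) = Re h * a - Im h * b" for h
        using P[OF dom[OF z]] by (subst lin) (simp add: ql a_def b_def)
      have 2: "qc i (blinfun_apply (Db ?x) (Re h, Im h)) = Re h * b + Im h * a" for h
        using P[OF dom[OF z]] by (subst lin) (simp add: ql a_def b_def)
      have "(H i has_derivative (\<lambda>h. of_real (Re h * a - Im h * b) + \<i> * of_real (Re h * b + Im h * a))) (at z)"
        unfolding H_def Complex_eq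
        using has_derivative_add[OF bounded_linear.has_derivative[OF bounded_linear_of_real dal]
          has_derivative_mult_right[OF bounded_linear.has_derivative[OF bounded_linear_of_real dbe], of \<i>]]
        by (simp only: 1 2)
      moreover have "(\<lambda>h. of_real (Re h * a - Im h * b) + \<i> * of_real (Re h * b + Im h * a)) = (*) (Complex a b)"
        by (auto simp: fun_eq_iff complex_eq_iff algebra_simps)
      ultimately have "(H i has_field_derivative Complex a b) (at z)"
        by (simp add: has_field_derivative_def)
      then show "H i field_differentiable at z within sec t"
        using field_differentiable_at_within field_differentiable_def by blast
    qed
    show "H i (cnj s) = cnj (H i s)" if "s \<in> sec t" for i s
      using P[OF dom[OF that]] linear_neg[OF bounded_linear.linear[OF qc_bl]]
      by (simp add: H_def complex_eq_iff)
    show "h (qJ J z) = al (Re z, Im z) + qmul J (be (Re z, Im z))" if "J \<in> SS" "z \<in> sec t" for J z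
      using E[OF that(1) dom[OF that(2)]] by (simp add: qJ_def)
    show "\<forall>z\<in>sec t. is_real_q (al (Re z, Im z)) \<and> is_real_q (be (Re z, Im z))" if intr
      using I[OF that] dom by blast
  qed
qed

lemma left_slice_rep:
  assumes t: "0 < t" "t < pi" and h: "left_slice t h"
  obtains H where "slice_rep t h H"
proof (rule slice_fun_imp[OF t h])
  fix al be H
  assume H: "\<And>i. H i = (\<lambda>z. Complex (qc i (al (Re z, Im z))) (qc i (be (Re z, Im z))))"
    "\<And>i. H i holomorphic_on sec t" "\<And>i s. s \<in> sec t \<Longrightarrow> H i (cnj s) = cnj (H i s)"
    "\<And>J z. J \<in> SS \<Longrightarrow> z \<in> sec t \<Longrightarrow> h (qJ J z) = al (Re z, Im z) + qmul J (be (Re z, Im z))"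
  have "h (qJ J z) = (\<Sum>i<4. qmul (qJ J (H i z)) (qe i))" if "J \<in> SS" "z \<in> sec t" for J z
  proof -
    have "h (qJ J z) = (\<Sum>i<4. qc i (al (Re z, Im z)) *\<^sub>R qe i) + qmul J (\<Sum>i<4. qc i (be (Re z, Im z)) *\<^sub>R qe i)"
      unfolding H(4)[OF that] by (simp only: qc_sum[symmetric])
    also have "\<dots> = (\<Sum>i<4. qmul (qJ J (H i z)) (qe i))"
      by (simp add: H(1) qJ_def qmul_sum_right qmul_add_left qmul_scaleR_left qmul_scaleR_right sum.distrib)
    finally show ?thesis .
  qed
  then have "slice_rep t h H" unfolding slice_rep_def using H(2,3) by simp
  then show ?thesis by (rule that)
qed

lemma intrinsic_slice_rep:
  assumes t: "0 < t" "t < pi" and h: "intrinsic_slice t h"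
  obtains G where "intrinsic_rep t h G"
proof (rule slice_fun_imp[OF t h])
  fix al be H
  assume H: "\<And>i. H i = (\<lambda>z. Complex (qc i (al (Re z, Im z))) (qc i (be (Re z, Im z))))"
    "\<And>i. H i holomorphic_on sec t" "\<And>i s. s \<in> sec t \<Longrightarrow> H i (cnj s) = cnj (H i s)"
    "\<And>J z. J \<in> SS \<Longrightarrow> z \<in> sec t \<Longrightarrow> h (qJ J z) = al (Re z, Im z) + qmul J (be (Re z, Im z))"
    and r: "True \<Longrightarrow> (\<forall>z\<in>sec t. is_real_q (al (Re z, Im z)) \<and> is_real_q (be (Re z, Im z)))"
  have "h (qJ J z) = qJ J (H 0 z)" if J: "J \<in> SS" and z: "z \<in> sec t" for J z
  proof -
    have e: "q = (q$1) *\<^sub>R q1" if "is_real_q q" for q using that by (simp add: is_real_q_def quat_eq_iff)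
    have "al (Re z, Im z) = Re (H 0 z) *\<^sub>R q1" 
      unfolding H(1) using e[of "al (Re z, Im z)"] r[OF TrueI] z by (simp add: qc_def)
    moreover have "be (Re z, Im z) = Im (H 0 z) *\<^sub>R q1" 
      unfolding H(1) using e[of "be (Re z, Im z)"] r[OF TrueI] z by (simp add: qc_def)
    ultimately show ?thesis unfolding H(4)[OF J z] by (simp add: qJ_def[of J "H 0 z"] qmul_scaleR_right)
  qed
  then have "intrinsic_rep t h (H 0)" unfolding intrinsic_rep_def using H(2,3) by simp
  then show ?thesis by (rule that)
qed

text \<open>Pads an intrinsic function with zero components, as \<open>qe 0\<close> is the unit;
  facts about left slice functions then apply to intrinsic ones.\<close>

definition ext :: "(complex \<Rightarrow> complex) \<Rightarrow> nat \<Rightarrow> complex \<Rightarrow> complex" where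
  "ext G i = (if i = 0 then G else (\<lambda>_. 0))"

lemma ext_simps [simp]: "ext G 0 = G" "i \<noteq> 0 \<Longrightarrow> ext G i = (\<lambda>_. 0)"
  by (simp_all add: ext_def)

lemma intrinsic_rep_ext: "intrinsic_rep t h G \<longleftrightarrow> slice_rep t h (ext G)"
proof -
  have 1: "(\<Sum>i<4. qmul (qJ J (ext G i z)) (qe i)) = qJ J (G z)" for J z
    using qmul_q1(2)[of "qJ J (G z)"] by (simp add: sum_less_4 qe_simps qJ_def[of _ 0] flip: q1_def)
  have 2: "(\<forall>i<4::nat. P i) \<longleftrightarrow> P 0 \<and> P 1 \<and> P 2 \<and> P 3" for P
    by (auto simp: eval_nat_numeral less_Suc_eq)
  show ?thesis unfolding intrinsic_rep_def slice_rep_def 1 2 by auto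
qed

lemma slice_rep_slice_fun:
  assumes t: "0 < t" "t < pi" and h: "slice_rep t h H"
    and intr: "\<And>z i. intr \<Longrightarrow> z \<in> sec t \<Longrightarrow> 0 < i \<Longrightarrow> i < 4 \<Longrightarrow> H i z = 0"
  shows "slice_fun intr t h"
proof -
  have hol: "H i holomorphic_on sec t" if "i < 4" for i using h that unfolding slice_rep_def by blast
  have sym: "H i (cnj s) = cnj (H i s)" if "i < 4" "s \<in> sec t" for i s using h that unfolding slice_rep_def by blast
  have rep: "h (qJ J z) = (\<Sum>i<4. qmul (qJ J (H i z)) (qe i))" if "J \<in> SS" "z \<in> sec t" for J z
    using h that unfolding slice_rep_def by blast
  let ?z = "\<lambda>x. Complex (fst x) (snd x)"
  \<comment> \<open>The derivatives are assembled from the two coordinate maps with the real and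
    imaginary parts of the complex derivative as coefficients, so their continuity reduces to that
    of \<open>deriv (H i)\<close>.\<close>
  define Ba :: "nat \<Rightarrow> (real \<times> real) \<Rightarrow>\<^sub>L quat" where "Ba i = Blinfun (\<lambda>p. fst p *\<^sub>R qe i)" for i
  define Bb :: "nat \<Rightarrow> (real \<times> real) \<Rightarrow>\<^sub>L quat" where "Bb i = Blinfun (\<lambda>p. snd p *\<^sub>R qe i)" for i
  have Ba: "blinfun_apply (Ba i) p = fst p *\<^sub>R qe i" for i p
    unfolding Ba_def by (subst bounded_linear_Blinfun_apply) (auto intro!: bounded_linear_intros)
  have Bb: "blinfun_apply (Bb i) p = snd p *\<^sub>R qe i" for i p
    unfolding Bb_def by (subst bounded_linear_Blinfun_apply) (auto intro!: bounded_linear_intros)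
  define d where "d i x = deriv (H i) (?z x)" for i x
  define al where "al x = (\<Sum>i<4. Re (H i (?z x)) *\<^sub>R qe i)" for x
  define be where "be x = (\<Sum>i<4. Im (H i (?z x)) *\<^sub>R qe i)" for x
  define Da where "Da x = (\<Sum>i<4. Re (d i x) *\<^sub>R Ba i - Im (d i x) *\<^sub>R Bb i)" for x
  define Db where "Db x = (\<Sum>i<4. Im (d i x) *\<^sub>R Ba i + Re (d i x) *\<^sub>R Bb i)" for x
  have dom: "x \<in> slice_dom t \<Longrightarrow> ?z x \<in> sec t" for x
    using slice_dom_iff[OF t, of "fst x" "snd x"] by simp
  have Da': "blinfun_apply (Da x) p = (\<Sum>i<4. Re (?z p * d i x) *\<^sub>R qe i)" for x p
    unfolding Da_def blinfun.sum_left
    by (rule sum.cong[OF refl]) (simp add: Ba Bb blinfun.diff_left blinfun.scaleR_left algebra_simps)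
  have Db': "blinfun_apply (Db x) p = (\<Sum>i<4. Im (?z p * d i x) *\<^sub>R qe i)" for x p
    unfolding Db_def blinfun.sum_left
    by (rule sum.cong[OF refl]) (simp add: Ba Bb blinfun.add_left blinfun.scaleR_left algebra_simps)
  have zd: "(?z has_derivative ?z) (at x)" for x :: "real \<times> real"
    unfolding Complex_eq by (auto intro!: derivative_eq_intros)
  have dH: "((\<lambda>x. H i (?z x)) has_derivative (\<lambda>p. ?z p * d i x)) (at x)"
    if "i < 4" "x \<in> slice_dom t" for i x
    unfolding d_def
    by (rule has_derivative_compose[OF zd has_derivative_holomorphic[OF hol[OF that(1)] open_sec dom[OF that(2)]]])
  have dc: "continuous_on (slice_dom t) (\<lambda>x. d i x)" if "i < 4" for i
    unfolding d_def
  proof (rule continuous_on_compose2[of "sec t" "deriv (H i)" _ ?z])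
    show "continuous_on (sec t) (deriv (H i))"
      by (intro holomorphic_on_imp_continuous_on holomorphic_deriv hol that open_sec)
    show "continuous_on (slice_dom t) ?z" unfolding Complex_eq by (intro continuous_intros)
  qed (use dom in auto)
  have D: "(al has_derivative blinfun_apply (Da x)) (at x) \<and> (be has_derivative blinfun_apply (Db x)) (at x)"
    if x: "x \<in> slice_dom t" for x
  proof
    show "(al has_derivative blinfun_apply (Da x)) (at x)"
      unfolding al_def[abs_def] Da'[abs_def]
      by (rule has_derivative_sum)
         (rule bounded_linear.has_derivative[OF bounded_linear_scaleR_left], rule bounded_linear.has_derivative[OF bounded_linear_Re],
          rule dH[OF _ x], simp)
    show "(be has_derivative blinfun_apply (Db x)) (at x)"
      unfolding be_def[abs_def] Db'[abs_def]
      by (rule has_derivative_sum)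
         (rule bounded_linear.has_derivative[OF bounded_linear_scaleR_left], rule bounded_linear.has_derivative[OF bounded_linear_Im],
          rule dH[OF _ x], simp)
  qed
  have C: "continuous_on (slice_dom t) Da" "continuous_on (slice_dom t) Db"
    unfolding Da_def[abs_def] Db_def[abs_def]
    by (intro continuous_on_sum continuous_on_add continuous_on_diff continuous_on_scaleR continuous_on_Re continuous_on_Im
        continuous_on_const dc; simp)+
  have P: "al (a, - b) = al (a, b) \<and> be (a, - b) = - be (a, b) \<and>
      blinfun_apply (Da (a, b)) (1, 0) = blinfun_apply (Db (a, b)) (0, 1) \<and>
      blinfun_apply (Da (a, b)) (0, 1) = - blinfun_apply (Db (a, b)) (1, 0)" if ab: "(a, b) \<in> slice_dom t" for a b
  proof -
    have s: "H i (Complex a (- b)) = cnj (H i (Complex a b))" if "i < 4" for i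
      using sym[OF that dom[OF ab]] by (simp add: complex_cnj)
    have "al (a, - b) = al (a, b)" unfolding al_def by (rule sum.cong) (simp_all add: s)
    moreover have "be (a, - b) = - be (a, b)" unfolding be_def sum_negf[symmetric] by (rule sum.cong) (simp_all add: s)
    ultimately show ?thesis by (simp add: Da' Db' sum_negf)
  qed
  have V: "h (a *\<^sub>R q1 + b *\<^sub>R J) = al (a, b) + qmul J (be (a, b))" if J: "J \<in> SS" and ab: "(a, b) \<in> slice_dom t" for J a b
  proof -
    have "h (a *\<^sub>R q1 + b *\<^sub>R J) = (\<Sum>i<4. qmul (qJ J (H i (Complex a b))) (qe i))"
      using rep[OF J dom[OF ab]] by (simp add: qJ_def)
    then show ?thesis
      by (simp add: al_def be_def qJ_def qmul_sum_right qmul_add_left qmul_scaleR_left qmul_scaleR_right sum.distrib)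
  qed
  have I: "is_real_q (al x) \<and> is_real_q (be x)" if i: intr and x: "x \<in> slice_dom t" for x
  proof -
    have z: "H 1 (?z x) = 0" "H 2 (?z x) = 0" "H 3 (?z x) = 0" using intr[OF i dom[OF x]] by simp_all
    show ?thesis unfolding al_def be_def sum_less_4 z is_real_q_def by (simp add: qe_simps)
  qed
  show ?thesis
    unfolding slice_fun_def
    by (rule exI[of _ al], rule exI[of _ be], rule exI[of _ Da], rule exI[of _ Db])
       (intro conjI ballI allI impI C D P V I; (assumption | use D P I in blast))
qed

lemma intrinsic_rep_slice_fun:
  assumes t: "0 < t" "t < pi" and h: "intrinsic_rep t h G"
  shows "intrinsic_slice t h"
  using slice_rep_slice_fun[OF t h[unfolded intrinsic_rep_ext], of True] by simp

text \<open>The values at z and at its conjugate on one slice are \<alpha> + J\<beta> and \<alpha> -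
  J\<beta>. Their sum is 2\<alpha>, and J times their difference gives 2\<beta>; components are at
  most the norm.\<close>

lemma slice_rep_component_bound:
  assumes h: "slice_rep t h H" and i: "i < 4" and z: "z \<in> sec t"
  shows "cmod (H i z) \<le> norm (h (qJ (qe 1) z)) + norm (h (qJ (qe 1) (cnj z)))"
proof -
  have cz: "cnj z \<in> sec t" using z by (simp add: sec_def)
  have e: "h (qJ (qe 1) z) = (\<Sum>i<4. qmul (qJ (qe 1) (H i z)) (qe i))"
    "h (qJ (qe 1) (cnj z)) = (\<Sum>i<4. qmul (qJ (qe 1) (cnj (H i z))) (qe i))"
    using h z cz qe1_SS unfolding slice_rep_def by (auto intro!: sum.cong)
  let ?a = "h (qJ (qe 1) z)" and ?b = "h (qJ (qe 1) (cnj z))"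
  have 1: "?a + ?b = 2 *\<^sub>R (\<Sum>i<4. Re (H i z) *\<^sub>R qe i)"
    unfolding e sum_less_4 by (simp add: quat_eq_iff qe_simps qJ_def)
  have 2: "qmul (qe 1) (?b - ?a) = 2 *\<^sub>R (\<Sum>i<4. Im (H i z) *\<^sub>R qe i)"
    unfolding e sum_less_4 by (simp add: quat_eq_iff qe_simps qJ_def)
  have c: "qc i (2 *\<^sub>R (\<Sum>i<4. x i *\<^sub>R qe i)) = 2 * x i" for x
    proof -
    from i have "i = 0 \<or> i = 1 \<or> i = 2 \<or> i = 3" by linarith
    then show ?thesis by (auto simp: sum_less_4 qc_def qe_simps)
  qed
  have "2 * \<bar>Re (H i z)\<bar> \<le> norm (?a + ?b)" using qc_le_norm[of i "?a + ?b"] unfolding 1 c by simp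
  moreover have "2 * \<bar>Im (H i z)\<bar> \<le> norm (?b - ?a)"
    using qc_le_norm[of i "qmul (qe 1) (?b - ?a)"] unfolding norm_qmul[of "qe 1" "?b - ?a"] unfolding 2 c
    using qe1_SS by (simp add: SS_def)
  moreover have "norm (?a + ?b) \<le> norm ?a + norm ?b" by (rule norm_triangle_ineq)
  moreover have "norm (?b - ?a) \<le> norm ?b + norm ?a" by (rule norm_triangle_ineq4)
  ultimately show ?thesis using cmod_le[of "H i z"] by linarith
qed

lemma slice_rep_prod:
  assumes e: "intrinsic_rep t e G" and h: "slice_rep t h H"
  shows "slice_rep t (qprod_fun e h) (\<lambda>i z. G z * H i z)"
  unfolding slice_rep_def qprod_fun_def
proof (intro conjI allI impI ballI)
  fix i :: nat assume "i < 4"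
  then have "H i holomorphic_on sec t" "G holomorphic_on sec t"
    "\<forall>s\<in>sec t. H i (cnj s) = cnj (H i s)" "\<forall>s\<in>sec t. G (cnj s) = cnj (G s)"
    using e h unfolding slice_rep_def intrinsic_rep_def by blast+
  then show "(\<lambda>z. G z * H i z) holomorphic_on sec t"
    and "\<And>s. s \<in> sec t \<Longrightarrow> G (cnj s) * H i (cnj s) = cnj (G s * H i s)"
    by (auto intro: holomorphic_intros)
next
  fix J z assume J: "J \<in> SS" and z: "z \<in> sec t"
  have "e (qJ J z) = qJ J (G z)" "h (qJ J z) = (\<Sum>i<4. qmul (qJ J (H i z)) (qe i))"
    using e h J z unfolding slice_rep_def intrinsic_rep_def by blast+
  then show "qmul (e (qJ J z)) (h (qJ J z)) = (\<Sum>i<4. qmul (qJ J (G z * H i z)) (qe i))"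
    by (simp add: qmul_sum_right qJ_mult[OF J] flip: qmul_assoc)
qed

text \<open>A quaternion is sent to the point of the closed upper half-plane with the same real part
  and the same length of vector part; \<open>G\<close> is evaluated there and its imaginary part is
  put along the direction of the vector part. On the real axis the quotient by 0 has the value 0,
  which is right because symmetry makes \<open>G\<close> real there; below the axis symmetry turns
  G(cnj z) into the conjugate of G(z).\<close>

lemma intrinsic_rep_exists:
  assumes t: "0 < t" "t < pi" and G: "G holomorphic_on sec t" "\<And>s. s \<in> sec t \<Longrightarrow> G (cnj s) = cnj (G s)"
  obtains h where "intrinsic_rep t h G"
proof -
  define Z :: "quat \<Rightarrow> complex" where "Z s = Complex (s$1) (sqrt ((s$2)^2 + (s$3)^2 + (s$4)^2))" for s
  define h :: "quat \<Rightarrow> quat" where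
    "h s = Re (G (Z s)) *\<^sub>R q1 + (Im (G (Z s)) / Im (Z s)) *\<^sub>R qmk 0 (s$2) (s$3) (s$4)" for s
  have "h (qJ J z) = qJ J (G z)" if J: "J \<in> SS" and z: "z \<in> sec t" for J z
  proof -
    have J': "J$1 = 0" "(J$2)^2 + (J$3)^2 + (J$4)^2 = 1" using J by (simp_all add: SS_iff)
    have sq: "((Im z * J$2)^2 + (Im z * J$3)^2 + (Im z * J$4)^2) = (Im z)^2"
      unfolding power_mult_distrib distrib_left[symmetric] J'(2) by simp
    have Z: "Z (qJ J z) = Complex (Re z) \<bar>Im z\<bar>" by (simp add: Z_def qJ_def J' sq)
    have v: "qmk 0 (qJ J z$2) (qJ J z$3) (qJ J z$4) = Im z *\<^sub>R J" by (simp add: quat_eq_iff qJ_def J')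
    have h: "h (qJ J z) = Re (G (Complex (Re z) \<bar>Im z\<bar>)) *\<^sub>R q1 + (Im (G (Complex (Re z) \<bar>Im z\<bar>)) / \<bar>Im z\<bar>) *\<^sub>R (Im z *\<^sub>R J)"
      unfolding h_def Z v by simp
    consider "Im z = 0" | "Im z > 0" | "Im z < 0" by linarith
    then show ?thesis
    proof cases
      case 1
      then have "cnj z = z" by (simp add: complex_eq_iff)
      with G(2)[OF z] have "Im (G z) = 0" by (metis complex_cnj equal_neg_zero complex.sel(2) cnj.simps(2))
      moreover have "Complex (Re z) \<bar>Im z\<bar> = z" using 1 by (simp add: complex_eq_iff)
      ultimately show ?thesis using 1 unfolding h by (simp add: qJ_def)
    next
      case 2
      then have "Complex (Re z) \<bar>Im z\<bar> = z" by (simp add: complex_eq_iff)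
      then show ?thesis using 2 by (simp add: h qJ_def[of _ "G z"])
    next
      case 3
      then have "Complex (Re z) \<bar>Im z\<bar> = cnj z" by (simp add: complex_eq_iff)
      then show ?thesis using 3 by (simp add: h G(2)[OF z] qJ_def[of _ "G z"])
    qed
  qed
  with G show ?thesis using that[of h] unfolding intrinsic_rep_def by blast
qed

section \<open>From quaternionic growth conditions to complex ones and back\<close>

lemma bnd_mult:
  assumes "bnd t p q k" "bnd t p' q' h"
  shows "bnd t (p + p') (q + q') (\<lambda>s. k s * h s)"
proof -
  from assms obtain C D where k: "k holomorphic_on sec t" "\<And>z. z \<in> sec t \<Longrightarrow> cmod (k z) \<le> C * env p q 0 (cmod z)"
    and h: "h holomorphic_on sec t" "\<And>z. z \<in> sec t \<Longrightarrow> cmod (h z) \<le> D * env p' q' 0 (cmod z)"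
    unfolding bnd_def by blast
  have "cmod (k z * h z) \<le> (C * D) * env (p + p') (q + q') 0 (cmod z)" if z: "z \<in> sec t" for z
  proof -
    have "cmod (k z * h z) \<le> (C * env p q 0 (cmod z)) * (D * env p' q' 0 (cmod z))"
      unfolding norm_mult using k(2)[OF z] h(2)[OF z]
      by (intro mult_mono) (auto intro: order_trans[OF norm_ge_zero])
    also have "\<dots> = (C * D) * (env p q 0 (cmod z) * env p' q' 0 (cmod z))" by simp
    finally show ?thesis using env_mult[of "cmod z" p q 0 p' q' 0] sec_nz[OF z] by simp
  qed
  moreover have "(\<lambda>s. k s * h s) holomorphic_on sec t" by (intro holomorphic_intros k h)
  ultimately show ?thesis unfolding bnd_def by blast
qed

lemma bnd_mono:
  assumes "bnd t p q h" "p' \<le> p" "q \<le> q'" shows "bnd t p' q' h"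
proof -
  from assms(1) obtain C where h: "h holomorphic_on sec t" "\<And>z. z \<in> sec t \<Longrightarrow> cmod (h z) \<le> C * env p q 0 (cmod z)"
    unfolding bnd_def by blast
  have "cmod (h z) \<le> \<bar>C\<bar> * env p' q' 0 (cmod z)" if z: "z \<in> sec t" for z
  proof -
    have "cmod (h z) \<le> \<bar>C\<bar> * env p q 0 (cmod z)"
      by (rule order_trans[OF h(2)[OF z]]) (simp add: mult_right_mono env_nonneg)
    also have "\<dots> \<le> \<bar>C\<bar> * env p' q' 0 (cmod z)"
      by (intro mult_left_mono env_mono) (use sec_nz[OF z] assms in auto)
    finally show ?thesis .
  qed
  then show ?thesis using h unfolding bnd_def by blast
qed

lemma bnd_cls:
  assumes "bnd t p q h" "p' < p" "q < q'" shows "cls t p' q' h"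
proof -
  define a where "a = min 1 (min (p - p') (q' - q))"
  have a: "0 < a" "a \<le> 1" "p' + a \<le> p" "q \<le> q' - a" using assms by (auto simp: a_def)
  from bnd_mono[OF assms(1) a(3,4)] obtain C where
    h: "h holomorphic_on sec t" "\<And>z. z \<in> sec t \<Longrightarrow> cmod (h z) \<le> C * env (p' + a) (q' - a) 0 (cmod z)"
    unfolding bnd_def by blast
  have "env (p' + a) (q' - a) 0 = env p' q' a" by (simp add: env_def fun_eq_iff)
  then show ?thesis unfolding cls_def using h a by auto
qed

lemma powr_quotient_le_env:
  assumes r: "0 < r" and "p + a \<le> x" "x - y \<le> q - a" "0 \<le> y"
  shows "r powr x / (1 + r powr y) \<le> env p q a (r::real)"
proof (cases "r \<le> 1")
  case True
  have "r powr x / (1 + r powr y) \<le> r powr x" by (simp add: divide_le_eq add_pos_nonneg algebra_simps)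
  also have "\<dots> \<le> r powr (p + a)" using True assms by (intro powr_mono') auto
  finally show ?thesis using True by (simp add: env_def)
next
  case False
  have "r powr x / (1 + r powr y) \<le> r powr x / r powr y"
    using r by (intro divide_left_mono) (auto simp: add_pos_nonneg)
  also have "\<dots> = r powr (x - y)" by (simp add: powr_diff)
  also have "\<dots> \<le> r powr (q - a)" using False assms by (intro powr_mono) auto
  finally show ?thesis using False by (simp add: env_def)
qed

lemma slice_rep_bound:
  assumes t: "0 < t" "t < pi" and h: "slice_rep t h H" and i: "i < 4"
    and b: "\<And>s. s \<in> sector t \<Longrightarrow> norm (h s) \<le> B (norm s)" and z: "z \<in> sec t"
  shows "cmod (H i z) \<le> 2 * B (cmod z)"
proof -
  have "cnj z \<in> sec t" using z by (simp add: sec_def)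
  with b[of "qJ (qe 1) z"] b[of "qJ (qe 1) (cnj z)"] slice_rep_component_bound[OF h i z] z
  show ?thesis by (simp add: sector_qJ[OF qe1_SS[unfolded One_nat_def] t] norm_qJ[OF qe1_SS[unfolded One_nat_def]])
qed

lemma slice_rep_holomorphic: "slice_rep t h H \<Longrightarrow> i < 4 \<Longrightarrow> H i holomorphic_on sec t"
  unfolding slice_rep_def by blast

lemma slice_rep_sym: "slice_rep t h H \<Longrightarrow> i < 4 \<Longrightarrow> s \<in> sec t \<Longrightarrow> H i (cnj s) = cnj (H i s)"
  unfolding slice_rep_def by blast

lemma bnd_Psi_cls:
  assumes t: "0 < t" "t < pi" and h: "slice_rep t h H" and i: "i < 4" and b: "bnd_Psi t h"
  shows "cls t 0 0 (H i)"
proof -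
  from b obtain a C where a: "0 < a" "0 \<le> C" and
    b: "\<And>s. s \<in> sector t \<Longrightarrow> norm (h s) \<le> C * norm s powr a / (1 + norm s powr (1 + 2 * a))"
    unfolding bnd_Psi_def by blast
  have "cmod (H i z) \<le> (2 * C) * env 0 0 (min 1 a) (cmod z)" if z: "z \<in> sec t" for z
  proof -
    have "cmod (H i z) \<le> 2 * (C * cmod z powr a / (1 + cmod z powr (1 + 2 * a)))"
      by (rule slice_rep_bound[OF t h i b z])
    also have "\<dots> = (2 * C) * (cmod z powr a / (1 + cmod z powr (1 + 2 * a)))" by simp
    also have "\<dots> \<le> (2 * C) * env 0 0 (min 1 a) (cmod z)"
      using a sec_nz[OF z] by (intro mult_left_mono powr_quotient_le_env) auto
    finally show ?thesis .
  qed
  moreover have "0 < min 1 a" "min 1 a \<le> 1" using a by auto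
  ultimately show ?thesis unfolding cls_def using slice_rep_holomorphic[OF h i] by blast
qed

lemma bnd_PsiQ_cls:
  assumes t: "0 < t" "t < pi" and h: "slice_rep t h H" and i: "i < 4" and b: "bnd_PsiQ t h"
  shows "cls t 1 0 (H i)"
proof -
  from b obtain a C where a: "0 < a" "0 \<le> C" and
    b: "\<And>s. s \<in> sector t \<Longrightarrow> norm (h s) \<le> C * norm s powr (1 + a) / (1 + norm s powr (1 + 2 * a))"
    unfolding bnd_PsiQ_def by blast
  have "cmod (H i z) \<le> (2 * C) * env 1 0 (min 1 a) (cmod z)" if z: "z \<in> sec t" for z
  proof -
    have "cmod (H i z) \<le> 2 * (C * cmod z powr (1 + a) / (1 + cmod z powr (1 + 2 * a)))"
      by (rule slice_rep_bound[OF t h i b z])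
    also have "\<dots> = (2 * C) * (cmod z powr (1 + a) / (1 + cmod z powr (1 + 2 * a)))" by simp
    also have "\<dots> \<le> (2 * C) * env 1 0 (min 1 a) (cmod z)"
      using a sec_nz[OF z] by (intro mult_left_mono powr_quotient_le_env) auto
    finally show ?thesis .
  qed
  moreover have "0 < min 1 a" "min 1 a \<le> 1" using a by auto
  ultimately show ?thesis unfolding cls_def using slice_rep_holomorphic[OF h i] by blast
qed

lemma bnd_F_bnd:
  assumes t: "0 < t" "t < pi" and h: "slice_rep t h H" and b: "bnd_F t h"
  obtains a where "\<And>i. i < 4 \<Longrightarrow> bnd t (-a) a (H i)"
proof -
  from b obtain a C where a: "0 < a" "0 \<le> C" and
    b: "\<And>s. s \<in> sector t \<Longrightarrow> norm (h s) \<le> C * (norm s powr a + norm s powr (- a))"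
    unfolding bnd_F_def by blast
  have "bnd t (-a) a (H i)" if i: "i < 4" for i
    unfolding bnd_def
  proof (intro conjI exI ballI)
    fix z assume z: "z \<in> sec t"
    have "cmod (H i z) \<le> 2 * (C * (cmod z powr a + cmod z powr (- a)))"
      by (rule slice_rep_bound[OF t h i b z])
    also have "cmod z powr a + cmod z powr (- a) \<le> 2 * env (-a) a 0 (cmod z)"
    proof (cases "cmod z \<le> 1")
      case True
      then show ?thesis using a sec_nz[OF z] powr_mono'[of "-a" a "cmod z"] by (simp add: env_def)
    next
      case False
      then show ?thesis using a powr_mono[of "-a" a "cmod z"] by (simp add: env_def)
    qed
    finally show "cmod (H i z) \<le> (4 * C) * env (-a) a 0 (cmod z)" using a by (simp add: mult_left_mono)
  qed (rule slice_rep_holomorphic[OF h i])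
  then show ?thesis by (rule that)
qed

text \<open>The right-hand sides are the weights of \<Psi> and \<Psi>^Q with exponent 1, whence the
  3 = 1 + 2. One envelope thus serves both classes.\<close>

lemma env_2_le:
  assumes r: "0 < r"
  shows "env 2 (-2) 0 r \<le> 2 * (r powr 1 / (1 + r powr 3))" "env 2 (-2) 0 r \<le> 2 * (r powr 2 / (1 + r powr 3))"
proof -
  have "env 2 (-2) 0 r * (1 + r powr 3) \<le> 2 * r \<and> env 2 (-2) 0 r * (1 + r powr 3) \<le> 2 * r powr 2"
  proof (cases "r \<le> 1")
    case True
    have "r powr 3 \<le> 1" "r powr 2 \<le> r"
      using True r powr_le1[of 3 r] powr_mono'[of 1 2 r] by auto
    then have "r powr 2 * (1 + r powr 3) \<le> r powr 2 * 2" by (intro mult_left_mono) auto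
    then show ?thesis using True \<open>r powr 2 \<le> r\<close> by (simp add: env_def)
  next
    case False
    have e: "r powr (-2) * (1 + r powr 3) = r powr (-2) + r" using r by (simp only: distrib_left powr_add[symmetric]) simp
    have "r powr (-2) \<le> r" "r powr (-2) \<le> r powr 2" "r \<le> r powr 2"
      using False powr_mono[of "-2" 1 r] powr_mono[of "-2" 2 r] powr_mono[of 1 2 r] by auto
    then show ?thesis using False e by (simp add: env_def)
  qed
  moreover have "0 < 1 + r powr 3" by (simp add: add_pos_nonneg)
  ultimately show "env 2 (-2) 0 r \<le> 2 * (r powr 1 / (1 + r powr 3))" "env 2 (-2) 0 r \<le> 2 * (r powr 2 / (1 + r powr 3))"
    using r by (simp_all add: pos_le_divide_eq)
qed

lemma slice_rep_bnd_Psi: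
  assumes t: "0 < t" "t < pi" and h: "slice_rep t h H" and b: "\<And>i. i < 4 \<Longrightarrow> bnd t 2 (-2) (H i)"
  shows "bnd_Psi t h" "bnd_PsiQ t h"
proof -
  from b have "\<forall>i. \<exists>C. i < 4 \<longrightarrow> (\<forall>z\<in>sec t. cmod (H i z) \<le> C * env 2 (-2) 0 (cmod z))"
    unfolding bnd_def by blast
  then obtain C where C: "\<And>i z. i < 4 \<Longrightarrow> z \<in> sec t \<Longrightarrow> cmod (H i z) \<le> C i * env 2 (-2) 0 (cmod z)"
    by metis
  define D where "D = (\<Sum>i<4::nat. \<bar>C i\<bar>)"
  have D: "0 \<le> D" unfolding D_def by (simp add: sum_nonneg)
  have n: "0 < norm s \<and> norm (h s) \<le> D * env 2 (-2) 0 (norm s)" if s: "s \<in> sector t" for s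
  proof -
    obtain J z where J: "J \<in> SS" and sz: "s = qJ J z" using quat_slice by metis
    have z: "z \<in> sec t" using s sector_qJ[OF J t] sz by simp
    have nq: "norm (qe i) = 1" for i
    proof -
      have "(norm (qe i))^2 = 1^2" unfolding norm_quat by (simp add: qe_def)
      then show ?thesis by (rule power2_eq_imp_eq) auto
    qed
    have "h s = (\<Sum>i<4. qmul (qJ J (H i z)) (qe i))" using h J z sz unfolding slice_rep_def by blast
    then have "norm (h s) \<le> (\<Sum>i<4. norm (qmul (qJ J (H i z)) (qe i)))" by (simp add: norm_sum)
    also have "\<dots> = (\<Sum>i<4. cmod (H i z))" by (simp add: norm_qmul norm_qJ[OF J] nq)
    also have "\<dots> \<le> (\<Sum>i<4. \<bar>C i\<bar> * env 2 (-2) 0 (cmod z))"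
    proof (rule sum_mono)
      fix i :: nat assume "i \<in> {..<4}"
      then show "cmod (H i z) \<le> \<bar>C i\<bar> * env 2 (-2) 0 (cmod z)"
        using C[OF _ z, of i] mult_right_mono[OF abs_ge_self[of "C i"] env_nonneg[of 2 "-2" 0 "cmod z"]] by simp
    qed
    finally show ?thesis using sec_nz[OF z] by (simp add: D_def sum_distrib_right sz norm_qJ[OF J])
  qed
  have "norm (h s) \<le> (2 * D) * norm s powr 1 / (1 + norm s powr (1 + 2 * 1)) \<and>
      norm (h s) \<le> (2 * D) * norm s powr (1 + 1) / (1 + norm s powr (1 + 2 * 1))" if s: "s \<in> sector t" for s
    using order_trans[OF conjunct2[OF n[OF s]] mult_left_mono[OF env_2_le(1)[OF conjunct1[OF n[OF s]]] D]]
      order_trans[OF conjunct2[OF n[OF s]] mult_left_mono[OF env_2_le(2)[OF conjunct1[OF n[OF s]]] D]] by (simp add: mult_ac)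
  moreover have "(0::real) < 1" "0 \<le> 2 * D" using D by auto
  ultimately show "bnd_Psi t h" "bnd_PsiQ t h" unfolding bnd_Psi_def bnd_PsiQ_def by blast+
qed

lemma cls_zero: "cls t p q (\<lambda>s. 0)"
  unfolding cls_def by (intro conjI exI[of _ 1]) (auto simp: env_nonneg)

section \<open>Graph conditions and independence of the regularizer\<close>

context op_calc
begin

lemma csym_psi: "csym (psi m)"
  unfolding csym_def psi_def h0_def psi1_def by simp

lemma bnd_psi: "bnd t (real m + 2) (- real m - 1) (psi m)"
proof (induction m)
  case 0
  then show ?case using power_quotient_bnd[of 3] by (simp add: psi_def[abs_def] h0_def)
next
  case (Suc m)
  then show ?case using bnd_mult[OF bnd_psi1 Suc.IH] by (simp add: psi_Suc algebra_simps)
qed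

lemma psi_function:
  obtains e where "intrinsic_rep t e (psi m)"
  using intrinsic_rep_exists[OF angles_pi(4) angles(4), of "psi m"] csym_psi cls_psi
  unfolding csym_def cls_def by metis

text \<open>For growth exponent \<open>a\<close> the product has order at least m+2-a at 0 and at
  most -m-1+a at infinity. The target is the envelope with exponents 2 and -2, and the second
  requirement is where \<open>a + 1 \<le> real m\<close> comes from.\<close>

lemma regularizer:
  assumes e: "intrinsic_rep t e (psi m)" and m: "1 \<le> m"
    and H: "slice_rep t g H" and b: "\<And>i. i < 4 \<Longrightarrow> bnd t (-a) a (H i)" and am: "a + 1 \<le> real m"
  shows "Psi t e" "PsiQ t e" "PsiL t (qprod_fun e g)" "PsiQL t (qprod_fun e g)"
proof -
  note t = angles_pi(4) angles(4)
  have "bnd t 2 (-2) (ext (psi m) i)" for i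
    using bnd_mono[OF bnd_psi[of m], of 2 "-2"] m by (cases "i = 0") (auto simp: bnd_def env_def intro!: exI[of _ 0])
  from slice_rep_bnd_Psi[OF t e[unfolded intrinsic_rep_ext] this]
  show "Psi t e" "PsiQ t e" using intrinsic_rep_slice_fun[OF t e] by (simp_all add: Psi_def PsiQ_def)
  have "bnd t 2 (-2) (\<lambda>z. psi m z * H i z)" if "i < 4" for i
    using bnd_mono[OF bnd_mult[OF bnd_psi[of m] b[OF that]], of 2 "-2"] am by simp
  from slice_rep_bnd_Psi[OF t slice_rep_prod[OF e H] this]
  show "PsiL t (qprod_fun e g)" "PsiQL t (qprod_fun e g)"
    using slice_rep_slice_fun[OF t slice_rep_prod[OF e H]] by (simp_all add: PsiL_def PsiQL_def)
qed

text \<open>The complex form of a regularizer from \<Psi>^Q; \<open>EP\<close> plays the same role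
  for \<Psi>. Symmetry is included since every commutation rule relies on it.\<close>

definition EQ :: "(complex \<Rightarrow> complex) \<Rightarrow> bool" where
  "EQ h \<longleftrightarrow> cls t 1 0 h \<and> csym h"

lemma EQD: "EQ h \<Longrightarrow> cls t 1 0 h" "EQ h \<Longrightarrow> csym h" "EQ h \<Longrightarrow> cls t 0 0 h" "EQ h \<Longrightarrow> cls t 1 1 h"
  by (auto simp: EQ_def intro: cls00 cls11)

definition EP :: "(complex \<Rightarrow> complex) \<Rightarrow> bool" where
  "EP h \<longleftrightarrow> cls t 0 0 h \<and> csym h"

lemma EQ_EP: "EQ h \<Longrightarrow> EP h" by (simp add: EP_def EQD)

lemma EQ_psi: "EQ (psi m)" by (simp add: EQ_def cls_psi csym_psi)
lemma EQ_mult: "EQ a \<Longrightarrow> EQ b \<Longrightarrow> EQ (\<lambda>s. a s * b s)"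
  by (simp add: EQ_def cls_prod csym_mult)

lemma EQ_A_mult: "EQ a \<Longrightarrow> EQ b \<Longrightarrow> pr X Y \<Longrightarrow> A (\<lambda>s. a s * b s) v = Phi X a (A b v) + A a (Phi Y b v)"
  by (rule product_A) (simp_all add: EQD)
lemma EQ_Phi_mult: "EQ a \<Longrightarrow> EQ b \<Longrightarrow> pr X Y \<Longrightarrow> Phi X (\<lambda>s. a s * b s) v = Phi X a (Phi X b v)"
  by (rule Phi_mult) (simp_all add: EQD)
lemma EQ_A_Phi: "EQ a \<Longrightarrow> EQ k \<Longrightarrow> pr X Y \<Longrightarrow> A k (Phi X a v) = Phi X a (A k v)"
  by (rule Phi_A_commute) (simp_all add: EQD)
lemma EQ_Phi_Phi: "EQ a \<Longrightarrow> EQ b \<Longrightarrow> pr X Y \<Longrightarrow> pr X' Y' \<Longrightarrow> Phi X' b (Phi X a v) = Phi X a (Phi X' b v)"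
  by (rule Phi_Phi_commute) (simp_all add: EQD)

lemma EQ_Phi_linear:
  assumes "EQ a" "pr X Y"
  shows "Phi X a (v + w) = Phi X a v + Phi X a w" "Phi X a (v - w) = Phi X a v - Phi X a w"
    "Phi X a (\<Sum>i\<in>I. z i) = (\<Sum>i\<in>I. Phi X a (z i))"
  using bounded_linear.linear[OF Phi_bl[OF EQD(3)[OF assms(1)] assms(2)]]
  by (auto intro: linear_add linear_diff linear_sum)

lemma EQ_A_linear:
  assumes "EQ a"
  shows "A a (v + w) = A a v + A a w" "A a (v - w) = A a v - A a w"
    "A a (\<Sum>i\<in>I. z i) = (\<Sum>i\<in>I. A a (z i))"
  using bounded_linear.linear[OF A_bl[OF EQD(4)[OF assms]]]
  by (auto intro: linear_add linear_diff linear_sum)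

definition Pinj :: "(complex \<Rightarrow> complex) \<Rightarrow> bool" where
  "Pinj a \<longleftrightarrow> (\<forall>X Y v w. pr X Y \<longrightarrow> Phi X a v = Phi X a w \<longrightarrow> v = w)"

lemma PinjD: "Pinj a \<Longrightarrow> pr X Y \<Longrightarrow> Phi X a v = Phi X a w \<Longrightarrow> v = w"
  unfolding Pinj_def by blast

lemma Pinj_psi: "Pinj (psi m)"
  unfolding Pinj_def
proof (intro allI impI)
  fix X Y v w assume p: "pr X Y" and e: "Phi X (psi m) v = Phi X (psi m) w"
  have "Phi X (psi m) (v - w) = 0" by (simp only: EQ_Phi_linear(2)[OF EQ_psi p] e diff_self)
  from Phi_psi_inj[OF p this] show "v = w" by (simp only: right_minus_eq)
qed

lemma Pinj_mult: assumes a: "EQ a" "Pinj a" and b: "EQ b" "Pinj b" shows "Pinj (\<lambda>s. a s * b s)"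
  unfolding Pinj_def
proof (intro allI impI)
  fix X Y v w assume p: "pr X Y" and e: "Phi X (\<lambda>s. a s * b s) v = Phi X (\<lambda>s. a s * b s) w"
  show "v = w"
    using e unfolding EQ_Phi_mult[OF a(1) b(1) p] by (rule PinjD[OF b(2) p PinjD[OF a(2) p]])
qed

text \<open>\<open>hgr X a H w y\<close> says that \<open>y\<close> is the value at \<open>x\<close> of the \<open>H\<^sup>\<infinity>\<close>-calculus for the function with
  components \<open>H\<close>, where \<open>a\<close> is the regularizer and \<open>w i\<close> stands for \<open>e\<^sub>i x\<close>; \<open>dgr\<close> is the harmonic analogue,
  with separate regularizers \<open>a\<close> for \<open>H\<close> itself and \<open>b\<close> for its image under \<open>D\<close>.\<close>

definition hgr :: "('v \<Rightarrow> 'v) \<Rightarrow> (complex \<Rightarrow> complex) \<Rightarrow> (nat \<Rightarrow> complex \<Rightarrow> complex) \<Rightarrow> (nat \<Rightarrow> 'v) \<Rightarrow> 'v \<Rightarrow> bool" where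
  "hgr X a H w y \<longleftrightarrow> (\<Sum>i<4. Phi X (\<lambda>s. a s * H i s) (w i)) = Phi X a y"

definition dgr :: "('v \<Rightarrow> 'v) \<Rightarrow> ('v \<Rightarrow> 'v) \<Rightarrow> (complex \<Rightarrow> complex) \<Rightarrow> (complex \<Rightarrow> complex) \<Rightarrow>
    (nat \<Rightarrow> complex \<Rightarrow> complex) \<Rightarrow> (nat \<Rightarrow> 'v) \<Rightarrow> 'v \<Rightarrow> bool" where
  "dgr X Y a b H w z \<longleftrightarrow> (\<Sum>i<4. Phi X a (A (\<lambda>s. b s * H i s) (w i)) - A b (Phi X (\<lambda>s. a s * H i s) (w i)))
     = Phi X a (Phi Y b z)"

lemma fun_mult_left_commute: "(\<lambda>s. a s * (b s * h s)) = (\<lambda>s. b s * (a s * h s))" for a b h :: "complex \<Rightarrow> complex"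
  by (simp add: fun_eq_iff)

lemma Phi_swap:
  assumes "EP a" "EP b" "EP (\<lambda>s. a s * h s)" "EP (\<lambda>s. b s * h s)" "pr X Y"
  shows "Phi X a (Phi X (\<lambda>s. b s * h s) v) = Phi X b (Phi X (\<lambda>s. a s * h s) v)"
proof -
  note E = assms(1-4)[unfolded EP_def]
  show ?thesis
    using Phi_mult[of a "\<lambda>s. b s * h s" X Y v] Phi_mult[of b "\<lambda>s. a s * h s" X Y v] E assms(5)
    by (simp add: fun_mult_left_commute[of b a h])
qed

text \<open>By multiplicativity a(T)(bg)(T) = b(T)(ag)(T), and the injective a(T) is then cancelled.
  This frees the argument from the regularizer that the definition of the calculus happens to
  pick.\<close>

lemma hgr_change:
  assumes a: "EP a" "\<And>v w. Phi X a v = Phi X a w \<Longrightarrow> v = w" and b: "EP b" and p: "pr X Y"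
    and H: "\<And>i. i < 4 \<Longrightarrow> EP (\<lambda>s. a s * H i s)" "\<And>i. i < 4 \<Longrightarrow> EP (\<lambda>s. b s * H i s)"
    and h: "hgr X a H w y"
  shows "hgr X b H w y"
proof -
  have l: "Phi X a (\<Sum>i<4. z i) = (\<Sum>i<4. Phi X a (z i))" if "EP a" for a and z :: "nat \<Rightarrow> 'v"
    using that unfolding EP_def by (intro linear_sum bounded_linear.linear Phi_bl[OF _ p]) simp
  have "Phi X a (\<Sum>i<4. Phi X (\<lambda>s. b s * H i s) (w i)) = Phi X b (\<Sum>i<4. Phi X (\<lambda>s. a s * H i s) (w i))"
    unfolding l[OF a(1)] l[OF b]
    by (rule sum.cong[OF refl]) (simp add: Phi_swap[OF a(1) b H p])
  also have "\<dots> = Phi X a (Phi X b y)"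
    using h a(1) b unfolding hgr_def EP_def by (simp only: Phi_Phi_commute[of a X Y b X Y] p)
  finally show ?thesis unfolding hgr_def by (rule a(2))
qed

lemma diff_eq_from_sums:
  fixes p1 :: 'v
  assumes "p1 + a1 = p2 + a2" "r1 + a1 = r2 + a2" shows "p1 - r1 = p2 - r2"
  using arg_cong2[where f = "(-)", OF assms] by simp

text \<open>The integrals \<open>A\<close> of abh at \<open>v\<close> and of ab at u = (ah)(X) v are
  each expanded by \<open>product_A\<close> in the two possible orders of factors. After applying
  \<open>Phi X a\<close> to the first equality, both share the term with \<open>A a\<close>, and
  subtraction removes it.\<close>

lemma dgr_identity:
  assumes a: "EQ a" and b: "EQ b" and h: "EQ (\<lambda>s. a s * h s)" "EQ (\<lambda>s. b s * h s)" and p: "pr X Y"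
  shows "Phi Y a (Phi X a (A (\<lambda>s. b s * h s) v) - A b (Phi X (\<lambda>s. a s * h s) v))
       = Phi Y b (Phi X a (A (\<lambda>s. a s * h s) v) - A a (Phi X (\<lambda>s. a s * h s) v))"
proof -
  let ?ah = "\<lambda>s. a s * h s" and ?bh = "\<lambda>s. b s * h s"
  note q = pr_sym[OF p]
  have 1: "Phi Y a (A ?bh v) + A a (Phi X ?bh v) = Phi Y b (A ?ah v) + A b (Phi X ?ah v)"
    using EQ_A_mult[OF a h(2) q, of v] EQ_A_mult[OF b h(1) q, of v] by (simp add: fun_mult_left_commute[of b a h])
  let ?u = "Phi X ?ah v"
  have 2: "Phi Y a (A b ?u) + A a (Phi X b ?u) = Phi Y b (A a ?u) + A b (Phi X a ?u)"
    using EQ_A_mult[OF a b q, of ?u] EQ_A_mult[OF b a q, of ?u] by (simp add: mult.commute)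
  have "Phi X a (Phi Y a (A ?bh v) + A a (Phi X ?bh v)) = Phi X a (Phi Y b (A ?ah v) + A b (Phi X ?ah v))"
    by (simp only: 1)
  then have 3: "Phi X a (Phi Y a (A ?bh v)) + A a (Phi X a (Phi X ?bh v))
      = Phi X a (Phi Y b (A ?ah v)) + A b (Phi X a ?u)"
    by (simp only: EQ_Phi_linear[OF a p] EQ_A_Phi[OF a a p] EQ_A_Phi[OF a b p])
  have 4: "Phi X a (Phi X ?bh v) = Phi X b ?u" by (rule Phi_swap[OF EQ_EP[OF a] EQ_EP[OF b] EQ_EP[OF h(1)] EQ_EP[OF h(2)] p])
  have 5: "Phi Y a (Phi X a (A ?bh v)) = Phi X a (Phi Y a (A ?bh v))"
    "Phi Y b (Phi X a (A ?ah v)) = Phi X a (Phi Y b (A ?ah v))"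
    by (rule EQ_Phi_Phi[OF a a p q], rule EQ_Phi_Phi[OF a b p q])
  show ?thesis
    unfolding EQ_Phi_linear(2)[OF a q] EQ_Phi_linear(2)[OF b q] 5
    by (rule diff_eq_from_sums[OF 3[unfolded 4] 2])
qed

text \<open>\<open>dgr_identity\<close> says that applying \<open>Phi Y a\<close> on one side
  matches applying \<open>Phi Y b\<close> on the other; injectivity cancels them in either
  direction. The outer regularizer of the harmonic calculus is thereby merged with the inner
  one.\<close>

lemma dgr_diagonal:
  assumes a: "EQ a" "Pinj a" and b: "EQ b" "Pinj b" and p: "pr X Y"
    and H: "\<And>i. i < 4 \<Longrightarrow> EQ (\<lambda>s. a s * H i s)" "\<And>i. i < 4 \<Longrightarrow> EQ (\<lambda>s. b s * H i s)"
  shows "dgr X Y a b H w z \<longleftrightarrow> dgr X Y a a H w z"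
proof -
  note q = pr_sym[OF p]
  let ?L = "\<lambda>b. \<Sum>i<4. Phi X a (A (\<lambda>s. b s * H i s) (w i)) - A b (Phi X (\<lambda>s. a s * H i s) (w i))"
  have 1: "Phi Y a (?L b) = Phi Y b (?L a)"
    unfolding EQ_Phi_linear(3)[OF a(1) q] EQ_Phi_linear(3)[OF b(1) q]
    by (rule sum.cong[OF refl], rule dgr_identity[OF a(1) b(1) H p]) simp_all
  have 2: "Phi Y a (Phi X a (Phi Y b z)) = Phi Y b (Phi X a (Phi Y a z))"
    by (simp only: EQ_Phi_Phi[OF a(1) b(1) p q] EQ_Phi_Phi[OF a(1) a(1) p q] EQ_Phi_Phi[OF a(1) b(1) q q])
  show ?thesis
    unfolding dgr_def
  proof
    assume "?L b = Phi X a (Phi Y b z)"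
    then have "Phi Y b (?L a) = Phi Y b (Phi X a (Phi Y a z))" using 1 2 by simp
    then show "?L a = Phi X a (Phi Y a z)" by (rule PinjD[OF b(2) q])
  next
    assume "?L a = Phi X a (Phi Y a z)"
    then have "Phi Y a (?L b) = Phi Y a (Phi X a (Phi Y b z))" using 1 2 by simp
    then show "?L b = Phi X a (Phi Y b z)" by (rule PinjD[OF a(2) q])
  qed
qed

text \<open>Both sides rearrange the two forms of \<open>product_A\<close>, once for (X,Y) and once
  for (Y,X). It makes the harmonic calculus insensitive to exchanging T and its conjugate.\<close>

lemma Phi_A_swap:
  assumes a: "EQ a" and h: "EQ h" and p: "pr X Y"
  shows "Phi X a (A h v) - A a (Phi X h v) = Phi Y a (A h v) - A a (Phi Y h v)"
  using EQ_A_mult[OF a h p, of v] EQ_A_mult[OF a h pr_sym[OF p], of v] by (simp add: algebra_simps)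

lemma dgr_swap:
  assumes a: "EQ a" and p: "pr X Y" and H: "\<And>i. i < 4 \<Longrightarrow> EQ (\<lambda>s. a s * H i s)" and z: "dgr X Y a a H w z"
  shows "dgr Y X a a H w z"
proof -
  have "(\<Sum>i<4. Phi Y a (A (\<lambda>s. a s * H i s) (w i)) - A a (Phi Y (\<lambda>s. a s * H i s) (w i)))
      = (\<Sum>i<4. Phi X a (A (\<lambda>s. a s * H i s) (w i)) - A a (Phi X (\<lambda>s. a s * H i s) (w i)))"
    by (rule sum.cong[OF refl], rule Phi_A_swap[OF a H pr_sym[OF p]]) simp
  then show ?thesis
    using z unfolding dgr_def by (simp only: EQ_Phi_Phi[OF a a pr_sym[OF p] p])
qed

text \<open>The algebraic heart. With X, Y in the roles of T and conj T, \<open>y1\<close> is g(X) x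
  and \<open>y2\<close> is Dg x, while \<open>z1\<close> and \<open>z2\<close> are Df
  \<open>y1\<close> and f(Y) \<open>y2\<close>, harmonic terms being scaled by -1/2. One regularizer
  \<open>a\<close> belongs to f and one to g, so the square regularizes the product.\<close>

lemma dgr_product:
  assumes a: "EQ a" and p: "pr X Y"
    and F: "EQ (\<lambda>s. a s * F s)" and H: "\<And>i. i < 4 \<Longrightarrow> EQ (\<lambda>s. a s * H i s)"
    and y1: "hgr X a H w y1"
    and z1: "Phi X a (A (\<lambda>s. a s * F s) y1) - A a (Phi X (\<lambda>s. a s * F s) y1) = Phi X a (Phi Y a z1)"
    and y2: "dgr X Y a a H w y2"
    and z2: "Phi Y (\<lambda>s. a s * F s) y2 = Phi Y a z2"
  shows "dgr X Y (\<lambda>s. a s * a s) (\<lambda>s. a s * a s) (\<lambda>i s. F s * H i s) w (z1 + z2)"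
proof -
  note q = pr_sym[OF p]
  let ?aF = "\<lambda>s. a s * F s" and ?aH = "\<lambda>i s. a s * H i s" and ?aa = "\<lambda>s. a s * a s"
  note aa = EQ_mult[OF a a]
  have f: "(\<lambda>s. a s * a s * (F s * H i s)) = (\<lambda>s. ?aF s * ?aH i s)" for i by (simp add: fun_eq_iff mult_ac)
  let ?W = "\<Sum>i<4. A (?aH i) (w i)"
  \<comment> \<open>The condition on \<open>y2\<close>, after the sum of the terms
    \<open>Phi X (?aH i) (w i)\<close> has been replaced by \<open>Phi X a y1\<close>.\<close>
  have W: "Phi X a ?W - A a (Phi X a y1) = Phi X a (Phi Y a y2)"
    using y2 y1 unfolding dgr_def hgr_def
    by (simp only: sum_subtractf EQ_Phi_linear(3)[OF a p, symmetric] EQ_A_linear(3)[OF a, symmetric])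
  have S1: "(\<Sum>i<4. A (\<lambda>s. ?aF s * ?aH i s) (w i)) = Phi Y ?aF ?W + A ?aF (Phi X a y1)"
  proof -
    have "(\<Sum>i<4. A (\<lambda>s. ?aF s * ?aH i s) (w i)) = (\<Sum>i<4. Phi Y ?aF (A (?aH i) (w i)) + A ?aF (Phi X (?aH i) (w i)))"
      by (rule sum.cong[OF refl], rule EQ_A_mult[OF F H q]) simp
    also have "\<dots> = Phi Y ?aF ?W + A ?aF (\<Sum>i<4. Phi X (?aH i) (w i))"
      by (simp only: sum.distrib EQ_Phi_linear(3)[OF F q, symmetric] EQ_A_linear(3)[OF F, symmetric])
    finally show ?thesis using y1 unfolding hgr_def by (simp only:)
  qed
  have S2: "(\<Sum>i<4. Phi X (\<lambda>s. ?aF s * ?aH i s) (w i)) = Phi X ?aF (Phi X a y1)"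
  proof -
    have "(\<Sum>i<4. Phi X (\<lambda>s. ?aF s * ?aH i s) (w i)) = (\<Sum>i<4. Phi X ?aF (Phi X (?aH i) (w i)))"
      by (rule sum.cong[OF refl], rule EQ_Phi_mult[OF F H p]) simp
    then show ?thesis using y1 unfolding hgr_def by (simp only: EQ_Phi_linear(3)[OF F p, symmetric])
  qed
  \<comment> \<open>The expansion yields \<open>?g\<close> on the terms coming from
    \<open>y2\<close> but \<open>?f\<close> on those coming from \<open>y1\<close>. This exchange
    lets the \<open>?g\<close> terms in \<open>A a y1\<close> cancel; it is then used in reverse to
    meet the condition on \<open>z1\<close>.\<close>
  have key: "Phi X a (A ?aF y1) - A a (Phi X ?aF y1) = Phi Y a (A ?aF y1) - A a (Phi Y ?aF y1)"
    by (rule Phi_A_swap[OF a F p])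
  note cA = EQ_A_Phi[OF a a p] EQ_A_Phi[OF a F p] EQ_A_Phi[OF F a p] EQ_A_Phi[OF a a q] EQ_A_Phi[OF a F q] EQ_A_Phi[OF F a q]
  let ?P = "Phi X a" and ?Q = "Phi Y a" and ?f = "Phi X ?aF" and ?g = "Phi Y ?aF"
  have c1: "?Q (?P v) = ?P (?Q v)" "?f (?P v) = ?P (?f v)" "?g (?P v) = ?P (?g v)" "?f (?Q v) = ?Q (?f v)"
    "?g (?Q v) = ?Q (?g v)" for v
    by (rule EQ_Phi_Phi[OF a a p q], rule EQ_Phi_Phi[OF a F p p], rule EQ_Phi_Phi[OF a F p q],
        rule EQ_Phi_Phi[OF a F q p], rule EQ_Phi_Phi[OF a F q q])
  have gW: "?P (?g ?W) = ?P (?g (A a y1)) + ?P (?Q (?g y2))"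
  proof -
    have "?g (?P ?W) = ?g (A a (?P y1) + ?P (?Q y2))" using W by (simp add: algebra_simps)
    then show ?thesis by (simp only: EQ_Phi_linear[OF F q] EQ_Phi_linear[OF a p] c1 cA)
  qed
  have "(\<Sum>i<4. Phi X ?aa (A (\<lambda>s. ?aF s * ?aH i s) (w i)) - A ?aa (Phi X (\<lambda>s. ?aF s * ?aH i s) (w i)))
      = Phi X ?aa (Phi Y ?aF ?W + A ?aF (Phi X a y1)) - A ?aa (Phi X ?aF (Phi X a y1))"
    by (simp only: sum_subtractf EQ_Phi_linear(3)[OF aa p, symmetric] EQ_A_linear(3)[OF aa, symmetric] S1 S2)
  also have "\<dots> = ?P (?P (?g ?W)) + ?P (?P (?P (A ?aF y1))) - (?P (?P (?f (A a y1))) + ?P (?Q (?f (A a y1))))"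
    by (simp only: EQ_Phi_mult[OF a a p] EQ_A_mult[OF a a p] EQ_Phi_linear[OF a p] EQ_Phi_linear[OF a q] c1 cA)
  also have "\<dots> = ?P (?P (?g (A a y1))) + ?P (?P (?Q (?g y2))) + ?P (?P (?P (A ?aF y1))) - (?P (?P (?f (A a y1))) + ?P (?Q (?f (A a y1))))"
    by (simp only: gW EQ_Phi_linear[OF a p])
  also have "\<dots> = ?P (?P (?P (A ?aF y1) - ?f (A a y1))) + ?P (?P (?g (A a y1))) + ?P (?P (?Q (?g y2))) - ?P (?Q (?f (A a y1)))"
    by (simp only: EQ_Phi_linear[OF a p]) (simp only: algebra_simps)
  also have "?P (A ?aF y1) - ?f (A a y1) = ?Q (A ?aF y1) - ?g (A a y1)"
    using key by (simp only: cA)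
  also have "?P (?P (?Q (A ?aF y1) - ?g (A a y1))) + ?P (?P (?g (A a y1))) + ?P (?P (?Q (?g y2))) - ?P (?Q (?f (A a y1)))
      = ?P (?Q (?P (A ?aF y1) - ?f (A a y1))) + ?P (?P (?Q (?g y2)))"
    by (simp only: EQ_Phi_linear[OF a p] EQ_Phi_linear[OF a q] c1) (simp only: algebra_simps)
  also have "?P (A ?aF y1) - ?f (A a y1) = ?P (?Q z1)"
    using z1 by (simp only: cA)
  also have "?P (?Q (?P (?Q z1))) + ?P (?P (?Q (?g y2))) = Phi X ?aa (Phi Y ?aa (z1 + z2))"
    by (simp only: z2 EQ_Phi_mult[OF a a p] EQ_Phi_mult[OF a a q] EQ_Phi_linear[OF a p] EQ_Phi_linear[OF a q] c1)
  finally show ?thesis unfolding dgr_def f .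
qed

lemma RN_ray:
  assumes h: "cls t 1 1 h" and y: "y = f \<or> y = -f"
  shows "(\<lambda>r. R (N (rcis r y) (c (u y * h (rcis r y)) v))) integrable_on {0<..}"
proof -
  have e: "c (- \<i>) (c (cis y) (G h v (rcis r y))) = R (N (rcis r y) (c (u y * h (rcis r y)) v))"
    if "0 < r" for r
    by (simp only: u_def G_def N_c[OF contour_Om[OF that y]] R_c c_mult)
  have "(\<lambda>r. c (- \<i>) (c (cis y) (G h v (rcis r y)))) integrable_on {0<..}"
    using integrable_linear[OF ray_integrable[OF G_ok[OF h y]] c_bounded_linear[of "- \<i>"]] by (simp add: o_def)
  then show ?thesis by (rule integrable_eq) (simp add: e)
qed

lemma Phi_zero: assumes p: "pr X Y" shows "Phi X (\<lambda>s. 0) v = 0"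
proof -
  have "cls t 0 0 (\<lambda>s. psi 0 s - psi 0 s)" using cls_zero by simp
  from Phi_diff_fun[OF cls00[OF cls_psi] cls00[OF cls_psi] this p, of v] show ?thesis by simp
qed

lemma A_zero: "A (\<lambda>s. 0) v = 0"
proof -
  have "EQ (\<lambda>s. 0)" by (simp add: EQ_def csym_def cls_zero)
  from EQ_A_mult[OF this this prS(1), of v] EQ_A_linear(2)[OF this, of 0 0] show ?thesis
    by (simp add: Phi_zero[OF prS(1)] Phi_zero[OF prS(2)])
qed

end

section \<open>Quaternionic operators with commuting components\<close>

locale quat_operator =
  fixes lm rm :: "quat \<Rightarrow> 'v::banach \<Rightarrow> 'v" and Tc :: "nat \<Rightarrow> 'v op" and om th :: real
  assumes tsb: "two_sided_banach lm rm" and kc: "KC lm rm Tc" and om: "0 < om"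
    and injT: "inj_op (opT lm Tc)" and injTb: "inj_op (opT lm (conjC Tc))"
    and type: "type_omega lm Tc om" and typeb: "type_omega lm (conjC Tc) om"
    and th: "om < th" "th < pi"
begin

lemma lm_mult: "lm (qmul a b) v = lm a (lm b v)"
  and lm_add: "lm (a + b) v = lm a v + lm b v"
  and lm_addv: "lm a (v + w) = lm a v + lm a w"
  and lm_real: "lm (r *\<^sub>R q1) v = r *\<^sub>R v"
  and norm_lm: "norm (lm a v) = norm a * norm v"
  using tsb unfolding two_sided_banach_def by simp_all

lemma lm_q1 [simp]: "lm q1 v = v" using lm_real[of 1 v] by simp
lemma lm_0v [simp]: "lm a 0 = 0" using lm_addv[of a 0 0] by simp
lemma lm_0 [simp]: "lm 0 v = 0" using lm_add[of 0 0 v] by simp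
lemma lm_scaleR: "lm (r *\<^sub>R a) v = r *\<^sub>R lm a v"
  using lm_mult[of "r *\<^sub>R q1" a v] by (simp add: qmul_scaleR_left lm_real)
lemma lm_scaleRv: "lm a (r *\<^sub>R v) = r *\<^sub>R lm a v"
  using lm_mult[of a "r *\<^sub>R q1" v] by (simp add: qmul_scaleR_right lm_real lm_scaleR)
lemma lm_minusv: "lm a (- v) = - lm a v" using lm_scaleRv[of a "-1" v] by simp
lemma lm_minus: "lm (- a) v = - lm a v" using lm_scaleR[of "-1" a v] by simp
lemma lm_diffv: "lm a (v - w) = lm a v - lm a w" using lm_addv[of a v "- w"] by (simp add: lm_minusv)

lemma lm_bl: "bounded_linear (lm a)"
  by (rule bounded_linear_intro[where K = "norm a"]) (simp_all add: lm_addv lm_scaleRv norm_lm)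

lemma qe_mult: "qmul (qe 1) (qe 1) = - q1" "qmul (qe 2) (qe 2) = - q1" "qmul (qe 3) (qe 3) = - q1"
  "qmul (qe 1) (qe 2) = qe 3" "qmul (qe 2) (qe 3) = qe 1" "qmul (qe 3) (qe 1) = qe 2"
  "qmul (qe 2) (qe 1) = - qe 3" "qmul (qe 3) (qe 2) = - qe 1" "qmul (qe 1) (qe 3) = - qe 2"
  by (simp_all add: quat_eq_iff qe_simps)

abbreviation "E1 \<equiv> lm (qe 1)"
abbreviation "E2 \<equiv> lm (qe 2)"
abbreviation "E3 \<equiv> lm (qe 3)"

lemma EE: "E1 (E1 v) = - v" "E2 (E2 v) = - v" "E3 (E3 v) = - v"
  "E1 (E2 v) = E3 v" "E2 (E3 v) = E1 v" "E3 (E1 v) = E2 v"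
  "E2 (E1 v) = - E3 v" "E3 (E2 v) = - E1 v" "E1 (E3 v) = - E2 v"
  by (simp_all only: lm_mult[symmetric] qe_mult lm_minus lm_q1)

text \<open>The slice of e_1, the one along which the path of the functional calculi runs.\<close>

definition c :: "complex \<Rightarrow> 'v \<Rightarrow> 'v" where "c z = lm (qJ (qe 1) z)"

lemma complex_module_c: "complex_module c"
proof (rule complex_module.intro)
  have "norm (c a b) \<le> norm a * norm b * 1" for a b
    unfolding c_def norm_lm norm_qJ[OF qe1_SS] by simp
  then have "\<exists>K. \<forall>a b. norm (c a b) \<le> norm a * norm b * K" by blast
  moreover have "c (r *\<^sub>R a) b = r *\<^sub>R c a b" for r a b
    unfolding c_def lm_scaleR[symmetric] by (simp add: qJ_def scaleR_add_right)
  ultimately show "bounded_bilinear c"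
    by (intro bounded_bilinear.intro) (auto simp: c_def qJ_add lm_add lm_addv lm_scaleRv)
  show "c (z * w) v = c z (c w v)" for z w v
    unfolding c_def lm_mult[symmetric] qJ_mult[OF qe1_SS] ..
  show "c 1 v = v" for v by (simp add: c_def qJ_def)
  show "norm (c z v) = cmod z * norm v" for z v
    unfolding c_def norm_lm norm_qJ[OF qe1_SS] ..
qed

sublocale complex_module c by (rule complex_module_c)

definition D :: "'v set" where "D = op_dom (Tc 0)"
definition t :: "nat \<Rightarrow> 'v \<Rightarrow> 'v" where "t i = op_app (Tc i)"
text \<open>The vector part: T is T_0 + \<open>W\<close> and its conjugate is T_0 -
  \<open>W\<close>.\<close>

definition W :: "'v \<Rightarrow> 'v" where "W x = E1 (t 1 x) + E2 (t 2 x) + E3 (t 3 x)"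
definition D2 :: "'v set" where "D2 = domT2 lm Tc"

lemma D_add: "x \<in> D \<Longrightarrow> y \<in> D \<Longrightarrow> x + y \<in> D"
  and D_lm: "x \<in> D \<Longrightarrow> lm a x \<in> D"
  and D_0: "0 \<in> D"
  using kc unfolding KC_def two_sided_linear_op_def right_linear_op_def two_sided_subspace_def D_def
  by (metis zero_less_numeral)+

lemma D_minus: "x \<in> D \<Longrightarrow> - x \<in> D" using D_lm[of x "- q1"] by (simp add: lm_minus)
lemma D_diff: "x \<in> D \<Longrightarrow> y \<in> D \<Longrightarrow> x - y \<in> D" using D_add[of x "- y"] D_minus by simp
lemma D_scaleR: "x \<in> D \<Longrightarrow> r *\<^sub>R x \<in> D" using D_lm[of x "r *\<^sub>R q1"] by (simp add: lm_real)

lemma t_add: "i < 4 \<Longrightarrow> x \<in> D \<Longrightarrow> y \<in> D \<Longrightarrow> t i (x + y) = t i x + t i y"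
  and t_lm: "i < 4 \<Longrightarrow> x \<in> D \<Longrightarrow> t i (lm a x) = lm a (t i x)"
  using kc unfolding KC_def two_sided_linear_op_def right_linear_op_def D_def t_def by metis+

lemma t_minus: "i < 4 \<Longrightarrow> x \<in> D \<Longrightarrow> t i (- x) = - t i x" using t_lm[of i x "- q1"] by (simp add: lm_minus)
lemma t_diff: "i < 4 \<Longrightarrow> x \<in> D \<Longrightarrow> y \<in> D \<Longrightarrow> t i (x - y) = t i x - t i y"
  using t_add[of i x "- y"] D_minus t_minus by simp
lemma t_scaleR: "i < 4 \<Longrightarrow> x \<in> D \<Longrightarrow> t i (r *\<^sub>R x) = r *\<^sub>R t i x"
  using t_lm[of i x "r *\<^sub>R q1"] by (simp add: lm_real)

lemma T_app: "op_app (opT lm Tc) x = t 0 x + W x"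
  by (simp add: opT_def op_app_def[of "(_, _)"] sum_less_4 W_def t_def qe_def[of 0] flip: q1_def)
lemma Tb_app: "op_app (opT lm (conjC Tc)) x = t 0 x - W x"
  by (simp add: opT_def op_app_def[of "(_, _)"] sum_less_4 W_def t_def qe_def[of 0] conjC_def op_neg_def lm_minusv flip: q1_def)
lemma Tbb_app: "op_app (opT lm (conjC (conjC Tc))) x = t 0 x + W x"
  by (simp add: opT_def op_app_def[of "(_, _)"] sum_less_4 W_def t_def qe_def[of 0] conjC_def op_neg_def lm_minusv flip: q1_def)
lemma T_dom: "op_dom (opT lm Tc) = D" "op_dom (opT lm (conjC Tc)) = D"
  by (simp_all add: opT_def op_dom_def D_def conjC_def)

lemma D2_iff: "x \<in> D2 \<longleftrightarrow> x \<in> D \<and> t 0 x + W x \<in> D"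
  by (simp add: D2_def domT2_def op_comp_def op_dom_def[of "(_, _)"] T_dom T_app)
lemma D2b_iff: "x \<in> domT2 lm (conjC Tc) \<longleftrightarrow> x \<in> D \<and> t 0 x - W x \<in> D"
  by (simp add: domT2_def op_comp_def op_dom_def[of "(_, _)"] T_dom Tb_app)

lemma D2_t: "i < 4 \<Longrightarrow> x \<in> D2 \<Longrightarrow> t i x \<in> D"
  and t_t: "i < 4 \<Longrightarrow> j < 4 \<Longrightarrow> x \<in> D2 \<Longrightarrow> t i (t j x) = t j (t i x)"
proof -
  assume i: "i < 4" and x: "x \<in> D2"
  have "domT2 lm Tc \<subseteq> op_dom (op_comp (Tc 0) (Tc i))" using kc i unfolding KC_def by (metis zero_less_numeral)
  then show "t i x \<in> D" using x by (auto simp: D2_def op_comp_def op_dom_def D_def t_def)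
next
  assume "i < 4" "j < 4" "x \<in> D2"
  then show "t i (t j x) = t j (t i x)" using kc unfolding KC_def D2_def t_def by metis
qed

lemma D2_D: "x \<in> D2 \<Longrightarrow> x \<in> D" by (simp add: D2_iff)
lemma D2_W: "x \<in> D2 \<Longrightarrow> W x \<in> D" by (simp add: W_def D_add D_lm D2_t)
lemma D2_sub: "x \<in> D2 \<Longrightarrow> x \<in> domT2 lm (conjC Tc)" by (simp add: D2b_iff D2_D D_diff D2_t D2_W)

lemma W_add: "x \<in> D \<Longrightarrow> y \<in> D \<Longrightarrow> W (x + y) = W x + W y"
  by (simp add: W_def t_add lm_addv)
lemma W_minus: "x \<in> D \<Longrightarrow> W (- x) = - W x"
  by (simp add: W_def t_minus lm_minusv)
lemma W_diff: "x \<in> D \<Longrightarrow> y \<in> D \<Longrightarrow> W (x - y) = W x - W y"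
  using W_add[of x "- y"] W_minus D_minus by simp
lemma W_scaleR: "x \<in> D \<Longrightarrow> W (r *\<^sub>R x) = r *\<^sub>R W x"
  by (simp add: W_def t_scaleR lm_scaleRv scaleR_add_right)

lemma t0_W: assumes x: "x \<in> D2" shows "t 0 (W x) = W (t 0 x)"
  unfolding W_def using x
  by (simp add: t_add t_lm D_add D_lm D2_t t_t[of 0 _ x])

text \<open>The mixed products cancel because the units anticommute while the components commute.
  Hence |T|^2 = T_0^2 - \<open>W\<close>^2, so that \<open>Q\<close> becomes a difference of
  squares.\<close>

lemma W_W: assumes x: "x \<in> D2" shows "W (W x) = - (t 1 (t 1 x) + t 2 (t 2 x) + t 3 (t 3 x))"
proof -
  have "t j (W x) = E1 (t j (t 1 x)) + E2 (t j (t 2 x)) + E3 (t j (t 3 x))" if "j < 4" for j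
    unfolding W_def using x that by (simp add: t_add t_lm D_add D_lm D2_t)
  then have "W (W x) = E1 (E1 (t 1 (t 1 x)) + E2 (t 1 (t 2 x)) + E3 (t 1 (t 3 x)))
     + E2 (E1 (t 2 (t 1 x)) + E2 (t 2 (t 2 x)) + E3 (t 2 (t 3 x)))
     + E3 (E1 (t 3 (t 1 x)) + E2 (t 3 (t 2 x)) + E3 (t 3 (t 3 x)))" unfolding W_def[of "W x"] by simp
  moreover have tc: "t 2 (t 1 x) = t 1 (t 2 x)" "t 3 (t 1 x) = t 1 (t 3 x)" "t 3 (t 2 x) = t 2 (t 3 x)"
    by (rule t_t[OF _ _ x]; simp)+
  ultimately show ?thesis
    unfolding lm_addv EE tc by simp
qed

definition Q :: "quat \<Rightarrow> 'v \<Rightarrow> 'v" where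
  "Q s x = lm (qmul s s) x - 2 *\<^sub>R lm s (t 0 x) + (t 0 (t 0 x) + t 1 (t 1 x) + t 2 (t 2 x) + t 3 (t 3 x))"

lemma Q_app: "op_app (Qop lm Tc s) x = Q s x"
  by (simp add: Qop_def op_app_def[of "(_, _)"] sum_less_4 Q_def t_def)
lemma Qb_app: "x \<in> D2 \<Longrightarrow> op_app (Qop lm (conjC Tc) s) x = Q s x"
  using D2_t[of _ x] t_minus
  by (simp add: Qop_def op_app_def[of "(_, _)"] sum_less_4 Q_def conjC_def op_neg_def flip: t_def)

text \<open>At s = -1, \<open>Q\<close> is (1 + T_0)^2 - \<open>W\<close>^2, and since T_0 commutes
  with \<open>W\<close> it factors in either order.\<close>

lemma Q_factor:
  assumes x: "x \<in> D2" and y: "y = x + t 0 x + W x" "y' = x + t 0 x - W x"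
  shows "y + t 0 y - W y = Q (- q1) x" "y' + t 0 y' + W y' = Q (- q1) x"
proof -
  have m: "qmul (- q1) (- q1) = q1" by (simp add: quat_eq_iff)
  have d: "x \<in> D" "t 0 x \<in> D" "W x \<in> D" using D2_D[OF x] D2_t[OF _ x] D2_W[OF x] by auto
  have 0: "(0::nat) < 4" by simp
  show "y + t 0 y - W y = Q (- q1) x" "y' + t 0 y' + W y' = Q (- q1) x"
    unfolding y Q_def m lm_minus lm_q1
    using d by (simp_all add: t_add t_diff W_add W_diff D_add D_diff t0_W[OF x] W_W[OF x] scaleR_2 algebra_simps)
qed

lemma sector_closure:
  assumes w: "0 < w" "w < pi" and s: "s \<in> closure (sector w)" shows "norm s * cos w \<le> s $ 1"
proof -
  have "closure (sector w) \<subseteq> {s. norm s * cos w \<le> s $ 1}"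
  proof (rule closure_minimal)
    show "sector w \<subseteq> {s. norm s * cos w \<le> s $ 1}"
    proof
      fix s assume s: "s \<in> sector w"
      obtain J z where J: "J \<in> SS" and sz: "s = qJ J z" using quat_slice by metis
      then have "z \<in> sec w" using s sector_qJ[OF J w] by simp
      then show "s \<in> {s. norm s * cos w \<le> s $ 1}" by (simp add: sz norm_qJ[OF J] qJ_nth1[OF J] sec_def)
    qed
    show "closed {s :: quat. norm s * cos w \<le> s $ 1}" by (intro closed_Collect_le continuous_intros)
  qed
  then show ?thesis using s by blast
qed

text \<open>The midpoint of \<open>om\<close> and the contour angle. The type condition is invoked
  at this angle, so that resolvents and bounds are available on an open set around the
  contour.\<close>

definition f0 :: real where "f0 = (3 * om + th) / 4"
definition f :: real where "f = path_angle om th"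

lemma f0: "om < f0" "f0 < f" "f < th" "0 < f0" "f0 < pi" "om < pi" "f0 < th"
  using om th by (simp_all add: f0_def f_def path_angle_def)

lemma outside:
  assumes "s $ 1 < norm s * cos f0"
  shows "s \<in> rhoS lm Tc" "s \<in> rhoS lm (conjC Tc)" "s \<in> UNIV - sector f0 - {0}"
proof -
  have "cos f0 \<le> cos om" using f0 om by (intro cos_monotone_0_pi_le) auto
  then have "norm s * cos f0 \<le> norm s * cos om" by (intro mult_left_mono) auto
  then have "s \<notin> closure (sector om)" using sector_closure[OF om f0(6)] assms by force
  then show "s \<in> rhoS lm Tc" "s \<in> rhoS lm (conjC Tc)"
    using type typeb unfolding type_omega_def sigmaS_def by blast+
  have "s \<notin> sector f0" using sector_closure[OF f0(4,5), of s] assms closure_subset by force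
  then show "s \<in> UNIV - sector f0 - {0}" using assms by auto
qed

abbreviation out :: "quat \<Rightarrow> bool" where "out s \<equiv> s $ 1 < norm s * cos f0"

lemma out_m1: "out (- q1)"
proof -
  have "norm q1 = 1" using norm_qJ[OF qe1_SS, of 1] by (simp add: qJ_def)
  then show ?thesis using f0 cos_monotone_0_pi[of f0 pi] by simp
qed

text \<open>For \<open>x\<close> in the domain of the squared conjugate, surjectivity of Q(T)
  provides \<open>y\<close> in \<open>D2\<close> with the same image. On \<open>D2\<close> the two
  versions of Q coincide, and injectivity of the conjugate one gives x = y.\<close>

lemma D2b: "domT2 lm (conjC Tc) = D2"
proof
  show "D2 \<subseteq> domT2 lm (conjC Tc)" using D2_sub by blast
  show "domT2 lm (conjC Tc) \<subseteq> D2"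
  proof
    fix x assume x: "x \<in> domT2 lm (conjC Tc)"
    let ?Q = "op_app (Qop lm Tc (- q1))" and ?Qb = "op_app (Qop lm (conjC Tc) (- q1))"
    have b: "bij_betw ?Q D2 UNIV" "bij_betw ?Qb (domT2 lm (conjC Tc)) UNIV"
      using outside[OF out_m1] by (simp_all add: rhoS_def D2_def)
    obtain y where y: "y \<in> D2" "?Q y = ?Qb x" using b(1) unfolding bij_betw_def by (metis UNIV_I imageE)
    then have "?Qb y = ?Qb x" by (simp add: Q_app Qb_app)
    then have "y = x" using b(2) x D2_sub[OF y(1)] unfolding bij_betw_def by (metis inj_onD)
    then show "x \<in> D2" using y by simp
  qed
qed

definition Qi :: "quat \<Rightarrow> 'v \<Rightarrow> 'v" where "Qi s = Qinv lm Tc s"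

lemma bijQ: "out s \<Longrightarrow> bij_betw (Q s) D2 UNIV"
  using outside(1)[of s] by (simp add: rhoS_def D2_def Q_app[abs_def])

lemma Qi_D2: "out s \<Longrightarrow> Qi s v \<in> D2"
  using bijQ[of s] unfolding Qi_def Qinv_def Q_app[abs_def] D2_def[symmetric] bij_betw_def by (metis UNIV_I inv_into_into)
lemma Q_Qi: "out s \<Longrightarrow> Q s (Qi s v) = v"
  using bijQ[of s] unfolding Qi_def Qinv_def Q_app[abs_def] D2_def[symmetric] bij_betw_def by (metis UNIV_I f_inv_into_f)
lemma Qi_Q: "out s \<Longrightarrow> x \<in> D2 \<Longrightarrow> Qi s (Q s x) = x"
  using bijQ[of s] unfolding Qi_def Qinv_def Q_app[abs_def] D2_def[symmetric] bij_betw_def by (metis inv_into_f_f)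

lemma Qib: assumes s: "out s" shows "Qinv lm (conjC Tc) s v = Qi s v"
proof -
  have b: "bij_betw (op_app (Qop lm (conjC Tc) s)) D2 UNIV"
    using outside(2)[OF s] by (simp add: rhoS_def D2b)
  have "op_app (Qop lm (conjC Tc) s) (Qi s v) = v" using Qb_app[OF Qi_D2[OF s]] Q_Qi[OF s] by simp
  then show ?thesis using b Qi_D2[OF s] unfolding Qinv_def D2b bij_betw_def by (metis inv_into_f_f)
qed


section \<open>Bounded inverses of 1+T and 1+conj T\<close>

declare One_nat_def [simp del]

lemma D2_add: "x \<in> D2 \<Longrightarrow> y \<in> D2 \<Longrightarrow> x + y \<in> D2"
  by (simp add: D2_iff D_add t_add W_add) (metis D_add add.assoc add.left_commute)

lemma D2_lm: assumes x: "x \<in> D2" shows "lm a x \<in> D2"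
proof -
  have "W (lm a x) \<in> D" unfolding W_def by (simp add: t_lm D_lm D_add D2_D[OF x] D2_t[OF _ x])
  then show ?thesis by (simp add: D2_iff D_lm D_add t_lm D2_D[OF x] D2_t[OF _ x])
qed

lemma Q_add: "x \<in> D2 \<Longrightarrow> y \<in> D2 \<Longrightarrow> Q s (x + y) = Q s x + Q s y"
  by (simp add: Q_def t_add D2_t D2_D lm_addv scaleR_add_right)

lemma Q_lm:
  assumes x: "x \<in> D2" and a: "qmul a s = qmul s a" shows "Q s (lm a x) = lm a (Q s x)"
proof -
  have "qmul (qmul s s) a = qmul a (qmul s s)" by (metis a qmul_assoc)
  then show ?thesis
    by (simp add: Q_def t_lm D2_t[OF _ x] D2_D[OF x] x lm_addv lm_diffv lm_scaleRv a flip: lm_mult)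
qed

lemma Qi_add: assumes s: "out s" shows "Qi s (v + w) = Qi s v + Qi s w"
  using Qi_Q[OF s D2_add[OF Qi_D2[OF s, of v] Qi_D2[OF s, of w]]] by (simp add: Q_add Qi_D2 Q_Qi s)
lemma Qi_lm: assumes s: "out s" and a: "qmul a s = qmul s a" shows "Qi s (lm a v) = lm a (Qi s v)"
  using Qi_Q[OF s D2_lm[OF Qi_D2[OF s, of v], of a]] by (simp add: Q_lm[OF Qi_D2[OF s] a] Q_Qi s)

text \<open>The point -1 is real, so this inverse commutes with every left multiplication, whereas
  \<open>Qi s\<close> does so only for scalars commuting with s.\<close>

definition Ri :: "'v \<Rightarrow> 'v" where "Ri v = Qi (- q1) v"

lemma Ri_D2: "Ri v \<in> D2" unfolding Ri_def by (rule Qi_D2[OF out_m1])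
lemma Q_Ri: "Q (- q1) (Ri v) = v" unfolding Ri_def by (rule Q_Qi[OF out_m1])
lemma Ri_Q: "x \<in> D2 \<Longrightarrow> Ri (Q (- q1) x) = x" unfolding Ri_def by (rule Qi_Q[OF out_m1])
lemma Ri_add: "Ri (v + w) = Ri v + Ri w" unfolding Ri_def by (rule Qi_add[OF out_m1])
lemma Ri_lm: "Ri (lm a v) = lm a (Ri v)"
  unfolding Ri_def by (rule Qi_lm[OF out_m1]) (simp add: quat_eq_iff)
lemma Ri_minus: "Ri (- v) = - Ri v" using Ri_lm[of "- q1" v] by (simp add: lm_minus)
lemma Ri_diff: "Ri (v - w) = Ri v - Ri w" using Ri_add[of v "- w"] by (simp add: Ri_minus)
lemma Ri_scaleR: "Ri (r *\<^sub>R v) = r *\<^sub>R Ri v" using Ri_lm[of "r *\<^sub>R q1" v] by (simp add: lm_real)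

lemmas Ri_D = D2_D[OF Ri_D2]
lemmas Ri_t = D2_t[OF _ Ri_D2]
lemmas Ri_W = D2_W[OF Ri_D2]

text \<open>\<open>P1\<close> is 1+T and \<open>P2\<close> is 1+conj T; on \<open>D2\<close> they
  compose to \<open>Q (- q1)\<close>.\<close>

definition P1 :: "'v \<Rightarrow> 'v" where "P1 x = x + t 0 x + W x"
definition P2 :: "'v \<Rightarrow> 'v" where "P2 x = x + t 0 x - W x"

lemma P_D: "x \<in> D2 \<Longrightarrow> P1 x \<in> D" "x \<in> D2 \<Longrightarrow> P2 x \<in> D"
  by (simp_all add: P1_def P2_def D_add D_diff D2_D D2_t D2_W)
lemma P_Q: "x \<in> D2 \<Longrightarrow> P2 (P1 x) = Q (- q1) x" "x \<in> D2 \<Longrightarrow> P1 (P2 x) = Q (- q1) x"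
  using Q_factor[OF _ P1_def P2_def] by (auto simp: P1_def[of "P2 x"] P2_def[of "P1 x"])

text \<open>\<open>P2\<close> maps \<open>P1 x\<close> into the domain, which places
  \<open>P1 x\<close> in the domain of the squared conjugate, and this is \<open>D2\<close> by
  \<open>D2b\<close>. For \<open>P2 x\<close> the domain of T^2 appears directly.\<close>

lemma P_D2: assumes x: "x \<in> D2" and q: "Q (- q1) x \<in> D" shows "P1 x \<in> D2" "P2 x \<in> D2"
proof -
  have "t 0 (P1 x) - W (P1 x) = Q (- q1) x - P1 x" using P_Q(1)[OF x] by (simp add: P2_def[of "P1 x"] algebra_simps)
  then have "P1 x \<in> domT2 lm (conjC Tc)" unfolding D2b_iff using P_D(1)[OF x] q by (simp add: D_diff)
  then show "P1 x \<in> D2" by (simp add: D2b)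
  have "t 0 (P2 x) + W (P2 x) = Q (- q1) x - P2 x" using P_Q(2)[OF x] by (simp add: P1_def[of "P2 x"] algebra_simps)
  then show "P2 x \<in> D2" unfolding D2_iff using P_D(2)[OF x] q by (simp add: D_diff)
qed

text \<open>Associativity: (P1 P2) P1 = P1 (P2 P1) says that \<open>P1\<close> commutes with Q,
  provided the domains fit; this is ensured by \<open>P_D2\<close>, since Q takes
  \<open>Ri y\<close> back to \<open>y\<close> in the domain.\<close>

lemma Ri_P: assumes y: "y \<in> D" shows "Ri (P1 y) = P1 (Ri y)" "Ri (P2 y) = P2 (Ri y)"
proof -
  have q: "Q (- q1) (Ri y) \<in> D" using y by (simp add: Q_Ri)
  have "Q (- q1) (P1 (Ri y)) = P1 (P2 (P1 (Ri y)))" using P_Q(2)[OF P_D2(1)[OF Ri_D2 q]] by simp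
  then have "Q (- q1) (P1 (Ri y)) = P1 y" by (simp add: P_Q(1)[OF Ri_D2] Q_Ri)
  then show "Ri (P1 y) = P1 (Ri y)" using Ri_Q[OF P_D2(1)[OF Ri_D2 q]] by simp
  have "Q (- q1) (P2 (Ri y)) = P2 (P1 (P2 (Ri y)))" using P_Q(1)[OF P_D2(2)[OF Ri_D2 q]] by simp
  then have "Q (- q1) (P2 (Ri y)) = P2 y" by (simp add: P_Q(2)[OF Ri_D2] Q_Ri)
  then show "Ri (P2 y) = P2 (Ri y)" using Ri_Q[OF P_D2(2)[OF Ri_D2 q]] by simp
qed

lemma Ri_W_commute: assumes y: "y \<in> D" shows "Ri (W y) = W (Ri y)"
proof -
  have "Ri (P1 y - P2 y) = P1 (Ri y) - P2 (Ri y)" by (simp add: Ri_diff Ri_P[OF y])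
  then have "Ri (2 *\<^sub>R W y) = 2 *\<^sub>R W (Ri y)" by (simp add: P1_def P2_def scaleR_2 algebra_simps)
  then show ?thesis by (simp only: Ri_scaleR) simp
qed

lemma Ri_t0_commute: assumes y: "y \<in> D" shows "Ri (t 0 y) = t 0 (Ri y)"
  using Ri_P(1)[OF y] Ri_W_commute[OF y] by (simp add: P1_def Ri_add)

text \<open>The components of the operator are recovered from its vector part by conjugation with the units.\<close>

lemma t_from_W:
  assumes x: "x \<in> D"
  shows "(2::real) *\<^sub>R t 1 x = - E1 (W x) - W (E1 x)" "(2::real) *\<^sub>R t 2 x = - E2 (W x) - W (E2 x)"
    "(2::real) *\<^sub>R t 3 x = - E3 (W x) - W (E3 x)"
  using x by (simp_all add: W_def t_lm lm_addv EE lm_minusv scaleR_2)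

lemma Ri_t_commute: assumes y: "y \<in> D" and i: "i < 4" shows "Ri (t i y) = t i (Ri y)"
proof -
  have "i = 0 \<or> i = 1 \<or> i = 2 \<or> i = 3" using i by linarith
  moreover have "Ri (2 *\<^sub>R t j y) = 2 *\<^sub>R t j (Ri y)" if j: "j = 1 \<or> j = 2 \<or> j = 3" for j
    using j by (auto simp only: t_from_W[OF y] t_from_W[OF Ri_D] Ri_diff Ri_minus Ri_lm Ri_W_commute y D_lm)
  then have "Ri (t j y) = t j (Ri y)" if "j = 1 \<or> j = 2 \<or> j = 3" for j
    using that unfolding Ri_scaleR by (metis real_vector.scale_left_imp_eq zero_neq_numeral)
  ultimately show ?thesis using Ri_t0_commute[OF y] by blast
qed

text \<open>The inverse of 1+T, since \<open>P1 (P2 (Ri v))\<close> is \<open>v\<close>;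
  correspondingly \<open>S2\<close> inverts 1+conj T.\<close>

definition S1 :: "'v \<Rightarrow> 'v" where "S1 v = P2 (Ri v)"
definition S2 :: "'v \<Rightarrow> 'v" where "S2 v = P1 (Ri v)"

lemma S1_S2: "S1 (S2 v) = Ri v" "S2 (S1 v) = Ri v"
  unfolding S1_def S2_def Ri_P[OF Ri_D] using P_Q[OF Ri_D2[of "Ri v"]] by (simp_all add: Q_Ri)

lemma S_sum: "S1 v + S2 v = 2 *\<^sub>R Ri v + 2 *\<^sub>R t 0 (Ri v)"
  by (simp add: S1_def S2_def P1_def P2_def scaleR_2)

lemma P_0 [simp]: "P1 0 = 0" "P2 0 = 0"
proof -
  have "t i 0 = 0" if "i < 4" for i using t_lm[OF that D_0, of 0] by simp
  then show "P1 0 = 0" "P2 0 = 0" by (simp_all add: P1_def P2_def W_def)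
qed

lemma S_inj: "S1 v = 0 \<Longrightarrow> v = 0" "S2 v = 0 \<Longrightarrow> v = 0"
  using P_Q[OF Ri_D2[of v]] by (simp_all add: S1_def S2_def Q_Ri)

text \<open>A fixed point of the inverse of 1+T satisfies (1+T) v = v, so T v = 0; this is the point
  where injectivity of T and conj T is used.\<close>

lemma S_inj1: "S1 v = v \<Longrightarrow> v = 0" "S2 v = v \<Longrightarrow> v = 0"
proof -
  have z: "op_app (opT lm Tc) 0 = 0" "op_app (opT lm (conjC Tc)) 0 = 0"
    using P_0 by (simp_all add: T_app Tb_app P1_def P2_def)
  assume v: "S1 v = v"
  then have d: "v \<in> D" using P_D(2)[OF Ri_D2[of v]] by (simp add: S1_def)
  have "P1 (S1 v) = v" using P_Q(2)[OF Ri_D2[of v]] by (simp add: S1_def Q_Ri)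
  then have "op_app (opT lm Tc) v = 0" unfolding v by (simp add: P1_def T_app add.assoc)
  then show "v = 0" using injT d D_0 z unfolding inj_op_def T_dom by (metis inj_onD)
next
  have z: "op_app (opT lm Tc) 0 = 0" "op_app (opT lm (conjC Tc)) 0 = 0"
    using P_0 by (simp_all add: T_app Tb_app P1_def P2_def)
  assume v: "S2 v = v"
  then have d: "v \<in> D" using P_D(1)[OF Ri_D2[of v]] by (simp add: S2_def)
  have "P2 (S2 v) = v" using P_Q(1)[OF Ri_D2[of v]] by (simp add: S2_def Q_Ri)
  then have "op_app (opT lm (conjC Tc)) v = 0" unfolding v by (simp add: P2_def Tb_app diff_add_eq)
  then show "v = 0" using injTb d D_0 z unfolding inj_op_def T_dom by (metis inj_onD)
qed

lemma SL_app: "SL lm Tc s v = lm s (Qi s v) - (t 0 (Qi s v) - W (Qi s v))"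
  by (simp add: SL_def Tb_app Qi_def)
lemma SLb_app: "out s \<Longrightarrow> SL lm (conjC Tc) s v = lm s (Qi s v) - (t 0 (Qi s v) + W (Qi s v))"
  by (simp add: SL_def Tbb_app Qib)

lemma SR_diff:
  assumes s: "out s"
  shows "SR lm Tc s v - SR lm (conjC Tc) s v = 2 *\<^sub>R (t 1 (Qi s (E1 v)) + t 2 (Qi s (E2 v)) + t 3 (Qi s (E3 v)))"
proof -
  have q: "qconj (qe 1) = - qe 1" "qconj (qe 2) = - qe 2" "qconj (qe 3) = - qe 3"
    by (simp_all add: quat_eq_iff qe_simps qconj_def)
  have m: "Qi s (- v) = - Qi s v" for v
    using Qi_lm[OF s, of "- q1" v] by (simp add: lm_minus quat_eq_iff)
  have "t i (- Qi s v) = - t i (Qi s v)" if "i < 4" for i v by (rule t_minus[OF that D2_D[OF Qi_D2[OF s]]])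
  then show ?thesis
    unfolding SR_def sum_less_4 Qib[OF s] q lm_minus m
    by (simp add: q lm_minus m conjC_def op_neg_def op_app_def[of "(_, _)"] scaleR_2 flip: t_def Qi_def)
qed

lemma type_bounds:
  obtains K where "0 \<le> K"
    "\<And>s v. out s \<Longrightarrow> norm (SL lm Tc s v) \<le> K / norm s * norm v \<and> norm (SR lm Tc s v) \<le> K / norm s * norm v \<and>
      norm (SL lm (conjC Tc) s v) \<le> K / norm s * norm v \<and> norm (SR lm (conjC Tc) s v) \<le> K / norm s * norm v"
proof -
  from type typeb f0 obtain C C' where
    C: "\<And>s v. s \<in> UNIV - sector f0 - {0} \<Longrightarrow> norm (SL lm Tc s v) \<le> C / norm s * norm v \<and> norm (SR lm Tc s v) \<le> C / norm s * norm v"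
    and C': "\<And>s v. s \<in> UNIV - sector f0 - {0} \<Longrightarrow>
      norm (SL lm (conjC Tc) s v) \<le> C' / norm s * norm v \<and> norm (SR lm (conjC Tc) s v) \<le> C' / norm s * norm v"
    unfolding type_omega_def by meson
  have le: "B / norm s * norm v \<le> (\<bar>C\<bar> + \<bar>C'\<bar>) / norm s * norm v" if "B = C \<or> B = C'" for B and s :: quat and v :: 'v
    using that by (intro mult_right_mono divide_right_mono) auto
  show ?thesis
  proof (rule that[of "\<bar>C\<bar> + \<bar>C'\<bar>"])
    fix s v assume s: "out s"
    show "norm (SL lm Tc s v) \<le> (\<bar>C\<bar> + \<bar>C'\<bar>) / norm s * norm v \<and> norm (SR lm Tc s v) \<le> (\<bar>C\<bar> + \<bar>C'\<bar>) / norm s * norm v \<and>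
      norm (SL lm (conjC Tc) s v) \<le> (\<bar>C\<bar> + \<bar>C'\<bar>) / norm s * norm v \<and> norm (SR lm (conjC Tc) s v) \<le> (\<bar>C\<bar> + \<bar>C'\<bar>) / norm s * norm v"
      using C[OF outside(3)[OF s], of v] C'[OF outside(3)[OF s], of v] le[of C s v] le[of C' s v] by auto
  qed simp
qed

section \<open>The relative resolvent and its bounds\<close>

definition Nz :: "complex \<Rightarrow> 'v \<Rightarrow> 'v" where "Nz z v = Q (- q1) (Qi (qJ (qe 1) z) v)"

lemma out_qJ: "Re z < cmod z * cos f0 \<Longrightarrow> out (qJ (qe 1) z)"
  by (simp add: norm_qJ[OF qe1_SS] qJ_nth1[OF qe1_SS] del: One_nat_def)

lemma Ri_Nz: "Re z < cmod z * cos f0 \<Longrightarrow> Ri (Nz z v) = Qi (qJ (qe 1) z) v"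
  unfolding Nz_def by (rule Ri_Q[OF Qi_D2[OF out_qJ]])

lemma c_lm: "lm (qJ (qe 1) z) v = c z v" by (simp add: c_def)

text \<open>The expansion of the quadratic polynomial Q_{c,s}(T) in powers of 1+s.\<close>

lemma Q_shift:
  assumes x: "x \<in> D2"
  shows "Q (qJ (qe 1) z) x = Q (- q1) x - c (1 + z) (2 *\<^sub>R x + 2 *\<^sub>R t 0 x) + c ((1 + z)^2) x"
proof -
  have m: "qmul (- q1) (- q1) = q1" by (simp add: quat_eq_iff)
  have s: "2 *\<^sub>R v = v + v" for v :: 'v by (rule scaleR_2)
  have "c ((1 + z)^2) x = x + c z x + c z x + c (z * z) x"
    unfolding power2_eq_square distrib_left distrib_right c_add_left by (simp add: algebra_simps)
  moreover have "c (1 + z) (2 *\<^sub>R x + 2 *\<^sub>R t 0 x) = x + x + t 0 x + t 0 x + (c z x + c z x + c z (t 0 x) + c z (t 0 x))"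
    by (simp add: s c_add_left c_add_right algebra_simps)
  ultimately show ?thesis
    unfolding Q_def m lm_minus lm_q1 qJ_mult[OF qe1_SS] c_lm s by (simp add: algebra_simps)
qed

lemma M_Nz:
  assumes z: "Re z < cmod z * cos f0"
  shows "Nz z v - c (1 + z) (S1 (Nz z v) + S2 (Nz z v)) + c ((1 + z)^2) (S1 (S2 (Nz z v))) = v"
  unfolding S1_S2 S_sum Ri_Nz[OF z]
  using Q_shift[OF Qi_D2[OF out_qJ[OF z]], of z v] Q_Qi[OF out_qJ[OF z], of v] by (simp add: Nz_def)

lemma Nz_M: assumes z: "Re z < cmod z * cos f0"
  shows "Nz z (v - c (1 + z) (S1 v + S2 v) + c ((1 + z)^2) (S1 (S2 v))) = v"
proof -
  have "v - c (1 + z) (S1 v + S2 v) + c ((1 + z)^2) (S1 (S2 v)) = Q (qJ (qe 1) z) (Ri v)"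
    unfolding Q_shift[OF Ri_D2] by (simp add: S1_S2 S_sum Q_Ri)
  then show ?thesis by (simp add: Nz_def Qi_Q[OF out_qJ[OF z] Ri_D2] Q_Ri)
qed

lemma SL_Nz:
  assumes z: "Re z < cmod z * cos f0"
  shows "c (1 + z) (S1 (S2 (Nz z v))) - S1 (Nz z v) = SL lm Tc (qJ (qe 1) z) v"
    "c (1 + z) (S1 (S2 (Nz z v))) - S2 (Nz z v) = SL lm (conjC Tc) (qJ (qe 1) z) v"
  unfolding S1_S2 SL_app SLb_app[OF out_qJ[OF z]] c_lm
  unfolding S1_def S2_def P1_def P2_def Ri_Nz[OF z] by (simp_all add: c_add_left)

text \<open>Everywhere defined stand-ins for the components T_i. They commute with each other, with
  \<open>Ri\<close> and with all left multiplications, so the computations below carry no domain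
  conditions.\<close>

definition U :: "nat \<Rightarrow> 'v \<Rightarrow> 'v" where "U i v = t i (Ri v)"

lemma U_add: "i < 4 \<Longrightarrow> U i (v + w) = U i v + U i w"
  and U_diff: "i < 4 \<Longrightarrow> U i (v - w) = U i v - U i w"
  and U_minus: "i < 4 \<Longrightarrow> U i (- v) = - U i v"
  and U_lm: "i < 4 \<Longrightarrow> U i (lm a v) = lm a (U i v)"
  and U_scaleR: "i < 4 \<Longrightarrow> U i (r *\<^sub>R v) = r *\<^sub>R U i v"
  and Ri_U: "i < 4 \<Longrightarrow> Ri (U i v) = U i (Ri v)"
  by (simp_all add: U_def Ri_add Ri_diff Ri_minus Ri_lm Ri_scaleR t_add t_diff t_minus t_lm t_scaleR Ri_D Ri_t_commute)

lemma U_U: "i < 4 \<Longrightarrow> j < 4 \<Longrightarrow> U i (U j v) = U j (U i v)"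
  unfolding U_def by (simp add: Ri_t_commute Ri_D t_t[OF _ _ Ri_D2, of i j])

definition Mz :: "complex \<Rightarrow> 'v \<Rightarrow> 'v" where
  "Mz z v = v - c (1 + z) (2 *\<^sub>R Ri v + 2 *\<^sub>R U 0 v) + c ((1 + z)^2) (Ri v)"

lemma Mz_Nz: "Re z < cmod z * cos f0 \<Longrightarrow> Mz z (Nz z v) = v"
  using M_Nz[of z v] by (simp add: Mz_def S1_S2 S_sum U_def)
lemma Nz_Mz: "Re z < cmod z * cos f0 \<Longrightarrow> Nz z (Mz z v) = v"
  using Nz_M[of z v] by (simp add: Mz_def S1_S2 S_sum U_def)

lemma U_Mz: "i < 4 \<Longrightarrow> U i (Mz z v) = Mz z (U i v)"
  by (simp add: Mz_def U_add U_diff U_lm U_scaleR Ri_U U_U[of i 0] flip: c_lm)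
lemma Ri_Mz: "Ri (Mz z v) = Mz z (Ri v)"
  by (simp add: Mz_def Ri_add Ri_diff Ri_lm Ri_scaleR Ri_U flip: c_lm)
lemma c_Mz: "c w (Mz z v) = Mz z (c w v)"
  unfolding Mz_def c_add_right c_diff_right c_scaleR_right c_commute[of w]
  by (simp add: Ri_lm U_lm flip: c_lm)

lemma Nz_commute:
  assumes z: "Re z < cmod z * cos f0" and L: "\<And>v. L (Mz z v) = Mz z (L v)"
  shows "Nz z (L v) = L (Nz z v)"
  using Nz_Mz[OF z, of "L (Nz z v)"] by (simp add: Mz_Nz[OF z] flip: L)

lemma Nz_add: assumes z: "Re z < cmod z * cos f0" shows "Nz z (v + w) = Nz z v + Nz z w"
  unfolding Nz_def by (simp add: Qi_add[OF out_qJ[OF z]] Q_add Qi_D2[OF out_qJ[OF z]])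

text \<open>The quadratic resolvent bound follows from the two linear ones because
  \<open>Q\<^sub>s(T) = (s - T\<^sub>0)\<^sup>2 - (e\<^sub>1 T\<^sub>1 + e\<^sub>2 T\<^sub>2 + e\<^sub>3 T\<^sub>3)\<^sup>2\<close>, where \<open>s - T\<^sub>0\<close> and the vector part are half the sum
  and half the difference of \<open>s - T\<close> and its conjugate. The right resolvents enter because the units do not
  commute with the inverse of \<open>Q\<^sub>s(T)\<close>.\<close>

lemma Qi_decomposition:
  fixes v :: 'v
  assumes z: "Re z < cmod z * cos f0"
  defines "s \<equiv> qJ (qe 1) z"
  defines "X \<equiv> \<lambda>v. (1 / 2) *\<^sub>R (SL lm Tc s v + SL lm (conjC Tc) s v)"
    and "Y \<equiv> \<lambda>v. (1 / 2) *\<^sub>R (SL lm Tc s v - SL lm (conjC Tc) s v)"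
    and "Y' \<equiv> \<lambda>v. (1 / 2) *\<^sub>R (SR lm Tc s v - SR lm (conjC Tc) s v)"
  shows "Qi s v = X (X v) - Y' (Y v)"
proof -
  have o: "out s" unfolding s_def by (rule out_qJ[OF z])
  have four: "(0::nat) < 4" "(1::nat) < 4" "(2::nat) < 4" "(3::nat) < 4" by simp_all
  have q: "Qi s v = Ri (Nz z v)" for v unfolding s_def by (simp add: Ri_Nz[OF z])
  have tq: "t i (Qi s v) = U i (Nz z v)" for i v by (simp add: q U_def)
  have nU: "Nz z (U i v) = U i (Nz z v)" if "i < 4" for i v by (rule Nz_commute[OF z, where L = "U i"]) (rule U_Mz[OF that])
  have nR: "Nz z (Ri v) = Ri (Nz z v)" for v by (rule Nz_commute[OF z, where L = Ri]) (rule Ri_Mz)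
  have nc: "Nz z (c w v) = c w (Nz z v)" for w v by (rule Nz_commute[OF z, where L = "c w"]) (rule c_Mz)
  have nm: "Nz z (- v) = - Nz z v" for v using nc[of "-1" v] by (simp add: c_minus_left)
  have nd: "Nz z (v - w) = Nz z v - Nz z w" for v w using Nz_add[OF z, of v "- w"] by (simp add: nm)
  have half: "(1 / 2) *\<^sub>R ((p - (x - w)) + (p - (x + w))) = p - x" for p x w :: 'v
  proof -
    have "(p - (x - w)) + (p - (x + w)) = (2::real) *\<^sub>R (p - x)" by (simp add: scaleR_2)
    then show ?thesis by simp
  qed
  have X: "X v = c z (Ri (Nz z v)) - U 0 (Nz z v)" for v
    unfolding X_def SL_app SLb_app[OF o] half tq unfolding q unfolding s_def c_lm ..
  have W: "W (Qi s v) = E1 (U 1 (Nz z v)) + E2 (U 2 (Nz z v)) + E3 (U 3 (Nz z v))" for v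
    by (simp add: W_def tq)
  have Y: "Y v = W (Qi s v)" for v
    unfolding Y_def SL_app SLb_app[OF o] by (simp add: scaleR_2[symmetric])
  have Y': "Y' v = U 1 (Nz z (E1 v)) + U 2 (Nz z (E2 v)) + U 3 (Nz z (E3 v))" for v
    unfolding Y'_def SR_diff[OF o] tq by simp
  define a where "a = Nz z v"
  define b where "b = Nz z a"
  have XX: "X (X v) = c (z * z) (Ri (Ri b)) - 2 *\<^sub>R c z (U 0 (Ri b)) + U 0 (U 0 b)"
  proof -
    have "Nz z (X v) = c z (Ri b) - U 0 b" by (simp add: X nd nc nR nU a_def b_def)
    then show ?thesis
      unfolding X[of "X v"]
      by (simp add: Ri_diff U_diff c_diff_right Ri_U scaleR_2 c_mult Ri_lm[of "qJ (qe 1) z", unfolded c_lm] U_lm[of _ "qJ (qe 1) z", unfolded c_lm])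
  qed
  \<comment> \<open>\<open>Nz z\<close> does not pass e_2 and e_3, so the vectors
    \<open>Nz z (E1 a)\<close>, \<open>Nz z (E2 a)\<close> and \<open>Nz z (E3 a)\<close> are kept
    as they are; each occurs twice with opposite signs and cancels because the \<open>U i\<close>
    commute.\<close>
  have YY: "Y' (Y v) = - (U 1 (U 1 b) + U 2 (U 2 b) + U 3 (U 3 b))"
  proof -
    have e: "Y v = E1 (U 1 a) + E2 (U 2 a) + E3 (U 3 a)" by (simp add: Y W a_def)
    have "E1 (Y v) = - U 1 a + U 2 (E3 a) - U 3 (E2 a)"
      "E2 (Y v) = - U 1 (E3 a) - U 2 a + U 3 (E1 a)"
      "E3 (Y v) = U 1 (E2 a) - U 2 (E1 a) - U 3 a"
      unfolding e by (simp_all add: lm_addv EE U_lm four)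
    then have "Y' (Y v) = U 1 (- U 1 b + U 2 (Nz z (E3 a)) - U 3 (Nz z (E2 a)))
        + U 2 (- U 1 (Nz z (E3 a)) - U 2 b + U 3 (Nz z (E1 a)))
        + U 3 (U 1 (Nz z (E2 a)) - U 2 (Nz z (E1 a)) - U 3 b)"
      unfolding Y'[of "Y v"] by (simp add: nd Nz_add[OF z] nm nU four b_def)
    then show ?thesis
      by (simp add: U_add U_diff U_minus U_U[of 2 1] U_U[of 3 1] U_U[of 3 2])
  qed
  have "X (X v) - Y' (Y v) = Q s (Ri (Ri b))"
    unfolding XX YY Q_def s_def qJ_mult[OF qe1_SS] c_lm by (simp add: U_def Ri_t_commute Ri_D algebra_simps)
  also have "Ri (Ri b) = Qi s (Qi s v)" by (simp add: q nR a_def b_def)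
  finally show ?thesis by (simp add: Q_Qi[OF o])
qed

lemma op_calc_exists: "\<exists>K. op_calc c S1 S2 Nz f0 f th K"
proof -
  obtain K0 where K0: "0 \<le> K0" and
    b: "\<And>s v. out s \<Longrightarrow> norm (SL lm Tc s v) \<le> K0 / norm s * norm v \<and> norm (SR lm Tc s v) \<le> K0 / norm s * norm v \<and>
      norm (SL lm (conjC Tc) s v) \<le> K0 / norm s * norm v \<and> norm (SR lm (conjC Tc) s v) \<le> K0 / norm s * norm v"
    using type_bounds by metis
  \<comment> \<open>\<open>K0\<close> serves the linear bounds; 2 K0^2 comes from the two products
    of resolvents in the decomposition of the inverse of Q.\<close>
  define K where "K = max K0 (2 * (K0 * K0))"
  have nq: "norm (qJ (qe 1) z) = cmod z" for z by (rule norm_qJ[OF qe1_SS])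
  have Kle: "K0 / x * y \<le> K / x * y" if "0 \<le> x" "0 \<le> y" for x y :: real
    using that by (intro mult_right_mono divide_right_mono) (auto simp: K_def)
  have bQ: "norm (Qi (qJ (qe 1) z) v) \<le> K / (cmod z)^2 * norm v" if z: "Re z < cmod z * cos f0" for z v
  proof -
    let ?s = "qJ (qe 1) z"
    let ?X = "\<lambda>v. (1 / 2) *\<^sub>R (SL lm Tc ?s v + SL lm (conjC Tc) ?s v)"
    let ?Y = "\<lambda>v. (1 / 2) *\<^sub>R (SL lm Tc ?s v - SL lm (conjC Tc) ?s v)"
    let ?Z = "\<lambda>v. (1 / 2) *\<^sub>R (SR lm Tc ?s v - SR lm (conjC Tc) ?s v)"
    let ?k = "K0 / cmod z"
    have k: "0 \<le> ?k" using K0 by simp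
    have h: "norm ((1 / 2) *\<^sub>R (x + y)) \<le> B" "norm ((1 / 2) *\<^sub>R (x - y)) \<le> B"
      if "norm x \<le> B" "norm y \<le> B" for x y :: 'v and B
      using that norm_triangle_ineq[of x y] norm_triangle_ineq4[of x y] by simp_all
    note bs = b[OF out_qJ[OF z], unfolded nq]
    have X: "norm (?X v) \<le> ?k * norm v" and Y: "norm (?Y v) \<le> ?k * norm v" and Z: "norm (?Z v) \<le> ?k * norm v" for v
      using bs[of v] h by blast+
    have "norm (Qi ?s v) \<le> norm (?X (?X v)) + norm (?Z (?Y v))"
      unfolding Qi_decomposition[OF z, of v] by (rule norm_triangle_ineq4)
    also have "\<dots> \<le> ?k * (?k * norm v) + ?k * (?k * norm v)"
      by (rule add_mono[OF order_trans[OF X mult_left_mono[OF X k]] order_trans[OF Z mult_left_mono[OF Y k]]])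
    also have "\<dots> = (2 * (K0 * K0)) / (cmod z)^2 * norm v" by (simp add: power2_eq_square)
    also have "\<dots> \<le> K / (cmod z)^2 * norm v"
      by (intro mult_right_mono divide_right_mono) (auto simp: K_def)
    finally show ?thesis .
  qed
  have n1: "norm (- q1) = 1" using nq[of 1] by (simp add: qJ_def)
  \<comment> \<open>The inverse of 1+T is minus the left S-resolvent at -1, a point of norm 1
    outside the sector.\<close>
  have Sb: "norm (S1 v) \<le> norm v * K0" "norm (S2 v) \<le> norm v * K0" for v
  proof -
    have "S1 v = - SL lm Tc (- q1) v" "S2 v = - SL lm (conjC Tc) (- q1) v"
      by (simp_all add: SL_app SLb_app[OF out_m1] S1_def S2_def P1_def P2_def lm_minus flip: Ri_def)
    then show "norm (S1 v) \<le> norm v * K0" "norm (S2 v) \<le> norm v * K0"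
      using b[OF out_m1, of v] n1 by (simp_all add: mult.commute)
  qed
  have lin: "S1 (v + w) = S1 v + S1 w" "S2 (v + w) = S2 v + S2 w" "S1 (r *\<^sub>R v) = r *\<^sub>R S1 v" "S2 (r *\<^sub>R v) = r *\<^sub>R S2 v" for v w r
    by (simp_all add: S1_def S2_def P1_def P2_def Ri_add Ri_scaleR t_add t_scaleR W_add W_scaleR Ri_D algebra_simps)
  show ?thesis
  proof (rule exI[of _ K], rule op_calc.intro[OF complex_module_c], rule op_calc_axioms.intro)
    show "bounded_linear S1" "bounded_linear S2" by (rule bounded_linear_intro[where K = K0], simp_all add: lin Sb)+
    show "S1 (S2 (c z v)) = c z (S1 (S2 v))" for z v
      unfolding S1_S2 c_def Ri_lm ..
    show "S1 (c z v) + S2 (c z v) = c z (S1 v + S2 v)" for z v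
      unfolding S_sum c_def Ri_lm t_lm[OF _ Ri_D, of 0, simplified] by (simp add: lm_addv lm_scaleRv)
    show "norm (S1 (S2 (Nz s v))) \<le> K / (cmod s)^2 * norm v" if "Re s < cmod s * cos f0" for s v
      using bQ[OF that, of v] by (simp add: S1_S2 Ri_Nz[OF that])
    show "norm (c (1 + s) (S1 (S2 (Nz s v))) - S1 (Nz s v)) \<le> K / cmod s * norm v"
      "norm (c (1 + s) (S1 (S2 (Nz s v))) - S2 (Nz s v)) \<le> K / cmod s * norm v"
      if "Re s < cmod s * cos f0" for s v
      unfolding SL_Nz[OF that] using b[OF out_qJ[OF that], of v] Kle[of "cmod s" "norm v"]
      unfolding nq by (meson norm_ge_zero order_trans)+
    show "0 < f0" "f0 < f" "f < th" "th < pi" using f0 th by simp_all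
    show "S2 (S1 v) = S1 (S2 v)" for v by (simp only: S1_S2)
  qed (fact S_inj S_inj1 M_Nz Nz_M)+
qed

end

section \<open>Integrals over the punctured line and graphs of operators\<close>

lemma has_integral_reflect_halfline:
  fixes f :: "real \<Rightarrow> 'a::banach"
  assumes "(f has_integral I) {0<..}" shows "((\<lambda>x. f (- x)) has_integral I) {..<0}"
proof -
  let ?g = "\<lambda>x. if x \<in> {0<..} then f x else 0" and ?h = "\<lambda>x. if x \<in> {..<0} then f (- x) else 0"
  have h: "?h = (\<lambda>x. ?g (- x))" by auto
  have int: "?g integrable_on cbox a b" for a b using assms unfolding has_integral_alt'[of f] by blast
  have lim: "\<exists>B>0. \<forall>a b. ball 0 B \<subseteq> cbox a b \<longrightarrow> norm (integral (cbox a b) ?g - I) < e" if "0 < e" for e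
    using assms that unfolding has_integral_alt'[of f] by blast
  have r: "?h integrable_on cbox a b" "integral (cbox a b) ?h = integral (cbox (- b) (- a)) ?g" for a b
    unfolding h using int[of "-b" "-a"] integrable_reflect[of ?g "-a" "-b"] integral_reflect[of "-a" "-b" ?g] by simp_all
  have s: "ball 0 B \<subseteq> cbox (- b) (- a)" if "ball 0 B \<subseteq> cbox a b" for B a b :: real
  proof
    fix x :: real assume "x \<in> ball 0 B"
    then have "- x \<in> ball 0 B" by simp
    then have "- x \<in> cbox a b" using that by blast
    then show "x \<in> cbox (- b) (- a)" by simp
  qed
  show ?thesis
    unfolding has_integral_alt'[of "\<lambda>x. f (- x)"] r(2)
  proof (intro conjI allI impI r(1))
    fix e :: real assume "0 < e"
    then obtain B where "0 < B" "\<And>a b. ball 0 B \<subseteq> cbox a b \<Longrightarrow> norm (integral (cbox a b) ?g - I) < e"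
      using lim by meson
    then show "\<exists>B>0. \<forall>a b. ball 0 B \<subseteq> cbox a b \<longrightarrow> norm (integral (cbox (- b) (- a)) ?g - I) < e"
      using s by (intro exI[of _ B]) auto
  qed
qed

lemma has_integral_punctured_line:
  fixes f :: "real \<Rightarrow> 'a::banach"
  assumes "(f has_integral I) {0<..}" "((\<lambda>x. f (- x)) has_integral J) {0<..}"
  shows "(f has_integral (I + J)) (UNIV - {0})"
proof -
  have "(f has_integral J) {..<0}" using has_integral_reflect_halfline[OF assms(2)] by simp
  moreover have "{0<..} \<union> {..<0} = UNIV - {0::real}" "{0<..} \<inter> {..<0::real} = {}" by auto
  ultimately show ?thesis using has_integral_Un[OF assms(1), of J "{..<0}"] by simp
qed

text \<open>With graphs, inclusion becomes implication, and sums and products with natural domains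
  become existential statements, so no domain has to be computed.\<close>

definition op_graph :: "'v op \<Rightarrow> 'v \<Rightarrow> 'v \<Rightarrow> bool" where
  "op_graph A x y \<longleftrightarrow> x \<in> op_dom A \<and> op_app A x = y"

lemma op_le_graph: "op_le A B \<longleftrightarrow> (\<forall>x y. op_graph A x y \<longrightarrow> op_graph B x y)"
  unfolding op_le_def op_graph_def by auto

lemma op_graph_comp: "op_graph (op_comp A B) x y \<longleftrightarrow> (\<exists>u. op_graph B x u \<and> op_graph A u y)"
  unfolding op_graph_def op_comp_def by (auto simp: op_dom_def op_app_def)

lemma op_graph_add: "op_graph (op_add A B) x y \<longleftrightarrow> (\<exists>u v. op_graph A x u \<and> op_graph B x v \<and> u + v = y)"
  unfolding op_graph_def op_add_def by (auto simp: op_dom_def op_app_def)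

lemma op_graph_minus: "op_graph (op_minus A B) x y \<longleftrightarrow> (\<exists>u v. op_graph A x u \<and> op_graph B x v \<and> u - v = y)"
  unfolding op_graph_def op_minus_def by (auto simp: op_dom_def op_app_def)

lemma op_graph_inv:
  assumes "inj_op A" shows "op_graph (op_inv A) y x \<longleftrightarrow> op_graph A x y"
proof -
  have i: "inj_on (op_app A) (op_dom A)" using assms by (simp add: inj_op_def)
  show ?thesis
    unfolding op_graph_def op_inv_def op_dom_def[of "(_, _)"] op_app_def[of "(_, _)"] fst_conv snd_conv
    using i by (auto simp: inv_into_f_f)
qed

lemma inj_op_graph: "inj_op A \<longleftrightarrow> (\<forall>x x' y. op_graph A x y \<longrightarrow> op_graph A x' y \<longrightarrow> x = x')"
  unfolding inj_op_def inj_on_def op_graph_def by auto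

section \<open>The quaternionic calculi in terms of the abstract one\<close>

context quat_operator
begin

text \<open>A chosen constant, because the parameters of the sublocale must be terms while the bound
  is only known to exist.\<close>

definition KK :: real where "KK = (SOME K. op_calc c S1 S2 Nz f0 f th K)"

sublocale op: op_calc c S1 S2 Nz f0 f th KK
  unfolding KK_def by (rule someI_ex[OF op_calc_exists])

lemma th01: "0 < th" "th < pi" using om th by simp_all

text \<open>Matches each of the two families of components with the bounded inverse that represents
  it in the abstract calculus.\<close>

definition link :: "(nat \<Rightarrow> 'v op) \<Rightarrow> ('v \<Rightarrow> 'v) \<Rightarrow> bool" where
  "link Tx X \<longleftrightarrow> Tx = Tc \<and> X = S1 \<or> Tx = conjC Tc \<and> X = S2"

lemma link_pr: "link Tx X \<Longrightarrow> \<exists>Y. op.pr X Y" by (auto simp: link_def op.pr_def)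

lemma link_SL: assumes "link Tx X" "z \<in> op.Om" shows "SL lm Tx (qJ (qe 1) z) v = op.SL X z v"
  using assms(1) SL_Nz[OF op.OmD[OF assms(2)], of v]
  unfolding link_def op.SL_def op.R_def by auto

text \<open>Positive parameters run outwards along the ray of angle -f, and negative ones run
  inwards along the ray of angle f, which explains the difference in \<open>pI\<close>. The complex
  component stays next to the operator, while the unit \<open>qe i\<close> on its right is absorbed
  into the vector.\<close>

lemma pint_pI:
  assumes h: "slice_rep th h H"
    and F: "\<And>z v. z \<in> op.Om \<Longrightarrow> F (qJ (qe 1) z) v = F' z v"
    and F_add: "\<And>z v w. z \<in> op.Om \<Longrightarrow> F' z (v + w) = F' z v + F' z w"
    and int: "\<And>i y v. i < 4 \<Longrightarrow> y = f \<or> y = - f \<Longrightarrow>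
      (\<lambda>r. F' (rcis r y) (c (op.u y * H i (rcis r y)) v)) integrable_on {0<..}"
  shows "pint lm f (qe 1) F h v = (\<Sum>i<4. op.pI F' (H i) (lm (qe i) v))"
proof -
  let ?J = "qe 1"
  let ?g = "\<lambda>t. F (gam f ?J t) (lm (qmul (gam' f ?J t) (qmul (qinv ?J) (h (gam f ?J t)))) v)"
  let ?k = "\<lambda>y i r. F' (rcis r y) (c (op.u y * H i (rcis r y)) (lm (qe i) v))"
  have F0: "F' z 0 = 0" if "z \<in> op.Om" for z using F_add[OF that, of 0 0] by simp
  have Fs: "F' z (\<Sum>i\<in>I. x i) = (\<Sum>i\<in>I. F' z (x i))" if "z \<in> op.Om" for z and I :: "nat set" and x
    by (induction I rule: infinite_finite_induct) (simp_all add: F0[OF that] F_add[OF that])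
  have Fm: "F' z (- v) = - F' z v" if "z \<in> op.Om" for z v
    using F_add[OF that, of v "- v"] by (simp add: F0[OF that] eq_neg_iff_add_eq_0 add.commute)
  have qi: "qinv ?J = qJ ?J (- \<i>)"
  proof -
    have "norm ?J = 1" using qe1_SS by (simp add: SS_def)
    then show ?thesis by (simp add: qinv_def quat_eq_iff qconj_def qe_simps qJ_def)
  qed
  have hs: "lm (qmul (qJ ?J w) (h (qJ ?J z))) v = (\<Sum>i<4. c (w * H i z) (lm (qe i) v))" if "z \<in> sec th" for w z
  proof -
    have "h (qJ ?J z) = (\<Sum>i<4. qmul (qJ ?J (H i z)) (qe i))" using h qe1_SS that unfolding slice_rep_def by blast
    then have "qmul (qJ ?J w) (h (qJ ?J z)) = (\<Sum>i<4. qmul (qJ ?J (w * H i z)) (qe i))"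
      by (simp only: qmul_sum_right qmul_assoc[symmetric] qJ_mult[OF qe1_SS])
    moreover have "lm (\<Sum>i\<in>I. q i) v = (\<Sum>i\<in>I. lm (q i) v)" for q and I :: "nat set"
      by (induction I rule: infinite_finite_induct) (simp_all add: lm_add)
    ultimately show ?thesis by (simp add: lm_mult c_lm)
  qed
  have rq: "r *\<^sub>R qexp ?J y = qJ ?J (rcis r y)" for r y by (simp add: qexp_qJ qJ_def scaleR_add_right)
  have pos: "?g r = (\<Sum>i<4. ?k (-f) i r)" if r: "0 < r" for r
  proof -
    let ?z = "rcis r (-f)"
    have o: "?z \<in> op.Om" by (rule op.contour_Om[OF r]) simp
    have s: "?z \<in> sec th" by (rule op.contour_sec[OF r]) simp
    have g: "gam f ?J r = qJ ?J ?z" "gam' f ?J r = qJ ?J (cis (-f))"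
      using r by (simp_all add: gam_def gam'_def rq) (simp add: qexp_qJ)
    have "?g r = F' ?z (lm (qmul (qJ ?J (cis (-f) * (- \<i>))) (h (qJ ?J ?z))) v)"
      unfolding g qi qmul_assoc[symmetric] qJ_mult[OF qe1_SS] by (rule F[OF o])
    also have "\<dots> = (\<Sum>i<4. ?k (-f) i r)"
      unfolding hs[OF s] Fs[OF o] op.u_def by (simp add: mult_ac)
    finally show ?thesis .
  qed
  have neg: "?g (- r) = - (\<Sum>i<4. ?k f i r)" if r: "0 < r" for r
  proof -
    let ?z = "rcis r f"
    have o: "?z \<in> op.Om" by (rule op.contour_Om[OF r]) simp
    have s: "?z \<in> sec th" by (rule op.contour_sec[OF r]) simp
    have g: "gam f ?J (- r) = qJ ?J ?z" "gam' f ?J (- r) = qJ ?J (- cis f)"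
      using r by (simp_all add: gam_def gam'_def rq) (simp add: qexp_qJ qJ_def)
    have "?g (- r) = F' ?z (lm (qmul (qJ ?J (- cis f * (- \<i>))) (h (qJ ?J ?z))) v)"
      unfolding g qi qmul_assoc[symmetric] qJ_mult[OF qe1_SS] by (rule F[OF o])
    also have "\<dots> = F' ?z (- (\<Sum>i<4. c (op.u f * H i ?z) (lm (qe i) v)))"
    proof -
      have "c (- cis f * (- \<i>) * H i ?z) x = - c (op.u f * H i ?z) x" for i x
        unfolding op.u_def c_minus_left[symmetric] by (simp add: mult_ac)
      then show ?thesis unfolding hs[OF s] by (simp only: sum_negf)
    qed
    finally show ?thesis unfolding Fm[OF o] Fs[OF o] .
  qed
  have ki: "((\<lambda>r. ?k y i r) has_integral integral {0<..} (?k y i)) {0<..}" if "i < 4" "y = f \<or> y = -f" for i y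
    using int[OF that] by (rule integrable_integral)
  have 1: "(?g has_integral (\<Sum>i<4. integral {0<..} (?k (-f) i))) {0<..}"
    by (rule has_integral_eq[where f = "\<lambda>r. \<Sum>i<4. ?k (-f) i r"], simp only: pos greaterThan_iff,
        rule has_integral_sum, simp, rule ki, simp_all)
  have 2: "((\<lambda>r. ?g (- r)) has_integral - (\<Sum>i<4. integral {0<..} (?k f i))) {0<..}"
    by (rule has_integral_eq[where f = "\<lambda>r. - (\<Sum>i<4. ?k f i r)"], simp only: neg greaterThan_iff,
        rule has_integral_neg, rule has_integral_sum, simp, rule ki, simp_all)
  have pI: "op.pI F' (H i) (lm (qe i) v) = integral {0<..} (?k (-f) i) - integral {0<..} (?k f i)" if "i < 4" for i
    unfolding op.pI_def by (rule integral_diff; rule int[OF that]; simp)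
  have "pint lm f ?J F h v = (\<Sum>i<4. integral {0<..} (?k (-f) i)) + - (\<Sum>i<4. integral {0<..} (?k f i))"
    unfolding pint_def by (rule integral_unique[OF has_integral_punctured_line[OF 1 2]])
  also have "\<dots> = (\<Sum>i<4. integral {0<..} (?k (-f) i) - integral {0<..} (?k f i))"
    by (simp add: sum_subtractf)
  finally show ?thesis using pI by simp
qed

lemma scalc_app:
  assumes h: "slice_rep th h H" and c: "\<forall>i<4. cls th 0 0 (H i)" and l: "link Tx X"
  shows "op_graph (scalc lm Tx om th h) v y \<longleftrightarrow> (\<Sum>i<4. op.Phi X (H i) (lm (qe i) v)) = y"
proof -
  obtain Y where p: "op.pr X Y" using link_pr[OF l] by blast
  have "pint lm f (qe 1) (SL lm Tx) h v = (\<Sum>i<4. op.pI (op.SL X) (H i) (lm (qe i) v))"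
    by (rule pint_pI[OF h]) (simp_all only: link_SL[OF l] op.SL_add[OF _ p] op.SL_ray(1)[OF c[rule_format] p])
  then show ?thesis
    by (simp add: op_graph_def scalc_def op_dom_def op_app_def op.Phi_def scaleR_sum_right flip: f_def)
qed

text \<open>The factor is the quotient of -1/\<pi> by 1/(2\<pi>).\<close>

lemma hcalc_app:
  assumes h: "slice_rep th h H" and c: "\<forall>i<4. cls th 1 1 (H i)"
  shows "op_graph (hcalc lm Tc om th h) v y \<longleftrightarrow> (- 2) *\<^sub>R (\<Sum>i<4. op.A (H i) (lm (qe i) v)) = y"
proof -
  have q: "Qinv lm Tc (qJ (qe 1) z) v = op.R (Nz z v)" if "z \<in> op.Om" for z v
    using Ri_Nz[OF op.OmD[OF that], of v] by (simp add: op.R_def S1_S2 flip: Qi_def)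
  have "pint lm f (qe 1) (Qinv lm Tc) h v = (\<Sum>i<4. op.pI (\<lambda>s v. op.R (Nz s v)) (H i) (lm (qe i) v))"
    by (rule pint_pI[OF h]) (simp_all only: q op.N_add op.R_add op.RN_ray[OF c[rule_format]])
  also have "\<dots> = (\<Sum>i<4. (2 * pi) *\<^sub>R op.A (H i) (lm (qe i) v))"
    by (rule sum.cong[OF refl]) (simp add: op.A_pI[OF c[rule_format]])
  finally show ?thesis
    by (simp add: op_graph_def hcalc_def op_dom_def op_app_def flip: f_def scaleR_sum_right)
qed

lemma ext_sum: "(\<Sum>i<4. op.Phi X (\<lambda>s. a s * ext F i s) (w i)) = op.Phi X (\<lambda>s. a s * F s) (w 0)"
  if "op.pr X Y" for F a w
  by (simp add: sum_less_4 op.Phi_zero[OF that])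

lemma lm_qe0 [simp]: "lm (qe 0) v = v"
  by (simp add: qe_def flip: q1_def)

lemma scalc_intrinsic:
  assumes e: "intrinsic_rep th e G" and c: "cls th 0 0 G" and l: "link Tx X"
  shows "op_graph (scalc lm Tx om th e) v y \<longleftrightarrow> op.Phi X G v = y"
proof -
  obtain Y where p: "op.pr X Y" using link_pr[OF l] by blast
  have "\<forall>i<4. cls th 0 0 (ext G i)" using c by (simp add: ext_def cls_zero)
  from scalc_app[OF e[unfolded intrinsic_rep_ext] this l] show ?thesis
    by (simp add: sum_less_4 op.Phi_zero[OF p])
qed

lemma hcalc_intrinsic:
  assumes e: "intrinsic_rep th e G" and c: "cls th 1 1 G"
  shows "op_graph (hcalc lm Tc om th e) v y \<longleftrightarrow> (- 2) *\<^sub>R op.A G v = y"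
proof -
  have "\<forall>i<4. cls th 1 1 (ext G i)" using c by (simp add: ext_def cls_zero)
  from hcalc_app[OF e[unfolded intrinsic_rep_ext] this] show ?thesis
    by (simp add: sum_less_4 op.A_zero)
qed

lemma Psi_rep:
  assumes "Psi th e"
  obtains G where "intrinsic_rep th e G" "op.EP G"
proof -
  obtain G where G: "intrinsic_rep th e G" using assms intrinsic_slice_rep[OF th01] unfolding Psi_def by blast
  have "cls th 0 0 (ext G 0)"
    using bnd_Psi_cls[OF th01 G[unfolded intrinsic_rep_ext], of 0] assms by (simp add: Psi_def)
  then have "op.EP G" using G by (simp add: op.EP_def op.csym_def intrinsic_rep_def)
  with G show ?thesis by (rule that)
qed

lemma PsiQ_rep:
  assumes "PsiQ th e"
  obtains G where "intrinsic_rep th e G" "op.EQ G"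
proof -
  obtain G where G: "intrinsic_rep th e G" using assms intrinsic_slice_rep[OF th01] unfolding PsiQ_def by blast
  have "cls th 1 0 (ext G 0)"
    using bnd_PsiQ_cls[OF th01 G[unfolded intrinsic_rep_ext], of 0] assms by (simp add: PsiQ_def)
  then have "op.EQ G" using G by (simp add: op.EQ_def op.csym_def intrinsic_rep_def)
  with G show ?thesis by (rule that)
qed

lemma slice_rep_csym: "slice_rep th h H \<Longrightarrow> i < 4 \<Longrightarrow> op.csym (H i)"
  unfolding slice_rep_def op.csym_def by blast

text \<open>The calculus picks some regularizer by choice. A suitable \<open>psi m\<close> shows
  that one exists, and \<open>hgr_change\<close> in both directions replaces the unknown choice by
  the given \<open>b\<close>.\<close>

lemma hinf_graph:
  assumes H: "slice_rep th g H" and bd: "\<forall>i<4. bnd th (-a) a (H i)"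
    and b: "op.EQ b" "op.Pinj b" and bH: "\<forall>i<4. op.EQ (\<lambda>s. b s * H i s)"
    and l: "link Tx X"
  shows "op_graph (hinf lm Tx om th g) x y \<longleftrightarrow> op.hgr X b H (\<lambda>i. lm (qe i) x) y"
proof -
  obtain Y where p: "op.pr X Y" using link_pr[OF l] by blast
  let ?P = "\<lambda>e. Psi th e \<and> inj_op (scalc lm Tx om th e) \<and> PsiL th (qprod_fun e g)"
  define e where "e = (SOME e. ?P e)"
  have "\<exists>e. ?P e"
  proof -
    \<comment> \<open>The two lower bounds required by \<open>op.regularizer\<close>: one for
      \<open>psi m\<close> itself, one for its product with \<open>g\<close>.\<close>
    obtain m where "max 1 (a + 1) \<le> real m" using real_arch_simple by blast
    then have m: "1 \<le> m" "a + 1 \<le> real m" by simp_all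
    obtain e where e: "intrinsic_rep th e (op.psi m)" by (rule op.psi_function)
    have "inj_op (scalc lm Tx om th e)"
      unfolding inj_op_graph scalc_intrinsic[OF e op.EQD(3)[OF op.EQ_psi] l]
      by (intro allI impI, rule op.PinjD[OF op.Pinj_psi[of m] p]) simp
    then show ?thesis using op.regularizer[OF e m(1) H bd[rule_format] m(2)] by (intro exI[of _ e]) simp
  qed
  then have "?P e" unfolding e_def by (rule someI_ex)
  then have e: "Psi th e" "inj_op (scalc lm Tx om th e)" "PsiL th (qprod_fun e g)" by auto
  obtain G where G: "intrinsic_rep th e G" "op.EP G" using Psi_rep[OF e(1)] .
  have G0: "cls th 0 0 G" using G(2) by (simp add: op.EP_def)
  note GH = slice_rep_prod[OF G(1) H]
  have cG: "\<forall>i<4. cls th 0 0 (\<lambda>z. G z * H i z)"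
    using bnd_Psi_cls[OF th01 GH] e(3) by (simp add: PsiL_def)
  have EG: "op.EP (\<lambda>z. G z * H i z)" if "i < 4" for i
    using cG[rule_format, OF that] slice_rep_csym[OF GH that] by (simp add: op.EP_def)
  have inj: "v = w" if "op.Phi X G v = op.Phi X G w" for v w
    by (rule e(2)[unfolded inj_op_graph scalc_intrinsic[OF G(1) G0 l], rule_format, OF that refl])
  have "op_graph (hinf lm Tx om th g) x y \<longleftrightarrow>
      op_graph (op_comp (op_inv (scalc lm Tx om th e)) (scalc lm Tx om th (qprod_fun e g))) x y"
    unfolding hinf_def Let_def e_def ..
  also have "\<dots> \<longleftrightarrow> op.hgr X G H (\<lambda>i. lm (qe i) x) y"
    unfolding op_graph_comp op_graph_inv[OF e(2)] scalc_intrinsic[OF G(1) G0 l] scalc_app[OF GH cG l] op.hgr_def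
    by (rule iffI, elim exE conjE, simp only:) (rule exI, rule conjI, assumption, rule refl)
  also have "\<dots> \<longleftrightarrow> op.hgr X b H (\<lambda>i. lm (qe i) x) y"
  proof
    show "op.hgr X G H (\<lambda>i. lm (qe i) x) y \<Longrightarrow> op.hgr X b H (\<lambda>i. lm (qe i) x) y"
      by (rule op.hgr_change[OF G(2) inj op.EQ_EP[OF b(1)] p EG op.EQ_EP[OF bH[rule_format]]])
    show "op.hgr X b H (\<lambda>i. lm (qe i) x) y \<Longrightarrow> op.hgr X G H (\<lambda>i. lm (qe i) x) y"
      by (rule op.hgr_change[OF op.EQ_EP[OF b(1)] op.PinjD[OF b(2) p] G(2) p op.EQ_EP[OF bH[rule_format]] EG])
  qed
  finally show ?thesis .
qed

lemma hgr_ext: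
  assumes "op.pr X Y"
  shows "op.hgr X b (ext F) (\<lambda>i. lm (qe i) x) y \<longleftrightarrow> op.Phi X (\<lambda>s. b s * F s) x = op.Phi X b y"
  by (simp add: op.hgr_def ext_sum[OF assms])

lemma ext_bnd: assumes "bnd th p q F" shows "\<forall>i<4. bnd th p q (ext F i)"
proof -
  have "bnd th p q (\<lambda>_. 0)"
    unfolding bnd_def by (rule conjI, rule holomorphic_on_const, rule exI[of _ 0]) simp
  then show ?thesis using assms by (simp add: ext_def)
qed

lemma ext_EQ: "op.EQ (\<lambda>s. b s * F s) \<Longrightarrow> \<forall>i<4. op.EQ (\<lambda>s. b s * ext F i s)"
  by (simp add: ext_def op.EQ_def cls_zero op.csym_def)

text \<open>On a regularizer the extended calculus gives back the bounded operator. The function of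
  class \<Psi>^Q is treated as one of moderate growth, regularized by \<open>psi 0\<close>, and
  multiplicativity lets \<open>psi 0\<close> cancel. This is how e(T) and e(conj T) in the harmonic
  calculus are made explicit.\<close>

lemma hinf_regularizer:
  assumes G: "intrinsic_rep th e G" "op.EQ G" and l: "link Tx X"
  shows "op_graph (hinf lm Tx om th e) x y \<longleftrightarrow> op.Phi X G x = y"
proof -
  obtain Y where p: "op.pr X Y" using link_pr[OF l] by blast
  have "bnd th (-1) 1 G"
    by (rule bnd_mono[OF cls_imp_bnd[OF op.EQD(1)[OF G(2)]]]) (use th01 in auto)
  note b = ext_bnd[OF this]
  note q = op.EQ_mult[OF op.EQ_psi[of 0] G(2)]
  have "op_graph (hinf lm Tx om th e) x y \<longleftrightarrow> op.Phi X (\<lambda>s. op.psi 0 s * G s) x = op.Phi X (op.psi 0) y"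
    unfolding hinf_graph[OF G(1)[unfolded intrinsic_rep_ext] b op.EQ_psi op.Pinj_psi ext_EQ[OF q] l] hgr_ext[OF p] ..
  also have "\<dots> \<longleftrightarrow> op.Phi X G x = y"
    unfolding op.EQ_Phi_mult[OF op.EQ_psi G(2) p]
    by (rule iffI, rule op.PinjD[OF op.Pinj_psi[of 0] p], assumption, simp only:)
  finally show ?thesis .
qed

text \<open>The choice in the definition fixes the outer regularizer, whereas the inner calculus of
  \<open>g\<close> is described with \<open>b\<close>; the mixed condition that results is made
  diagonal by \<open>dgr_diagonal\<close>. The factor -1/2 passes from D to the integral
  \<open>A\<close>.\<close>

lemma hDinf_graph:
  assumes H: "slice_rep th g H" and bd: "\<forall>i<4. bnd th (-a) a (H i)"
    and b: "op.EQ b" "op.Pinj b" and bH: "\<forall>i<4. op.EQ (\<lambda>s. b s * H i s)"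
  shows "op_graph (hDinf lm Tc om th g) x y \<longleftrightarrow> op.dgr S1 S2 b b H (\<lambda>i. lm (qe i) x) ((- 1 / 2) *\<^sub>R y)"
proof -
  have l: "link Tc S1" "link (conjC Tc) S2" by (simp_all add: link_def)
  have p: "op.pr S1 S2" "op.pr S2 S1" by simp_all
  let ?P = "\<lambda>e. PsiQ th e \<and> inj_op (hinf lm Tc om th e) \<and> inj_op (hinf lm (conjC Tc) om th e)
      \<and> PsiQL th (qprod_fun e g)"
  define e where "e = (SOME e. ?P e)"
  have "\<exists>e. ?P e"
  proof -
    obtain m where "max 1 (a + 1) \<le> real m" using real_arch_simple by blast
    then have m: "1 \<le> m" "a + 1 \<le> real m" by simp_all
    obtain e where e: "intrinsic_rep th e (op.psi m)" by (rule op.psi_function)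
    have "inj_op (hinf lm Tc om th e)" "inj_op (hinf lm (conjC Tc) om th e)"
      unfolding inj_op_graph hinf_regularizer[OF e op.EQ_psi l(1)] hinf_regularizer[OF e op.EQ_psi l(2)]
      by (intro allI impI, rule op.PinjD[OF op.Pinj_psi[of m] p(1)], simp)
         (intro allI impI, rule op.PinjD[OF op.Pinj_psi[of m] p(2)], simp)
    then show ?thesis using op.regularizer[OF e m(1) H bd[rule_format] m(2)] by (intro exI[of _ e]) simp
  qed
  then have "?P e" unfolding e_def by (rule someI_ex)
  then have e: "PsiQ th e" "inj_op (hinf lm Tc om th e)" "inj_op (hinf lm (conjC Tc) om th e)"
    "PsiQL th (qprod_fun e g)" by auto
  obtain G where G: "intrinsic_rep th e G" "op.EQ G" using PsiQ_rep[OF e(1)] .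
  note GH = slice_rep_prod[OF G(1) H]
  have EG: "\<forall>i<4. op.EQ (\<lambda>z. G z * H i z)"
    using bnd_PsiQ_cls[OF th01 GH] slice_rep_csym[OF GH] e(4) by (simp add: PsiQL_def op.EQ_def)
  then have EG4: "\<forall>i<4. cls th 1 1 (\<lambda>z. G z * H i z)" by (intro allI impI, intro op.EQD(4)) simp
  have inj: "op.Pinj G"
    unfolding op.Pinj_def
  proof (intro allI impI)
    fix X Y v w assume X: "op.pr X Y" and vw: "op.Phi X G v = op.Phi X G w"
    have "X = S1 \<or> X = S2" using X by (auto simp: op.pr_def)
    then show "v = w"
    proof
      assume "X = S1"
      with vw show "v = w"
        using e(2)[unfolded inj_op_graph hinf_regularizer[OF G l(1)], rule_format, of v "op.Phi S1 G w" w] by simp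
    next
      assume "X = S2"
      with vw show "v = w"
        using e(3)[unfolded inj_op_graph hinf_regularizer[OF G l(2)], rule_format, of v "op.Phi S2 G w" w] by simp
    qed
  qed
  let ?w = "\<lambda>i. lm (qe i) x"
  let ?A = "\<Sum>i<4. op.A (\<lambda>z. G z * H i z) (?w i)"
  have aux1: "(\<exists>u. (\<exists>a b. A = a \<and> (\<exists>w. W = w \<and> P w b) \<and> a - b = u) \<and> B = u) \<longleftrightarrow> (\<exists>b. P W b \<and> A - b = B)"
    for A B W :: 'v and P :: "'v \<Rightarrow> 'v \<Rightarrow> bool" by auto
  have aux2: "(\<exists>y. P y \<and> A - y = B) \<longleftrightarrow> P (A - B)" for A B :: 'v and P :: "'v \<Rightarrow> bool"
  proof
    assume "P (A - B)" then show "\<exists>y. P y \<and> A - y = B" by (intro exI[of _ "A - B"]) simp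
  qed auto
  have lin: "op.Phi X k ((- 2) *\<^sub>R v) = (- 2) *\<^sub>R op.Phi X k v" if "op.EQ k" "op.pr X Y" for X Y k v
    by (rule linear_scale[OF bounded_linear.linear[OF op.Phi_bl[OF op.EQD(3)[OF that(1)] that(2)]]])
  have lin': "op.Phi X k ((- 1 / 2) *\<^sub>R v) = (- 1 / 2) *\<^sub>R op.Phi X k v" if "op.EQ k" "op.pr X Y" for X Y k v
    by (rule linear_scale[OF bounded_linear.linear[OF op.Phi_bl[OF op.EQD(3)[OF that(1)] that(2)]]])
  \<comment> \<open>Left multiplication by an arbitrary quaternion is not complex linear over the
    slice; it commutes with \<open>op.A G\<close> because \<open>G\<close> is symmetric.\<close>
  have lA: "lm q (op.A G v) = op.A G (lm q v)" for q v
    by (rule op.A_commute[OF op.EQD(4)[OF G(2)] op.EQD(2)[OF G(2)] lm_bl])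
       (simp_all add: op.R_def op.sg_def S1_S2 Ri_lm S_sum t_lm[OF _ Ri_D] lm_addv lm_scaleRv)
  have "op_graph (hDinf lm Tc om th g) x y \<longleftrightarrow>
      op_graph (op_comp (op_inv (hinf lm (conjC Tc) om th e))
           (op_minus (hcalc lm Tc om th (qprod_fun e g)) (op_comp (hinf lm Tc om th g) (hcalc lm Tc om th e)))) x y"
    unfolding hDinf_def Let_def e_def ..
  also have "\<dots> \<longleftrightarrow> (\<exists>y'. op.hgr S1 b H (\<lambda>i. lm (qe i) ((- 2) *\<^sub>R op.A G x)) y' \<and> (- 2) *\<^sub>R ?A - y' = op.Phi S2 G y)"
    unfolding op_graph_comp op_graph_minus op_graph_inv[OF e(3)] hinf_regularizer[OF G l(2)]
      hcalc_app[OF GH EG4] hcalc_intrinsic[OF G(1) op.EQD(4)[OF G(2)]]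
      hinf_graph[OF H bd b bH l(1)] by (rule aux1)
  also have "\<dots> \<longleftrightarrow> op.hgr S1 b H (\<lambda>i. lm (qe i) ((- 2) *\<^sub>R op.A G x)) ((- 2) *\<^sub>R ?A - op.Phi S2 G y)"
    by (rule aux2)
  also have "\<dots> \<longleftrightarrow> op.dgr S1 S2 b G H ?w ((- 1 / 2) *\<^sub>R y)"
  proof -
    have 1: "(\<Sum>i<4. op.Phi S1 (\<lambda>s. b s * H i s) (lm (qe i) ((- 2) *\<^sub>R op.A G x)))
        = (- 2) *\<^sub>R (\<Sum>i<4. op.A G (op.Phi S1 (\<lambda>s. b s * H i s) (?w i)))"
      unfolding scaleR_sum_right
    proof (rule sum.cong[OF refl])
      fix i :: nat assume "i \<in> {..<4}"
      then have i: "i < 4" by simp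
      show "op.Phi S1 (\<lambda>s. b s * H i s) (lm (qe i) ((- 2) *\<^sub>R op.A G x))
          = (- 2) *\<^sub>R op.A G (op.Phi S1 (\<lambda>s. b s * H i s) (?w i))"
        by (simp only: lm_scaleRv lA lin[OF bH[rule_format, OF i] p(1)] op.EQ_A_Phi[OF bH[rule_format, OF i] G(2) p(1)])
    qed
    have 2: "op.Phi S1 b ((- 2) *\<^sub>R ?A - op.Phi S2 G y)
        = (- 2) *\<^sub>R (\<Sum>i<4. op.Phi S1 b (op.A (\<lambda>z. G z * H i z) (?w i))) - op.Phi S1 b (op.Phi S2 G y)"
      by (simp only: op.EQ_Phi_linear[OF b(1) p(1)] lin[OF b(1) p(1)])
    have half: "(- 2) *\<^sub>R q = (- 2) *\<^sub>R r - z \<longleftrightarrow> r - q = (- 1 / 2) *\<^sub>R z" for q r z :: 'v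
    proof
      assume "(- 2) *\<^sub>R q = (- 2) *\<^sub>R r - z"
      then have "z = (- 2) *\<^sub>R (r - q)" by (simp add: scaleR_diff_right)
      then show "r - q = (- 1 / 2) *\<^sub>R z" by simp
    next
      assume "r - q = (- 1 / 2) *\<^sub>R z"
      then have z: "z = (- 2) *\<^sub>R (r - q)" by simp
      show "(- 2) *\<^sub>R q = (- 2) *\<^sub>R r - z" unfolding z by (simp add: scaleR_diff_right)
    qed
    show ?thesis
      unfolding op.hgr_def op.dgr_def 1 2 half sum_subtractf lin'[OF G(2) p(2)] lin'[OF b(1) p(1)] ..
  qed
  also have "\<dots> \<longleftrightarrow> op.dgr S1 S2 b b H ?w ((- 1 / 2) *\<^sub>R y)"
    by (rule op.dgr_diagonal[OF b G(2) inj p(1) bH[rule_format] EG[rule_format]])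
  finally show ?thesis .
qed

lemma dgr_ext:
  assumes "op.pr X Y" "op.EQ b"
  shows "op.dgr X Y b b (ext F) (\<lambda>i. lm (qe i) x) z \<longleftrightarrow>
    op.Phi X b (op.A (\<lambda>s. b s * F s) x) - op.A b (op.Phi X (\<lambda>s. b s * F s) x) = op.Phi X b (op.Phi Y b z)"
  using op.EQ_Phi_linear(2)[OF assms(2,1), of 0 0] op.EQ_A_linear(2)[OF assms(2), of 0 0]
  by (simp add: op.dgr_def sum_less_4 op.Phi_zero[OF assms(1)] op.A_zero)

section \<open>The product rule for unbounded operators\<close>

text \<open>A single \<open>psi m\<close> regularizes both factors and its square regularizes their
  product, so all graph conditions use common regularizers and \<open>dgr_product\<close> applies.
  The pair (X, Y) decides at which operator \<open>g\<close> and \<open>f'\<close> are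
  evaluated.\<close>

lemma product_inclusion:
  assumes f: "FI th f'" and g: "FL th g" and l: "link Tx X" "link Ty Y" and p: "op.pr X Y"
  shows "op_le (op_add (op_comp (hDinf lm Tc om th f') (hinf lm Tx om th g))
                       (op_comp (hinf lm Ty om th f') (hDinf lm Tc om th g)))
               (hDinf lm Tc om th (qprod_fun f' g))"
proof -
  obtain F where F: "intrinsic_rep th f' F" using f intrinsic_slice_rep[OF th01] unfolding FI_def by blast
  obtain H where H: "slice_rep th g H" using g left_slice_rep[OF th01] unfolding FL_def by blast
  note F' = F[unfolded intrinsic_rep_ext]
  have "bnd_F th f'" "bnd_F th g" using f g by (simp_all add: FI_def FL_def)
  then obtain a1 a2 where a1: "\<forall>i<4. bnd th (- a1) a1 (ext F i)" and a2: "\<forall>i<4. bnd th (- a2) a2 (H i)"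
    using bnd_F_bnd[OF th01 F'] bnd_F_bnd[OF th01 H] by (metis (mono_tags))
  have aF: "bnd th (- a1) a1 F" using a1[rule_format, of 0] by simp
  note FH = slice_rep_prod[OF F H]
  have a12: "\<forall>i<4. bnd th (- (a1 + a2)) (a1 + a2) (\<lambda>z. F z * H i z)"
  proof (intro allI impI)
    fix i :: nat assume "i < 4"
    from bnd_mult[OF aF a2[rule_format, OF this]] show "bnd th (- (a1 + a2)) (a1 + a2) (\<lambda>z. F z * H i z)" by simp
  qed
  \<comment> \<open>One more than both growth exponents, so that the product of \<open>psi m\<close>
    with either function has negative order at infinity and order above 1 at 0.\<close>
  obtain m where m: "max a1 a2 + 1 \<le> real m" using real_arch_simple by blast
  define b where "b = op.psi m"
  have b: "op.EQ b" "op.Pinj b" unfolding b_def by (rule op.EQ_psi, rule op.Pinj_psi)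
  have cb: "cls th 1 0 (\<lambda>s. b s * k s)" if "bnd th (- a') a' k" "a' + 1 \<le> real m" for k a'
    using bnd_cls[OF bnd_mult[OF op.bnd_psi[of m] that(1)], of 1 0] that(2) unfolding b_def by simp
  have bF: "op.EQ (\<lambda>s. b s * F s)"
    using cb[OF aF] m F op.csym_mult[OF op.EQD(2)[OF b(1)], of F] by (simp add: op.EQ_def intrinsic_rep_def op.csym_def)
  have bH: "\<forall>i<4. op.EQ (\<lambda>s. b s * H i s)"
  proof (intro allI impI)
    fix i :: nat assume i: "i < 4"
    show "op.EQ (\<lambda>s. b s * H i s)"
      using cb[OF a2[rule_format, OF i]] m op.csym_mult[OF op.EQD(2)[OF b(1)] slice_rep_csym[OF H i]] by (simp add: op.EQ_def)
  qed
  have bbFH: "\<forall>i<4. op.EQ (\<lambda>s. b s * b s * (F s * H i s))"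
  proof (intro allI impI)
    fix i :: nat assume i: "i < 4"
    show "op.EQ (\<lambda>s. b s * b s * (F s * H i s))"
      using op.EQ_mult[OF bF bH[rule_format, OF i]] by (simp add: mult_ac)
  qed
  note bb = op.EQ_mult[OF b(1) b(1)] op.Pinj_mult[OF b b]
  note q = op.pr_sym[OF p]
  note gf = hDinf_graph[OF F' a1 b ext_EQ[OF bF]] and gg = hDinf_graph[OF H a2 b bH]
    and gp = hDinf_graph[OF FH a12 bb bbFH]
  \<comment> \<open>The definition of the harmonic calculus singles out T, that is, the order
    \<open>S1\<close>, \<open>S2\<close>; by \<open>dgr_swap\<close> the condition may be read in
    the order that \<open>X\<close> and \<open>Y\<close> prescribe.\<close>
  have swap: "op.dgr S1 S2 k k K w z \<longleftrightarrow> op.dgr X Y k k K w z"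
    if k: "op.EQ k" "\<forall>i<4. op.EQ (\<lambda>s. k s * K i s)" for k K w z
  proof -
    have "op.dgr S1 S2 k k K w z \<longleftrightarrow> op.dgr S2 S1 k k K w z"
      by (rule iffI, rule op.dgr_swap[OF k(1) op.prS(1) k(2)[rule_format]], assumption+,
          rule op.dgr_swap[OF k(1) op.prS(2) k(2)[rule_format]], assumption+)
    then show ?thesis using p unfolding op.pr_def by auto
  qed
  show ?thesis
    unfolding op_le_graph op_graph_add op_graph_comp
  proof (intro allI impI, elim exE conjE)
    fix x y u v y1 y2
    assume y1: "op_graph (hinf lm Tx om th g) x y1" and z1: "op_graph (hDinf lm Tc om th f') y1 u"
      and y2: "op_graph (hDinf lm Tc om th g) x y2" and z2: "op_graph (hinf lm Ty om th f') y2 v"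
      and y: "u + v = y"
    let ?h = "(*\<^sub>R) (- 1 / 2) :: 'v \<Rightarrow> 'v"
    have "op.Phi Y (\<lambda>s. b s * F s) y2 = op.Phi Y b v"
      using z2 unfolding hinf_graph[OF F' a1 b ext_EQ[OF bF] l(2)] hgr_ext[OF q] .
    then have 1: "op.Phi Y (\<lambda>s. b s * F s) (?h y2) = op.Phi Y b (?h v)"
      using linear_scale[OF bounded_linear.linear[OF op.Phi_bl[OF op.EQD(3)[OF bF] q]], of "- 1 / 2" y2]
        linear_scale[OF bounded_linear.linear[OF op.Phi_bl[OF op.EQD(3)[OF b(1)] q]], of "- 1 / 2" v] by simp
    have 2: "op.hgr X b H (\<lambda>i. lm (qe i) x) y1"
      using y1 unfolding hinf_graph[OF H a2 b bH l(1)] .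
    have 3: "op.Phi X b (op.A (\<lambda>s. b s * F s) y1) - op.A b (op.Phi X (\<lambda>s. b s * F s) y1) = op.Phi X b (op.Phi Y b (?h u))"
      using z1 unfolding gf swap[OF b(1) ext_EQ[OF bF]] dgr_ext[OF p b(1)] .
    have 4: "op.dgr X Y b b H (\<lambda>i. lm (qe i) x) (?h y2)"
      using y2 unfolding gg swap[OF b(1) bH] .
    have "op.dgr X Y (\<lambda>s. b s * b s) (\<lambda>s. b s * b s) (\<lambda>i s. F s * H i s) (\<lambda>i. lm (qe i) x) (?h u + ?h v)"
      by (rule op.dgr_product[OF b(1) p bF _ 2 3 4 1]) (rule bH[rule_format])
    then show "op_graph (hDinf lm Tc om th (qprod_fun f' g)) x y"
      unfolding gp swap[OF bb(1) bbFH] y[symmetric] by (simp only: scaleR_add_right)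
  qed
qed

end

theorem theorem4p9:
  fixes lm rm :: "quat \<Rightarrow> 'v::banach \<Rightarrow> 'v"
    and Tc :: "nat \<Rightarrow> 'v op"
    and \<omega> \<theta> :: real
    and f g :: "quat \<Rightarrow> quat"
  assumes "two_sided_banach lm rm"
    and "KC lm rm Tc"
    and "0 < \<omega>" and "\<omega> < pi"
    and "inj_op (opT lm Tc)" and "inj_op (opT lm (conjC Tc))"
    and "type_omega lm Tc \<omega>" and "type_omega lm (conjC Tc) \<omega>"
    and "\<omega> < \<theta>" and "\<theta> < pi"
    and "FI \<theta> f" and "FL \<theta> g"
  shows "op_le (op_add (op_comp (hDinf lm Tc \<omega> \<theta> f) (hinf lm Tc \<omega> \<theta> g))
                       (op_comp (hinf lm (conjC Tc) \<omega> \<theta> f) (hDinf lm Tc \<omega> \<theta> g)))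
               (hDinf lm Tc \<omega> \<theta> (qprod_fun f g))
       \<and> op_le (op_add (op_comp (hDinf lm Tc \<omega> \<theta> f) (hinf lm (conjC Tc) \<omega> \<theta> g))
                       (op_comp (hinf lm Tc \<omega> \<theta> f) (hDinf lm Tc \<omega> \<theta> g)))
               (hDinf lm Tc \<omega> \<theta> (qprod_fun f g))"
proof -
  interpret quat_operator lm rm Tc \<omega> \<theta>
    by unfold_locales (fact assms)+
  have l: "link Tc S1" "link (conjC Tc) S2" by (simp_all add: link_def)
  \<comment> \<open>X = \<open>S1\<close> evaluates \<open>g\<close> at T and \<open>f\<close> at
    the conjugate; X = \<open>S2\<close> evaluates them the other way round.\<close>
  show ?thesis
    using product_inclusion[OF assms(11,12) l op.prS(1)] product_inclusion[OF assms(11,12) l(2,1) op.prS(2)] by simp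
qed

end
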